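(* Let $\Omega\subset\mathbb{R}^2$ be a convex compact set containing $0$ in its interior. Let $\gamma\subset G$ be a simple Lipschitz contour bounding a region $U_\gamma$, and let $\mathrm{Len}_+(\gamma)=L_{+\circ}$, $\mathrm{Len}_-(\gamma)=L_{-\circ}$, $\mathrm{Area}(U_\gamma)=A_\circ$. Then $$L_{+\circ}\ge\mathcal{L}_+(A_\circ)\quad\bigl(\Longleftrightarrow\ A_\circ\le\mathcal{F}_+(L_{+\circ})\bigr),$$ $$L_{-\circ}\ge\mathcal{L}_-(-A_\circ)\quad\bigl(\Longleftrightarrow\ -A_\circ\ge\mathcal{F}_-(L_{-\circ})\bigr).$$ Equality in the first relation is attained on, and only on, the contours of the families $\Gamma_+(g_\circ,A_\circ)$, and in the second on, and only on, the contours of the families $\Gamma_-(g_\circ,A_\circ)$, where $g_\circ\in G$ is arbitrary.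
   Context: Geometry. $G=\{(x,y):x\in\mathbb{R},\,y>0\}$ is the Lie group with product $(x_1,y_1)\cdot(x_2,y_2)=(x_1+x_2y_1,\,y_1y_2)$, unit $e=(0,1)$, and Lie algebra $T_eG\cong\mathbb{R}^2\supset\Omega$. Let $\|\cdot\|_e$ be the Minkowski functional (gauge) of $\Omega$ (possibly non-symmetric). The left-invariant Finsler structure is $\|(\xi_1,\xi_2)\|_{(x,y)}=\frac1y\|(\xi_1,\xi_2)\|_e$. A Lipschitz curve $\gamma(t)$, $t\in[a,b]$, in $G$ has length $\int_a^b\|\dot\gamma(t)\|_{\gamma(t)}dt$. A contour is the image of a closed curve (called its parametrization); it is simple if the closed curve has no self-intersections except that its initial and final points coincide, and Lipschitz if the closed curve is Lipschitz. For a simple Lipschitz contour $\gamma$, $\mathrm{Len}_+(\gamma)$ (resp. $\mathrm{Len}_-(\gamma)$) is the length of any Lipschitz parametrization of $\gamma$ (traversing it once) with positive, i.e. counterclockwise (resp. negative) orientation. The area of a region $U\subset G$ is $\mathrm{Area}(U)=\int_U\frac{1}{y^2}\,dx\wedge dy$. Convex trigonometry. $\Omega^\circ=\{(p,q): px+qy\le1\ \forall (x,y)\in\Omega\}$ is the polar of $\Omega$; $S_\Omega,S_{\Omega^\circ}$ are Euclidean areas. For a convex compact planar set $K$ with $0$ in its interior, $\cos_K,\sin_K$ are the Lipschitz $2S_K$-periodic functions such that $\theta\mapsto(\cos_K\theta,\sin_K\theta)$, $\theta\in[0,2S_K]$, parametrizes $\partial K$ once with positive orientation, $\sin_K(0)=0$,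 $\cos_K(0)>0$, and $\cos_K\sin_K'-\sin_K\cos_K'=1$ a.e. (so for $0\le\theta\le 2S_K$ the parameter $\theta$ is twice the Euclidean area of the sector of $K$ swept from the positive $x$-axis). Angles $\theta,\theta^\circ$ correspond to each other if $\cos_\Omega(\theta)\cos_{\Omega^\circ}(\theta^\circ)+\sin_\Omega(\theta)\sin_{\Omega^\circ}(\theta^\circ)=1$. For a.e. $\theta^\circ$ the corresponding $\theta$ is unique modulo $2S_\Omega$; $\theta(\theta^\circ)$ denotes a (monotone) selection of corresponding angles. Functions. $M_+^\circ=\max\cos_{\Omega^\circ}>0$, $-M_-^\circ=\min\cos_{\Omega^\circ}<0$, and $$L_+(\lambda)=\int_0^{2S_{\Omega^\circ}}\frac{d\theta^\circ}{\lambda-\cos_{\Omega^\circ}(\theta^\circ)},\quad F_+(\lambda)=\int_0^{2S_{\Omega^\circ}}\frac{\cos_\Omega(\theta(\theta^\circ))\,d\theta^\circ}{\lambda-\cos_{\Omega^\circ}(\theta^\circ)},\quad \lambda>M_+^\circ,$$ $$L_-(\lambda)=\int_0^{2S_{\Omega^\circ}}\frac{d\theta^\circ}{\cos_{\Omega^\circ}(\theta^\circ)-\lambda},\quad F_-(\lambda)=\int_0^{2S_{\Omega^\circ}}\frac{\cos_\Omega(\theta(\theta^\circ))\,d\theta^\circ}{\cos_{\Omega^\circ}(\theta^\circ)-\lambda},\quad \lambda<-M_-^\circ.$$ The functions $L_\pm$ are strictly monotone with range $(0,+\infty)$; $\Lambda_\pm=L_\pm^{-1}:(0,+\infty)\to\mathbb{R}$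 are their inverses. $\mathcal{F}_\pm(L)=F_\pm(\Lambda_\pm(L))$ for $L>0$; $\mathcal{F}_+$ is a strictly increasing bijection of $(0,+\infty)$ onto $(0,+\infty)$ and $\mathcal{F}_-$ a strictly decreasing bijection of $(0,+\infty)$ onto $(-\infty,0)$. $\mathcal{L}_\pm=\mathcal{F}_\pm^{-1}$ are their inverses. Families. For $g_\circ=(x_\circ,y_\circ)\in G$ and $A_\circ>0$, let $\lambda_+\in(M_+^\circ,+\infty)$, $\lambda_-\in(-\infty,-M_-^\circ)$ be the unique solutions of $F_\pm(\lambda_\pm)=\pm A_\circ$. For $\alpha\in[0,2S_{\Omega^\circ})$ put $R_\pm=\frac{y_\circ}{\lambda_\pm-\cos_{\Omega^\circ}(\alpha)}$, $c_{x\pm}=x_\circ-R_\pm\sin_{\Omega^\circ}(\alpha)$, $c_{y\pm}=R_\pm\lambda_\pm$, and let $\gamma_\pm^\alpha=\{(R_\pm\sin_{\Omega^\circ}(\theta^\circ)+c_{x\pm},\,-R_\pm\cos_{\Omega^\circ}(\theta^\circ)+c_{y\pm}):\theta^\circ\in[0,2S_{\Omega^\circ}]\}$, i.e. the boundary of $\Omega^\circ$ rotated by $\mp\frac\pi2$, dilated by $|R_\pm|$ and translated by $(c_{x\pm},c_{y\pm})$. Then $\Gamma_\pm(g_\circ,A_\circ)=\{\gamma_\pm^\alpha:\alpha\in[0,2S_{\Omega^\circ})\}$. *)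

theory Defs
  imports "HOL-Complex_Analysis.Complex_Analysis"
begin

text \<open>
  The plane is identified with the complex numbers, so that \<open>(x, y)\<close> is \<open>Complex x y\<close>, and
  \<open>p \<bullet> z = Re p * Re z + Im p * Im z\<close>.
\<close>

subsection \<open>The left-invariant Finsler structure on the half-plane\<close>

definition half_plane :: "complex set" where
  "half_plane = {g. Im g > 0}"

definition minkowski :: "complex set \<Rightarrow> complex \<Rightarrow> real" where
  "minkowski \<Omega> \<xi> = Inf {t. t > 0 \<and> \<xi> \<in> (\<lambda>z. t *\<^sub>R z) ` \<Omega>}"

definition finsler :: "complex set \<Rightarrow> complex \<Rightarrow> complex \<Rightarrow> real" where
  "finsler \<Omega> g \<xi> = minkowski \<Omega> \<xi> / Im g"

text \<open>A Lipschitz curve is differentiable almost everywhere, so the value of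
  \<^const>\<open>vector_derivative\<close> at the remaining points is irrelevant.\<close>

definition curve_length :: "complex set \<Rightarrow> (real \<Rightarrow> complex) \<Rightarrow> real" where
  "curve_length \<Omega> c = integral {0..1} (\<lambda>t. finsler \<Omega> (c t) (vector_derivative c (at t)))"

definition area :: "complex set \<Rightarrow> real" where
  "area U = integral U (\<lambda>z. 1 / (Im z)\<^sup>2)"


subsection \<open>Contours and their lengths\<close>

definition lipschitz_parametrization :: "(real \<Rightarrow> complex) \<Rightarrow> complex set \<Rightarrow> bool" where
  "lipschitz_parametrization c \<gamma> \<longleftrightarrow>
     simple_path c \<and> pathfinish c = pathstart c \<and> (\<exists>B. B-lipschitz_on {0..1} c) \<and> path_image c = \<gamma>"

definition simple_lipschitz_contour :: "complex set \<Rightarrow> bool" where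
  "simple_lipschitz_contour \<gamma> \<longleftrightarrow> (\<exists>c. lipschitz_parametrization c \<gamma>)"

definition positively_oriented :: "(real \<Rightarrow> complex) \<Rightarrow> bool" where
  "positively_oriented c \<longleftrightarrow> (\<forall>z \<in> inside (path_image c). winding_number c z = 1)"

definition negatively_oriented :: "(real \<Rightarrow> complex) \<Rightarrow> bool" where
  "negatively_oriented c \<longleftrightarrow> (\<forall>z \<in> inside (path_image c). winding_number c z = - 1)"

text \<open>The length of a contour with a given orientation does not depend on the parametrization.
  It is a relation here: a statement about all \<open>L\<close> with \<open>has_Len_plus \<Omega> \<gamma> L\<close> is
  a statement about all positively oriented Lipschitz parametrizations of \<open>\<gamma>\<close>.\<close>

definition has_Len_plus :: "complex set \<Rightarrow> complex set \<Rightarrow> real \<Rightarrow> bool" where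
  "has_Len_plus \<Omega> \<gamma> L \<longleftrightarrow>
     (\<exists>c. lipschitz_parametrization c \<gamma> \<and> positively_oriented c \<and> curve_length \<Omega> c = L)"

definition has_Len_minus :: "complex set \<Rightarrow> complex set \<Rightarrow> real \<Rightarrow> bool" where
  "has_Len_minus \<Omega> \<gamma> L \<longleftrightarrow>
     (\<exists>c. lipschitz_parametrization c \<gamma> \<and> negatively_oriented c \<and> curve_length \<Omega> c = L)"


subsection \<open>Convex trigonometry\<close>

definition polar :: "complex set \<Rightarrow> complex set" where
  "polar K = {p. \<forall>z\<in>K. p \<bullet> z \<le> 1}"

definition euclidean_area :: "complex set \<Rightarrow> real" where
  "euclidean_area K = measure lborel K"

text \<open>\<open>is_convex_trig K e\<close> says that \<open>e \<theta> = (cos\<^sub>K \<theta>, sin\<^sub>K \<theta>)\<close>.\<close>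

definition is_convex_trig :: "complex set \<Rightarrow> (real \<Rightarrow> complex) \<Rightarrow> bool" where
  "is_convex_trig K e \<longleftrightarrow>
     (\<exists>B. B-lipschitz_on UNIV e) \<and>
     (\<forall>\<theta>. e (\<theta> + 2 * euclidean_area K) = e \<theta>) \<and>
     simple_path (\<lambda>s. e (2 * euclidean_area K * s)) \<and>
     path_image (\<lambda>s. e (2 * euclidean_area K * s)) = frontier K \<and>
     positively_oriented (\<lambda>s. e (2 * euclidean_area K * s)) \<and>
     Im (e 0) = 0 \<and> Re (e 0) > 0 \<and>
     (AE \<theta> in lborel. \<exists>d. (e has_vector_derivative d) (at \<theta>) \<and>
                           Re (e \<theta>) * Im d - Im (e \<theta>) * Re d = 1)"

definition convex_trig :: "complex set \<Rightarrow> real \<Rightarrow> complex" where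
  "convex_trig K = (THE e. is_convex_trig K e)"

definition cosK :: "complex set \<Rightarrow> real \<Rightarrow> real" where
  "cosK K \<theta> = Re (convex_trig K \<theta>)"

definition sinK :: "complex set \<Rightarrow> real \<Rightarrow> real" where
  "sinK K \<theta> = Im (convex_trig K \<theta>)"

definition corresponding_angles :: "complex set \<Rightarrow> real \<Rightarrow> real \<Rightarrow> bool" where
  "corresponding_angles \<Omega> \<theta> \<theta>' \<longleftrightarrow>
     cosK \<Omega> \<theta> * cosK (polar \<Omega>) \<theta>' + sinK \<Omega> \<theta> * sinK (polar \<Omega>) \<theta>' = 1"

text \<open>Two selections give the same value of \<open>cosK \<Omega> (\<phi> t)\<close> for almost every \<open>t\<close>, so the integrals
  \<open>F_plus\<close> and \<open>F_minus\<close> below do not depend on the selection \<open>\<phi>\<close> they take as an argument.\<close>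

definition angle_selection :: "complex set \<Rightarrow> (real \<Rightarrow> real) \<Rightarrow> bool" where
  "angle_selection \<Omega> \<phi> \<longleftrightarrow>
     mono_on {0..2 * euclidean_area (polar \<Omega>)} \<phi> \<and>
     (\<forall>t \<in> {0..2 * euclidean_area (polar \<Omega>)}. corresponding_angles \<Omega> (\<phi> t) t)"


subsection \<open>The functions of the isoperimetric problem\<close>

definition M_plus :: "complex set \<Rightarrow> real" where
  "M_plus \<Omega> = Sup (range (cosK (polar \<Omega>)))"

definition M_minus :: "complex set \<Rightarrow> real" where
  "M_minus \<Omega> = - Inf (range (cosK (polar \<Omega>)))"

definition L_plus :: "complex set \<Rightarrow> real \<Rightarrow> real" where
  "L_plus \<Omega> \<mu> = integral {0..2 * euclidean_area (polar \<Omega>)} (\<lambda>t. 1 / (\<mu> - cosK (polar \<Omega>) t))"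

definition L_minus :: "complex set \<Rightarrow> real \<Rightarrow> real" where
  "L_minus \<Omega> \<mu> = integral {0..2 * euclidean_area (polar \<Omega>)} (\<lambda>t. 1 / (cosK (polar \<Omega>) t - \<mu>))"

definition F_plus :: "complex set \<Rightarrow> (real \<Rightarrow> real) \<Rightarrow> real \<Rightarrow> real" where
  "F_plus \<Omega> \<phi> \<mu> =
     integral {0..2 * euclidean_area (polar \<Omega>)} (\<lambda>t. cosK \<Omega> (\<phi> t) / (\<mu> - cosK (polar \<Omega>) t))"

definition F_minus :: "complex set \<Rightarrow> (real \<Rightarrow> real) \<Rightarrow> real \<Rightarrow> real" where
  "F_minus \<Omega> \<phi> \<mu> =
     integral {0..2 * euclidean_area (polar \<Omega>)} (\<lambda>t. cosK \<Omega> (\<phi> t) / (cosK (polar \<Omega>) t - \<mu>))"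

definition Lambda_plus :: "complex set \<Rightarrow> real \<Rightarrow> real" where
  "Lambda_plus \<Omega> = the_inv_into {M_plus \<Omega><..} (L_plus \<Omega>)"

definition Lambda_minus :: "complex set \<Rightarrow> real \<Rightarrow> real" where
  "Lambda_minus \<Omega> = the_inv_into {..< - M_minus \<Omega>} (L_minus \<Omega>)"

definition calF_plus :: "complex set \<Rightarrow> (real \<Rightarrow> real) \<Rightarrow> real \<Rightarrow> real" where
  "calF_plus \<Omega> \<phi> L = F_plus \<Omega> \<phi> (Lambda_plus \<Omega> L)"

definition calF_minus :: "complex set \<Rightarrow> (real \<Rightarrow> real) \<Rightarrow> real \<Rightarrow> real" where
  "calF_minus \<Omega> \<phi> L = F_minus \<Omega> \<phi> (Lambda_minus \<Omega> L)"

definition calL_plus :: "complex set \<Rightarrow> (real \<Rightarrow> real) \<Rightarrow> real \<Rightarrow> real" where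
  "calL_plus \<Omega> \<phi> = the_inv_into {0<..} (calF_plus \<Omega> \<phi>)"

definition calL_minus :: "complex set \<Rightarrow> (real \<Rightarrow> real) \<Rightarrow> real \<Rightarrow> real" where
  "calL_minus \<Omega> \<phi> = the_inv_into {0<..} (calF_minus \<Omega> \<phi>)"


subsection \<open>The families of extremal contours\<close>

definition extremal_contour :: "complex set \<Rightarrow> complex \<Rightarrow> real \<Rightarrow> real \<Rightarrow> complex set" where
  "extremal_contour \<Omega> g \<mu> \<alpha> =
     (let R = Im g / (\<mu> - cosK (polar \<Omega>) \<alpha>);
          cx = Re g - R * sinK (polar \<Omega>) \<alpha>;
          cy = R * \<mu>
      in (\<lambda>t. Complex (R * sinK (polar \<Omega>) t + cx) (- R * cosK (polar \<Omega>) t + cy))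
           ` {0..2 * euclidean_area (polar \<Omega>)})"

definition lambda_plus :: "complex set \<Rightarrow> (real \<Rightarrow> real) \<Rightarrow> real \<Rightarrow> real" where
  "lambda_plus \<Omega> \<phi> A = the_inv_into {M_plus \<Omega><..} (F_plus \<Omega> \<phi>) A"

definition lambda_minus :: "complex set \<Rightarrow> (real \<Rightarrow> real) \<Rightarrow> real \<Rightarrow> real" where
  "lambda_minus \<Omega> \<phi> A = the_inv_into {..< - M_minus \<Omega>} (F_minus \<Omega> \<phi>) (- A)"

definition Gamma_plus ::
    "complex set \<Rightarrow> (real \<Rightarrow> real) \<Rightarrow> complex \<Rightarrow> real \<Rightarrow> complex set set" where
  "Gamma_plus \<Omega> \<phi> g A =
     extremal_contour \<Omega> g (lambda_plus \<Omega> \<phi> A) ` {0..<2 * euclidean_area (polar \<Omega>)}"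

definition Gamma_minus ::
    "complex set \<Rightarrow> (real \<Rightarrow> real) \<Rightarrow> complex \<Rightarrow> real \<Rightarrow> complex set set" where
  "Gamma_minus \<Omega> \<phi> g A =
     extremal_contour \<Omega> g (lambda_minus \<Omega> \<phi> A) ` {0..<2 * euclidean_area (polar \<Omega>)}"

end

theory Submission
  imports Defs "HOL-Real_Asymp.Real_Asymp"
begin

text \<open>
  Let \<open>K\<close> be the polar of \<open>\<Omega>\<close>, with projection \<open>[l, r]\<close> to the first axis. A positively oriented contour
  whose ordinates range over \<open>[y1, y2]\<close> determines \<open>R\<close> and \<open>\<kappa>\<close> by \<open>y1 = R (\<kappa> - r)\<close> and \<open>y2 = R (\<kappa> - l)\<close>:
  the copy of \<open>K\<close>, turned and dilated by \<open>R\<close>, that lies between the same horizontal lines. To a point of the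
  contour at height \<open>R (\<kappa> - \<sigma>)\<close> attach the boundary point \<open>p\<close> of \<open>K\<close> with abscissa \<open>\<sigma>\<close>, on the upper boundary
  along the way from the lowest to the highest point and on the lower boundary along the way back. The gauge of
  \<open>\<Omega>\<close> is at least \<open>p \<bullet> c'\<close>, and by Green's formula the integral of \<open>p \<bullet> c' / y\<close> is \<open>\<kappa> A + G \<kappa>\<close>, where \<open>A\<close> is the
  area and \<open>G \<kappa>\<close> is the integral of \<open>1 / (\<kappa> - Re p)\<close> over \<open>K\<close>. This expression is minimal in \<open>\<kappa>\<close> exactly where
  \<open>F \<kappa> = A\<close>, with \<open>F \<kappa>\<close> the integral of \<open>1 / (\<kappa> - Re p)\<^sup>2\<close> over \<open>K\<close>, and the minimum is the length of the extremal
  contours. In the case of equality \<open>p\<close> maximizes \<open>q \<bullet> c'\<close> over \<open>q \<in> K\<close>, so both sides of the contour are arcs of the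
  copy of \<open>K\<close> up to horizontal shifts, which agree because of the area. The reflection in the vertical axis
  exchanges the two orientations.
\<close>

subsection \<open>Lipschitz functions of a real variable\<close>

text \<open>Contours are merely Lipschitz: derivatives exist only almost everywhere and the inside
  of a contour is known through winding numbers alone, so Green's formula has to be derived from
  these. The calibrating point depends only on the height and on the side of the contour. Hence
  \<open>Im p * Im c' / Im c\<close> integrates along each side to a number fixed by the two end
  heights, however the contour oscillates, while \<open>Re p\<close> is affine in the height and
  leaves only the area and an exact form. The bound so obtained carries the parameter \<kappa> of
  the contour's own strip, not the parameter \<mu> with \<open>F_area \<mu> = A\<close>. As
  \<open>G_area\<close> has derivative \<open>- F_area\<close>, comparing the convex function
  \<open>1 / (\<kappa> - s)\<close> of \<kappa> with its tangent at \<mu> closes this gap, strictly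
  unless \<kappa> = \<mu>. Since \<Omega> may have corners, the boundary of \<open>K\<close> may
  contain edges parallel to the second axis, which become horizontal pieces of extremal contours.
  There the height carries no information, and the equality case needs a separate argument, namely
  that the abscissa is monotone on them.\<close>

lemma strict_increasing_expansive_density:
  fixes F :: "real \<Rightarrow> real"
  assumes exp: "\<And>x y. x \<le> y \<Longrightarrow> y - x \<le> F y - F x" and lip: "B-lipschitz_on UNIV F"
  obtains g where "\<And>x y. x \<le> y \<Longrightarrow> (g has_integral (F y - F x)) {x..y}"
proof -
  have cont: "continuous_on UNIV F"
    using lip lipschitz_on_continuous_on by blast
  have smono: "x < y \<Longrightarrow> F x < F y" for x y
    using exp[of x y] by simp
  have inj: "inj F"
    by (metis smono injI linorder_neqE_linordered_idom less_irrefl)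
  have surj: "\<exists>x. F x = y" for y
  proof -
    define a where "a = - \<bar>y - F 0\<bar>"
    define b where "b = \<bar>y - F 0\<bar>"
    have "F a \<le> y" "y \<le> F b" "a \<le> b"
      using exp[of a 0] exp[of 0 b] by (auto simp: a_def b_def)
    then show ?thesis
      using IVT'[of F a y b] cont continuous_on_subset by blast
  qed
  define G where "G = inv F"
  have FG: "F (G y) = y" for y
    unfolding G_def using surj by (metis f_inv_into_f rangeI)
  have GF: "G (F x) = x" for x
    unfolding G_def by (simp add: inj)
  have Glip: "1-lipschitz_on UNIV G"
  proof (rule lipschitz_onI)
    fix u v :: real
    show "dist (G u) (G v) \<le> 1 * dist u v"
      using exp[of "G u" "G v"] exp[of "G v" "G u"] FG[of u] FG[of v]
      by (cases "G u \<le> G v") (auto simp: dist_real_def abs_if)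
  qed auto
  then have Gm: "G \<in> borel_measurable borel"
    by (intro borel_measurable_continuous_onI lipschitz_on_continuous_on)
  \<comment> \<open>\<open>\<nu>\<close> gives a Borel set the Lebesgue measure of its image under
    \<open>F\<close>. A Lipschitz map sends null sets to null sets, so Radon-Nikodym supplies a
    density, and the value on an interval is the increment of \<open>F\<close>.\<close>
  define \<nu> where "\<nu> = distr lborel borel G"
  have vim: "G -` A = F ` A" for A
    using FG GF by (auto simp: image_iff) metis
  have em: "emeasure \<nu> A = emeasure lborel (F ` A)" if "A \<in> sets borel" for A
    using that Gm by (simp add: \<nu>_def emeasure_distr vim)
  have "absolutely_continuous lborel \<nu>"
    unfolding absolutely_continuous_def
  proof
    fix A :: "real set" assume "A \<in> null_sets lborel"
    then have A: "A \<in> sets borel" "negligible A"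
      by (auto simp: null_sets_def negligible_iff_emeasure0 null_sets_completionI negligible_iff_null_sets)
    have "negligible (F ` A)"
      using A(2) by (intro negligible_locally_Lipschitz_image)
        (use lipschitz_on_normD[OF lip] in \<open>auto intro!: exI[of _ UNIV] exI[of _ B]\<close>)
    moreover have "F ` A \<in> sets borel"
      using measurable_sets[OF Gm A(1)] by (simp add: vim)
    ultimately have "emeasure lborel (F ` A) = 0"
      by (simp add: negligible_iff_null_sets null_sets_def)
    then show "A \<in> null_sets \<nu>"
      using A em by (auto simp: null_sets_def \<nu>_def)
  qed
  then obtain r where r: "r \<in> borel_measurable lborel" "density lborel r = \<nu>"
    using sigma_finite_measure.Radon_Nikodym[OF sigma_finite_lborel, of \<nu>] by (auto simp: \<nu>_def)
  have F_int: "F ` {x..y} = {F x..F y}" if "x \<le> y" for x y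
  proof
    show "F ` {x..y} \<subseteq> {F x..F y}"
      using smono by (auto simp: le_less)
    show "{F x..F y} \<subseteq> F ` {x..y}"
    proof
      fix z assume z: "z \<in> {F x..F y}"
      then have "G z \<in> {x..y}"
        using smono[of "G z" x] smono[of y "G z"] FG[of z] by (auto simp: not_less[symmetric])
      then show "z \<in> F ` {x..y}"
        using FG[of z] by (metis imageI)
    qed
  qed
  have rint: "(\<integral>\<^sup>+t. r t * indicator {x..y} t \<partial>lborel) = ennreal (F y - F x)" if "x \<le> y" for x y
  proof -
    have "emeasure \<nu> {x..y} = (\<integral>\<^sup>+t. r t * indicator {x..y} t \<partial>lborel)"
      using r by (subst r(2)[symmetric], subst emeasure_density) auto
    then show ?thesis
      using em[of "{x..y}"] F_int[OF that] exp[OF that] that by (simp add: emeasure_lborel_Icc)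
  qed
  \<comment> \<open>The density has a finite integral over every bounded interval, hence is finite
    almost everywhere and can be read as a real function.\<close>
  have "AE t in lborel. r t * indicator {- real n..real n} t \<noteq> \<infinity>" for n :: nat
    using r(1) rint[of "- real n" "real n"] by (intro nn_integral_PInf_AE) simp_all
  then have "AE t in lborel. \<forall>n::nat. r t * indicator {- real n..real n} t \<noteq> \<infinity>"
    by (subst AE_all_countable) auto
  then have fin: "AE t in lborel. r t \<noteq> \<infinity>"
  proof eventually_elim
    case (elim t)
    obtain n :: nat where "\<bar>t\<bar> \<le> real n" using real_arch_simple by blast
    then have "t \<in> {- real n..real n}" by auto
    with elim show ?case by (metis indicator_simps(1) mult.right_neutral)
  qed
  define g where "g t = enn2real (r t)" for t
  have "(g has_integral (F y - F x)) {x..y}" if "x \<le> y" for x y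
  proof -
    have "((\<lambda>t. indicator {x..y} t * g t) has_integral (F y - F x)) UNIV"
    proof (rule nn_integral_has_integral)
      show "(\<lambda>t. indicator {x..y} t * g t) \<in> borel_measurable borel"
        using r(1) unfolding g_def by measurable
      show "(\<integral>\<^sup>+ t. ennreal (indicator {x..y} t * g t) \<partial>lborel) = ennreal (F y - F x)"
        unfolding rint[OF that, symmetric]
        by (rule nn_integral_cong_AE) (use fin in eventually_elim, auto simp: g_def indicator_def less_top)
    qed (use exp[OF that] that in \<open>auto simp: g_def\<close>)
    moreover have "(\<lambda>t. indicator {x..y} t * g t) = (\<lambda>t. if t \<in> {x..y} then g t else 0)"
      by (auto simp: indicator_def)
    ultimately show ?thesis
      by (simp add: has_integral_restrict_UNIV del: atLeastAtMost_iff)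
  qed
  then show ?thesis using that by blast
qed

text \<open>Rademacher's theorem on the line together with the fundamental theorem: an integral
  density is found first, and Lebesgue differentiation then identifies it with the derivative almost
  everywhere.\<close>

lemma lipschitz_real_derivative_ae:
  fixes f :: "real \<Rightarrow> real"
  assumes lip: "B-lipschitz_on UNIV f"
  obtains g N where "negligible N" "\<And>x. x \<notin> N \<Longrightarrow> (f has_real_derivative g x) (at x)"
    "\<And>x y. x \<le> y \<Longrightarrow> (g has_integral (f y - f x)) {x..y}"
proof -
  have B: "B \<ge> 0" using lip lipschitz_on_nonneg by blast
  \<comment> \<open>The slope \<open>B + 1\<close> outweighs every decrease of \<open>f\<close>, so
    that increments of \<open>F\<close> are at least those of the argument; the constant is
    subtracted from the density below.\<close>
  define F where "F x = f x + (B + 1) * x" for x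
  have fd: "\<bar>f x - f y\<bar> \<le> B * \<bar>x - y\<bar>" for x y
    using lipschitz_onD[OF lip, of x y] by (simp add: dist_real_def)
  have "y - x \<le> F y - F x" if "x \<le> y" for x y
    using fd[of x y] that by (auto simp: F_def algebra_simps)
  moreover have "(B + (B + 1))-lipschitz_on UNIV F"
    unfolding F_def using B
    by (intro lipschitz_intros lip) (auto intro!: lipschitz_onI simp: dist_real_def abs_mult right_diff_distrib[symmetric])
  ultimately obtain g0 where g0: "\<And>x y. x \<le> y \<Longrightarrow> (g0 has_integral (F y - F x)) {x..y}"
    using strict_increasing_expansive_density[of F] by blast
  define g where "g = (\<lambda>x. g0 x - (B + 1))"
  have g: "(g has_integral (f y - f x)) {x..y}" if "x \<le> y" for x y
  proof -
    have "((\<lambda>t. g0 t - (B + 1)) has_integral (F y - F x - (y - x) *\<^sub>R (B + 1))) {x..y}"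
      using that by (intro has_integral_diff g0) (use has_integral_const_real[of "B+1" x y] in auto)
    then show ?thesis by (simp add: g_def F_def algebra_simps)
  qed
  have gi: "g integrable_on cbox a b" for a b
    using g[of a b] by (cases "a \<le> b") auto
  obtain N1 where N1: "negligible N1"
     "\<And>x e. \<lbrakk>x \<notin> N1; 0 < e\<rbrakk> \<Longrightarrow> \<exists>d>0. \<forall>h. 0 < h \<and> h < d \<longrightarrow>
        norm (integral (cbox x (x + h *\<^sub>R One)) g /\<^sub>R h ^ DIM(real) - g x) < e"
    using integrable_ccontinuous_explicit[of g] gi by metis
  \<comment> \<open>The set \<open>N1\<close> settles averages over intervals to the right of a
    point. The reflected density does the same for intervals to the left, and together they give the
    two-sided derivative.\<close>
  have gr: "((\<lambda>t. g (- t)) has_integral (f (-x) - f (-y))) {x..y}" if "x \<le> y" for x y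
    using g[of "-y" "-x"] that has_integral_reflect_real[of "\<lambda>t. g t" "f (-x) - f (-y)" "-x" "-y"]
    by (simp add: o_def)
  have gri: "(\<lambda>t. g (-t)) integrable_on cbox a b" for a b
    using gr[of a b] by (cases "a \<le> b") auto
  obtain N2 where N2: "negligible N2"
     "\<And>x e. \<lbrakk>x \<notin> N2; 0 < e\<rbrakk> \<Longrightarrow> \<exists>d>0. \<forall>h. 0 < h \<and> h < d \<longrightarrow>
        norm (integral (cbox x (x + h *\<^sub>R One)) (\<lambda>t. g (-t)) /\<^sub>R h ^ DIM(real) - g (-x)) < e"
    using integrable_ccontinuous_explicit[of "\<lambda>t. g (-t)"] gri by metis
  define N where "N = N1 \<union> uminus ` N2"
  have "negligible N"
    unfolding N_def using N1(1) N2(1)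
    by (intro negligible_Un negligible_locally_Lipschitz_image)
       (auto intro!: exI[of _ "UNIV :: real set"] exI[of _ "1 :: real"])
  moreover have "(f has_real_derivative g x) (at x)" if "x \<notin> N" for x
  proof -
    have x1: "x \<notin> N1" and x2: "-x \<notin> N2"
      using that by (auto simp: N_def image_iff)
    show ?thesis
      unfolding DERIV_def LIM_def
    proof (intro allI impI)
      fix e :: real assume e: "e > 0"
      obtain d1 where d1: "d1 > 0" "\<And>h. 0 < h \<Longrightarrow> h < d1 \<Longrightarrow> norm (integral (cbox x (x + h *\<^sub>R One)) g /\<^sub>R h ^ DIM(real) - g x) < e"
        using N1(2)[OF x1 e] by blast
      obtain d2 where d2: "d2 > 0" "\<And>h. 0 < h \<Longrightarrow> h < d2 \<Longrightarrow> norm (integral (cbox (-x) (-x + h *\<^sub>R One)) (\<lambda>t. g (-t)) /\<^sub>R h ^ DIM(real) - g x) < e"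
        using N2(2)[OF x2 e] by auto
      have "dist ((f (x + h) - f x) / h) (g x) < e" if h: "h \<noteq> 0" "\<bar>h\<bar> < min d1 d2" for h
      proof (cases "h > 0")
        case True
        then have "integral {x..x+h} g = f (x+h) - f x"
          using g[of x "x+h"] by (simp add: integral_unique)
        with d1(2)[of h] True h show ?thesis
          by (simp add: dist_real_def divide_inverse mult.commute)
      next
        case False
        then have "integral {-x..-x-h} (\<lambda>t. g (-t)) = f x - f (x+h)"
          using gr[of "-x" "-x-h"] by (simp add: integral_unique add.commute)
        then have "(f (x + h) - f x) / h = integral {-x..-x-h} (\<lambda>t. g (-t)) /\<^sub>R (- h)"
          using h(1) by (simp only:) (simp add: field_simps)
        with d2(2)[of "-h"] False h show ?thesis
          by (simp add: dist_real_def)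
      qed
      then show "\<exists>s>0. \<forall>h. h \<noteq> 0 \<and> dist h 0 < s \<longrightarrow> dist ((f (x + h) - f x) / h) (g x) < e"
        using d1(1) d2(1) by (intro exI[of _ "min d1 d2"]) auto
    qed
  qed
  ultimately show ?thesis by (rule that) (use g in blast)+
qed

lemma lipschitz_vector_derivative_ae:
  fixes f :: "real \<Rightarrow> 'a::euclidean_space"
  assumes lip: "B-lipschitz_on UNIV f"
  obtains g N where "negligible N" "\<And>x. x \<notin> N \<Longrightarrow> (f has_vector_derivative g x) (at x)"
    "\<And>x y. x \<le> y \<Longrightarrow> (g has_integral (f y - f x)) {x..y}"
proof -
  have "\<exists>g N. negligible N \<and> (\<forall>x. x \<notin> N \<longrightarrow> ((\<lambda>t. f t \<bullet> i) has_vector_derivative g x) (at x)) \<and>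
     (\<forall>x y. x \<le> y \<longrightarrow> (g has_integral (f y \<bullet> i - f x \<bullet> i)) {x..y})" if "i \<in> Basis" for i :: 'a
  proof -
    have "B-lipschitz_on UNIV (\<lambda>t. f t \<bullet> i)"
    proof (rule lipschitz_onI)
      fix x y
      have "dist (f x \<bullet> i) (f y \<bullet> i) \<le> dist (f x) (f y)"
        using Basis_le_norm[OF that, of "f x - f y"] by (simp add: dist_norm inner_diff_left)
      also have "\<dots> \<le> B * dist x y" using lipschitz_onD[OF lip] by auto
      finally show "dist (f x \<bullet> i) (f y \<bullet> i) \<le> B * dist x y" .
    qed (rule lipschitz_on_nonneg[OF lip])
    then show ?thesis
      by (rule lipschitz_real_derivative_ae) (auto simp: has_real_derivative_iff_has_vector_derivative)
  qed
  then obtain g N where gN: "\<And>i. i \<in> Basis \<Longrightarrow> negligible (N i)"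
    "\<And>i x. i \<in> Basis \<Longrightarrow> x \<notin> N i \<Longrightarrow> ((\<lambda>t. f t \<bullet> i) has_vector_derivative g i x) (at x)"
    "\<And>i x y. i \<in> Basis \<Longrightarrow> x \<le> y \<Longrightarrow> (g i has_integral (f y \<bullet> i - f x \<bullet> i)) {x..y}"
    by metis
  define h where "h x = (\<Sum>i\<in>Basis. g i x *\<^sub>R i)" for x
  have hi: "h x \<bullet> i = g i x" if "i \<in> Basis" for x i
    using that by (simp add: h_def)
  show ?thesis
  proof
    show "negligible (\<Union>(N ` Basis))"
      using gN(1) by (intro negligible_Union) auto
    show "(f has_vector_derivative h x) (at x)" if "x \<notin> \<Union>(N ` Basis)" for x
      unfolding has_vector_derivative_def
      by (subst has_derivative_componentwise_within)
         (use gN(2) that in \<open>auto simp: hi has_vector_derivative_def\<close>)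
    show "(h has_integral (f y - f x)) {x..y}" if "x \<le> y" for x y
      unfolding has_integral_componentwise_iff[of h]
      using gN(3) that by (auto simp: hi inner_diff_left)
  qed
qed

lemma AE_lborel_if_negligible:
  assumes "negligible N" "\<And>x. x \<notin> N \<Longrightarrow> P x"
  shows "AE x in lborel. P x"
proof -
  have "AE x in lebesgue. P x"
    using assms by (auto simp: negligible_iff_null_sets intro!: AE_I')
  then show ?thesis by (simp add: AE_completion_iff)
qed

lemma lipschitz_extension_interval:
  fixes f :: "real \<Rightarrow> 'a::metric_space"
  assumes "B-lipschitz_on {a..b} f" "a \<le> b"
  shows "B-lipschitz_on UNIV (\<lambda>t. f (max a (min b t)))"
proof (rule lipschitz_onI)
  fix x y
  have "dist (f (max a (min b x))) (f (max a (min b y))) \<le> B * dist (max a (min b x)) (max a (min b y))"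
    using assms by (intro lipschitz_onD) auto
  also have "\<dots> \<le> B * dist x y"
    using lipschitz_on_nonneg[OF assms(1)] by (intro mult_left_mono) (auto simp: dist_real_def)
  finally show "dist (f (max a (min b x))) (f (max a (min b y))) \<le> B * dist x y" .
qed (rule lipschitz_on_nonneg[OF assms(1)])

lemma lipschitz_ae_vector_derivative:
  fixes f :: "real \<Rightarrow> 'a::euclidean_space"
  assumes lip: "B-lipschitz_on {a..b} f"
  shows "AE t in lborel. t \<in> {a..b} \<longrightarrow> (f has_vector_derivative vector_derivative f (at t)) (at t)"
    and "a \<le> b \<Longrightarrow> ((\<lambda>t. vector_derivative f (at t)) has_integral (f b - f a)) {a..b}"
proof -
  have *: "(AE t in lborel. t \<in> {a..b} \<longrightarrow> (f has_vector_derivative vector_derivative f (at t)) (at t)) \<and>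
    ((\<lambda>t. vector_derivative f (at t)) has_integral (f b - f a)) {a..b}" if ab: "a \<le> b"
  proof -
    obtain g N where gN: "negligible N" "\<And>x. x \<notin> N \<Longrightarrow> ((\<lambda>t. f (max a (min b t))) has_vector_derivative g x) (at x)"
      "\<And>x y. x \<le> y \<Longrightarrow> (g has_integral (f (max a (min b y)) - f (max a (min b x)))) {x..y}"
      by (rule lipschitz_vector_derivative_ae[OF lipschitz_extension_interval[OF lip ab]]) (rule that; assumption)
    \<comment> \<open>The clamped extension agrees with \<open>f\<close> only inside the interval,
      hence the two end points join the exceptional set.\<close>
    have d: "(f has_vector_derivative g t) (at t)" if "t \<notin> N \<union> {a, b}" "t \<in> {a..b}" for t
    proof (rule has_vector_derivative_transform_within_open[OF gN(2), of _ "{a<..<b}"])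
      show "f (max a (min b x)) = f x" if "x \<in> {a<..<b}" for x
        using that by (auto simp: min_def max_def)
    qed (use that in auto)
    have neg: "negligible (N \<union> {a,b})" using gN(1) by simp
    have "AE t in lborel. t \<in> {a..b} \<longrightarrow> (f has_vector_derivative g t) (at t)"
      by (rule AE_lborel_if_negligible[OF neg]) (use d in auto)
    then have 1: "AE t in lborel. t \<in> {a..b} \<longrightarrow> (f has_vector_derivative vector_derivative f (at t)) (at t) \<and> vector_derivative f (at t) = g t"
      by eventually_elim (auto simp: vector_derivative_at)
    have "((\<lambda>t. vector_derivative f (at t)) has_integral (f b - f a)) {a..b}"
    proof (subst has_integral_AE)
      show "AE t in lborel. t \<in> {a..b} \<longrightarrow> vector_derivative f (at t) = g t"
        using 1 by eventually_elim auto
      show "(g has_integral (f b - f a)) {a..b}"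
        using gN(3)[OF ab] ab by simp
    qed
    moreover have "AE t in lborel. t \<in> {a..b} \<longrightarrow> (f has_vector_derivative vector_derivative f (at t)) (at t)"
      using 1 by eventually_elim auto
    ultimately show ?thesis by simp
  qed
  then show "a \<le> b \<Longrightarrow> ((\<lambda>t. vector_derivative f (at t)) has_integral (f b - f a)) {a..b}" by simp
  show "AE t in lborel. t \<in> {a..b} \<longrightarrow> (f has_vector_derivative vector_derivative f (at t)) (at t)"
    using * by (cases "a \<le> b") auto
qed

lemma lipschitz_has_integral_derivative:
  fixes f :: "real \<Rightarrow> 'a::euclidean_space"
  assumes lip: "B-lipschitz_on {a..b} f" and "a \<le> b"
    and ae: "AE t in lborel. t \<in> {a..b} \<longrightarrow> (f has_vector_derivative f' t) (at t)"
  shows "(f' has_integral (f b - f a)) {a..b}"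
proof (subst has_integral_AE)
  show "AE t in lborel. t \<in> {a..b} \<longrightarrow> f' t = vector_derivative f (at t)"
    using ae by eventually_elim (auto simp: vector_derivative_at)
qed (rule lipschitz_ae_vector_derivative(2)[OF assms(1,2)])

lemma has_integral_mono_AE:
  fixes f g :: "'a::euclidean_space \<Rightarrow> real"
  assumes "(f has_integral i) S" "(g has_integral j) S" "AE t in lborel. t \<in> S \<longrightarrow> f t \<le> g t"
  shows "i \<le> j"
proof -
  \<comment> \<open>An almost everywhere inequality is made pointwise: the minimum has the integral
    of \<open>f\<close> and never exceeds \<open>g\<close>.\<close>
  have "((\<lambda>t. min (f t) (g t)) has_integral i) S"
  proof (subst has_integral_AE)
    show "AE t in lborel. t \<in> S \<longrightarrow> min (f t) (g t) = f t"
      using assms(3) by eventually_elim auto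
  qed (rule assms(1))
  then show ?thesis
    using assms(2) by (rule has_integral_le) auto
qed

lemma lipschitz_mono_if_derivative_nonneg:
  fixes f :: "real \<Rightarrow> real"
  assumes lip: "B-lipschitz_on {a..b} f" and "a \<le> b"
    and ae: "AE t in lborel. t \<in> {a..b} \<longrightarrow> vector_derivative f (at t) \<ge> 0"
  shows "f a \<le> f b"
  using has_integral_mono_AE[OF has_integral_0 lipschitz_ae_vector_derivative(2)[OF lip \<open>a \<le> b\<close>] ae] by simp

lemma lipschitz_const_if_derivative_zero:
  fixes f :: "real \<Rightarrow> 'a::euclidean_space"
  assumes lip: "B-lipschitz_on {a..b} f" and "a \<le> b"
    and ae: "AE t in lborel. t \<in> {a..b} \<longrightarrow> vector_derivative f (at t) = 0"
  shows "f a = f b"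
proof -
  have "((\<lambda>t. vector_derivative f (at t)) has_integral 0) {a..b}"
    by (subst has_integral_AE[OF ae]) auto
  from has_integral_unique[OF this lipschitz_ae_vector_derivative(2)[OF lip \<open>a \<le> b\<close>]] show ?thesis by simp
qed

text \<open>Fubini's theorem and the integrability of the length ask for a version of the derivative
  that is Borel and bounded everywhere, while \<open>vector_derivative\<close> is arbitrary off the
  points of differentiability. A limit of difference quotients provides it.\<close>

lemma lipschitz_borel_derivative:
  fixes f :: "real \<Rightarrow> 'a::euclidean_space"
  assumes lip: "B-lipschitz_on {a..b} f" and "a \<le> b"
  obtains d where "d \<in> borel_measurable borel" "\<And>t. norm (d t) \<le> B"
    "AE t in lborel. t \<in> {a..b} \<longrightarrow> (f has_vector_derivative d t) (at t)"
proof -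
  define F where "F t = f (max a (min b t))" for t
  have F: "B-lipschitz_on UNIV F"
    unfolding F_def by (rule lipschitz_extension_interval[OF assms])
  have B: "B \<ge> 0" using lip lipschitz_on_nonneg by blast
  define D where "D n t = (F (t + 1 / real (Suc n)) - F t) /\<^sub>R (1 / real (Suc n))" for n t
  have Dm: "D n \<in> borel_measurable borel" for n
    unfolding D_def
    by (intro borel_measurable_continuous_onI continuous_intros continuous_on_compose2[OF lipschitz_on_continuous_on[OF F]]) auto
  define d0 where "d0 t = lim (\<lambda>n. D n t)" for t
  \<comment> \<open>Cutting off values of norm above \<open>B\<close> makes the bound hold also
    where the quotients diverge; at points of differentiability inside the interval nothing is cut
    off.\<close>
  define d where "d t = (if norm (d0 t) \<le> B then d0 t else 0)" for t
  have d0m: "d0 \<in> borel_measurable borel"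
    unfolding d0_def using Dm by measurable
  have "d \<in> borel_measurable borel"
    unfolding d_def using d0m by measurable
  moreover have "norm (d t) \<le> B" for t
    using B by (simp add: d_def)
  moreover have "AE t in lborel. t \<in> {a..b} \<longrightarrow> (f has_vector_derivative d t) (at t)"
    using lipschitz_ae_vector_derivative(1)[OF lip] AE_lborel_singleton[of a] AE_lborel_singleton[of b]
  proof eventually_elim
    case (elim t)
    show ?case
    proof
      assume "t \<in> {a..b}"
      with elim have t: "a < t" "t < b" and der: "(f has_vector_derivative vector_derivative f (at t)) (at t)"
        by auto
      let ?v = "vector_derivative f (at t)"
      have derF: "(F has_vector_derivative ?v) (at t)"
        by (rule has_vector_derivative_transform_within_open[OF der, of "{a<..<b}"])
           (use t in \<open>auto simp: F_def min_def max_def\<close>)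
      have lim: "((\<lambda>y. norm (F y - F t - (y - t) *\<^sub>R ?v) / norm (y - t)) \<longlongrightarrow> 0) (at t)"
        using derF by (simp add: has_vector_derivative_def has_derivative_iff_norm)
      have seq: "filterlim (\<lambda>n. t + 1 / real (Suc n)) (at t) sequentially"
        using tendsto_add[OF tendsto_const LIMSEQ_inverse_real_of_nat, of t]
        by (auto simp: filterlim_at divide_inverse)
      have "norm (D n t - ?v) = norm (F (t + 1 / real (Suc n)) - F t - (1 / real (Suc n)) *\<^sub>R ?v) / (1 / real (Suc n))" for n
      proof -
        have "D n t - ?v = (F (t + 1 / real (Suc n)) - F t - (1 / real (Suc n)) *\<^sub>R ?v) /\<^sub>R (1 / real (Suc n))"
          by (simp add: D_def algebra_simps)
        then show ?thesis by (simp add: divide_inverse mult.commute)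
      qed
      then have "(\<lambda>n. norm (D n t - ?v)) \<longlonglongrightarrow> 0"
        using filterlim_compose[OF lim seq] by simp
      then have lims: "(\<lambda>n. D n t) \<longlonglongrightarrow> ?v"
        using LIM_zero_iff tendsto_norm_zero_iff by blast
      then have d0: "d0 t = ?v"
        unfolding d0_def by (metis limI)
      moreover have "norm (D n t) \<le> B" for n
      proof -
        have "norm (D n t) = norm (F (t + 1 / real (Suc n)) - F t) / (1 / real (Suc n))"
          by (simp add: D_def)
        also have "\<dots> \<le> B * (1 / real (Suc n)) / (1 / real (Suc n))"
          using lipschitz_on_normD[OF F, of "t + 1 / real (Suc n)" t] by (intro divide_right_mono) auto
        finally show ?thesis by simp
      qed
      then have "norm ?v \<le> B"
        by (intro LIMSEQ_le_const2[OF tendsto_norm[OF lims]]) auto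
      ultimately show "(f has_vector_derivative d t) (at t)"
        using der by (simp add: d_def)
    qed
  qed
  ultimately show ?thesis by (rule that)
qed

text \<open>On a compact interval \<open>exp (q t)\<close> keeps a distance \<open>m\<close> from 0,
  so the logarithm is Lipschitz along it locally; on an interval a continuous function with local
  constant \<open>2 * B / m\<close> has this constant globally.\<close>

lemma lipschitz_on_log:
  fixes q :: "real \<Rightarrow> complex"
  assumes cont: "continuous_on {a..b} q" and lip: "B-lipschitz_on {a..b} (\<lambda>t. exp (q t))"
  obtains C where "C-lipschitz_on {a..b} q"
proof (cases "a \<le> b")
  case False
  then show ?thesis using that[of 0] by simp
next
  case True
  have "compact ((\<lambda>t. norm (exp (q t))) ` {a..b})"
    by (intro compact_continuous_image continuous_intros cont) auto
  then obtain u where u: "u \<in> {a..b}" "\<And>t. t \<in> {a..b} \<Longrightarrow> norm (exp (q u)) \<le> norm (exp (q t))"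
    using compact_attains_inf[of "(\<lambda>t. norm (exp (q t))) ` {a..b}"] True by auto
  define m where "m = norm (exp (q u))"
  have m: "m > 0" by (simp add: m_def)
  have B: "B \<ge> 0" using lip lipschitz_on_nonneg by blast
  have "(2 * B / m)-lipschitz_on {a..b} q"
  proof (rule locally_lipschitz_imp_lipschitz[OF cont])
    show "0 \<le> 2 * B / m" using B m by simp
    fix x y assume x: "x \<in> {a..<b}" and y: "x < y"
    have 1: "((\<lambda>t. q t - q x) \<longlongrightarrow> 0) (at x within {a..b})"
      using cont x by (auto simp: continuous_on LIM_zero_iff)
    have "eventually (\<lambda>t. norm (q t - q x) < 1) (at x within {a..b})"
      using order_tendstoD(2)[OF tendsto_norm[OF 1], of 1] by simp
    moreover have "((\<lambda>t. exp (q t - q x) - 1) \<longlongrightarrow> exp 0 - 1) (at x within {a..b})"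
      by (intro tendsto_intros 1)
    then have "eventually (\<lambda>t. norm (exp (q t - q x) - 1) < 1/2) (at x within {a..b})"
      using order_tendstoD(2)[OF tendsto_norm, of _ 0 _ "1/2"] by simp
    ultimately have "eventually (\<lambda>t. norm (q t - q x) < 1 \<and> norm (exp (q t - q x) - 1) < 1/2) (at x within {a..b})"
      by eventually_elim auto
    then obtain e where e: "e > 0" "\<And>t. t \<in> {a..b} \<Longrightarrow> t \<noteq> x \<Longrightarrow> dist t x < e \<Longrightarrow> norm (q t - q x) < 1 \<and> norm (exp (q t - q x) - 1) < 1/2"
      unfolding eventually_at by blast
    define z where "z = min (min y b) (x + e/2)"
    have z: "x < z" "z \<le> y" "z \<in> {a..b}" "dist z x < e"
      using x y e(1) by (auto simp: z_def dist_real_def min_def)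
    let ?w = "q z - q x"
    have w: "norm ?w < 1" "norm (exp ?w - 1) < 1/2"
      using e(2)[of z] z by auto
    \<comment> \<open>An increment of norm below 1 lies in the strip of the principal branch, so
      \<open>Ln\<close> recovers it from its exponential. The factor 2 comes from the bound of
      \<open>Ln (1 + u)\<close> for \<open>norm u < 1/2\<close>.\<close>
    have "\<bar>Im ?w\<bar> < pi"
      using abs_Im_le_cmod[of ?w] w(1) pi_gt3 by linarith
    then have "?w = Ln (1 + (exp ?w - 1))"
      by (simp add: Ln_exp)
    then have "norm ?w \<le> 2 * norm (exp ?w - 1)"
      using norm_Ln_le[OF w(2)] by simp
    also have "exp ?w - 1 = (exp (q z) - exp (q x)) / exp (q x)"
      by (simp add: exp_diff diff_divide_distrib)
    also have "2 * norm \<dots> = 2 * (norm (exp (q z) - exp (q x)) / norm (exp (q x)))"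
      by (simp only: norm_divide)
    also have "\<dots> \<le> 2 * (B * (z - x) / m)"
    proof (intro mult_left_mono frac_le)
      show "norm (exp (q z) - exp (q x)) \<le> B * (z - x)"
        using lipschitz_on_normD[OF lip, of z x] z x by auto
      show "m \<le> norm (exp (q x))" unfolding m_def using u(2)[of x] x by auto
    qed (use B z m in auto)
    finally show "\<exists>z\<in>{x<..y}. dist (q z) (q x) \<le> 2 * B / m * (z - x)"
      using z by (intro bexI[of _ z]) (auto simp: dist_norm)
  qed
  then show ?thesis using that by blast
qed

lemma has_vector_derivative_log_ae:
  fixes q c :: "real \<Rightarrow> complex"
  assumes q: "C-lipschitz_on {a..b} q" and c: "\<And>t. t \<in> {a..b} \<Longrightarrow> c t = z + exp (q t)"
    and d: "AE t in lborel. t \<in> {a..b} \<longrightarrow> (c has_vector_derivative d t) (at t)"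
  shows "AE t in lborel. t \<in> {a..b} \<longrightarrow> (q has_vector_derivative d t / (c t - z)) (at t)"
  using lipschitz_ae_vector_derivative(1)[OF q] d AE_lborel_singleton[of a] AE_lborel_singleton[of b]
proof eventually_elim
  case (elim t)
  show ?case
  proof
    assume "t \<in> {a..b}"
    with elim have t: "t \<in> {a<..<b}" and q': "(q has_vector_derivative vector_derivative q (at t)) (at t)"
      and c': "(c has_vector_derivative d t) (at t)" by auto
    have "((\<lambda>t. z + exp (q t)) has_vector_derivative exp (q t) * vector_derivative q (at t)) (at t)"
      using field_vector_diff_chain_at[OF q' DERIV_exp] by (auto intro!: derivative_eq_intros simp: o_def mult.commute)
    then have "(c has_vector_derivative exp (q t) * vector_derivative q (at t)) (at t)"
      by (rule has_vector_derivative_transform_within_open[of _ _ _ "{a<..<b}"]) (use t c in auto)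
    with c' have "d t = exp (q t) * vector_derivative q (at t)"
      using vector_derivative_unique_at by blast
    moreover have "c t - z = exp (q t)" using c t by auto
    ultimately show "(q has_vector_derivative d t / (c t - z)) (at t)"
      using q' by simp
  qed
qed

text \<open>A continuous logarithm of \<open>c t - z\<close> is again Lipschitz, hence the integral
  of its derivative, and its total increment is \<open>2 * pi * \<i>\<close> times the winding
  number. So the Cauchy integral is valid for curves that are only Lipschitz.\<close>

lemma winding_number_lipschitz:
  fixes c :: "real \<Rightarrow> complex"
  assumes lip: "B-lipschitz_on {0..1} c" and z: "z \<notin> path_image c"
    and d: "AE t in lborel. t \<in> {0..1} \<longrightarrow> (c has_vector_derivative d t) (at t)"
  shows "((\<lambda>t. d t / (c t - z)) has_integral (2 * of_real pi * \<i> * winding_number c z)) {0..1}"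
proof -
  have "path c" using lip by (simp add: path_def lipschitz_on_continuous_on)
  then obtain q where q: "path q" "pathfinish q - pathstart q = 2 * of_real pi * \<i> * winding_number c z"
                  "\<And>t. t \<in> {0..1} \<Longrightarrow> c t = z + exp(q t)"
    using winding_number_as_continuous_log z by blast
  have "B-lipschitz_on {0..1} (\<lambda>t. exp (q t))"
  proof (rule lipschitz_onI)
    show "dist (exp (q x)) (exp (q y)) \<le> B * dist x y" if "x \<in> {0..1}" "y \<in> {0..1}" for x y
      using lipschitz_onD[OF lip that] q(3) that by (auto simp: dist_norm)
  qed (rule lipschitz_on_nonneg[OF lip])
  then obtain C where C: "C-lipschitz_on {0..1} q"
    using lipschitz_on_log q(1) unfolding path_def by blast
  show ?thesis
    using lipschitz_has_integral_derivative[OF C _ has_vector_derivative_log_ae[OF C q(3) d]] q(2)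
    by (simp add: pathfinish_def pathstart_def)
qed

subsection \<open>Green's formula for Lipschitz curves\<close>

lemma lborel_complex_eq_distr:
  "(lborel :: complex measure) = distr lborel borel (\<lambda>p. Complex (fst p) (snd p))"
proof (rule lborel_eqI)
  have m: "(\<lambda>p. Complex (fst p) (snd p)) \<in> borel_measurable (borel :: (real \<times> real) measure)"
    by (intro borel_measurable_continuous_onI) (simp add: Complex_eq continuous_intros)
  fix l u :: complex assume lu: "\<And>b. b \<in> Basis \<Longrightarrow> l \<bullet> b \<le> u \<bullet> b"
  have "(\<lambda>p. Complex (fst p) (snd p)) -` box l u = box (Re l, Im l) (Re u, Im u)"
    by (auto simp: box_def Basis_complex_def Basis_prod_def)
  then have "emeasure (distr lborel borel (\<lambda>p. Complex (fst p) (snd p))) (box l u)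
     = emeasure lborel (box (Re l, Im l) (Re u, Im u))"
    using m by (simp add: emeasure_distr)
  also have "\<dots> = (\<Prod>b\<in>Basis. (u - l) \<bullet> b)"
    using lu[of 1] lu[of \<i>]
    by (simp add: emeasure_lborel_box_eq Basis_prod_def Basis_complex_def)
  finally show "emeasure (distr lborel borel (\<lambda>p. Complex (fst p) (snd p))) (box l u) = (\<Prod>b\<in>Basis. (u - l) \<bullet> b)" .
qed auto

lemma borel_measurable_Complex_pair [measurable]:
  "(\<lambda>p. Complex (fst p) (snd p)) \<in> borel_measurable (borel :: (real \<times> real) measure)"
  by (intro borel_measurable_continuous_onI) (simp add: Complex_eq continuous_intros)

lemma integral_complex_eq_integral_prod:
  fixes f :: "complex \<Rightarrow> 'b::{banach, second_countable_topology}"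
  assumes "f \<in> borel_measurable borel"
  shows "integral\<^sup>L lborel f = (\<integral>p. f (Complex (fst p) (snd p)) \<partial>lborel)"
    and "integrable lborel f \<longleftrightarrow> integrable lborel (\<lambda>p. f (Complex (fst p) (snd p)))"
proof -
  have "(\<lambda>p. Complex (fst p) (snd p)) \<in> lborel \<rightarrow>\<^sub>M borel" by simp
  then show "integral\<^sup>L lborel f = (\<integral>p. f (Complex (fst p) (snd p)) \<partial>lborel)"
    and "integrable lborel f \<longleftrightarrow> integrable lborel (\<lambda>p. f (Complex (fst p) (snd p)))"
    using assms by (subst lborel_complex_eq_distr, simp add: integral_distr integrable_distr_eq)+
qed

lemma AE_complex_pair:
  assumes "AE z::complex in lborel. P z"
  shows "AE p in lborel. P (Complex (fst p) (snd p))"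
  using assms by (subst (asm) lborel_complex_eq_distr) (rule AE_distrD, auto)

lemma nn_integral_inverse_sqrt:
  assumes "c \<ge> 0"
  shows "(\<integral>\<^sup>+x. ennreal (indicator {a - c..a + c} x / sqrt \<bar>a - x\<bar>) \<partial>lborel) = ennreal (4 * sqrt c)"
proof (rule nn_integral_has_integral_lborel)
  let ?S = "\<lambda>x. 2 * sgn (x - a) * sqrt \<bar>x - a\<bar>"
  have "((\<lambda>x. 1 / sqrt \<bar>a - x\<bar>) has_integral (?S (a + c) - ?S (a - c))) {a - c..a + c}"
  proof (rule fundamental_theorem_of_calculus_interior_strong[where S = "{a}"])
    show "(?S has_vector_derivative 1 / sqrt \<bar>a - x\<bar>) (at x)" if x: "x \<in> {a - c<..<a + c} - {a}" for x
    proof (cases "x > a")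
      case True
      have "((\<lambda>x. 2 * sqrt (x - a)) has_real_derivative 1 / sqrt \<bar>a - x\<bar>) (at x)"
        using True by (auto intro!: derivative_eq_intros simp: field_simps)
      then have "(?S has_real_derivative 1 / sqrt \<bar>a - x\<bar>) (at x)"
        by (rule has_field_derivative_transform_within_open[of _ _ _ "{a<..}"]) (use True in auto)
      then show ?thesis by (simp add: has_real_derivative_iff_has_vector_derivative)
    next
      case False
      with x have xa: "x < a" by auto
      have "((\<lambda>x. - 2 * sqrt (a - x)) has_real_derivative 1 / sqrt \<bar>a - x\<bar>) (at x)"
        using xa by (auto intro!: derivative_eq_intros simp: field_simps)
      then have "(?S has_real_derivative 1 / sqrt \<bar>a - x\<bar>) (at x)"
        by (rule has_field_derivative_transform_within_open[of _ _ _ "{..<a}"]) (use xa in auto)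
      then show ?thesis by (simp add: has_real_derivative_iff_has_vector_derivative)
    qed
    have "?S = (\<lambda>x. 2 * (sqrt (max 0 (x - a)) - sqrt (max 0 (a - x))))"
      by (auto simp: fun_eq_iff sgn_if)
    then show "continuous_on {a - c..a + c} ?S"
      by (simp only:) (intro continuous_intros)
  qed (use assms in auto)
  moreover have "?S (a + c) - ?S (a - c) = 4 * sqrt c"
    using assms by (simp add: sgn_if)
  ultimately have "((\<lambda>x. 1 / sqrt \<bar>a - x\<bar>) has_integral (4 * sqrt c)) {a - c..a + c}"
    by simp
  then have "((\<lambda>x. if x \<in> {a - c..a + c} then 1 / sqrt \<bar>a - x\<bar> else 0) has_integral (4 * sqrt c)) UNIV"
    by (simp only: has_integral_restrict_UNIV)
  moreover have "(\<lambda>x. if x \<in> {a - c..a + c} then 1 / sqrt \<bar>a - x\<bar> else 0) = (\<lambda>x. indicator {a - c..a + c} x / sqrt \<bar>a - x\<bar>)"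
    by (auto simp: indicator_def)
  ultimately show "((\<lambda>x. indicator {a - c..a + c} x / sqrt \<bar>a - x\<bar>) has_integral (4 * sqrt c)) UNIV"
    by (simp only:)
qed auto

lemma nn_integral_inverse_sqrt_le:
  assumes "\<bar>a\<bar> \<le> M" "A \<subseteq> {-M..M}"
  shows "(\<integral>\<^sup>+x. ennreal (indicator A x / sqrt \<bar>a - x\<bar>) \<partial>lborel) \<le> ennreal (4 * sqrt (2 * M))"
proof -
  have "(\<integral>\<^sup>+x. ennreal (indicator A x / sqrt \<bar>a - x\<bar>) \<partial>lborel)
     \<le> (\<integral>\<^sup>+x. ennreal (indicator {a - 2 * M..a + 2 * M} x / sqrt \<bar>a - x\<bar>) \<partial>lborel)"
    using assms by (intro nn_integral_mono ennreal_leI divide_right_mono) (force simp: indicator_def)+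
  also have "\<dots> = ennreal (4 * sqrt (2 * M))"
    using assms by (intro nn_integral_inverse_sqrt) auto
  finally show ?thesis .
qed

text \<open>By AM-GM \<open>\<bar>u\<bar> \<bar>v\<bar> \<le> u\<^sup>2 + v\<^sup>2\<close>, so that the Cauchy kernel is dominated by a product of two integrable
  functions of one variable.\<close>

lemma nn_integral_cauchy_kernel_le:
  assumes "\<bar>Re w\<bar> \<le> M" "\<bar>Im w\<bar> \<le> M" "A \<subseteq> {-M..M}" "A' \<subseteq> {-M..M}" "A \<in> sets borel" "A' \<in> sets borel"
  shows "(\<integral>\<^sup>+p. ennreal (indicator (A \<times> A') p / cmod (w - Complex (fst p) (snd p))) \<partial>lborel) \<le> ennreal (32 * M)"
proof -
  let ?f = "\<lambda>x. ennreal (indicator A x / sqrt \<bar>Re w - x\<bar>)" and ?g = "\<lambda>y. ennreal (indicator A' y / sqrt \<bar>Im w - y\<bar>)"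
  have M: "M \<ge> 0" using assms by auto
  have ae: "AE p in lborel. p \<noteq> (x, y) \<longrightarrow> True" for x y :: real by simp
  have "AE z::complex in lborel. z \<notin> {z. Re z = Re w} \<and> z \<notin> {z. Im z = Im w}"
  proof (rule AE_lborel_if_negligible)
    have "negligible {z::complex. 1 \<bullet> z = Re w}" "negligible {z. \<i> \<bullet> z = Im w}"
      by (intro negligible_hyperplane; simp)+
    then show "negligible ({z. Re z = Re w} \<union> {z. Im z = Im w})"
      by (simp add: inner_complex_def)
  qed auto
  note AE_complex_pair[OF this]
  then have "(\<integral>\<^sup>+p. ennreal (indicator (A \<times> A') p / cmod (w - Complex (fst p) (snd p))) \<partial>lborel)
     \<le> (\<integral>\<^sup>+p. ?f (fst p) * ?g (snd p) \<partial>lborel)"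
  proof (intro nn_integral_mono_AE, eventually_elim)
    case (elim p)
    obtain x y where p: "p = (x, y)" by (cases p)
    let ?u = "\<bar>Re w - x\<bar>" and ?v = "\<bar>Im w - y\<bar>"
    have uv: "?u > 0" "?v > 0" using elim p by auto
    have "?u * ?v \<le> ?u\<^sup>2 + ?v\<^sup>2"
      using sum_squares_bound[of ?u ?v] mult_nonneg_nonneg[of ?u ?v] by linarith
    then have "sqrt ?u * sqrt ?v \<le> cmod (w - Complex x y)"
      by (simp add: cmod_def real_sqrt_mult[symmetric])
    then have "1 / cmod (w - Complex x y) \<le> 1 / (sqrt ?u * sqrt ?v)"
      using uv by (intro divide_left_mono) (auto intro!: mult_pos_pos simp: complex_eq_iff)
    then have "indicator (A \<times> A') p / cmod (w - Complex (fst p) (snd p)) \<le> (indicator A x / sqrt ?u) * (indicator A' y / sqrt ?v)"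
      by (auto simp: p indicator_def)
    then show ?case by (simp add: p ennreal_mult'[symmetric] ennreal_leI)
  qed
  also have "\<dots> = (\<integral>\<^sup>+p. ?f (fst p) * ?g (snd p) \<partial>(lborel \<Otimes>\<^sub>M lborel))"
    by (simp add: lborel_prod)
  also have "\<dots> = (\<integral>\<^sup>+x. \<integral>\<^sup>+y. ?f x * ?g y \<partial>lborel \<partial>lborel)"
    using assms(5,6) by (subst lborel.nn_integral_fst[symmetric]) (auto simp: split_beta)
  also have "\<dots> = (\<integral>\<^sup>+x. ?f x \<partial>lborel) * (\<integral>\<^sup>+y. ?g y \<partial>lborel)"
    using assms(5,6) by (simp add: nn_integral_cmult nn_integral_multc)
  also have "\<dots> \<le> ennreal (4 * sqrt (2 * M)) * ennreal (4 * sqrt (2 * M))"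
    using assms by (intro mult_mono nn_integral_inverse_sqrt_le) auto
  also have "\<dots> = ennreal (32 * M)"
    using M by (simp add: ennreal_mult'[symmetric])
  finally show ?thesis .
qed

text \<open>The integral over \<open>-n \<le> x \<le> n\<close> of \<open>Im (d / (u - z))\<close>
  with \<open>z = Complex x y\<close>, where \<open>a = Re u\<close> and
  \<open>v = Im u - y\<close>: the real part of \<open>d\<close> gives arctangents, the imaginary
  part logarithms.\<close>

definition kernel_primitive :: "complex \<Rightarrow> real \<Rightarrow> real \<Rightarrow> real \<Rightarrow> real" where
  "kernel_primitive d a v n = Re d * (arctan ((a - n) / v) - arctan ((a + n) / v))
     + Im d / 2 * (ln ((a + n)\<^sup>2 + v\<^sup>2) - ln ((a - n)\<^sup>2 + v\<^sup>2))"

lemma integral_cauchy_kernel_horizontal: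
  assumes v: "v \<noteq> 0" and n: "n \<ge> 0"
  shows "(\<integral>x. indicator {-n..n} x * Im (d / Complex (a - x) v) \<partial>lborel) = kernel_primitive d a v n"
proof -
  have pos: "(a - x)\<^sup>2 + v\<^sup>2 > 0" for x using v by (simp add: sum_power2_gt_zero_iff)
  let ?F = "\<lambda>x. Re d * arctan ((a - x) / v) - Im d / 2 * ln ((a - x)\<^sup>2 + v\<^sup>2)"
  have eq: "Im (d / Complex (a - x) v) = (Im d * (a - x) - Re d * v) / ((a - x)\<^sup>2 + v\<^sup>2)" for x
    by (simp add: Im_divide)
  have "(\<integral>x. Im (d / Complex (a - x) v) * indicator {-n..n} x \<partial>lborel) = ?F n - ?F (-n)"
  proof (rule integral_FTC_Icc_real)
    fix x
    have "1 + ((a - x) / v)\<^sup>2 = ((a - x)\<^sup>2 + v\<^sup>2) / v\<^sup>2"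
      using v by (simp add: field_simps)
    then have e1: "inverse (1 + ((a - x) / v)\<^sup>2) * (- 1 / v) = - v / ((a - x)\<^sup>2 + v\<^sup>2)"
      using v by (simp add: field_simps power2_eq_square)
    have "((\<lambda>x. arctan ((a - x) / v)) has_real_derivative inverse (1 + ((a - x) / v)\<^sup>2) * (- 1 / v)) (at x)"
      using v by (auto intro!: derivative_eq_intros)
    moreover have "((\<lambda>x. ln ((a - x)\<^sup>2 + v\<^sup>2)) has_real_derivative 1 / ((a - x)\<^sup>2 + v\<^sup>2) * (2 * (a - x) * (-1))) (at x)"
      using pos[of x] by (auto intro!: derivative_eq_intros)
    ultimately have "(?F has_real_derivative (Re d * (inverse (1 + ((a - x) / v)\<^sup>2) * (- 1 / v))
        - Im d / 2 * (1 / ((a - x)\<^sup>2 + v\<^sup>2) * (2 * (a - x) * (-1))))) (at x)"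
      by (intro DERIV_diff DERIV_cmult)
    also have "(Re d * (inverse (1 + ((a - x) / v)\<^sup>2) * (- 1 / v))
        - Im d / 2 * (1 / ((a - x)\<^sup>2 + v\<^sup>2) * (2 * (a - x) * (-1)))) = Im (d / Complex (a - x) v)"
    proof -
      have "P \<noteq> 0 \<Longrightarrow> r * (- v / P) - i / 2 * (1 / P * (2 * u * (-1))) = (i * u - r * v) / P" for P r i u :: real
        by (simp add: field_simps)
      then show ?thesis unfolding e1 eq using pos[of x] by (metis less_irrefl)
    qed
    finally show "(?F has_real_derivative Im (d / Complex (a - x) v)) (at x)" .
    have "(a - x)\<^sup>2 + v\<^sup>2 \<noteq> 0" using pos[of x] by (metis less_irrefl)
    then show "isCont (\<lambda>x. Im (d / Complex (a - x) v)) x"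
      unfolding eq by (intro continuous_intros)
  qed (use n in auto)
  then show ?thesis by (simp add: kernel_primitive_def algebra_simps mult.commute)
qed

text \<open>The majorant for the passage to full horizontal lines. For
  \<open>2 * \<bar>a\<bar> < n\<close> the distances from \<open>a\<close> to \<open>n\<close> and
  to \<open>- n\<close> differ at most by the factor 3, so the quotient under the logarithm is at
  most 9, uniformly in \<open>v\<close>.\<close>

lemma kernel_primitive_bound:
  assumes "2 * \<bar>a\<bar> < n" "v \<noteq> 0"
  shows "\<bar>kernel_primitive d a v n\<bar> \<le> cmod d * (pi + ln 9)"
proof -
  let ?P = "(a + n)\<^sup>2 + v\<^sup>2" and ?Q = "(a - n)\<^sup>2 + v\<^sup>2"
  have pos: "?P > 0" "?Q > 0" using assms by (simp_all add: sum_power2_gt_zero_iff)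
  have "(a + n)\<^sup>2 \<le> (3 * (n - a))\<^sup>2" "(n - a)\<^sup>2 \<le> (3 * (a + n))\<^sup>2"
    using assms by (intro power_mono; auto)+
  then have le: "(a + n)\<^sup>2 \<le> 9 * (n - a)\<^sup>2" "(n - a)\<^sup>2 \<le> 9 * (a + n)\<^sup>2"
    unfolding power_mult_distrib by simp_all
  have PQ: "?P \<le> 9 * ?Q" "?Q \<le> 9 * ?P"
    unfolding distrib_left power2_commute[of a n] by (intro add_mono le; simp)+
  have "ln ?P \<le> ln (9 * ?Q)" "ln ?Q \<le> ln (9 * ?P)"
    by (rule ln_mono[OF PQ(1) pos(1)], rule ln_mono[OF PQ(2) pos(2)])
  moreover have "ln (9 * ?Q) = ln 9 + ln ?Q" "ln (9 * ?P) = ln 9 + ln ?P"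
    by (intro ln_mult_pos pos; simp)+
  ultimately have "\<bar>ln ?P - ln ?Q\<bar> \<le> ln 9" by linarith
  moreover have "\<bar>arctan ((a - n) / v) - arctan ((a + n) / v)\<bar> \<le> pi"
    using arctan_lbound[of "(a - n) / v"] arctan_ubound[of "(a - n) / v"]
      arctan_lbound[of "(a + n) / v"] arctan_ubound[of "(a + n) / v"] by linarith
  moreover have "\<bar>Re d\<bar> \<le> cmod d" "\<bar>Im d / 2\<bar> \<le> cmod d"
    using abs_Re_le_cmod[of d] abs_Im_le_cmod[of d] by auto
  ultimately have "\<bar>Re d * (arctan ((a - n) / v) - arctan ((a + n) / v))\<bar> \<le> cmod d * pi"
     "\<bar>Im d / 2 * (ln ?P - ln ?Q)\<bar> \<le> cmod d * ln 9"
    unfolding abs_mult by (intro mult_mono; simp)+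
  then show ?thesis unfolding kernel_primitive_def by (simp add: algebra_simps abs_le_iff)
qed

text \<open>On a full horizontal line the logarithms cancel and the arctangents leave half a turn,
  whose sign tells on which side of the line the point lies.\<close>

lemma kernel_primitive_tendsto:
  assumes "v \<noteq> 0"
  shows "(\<lambda>n. kernel_primitive d a v (real n)) \<longlonglongrightarrow> - pi * sgn v * Re d"
proof -
  have ln0: "(\<lambda>n. ln ((a + real n)\<^sup>2 + v\<^sup>2) - ln ((a - real n)\<^sup>2 + v\<^sup>2)) \<longlonglongrightarrow> 0"
    by real_asymp
  have "(\<lambda>n. arctan ((a - real n) / v) - arctan ((a + real n) / v)) \<longlonglongrightarrow> - pi * sgn v"
  proof (cases "v > 0")
    case True
    then have "(\<lambda>n. arctan ((a - real n) / v) - arctan ((a + real n) / v)) \<longlonglongrightarrow> - pi"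
      by real_asymp
    with True show ?thesis by simp
  next
    case False
    with assms have "v < 0" by simp
    then have "(\<lambda>n. arctan ((a - real n) / v) - arctan ((a + real n) / v)) \<longlonglongrightarrow> pi"
      by real_asymp
    with \<open>v < 0\<close> show ?thesis by simp
  qed
  from tendsto_add[OF tendsto_mult[OF tendsto_const[of "Re d"] this] tendsto_mult[OF tendsto_const[of "Im d / 2"] ln0]]
  show ?thesis by (simp add: kernel_primitive_def mult.commute mult.left_commute)
qed

lemma negligible_lipschitz_path_image:
  fixes c :: "real \<Rightarrow> complex"
  assumes lip: "B-lipschitz_on {0..1} c"
  shows "negligible (path_image c)"
proof -
  \<comment> \<open>The unit interval is laid on the real axis of the plane, a null set;
    \<open>c\<close> composed with \<open>Re\<close> is Lipschitz there, as a map from the plane to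
    itself, and keeps null sets null.\<close>
  let ?S = "{z::complex. \<i> \<bullet> z = 0} \<inter> {z. Re z \<in> {0..1}}"
  have "negligible ?S"
    by (rule negligible_subset[OF negligible_hyperplane[of \<i> 0]]) auto
  then have "negligible ((\<lambda>z. c (Re z)) ` ?S)"
  proof (intro negligible_locally_Lipschitz_image exI conjI ballI)
    fix x y assume "x \<in> ?S" "y \<in> ?S \<inter> UNIV"
    then have "norm (c (Re y) - c (Re x)) \<le> B * \<bar>Re (y - x)\<bar>"
      using lipschitz_on_normD[OF lip, of "Re y" "Re x"] by auto
    also have "\<dots> \<le> B * norm (y - x)"
      by (intro mult_left_mono abs_Re_le_cmod lipschitz_on_nonneg[OF lip])
    finally show "norm (c (Re y) - c (Re x)) \<le> B * norm (y - x)" .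
  qed auto
  moreover have "path_image c \<subseteq> (\<lambda>z. c (Re z)) ` ?S"
    unfolding path_image_def
  proof
    fix z assume "z \<in> c ` {0..1}"
    then obtain t where "t \<in> {0..1}" "z = c t" by auto
    then show "z \<in> (\<lambda>z. c (Re z)) ` ?S"
      by (intro image_eqI[of _ _ "of_real t"]) (auto simp: inner_complex_def)
  qed
  ultimately show ?thesis using negligible_subset by blast
qed

lemma integral_sgn_primitive:
  fixes k h :: "real \<Rightarrow> real"
  assumes b: "b \<in> {y1..y2}"
    and k: "\<And>y. y \<in> {y1..y2} \<Longrightarrow> (k has_real_derivative - h y) (at y)"
    and h: "continuous_on {y1..y2} h"
  shows "(\<integral>y. indicator {y1..y2} y * h y * sgn (b - y) \<partial>lborel) = k y1 + k y2 - 2 * k b"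
proof -
  have FTC: "has_bochner_integral lborel (\<lambda>y. indicator {u..v} y *\<^sub>R h y) (- k v - (- k u))"
    if "y1 \<le> u" "u \<le> v" "v \<le> y2" for u v
  proof (rule has_bochner_integral_FTC_Icc)
    show "((\<lambda>y. - k y) has_vector_derivative h y) (at y within {u..v})" if "u \<le> y" "y \<le> v" for y
    proof -
      have "((\<lambda>y. - k y) has_real_derivative - (- h y)) (at y)"
        using \<open>y1 \<le> u\<close> \<open>v \<le> y2\<close> that by (intro DERIV_minus k) auto
      then show ?thesis
        using has_real_derivative_iff_has_vector_derivative has_vector_derivative_at_within by fastforce
    qed
    show "continuous_on {u..v} h" using h that continuous_on_subset by fastforce
  qed (use that in auto)
  have "has_bochner_integral lborel (\<lambda>y. indicator {y1..b} y *\<^sub>R h y - indicator {b..y2} y *\<^sub>R h y)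
    ((- k b - (- k y1)) - (- k y2 - (- k b)))"
    using b by (intro has_bochner_integral_diff FTC) auto
  then have "(\<integral>y. indicator {y1..b} y *\<^sub>R h y - indicator {b..y2} y *\<^sub>R h y \<partial>lborel) = k y1 + k y2 - 2 * k b"
    and m: "(\<lambda>y. indicator {y1..b} y *\<^sub>R h y - indicator {b..y2} y *\<^sub>R h y) \<in> borel_measurable lborel"
    by (auto simp: has_bochner_integral_iff)
  moreover have "(\<integral>y. indicator {y1..y2} y * h y * sgn (b - y) \<partial>lborel)
    = (\<integral>y. indicator {y1..b} y *\<^sub>R h y - indicator {b..y2} y *\<^sub>R h y \<partial>lborel)"
  proof (rule integral_cong_AE)
    have "(\<lambda>y. indicator {y1..y2} y *\<^sub>R h y) \<in> borel_measurable borel"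
      by (intro borel_measurable_continuous_on_indicator h) auto
    then show "(\<lambda>y. indicator {y1..y2} y * h y * sgn (b - y)) \<in> borel_measurable lborel"
      by simp
    show "AE y in lborel. indicator {y1..y2} y * h y * sgn (b - y) = indicator {y1..b} y *\<^sub>R h y - indicator {b..y2} y *\<^sub>R h y"
      using AE_lborel_singleton[of b] by eventually_elim (use b in \<open>auto simp: indicator_def sgn_if\<close>)
  qed (rule m)
  ultimately show ?thesis by simp
qed

text \<open>Fubini's theorem for the double integral of \<open>h (Im z) * Im (c' / (c - z))\<close>
  over the points \<open>z\<close> and the parameter. Along the curve the kernel gives
  \<open>2 * pi\<close> times the winding number, which is \<open>w\<close> inside and 0 outside.
  Along horizontal lines it gives \<open>- pi * sgn (Im c - y) * Re c'\<close>, and integrating this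
  against \<open>h\<close> produces \<open>k (Im c)\<close> up to constants. The kernel is not
  absolutely integrable over whole lines, so the abscissa is first restricted to
  \<open>{-n..n}\<close>.\<close>

theorem green_horizontal:
  fixes c :: "real \<Rightarrow> complex" and h k :: "real \<Rightarrow> real"
  assumes lip: "B-lipschitz_on {0..1} c" and closed: "pathfinish c = pathstart c"
    and w: "\<And>z. z \<in> inside (path_image c) \<Longrightarrow> winding_number c z = of_real w"
    and strip: "\<And>t. t \<in> {0..1} \<Longrightarrow> Im (c t) \<in> {y1..y2}"
    and k: "\<And>y. y \<in> {y1..y2} \<Longrightarrow> (k has_real_derivative - h y) (at y)"
    and h: "continuous_on {y1..y2} h"
  shows "((\<lambda>t. k (Im (c t)) * Re (vector_derivative c (at t))) has_integral
           w * integral (inside (path_image c)) (\<lambda>z. h (Im z))) {0..1}"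
    and "set_integrable lborel (inside (path_image c)) (\<lambda>z. h (Im z))"
proof -
  define C where "C t = c (max 0 (min 1 t))" for t
  have Cc: "C t = c t" if "t \<in> {0..1}" for t using that by (simp add: C_def)
  have "B-lipschitz_on UNIV C"
    unfolding C_def by (rule lipschitz_extension_interval[OF lip]) simp
  then have contC: "continuous_on UNIV C" by (rule lipschitz_on_continuous_on)
  then have [measurable]: "C \<in> borel_measurable borel" by (rule borel_measurable_continuous_onI)
  have B: "B \<ge> 0" using lip lipschitz_on_nonneg by blast
  obtain d where d[measurable]: "d \<in> borel_measurable borel" and dB: "\<And>t. norm (d t) \<le> B"
    and dae: "AE t in lborel. t \<in> {0..1} \<longrightarrow> (c has_vector_derivative d t) (at t)"
    using lipschitz_borel_derivative[OF lip] by auto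
  have path: "path c" using lip by (simp add: path_def lipschitz_on_continuous_on)
  obtain M0 where M0: "\<And>z. z \<in> path_image c \<Longrightarrow> norm z \<le> M0"
    using bounded_path_image[OF path] by (auto simp: bounded_iff)
  define M where "M = \<bar>M0\<bar> + \<bar>y1\<bar> + \<bar>y2\<bar> + 1"
  have Mpos: "M > 0" by (simp add: M_def)
  have CM: "\<bar>Re (C t)\<bar> \<le> M" "\<bar>Im (C t)\<bar> \<le> M" "Im (C t) \<in> {y1..y2}" for t
  proof -
    have m: "max 0 (min 1 t) \<in> {0..1::real}" by auto
    then have "norm (C t) \<le> M0" using M0 by (auto simp: C_def path_image_def)
    then show "\<bar>Re (C t)\<bar> \<le> M" "\<bar>Im (C t)\<bar> \<le> M"
      using abs_Re_le_cmod[of "C t"] abs_Im_le_cmod[of "C t"] by (auto simp: M_def)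
    show "Im (C t) \<in> {y1..y2}" using strip[OF m] by (simp add: C_def)
  qed
  have yM: "{y1..y2} \<subseteq> {-M..M}" by (auto simp: M_def)
  let ?I = "inside (path_image c)"
  have inside_sub: "\<bar>Re z\<bar> \<le> M" "Im z \<in> {y1..y2}" if "z \<in> ?I" for z
  proof -
    let ?R = "{z. Re z \<in> {-M..M}} \<inter> {z. Im z \<in> {y1..y2}}"
    have "?R = Re -` {-M..M} \<inter> Im -` {y1..y2}" by auto
    then have "convex ?R"
      by (simp add: convex_Int convex_linear_vimage bounded_linear.linear bounded_linear_Re bounded_linear_Im)
    moreover have "path_image c \<subseteq> ?R"
    proof
      fix z assume "z \<in> path_image c"
      then obtain t where "t \<in> {0..1}" "z = c t" by (auto simp: path_image_def)
      then show "z \<in> ?R" using CM[of t] Cc[of t] by (auto simp: abs_le_iff)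
    qed
    ultimately have "- ?R \<subseteq> outside (path_image c)" by (rule outside_subset_convex)
    then have "z \<in> ?R"
      using that inside_Int_outside[of "path_image c"] by blast
    then show "\<bar>Re z\<bar> \<le> M" "Im z \<in> {y1..y2}"
      by (auto simp: abs_le_iff)
  qed
  have Iopen: "open ?I" by (simp add: closed_path_image open_inside path)
  then have [measurable]: "?I \<in> sets borel" by simp
  \<comment> \<open>Nothing is known of \<open>h\<close> outside the strip. The cut-off
    \<open>H\<close> is bounded and Borel and agrees with \<open>h\<close> on the inside, which lies
    in the strip.\<close>
  define H where "H y = indicator {y1..y2} y * h y" for y
  have [measurable]: "H \<in> borel_measurable borel"
    using borel_measurable_continuous_on_indicator[OF _ h] by (simp add: H_def[abs_def])
  obtain Hb where Hb: "\<And>y. \<bar>H y\<bar> \<le> Hb"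
  proof -
    have "bounded (h ` {y1..y2})" by (intro compact_imp_bounded compact_continuous_image h) auto
    then obtain b where "\<forall>y\<in>{y1..y2}. \<bar>h y\<bar> \<le> b" by (auto simp: bounded_iff)
    then have "\<bar>H y\<bar> \<le> max 0 b" for y by (force simp: H_def indicator_def)
    then show ?thesis by (rule that)
  qed
  have Hb0: "Hb \<ge> 0" using Hb[of 0] by linarith
  have Hsupp: "H y = 0" if "y \<notin> {y1..y2}" for y using that by (simp add: H_def)
  have intI: "integrable lborel (\<lambda>z. indicator ?I z *\<^sub>R H (Im z))"
  proof (rule integrableI_bounded_set_indicator)
    have "bounded ?I" by (simp add: bounded_inside bounded_path_image path)
    then show "emeasure lborel ?I < \<infinity>" by (rule emeasure_bounded_finite)
  qed (use Hb in auto)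
  moreover have HI: "(\<lambda>z. indicator ?I z *\<^sub>R H (Im z)) = (\<lambda>z. indicator ?I z *\<^sub>R h (Im z))"
    using inside_sub(2) by (auto simp: fun_eq_iff H_def indicator_def)
  ultimately show setint: "set_integrable lborel ?I (\<lambda>z. h (Im z))"
    by (simp add: set_integrable_def)
  define \<Phi> where "\<Phi> n p t = indicator {0..1} t * (indicator {-n..n} (fst p) * H (snd p))
      * Im (d t / (C t - Complex (fst p) (snd p)))" for n :: real and p :: "real \<times> real" and t :: real
  have \<Phi>m[measurable]: "(\<lambda>(p, t). \<Phi> n p t) \<in> borel_measurable (lborel \<Otimes>\<^sub>M lborel)" for n
  proof -
    have m: "(\<lambda>x. fst (fst x)) \<in> borel_measurable (borel :: ((real \<times> real) \<times> real) measure)"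
      "(\<lambda>x. snd (fst x)) \<in> borel_measurable (borel :: ((real \<times> real) \<times> real) measure)"
      "snd \<in> borel_measurable (borel :: ((real \<times> real) \<times> real) measure)"
      "fst \<in> borel_measurable (borel :: ((real \<times> real) \<times> real) measure)"
      by (intro borel_measurable_continuous_onI continuous_intros)+
    have "(\<lambda>x. C (snd x) - Complex (fst (fst x)) (snd (fst x))) \<in> borel_measurable (borel :: ((real \<times> real) \<times> real) measure)"
      by (intro borel_measurable_diff measurable_compose[OF m(3)] measurable_compose[OF m(4) borel_measurable_Complex_pair]) simp
    moreover have "(\<lambda>x. d (snd x)) \<in> borel_measurable (borel :: ((real \<times> real) \<times> real) measure)"
      by (rule measurable_compose[OF m(3) d])
    ultimately have "(\<lambda>x. Im (d (snd x) / (C (snd x) - Complex (fst (fst x)) (snd (fst x))))) \<in> borel_measurable (borel :: ((real \<times> real) \<times> real) measure)"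
      by (intro measurable_compose[OF borel_measurable_divide borel_measurable_Im])
    then have "(\<lambda>x. indicator {0..1} (snd x) * (indicator {-n..n} (fst (fst x)) * H (snd (fst x)))
      * Im (d (snd x) / (C (snd x) - Complex (fst (fst x)) (snd (fst x))))) \<in> borel_measurable (borel :: ((real \<times> real) \<times> real) measure)"
      by (intro borel_measurable_times measurable_compose[OF m(1)] measurable_compose[OF m(2)] measurable_compose[OF m(3)]) simp_all
    then show ?thesis by (simp add: lborel_prod \<Phi>_def split_beta)
  qed
  \<comment> \<open>Absolute integrability for Fubini, from the bound of the Cauchy kernel on a
    square; its half side \<open>M + n\<close> accommodates both the curve and the domain of
    integration.\<close>
  have nnb: "(\<integral>\<^sup>+p. ennreal (norm (\<Phi> n p t)) \<partial>lborel) \<le> ennreal (indicator {0..1} t * (Hb * B * (32 * (M + n))))"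
    if n: "n \<ge> 0" for n t
  proof -
    have "(\<integral>\<^sup>+p. ennreal (norm (\<Phi> n p t)) \<partial>lborel)
      \<le> (\<integral>\<^sup>+p. ennreal (indicator {0..1} t * (Hb * B)) * ennreal (indicator ({-n..n} \<times> {y1..y2}) p / cmod (C t - Complex (fst p) (snd p))) \<partial>lborel)"
    proof (rule nn_integral_mono)
      fix p :: "real \<times> real"
      have "norm (\<Phi> n p t) = indicator {0..1} t * (indicator {-n..n} (fst p) * \<bar>H (snd p)\<bar>) * \<bar>Im (d t / (C t - Complex (fst p) (snd p)))\<bar>"
        by (simp add: \<Phi>_def abs_mult)
      also have "\<dots> \<le> indicator {0..1} t * (indicator ({-n..n} \<times> {y1..y2}) p * Hb) * (B / cmod (C t - Complex (fst p) (snd p)))"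
      proof (rule mult_mono[OF mult_left_mono])
        show "indicator {- n..n} (fst p) * \<bar>H (snd p)\<bar> \<le> indicator ({-n..n} \<times> {y1..y2}) p * Hb"
          using Hb[of "snd p"] Hsupp[of "snd p"] by (cases p) (auto simp: indicator_def)
        have "\<bar>Im (d t / (C t - Complex (fst p) (snd p)))\<bar> \<le> cmod (d t) / cmod (C t - Complex (fst p) (snd p))"
          using abs_Im_le_cmod by (metis norm_divide)
        also have "\<dots> \<le> B / cmod (C t - Complex (fst p) (snd p))"
          using dB by (intro divide_right_mono) auto
        finally show "\<bar>Im (d t / (C t - Complex (fst p) (snd p)))\<bar> \<le> B / cmod (C t - Complex (fst p) (snd p))" .
      qed (use Hb0 in auto)
      also have "\<dots> = (indicator {0..1} t * (Hb * B)) * (indicator ({-n..n} \<times> {y1..y2}) p / cmod (C t - Complex (fst p) (snd p)))"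
        by simp
      finally show "ennreal (norm (\<Phi> n p t)) \<le> ennreal (indicator {0..1} t * (Hb * B)) * ennreal (indicator ({-n..n} \<times> {y1..y2}) p / cmod (C t - Complex (fst p) (snd p)))"
        using Hb0 B by (simp add: ennreal_mult'[symmetric] ennreal_leI del: times_divide_eq_right)
    qed
    also have "\<dots> = ennreal (indicator {0..1} t * (Hb * B)) * (\<integral>\<^sup>+p. ennreal (indicator ({-n..n} \<times> {y1..y2}) p / cmod (C t - Complex (fst p) (snd p))) \<partial>lborel)"
    proof (rule nn_integral_cmult)
      have "({-n..n} \<times> {y1..y2} :: (real \<times> real) set) \<in> sets borel"
        by (intro borel_closed closed_Times) auto
      then have "(\<lambda>p. indicator ({-n..n} \<times> {y1..y2}) p / cmod (C t - Complex (fst p) (snd p)))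
           \<in> borel_measurable (borel :: (real \<times> real) measure)"
        by (intro borel_measurable_divide borel_measurable_indicator measurable_compose[OF _ borel_measurable_norm] borel_measurable_diff
             borel_measurable_const borel_measurable_Complex_pair)
      then show "(\<lambda>p. ennreal (indicator ({-n..n} \<times> {y1..y2}) p / cmod (C t - Complex (fst p) (snd p)))) \<in> borel_measurable lborel"
        by simp
    qed
    also have "\<dots> \<le> ennreal (indicator {0..1} t * (Hb * B)) * ennreal (32 * (M + n))"
    proof (intro mult_left_mono nn_integral_cauchy_kernel_le)
      show "{-n..n} \<subseteq> {- (M + n)..M + n}" "{y1..y2} \<subseteq> {- (M + n)..M + n}"
        using n Mpos yM by auto
    qed (use CM[of t] n in auto)
    also have "\<dots> = ennreal (indicator {0..1} t * (Hb * B * (32 * (M + n))))"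
      using Mpos n by (subst ennreal_mult''[symmetric]) (simp_all only: mult.assoc, simp)
    finally show ?thesis .
  qed
  have int\<Phi>: "integrable (lborel \<Otimes>\<^sub>M lborel) (\<lambda>(p, t). \<Phi> n p t)" if n: "n \<ge> 0" for n
  proof (rule integrableI_bounded[OF \<Phi>m])
    have "(\<integral>\<^sup>+ x. ennreal (norm (case x of (p, t) \<Rightarrow> \<Phi> n p t)) \<partial>(lborel \<Otimes>\<^sub>M lborel))
        = (\<integral>\<^sup>+t. \<integral>\<^sup>+p. ennreal (norm (\<Phi> n p t)) \<partial>lborel \<partial>lborel)"
      by (subst lborel_pair.nn_integral_snd[symmetric]) auto
    also have "\<dots> \<le> (\<integral>\<^sup>+t. ennreal (Hb * B * (32 * (M + n))) * indicator {0..1} t \<partial>(lborel :: real measure))"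
    proof (rule nn_integral_mono)
      fix t :: real
      show "(\<integral>\<^sup>+p. ennreal (norm (\<Phi> n p t)) \<partial>lborel) \<le> ennreal (Hb * B * (32 * (M + n))) * indicator {0..1} t"
        using nnb[OF n, of t] by (cases "t \<in> {0..1}") simp_all
    qed
    also have "\<dots> < \<infinity>"
      by (subst nn_integral_cmult_indicator) (auto simp: emeasure_lborel_Icc_eq ennreal_mult_less_top)
    finally show "(\<integral>\<^sup>+ x. ennreal (norm (case x of (p, t) \<Rightarrow> \<Phi> n p t)) \<partial>(lborel \<Otimes>\<^sub>M lborel)) < \<infinity>" .
  qed
  have Fub: "(\<integral>t. (\<integral>p. \<Phi> n p t \<partial>lborel) \<partial>lborel) = (\<integral>p. (\<integral>t. \<Phi> n p t \<partial>lborel) \<partial>lborel)" if "n \<ge> 0" for n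
    using lborel_pair.Fubini_integral[OF int\<Phi>[OF that]] .
  have "AE z in lborel. z \<notin> path_image c"
    by (rule AE_lborel_if_negligible[OF negligible_lipschitz_path_image[OF lip]]) auto
  note aep = AE_complex_pair[OF this]
  \<comment> \<open>From \<open>n \<ge> M\<close> on, the restriction to \<open>{-n..n}\<close> no
    longer touches the inside, so this order of integration gives a value that does not depend on
    \<open>n\<close>.\<close>
  have LHS: "(\<integral>p. (\<integral>t. \<Phi> n p t \<partial>lborel) \<partial>lborel) = 2 * pi * w * integral ?I (\<lambda>z. h (Im z))" if n: "n \<ge> M" for n
  proof -
    have n0: "n \<ge> 0" using n Mpos by simp
    have "AE p in lborel. (\<integral>t. \<Phi> n p t \<partial>lborel) = 2 * pi * w * (indicator ?I (Complex (fst p) (snd p)) *\<^sub>R H (snd p))"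
      using aep lborel_pair.AE_integrable_fst'[OF int\<Phi>[OF n0]]
    proof eventually_elim
      case (elim p)
      let ?z = "Complex (fst p) (snd p)"
      have "((\<lambda>t. d t / (c t - ?z)) has_integral (2 * of_real pi * \<i> * winding_number c ?z)) {0..1}"
        by (rule winding_number_lipschitz[OF lip elim(1) dae])
      from has_integral_linear[OF this bounded_linear_Im]
      have "((\<lambda>t. Im (d t / (c t - ?z))) has_integral (2 * pi * Re (winding_number c ?z))) {0..1}"
        by (simp add: o_def)
      from has_integral_mult_right[OF this, of "indicator {-n..n} (fst p) * H (snd p)"]
      have "((\<lambda>t. \<Phi> n p t) has_integral (indicator {-n..n} (fst p) * H (snd p) * (2 * pi * Re (winding_number c ?z)))) {0..1}"
        by (rule has_integral_eq[rotated]) (simp add: \<Phi>_def Cc)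
      then have "((\<lambda>t. if t \<in> {0..1} then \<Phi> n p t else 0) has_integral (indicator {-n..n} (fst p) * H (snd p) * (2 * pi * Re (winding_number c ?z)))) UNIV"
        by (simp only: has_integral_restrict_UNIV)
      moreover have "(\<lambda>t. if t \<in> {0..1} then \<Phi> n p t else 0) = \<Phi> n p"
        by (auto simp: fun_eq_iff \<Phi>_def)
      ultimately have hi: "(\<Phi> n p has_integral (indicator {-n..n} (fst p) * H (snd p) * (2 * pi * Re (winding_number c ?z)))) UNIV"
        by (simp only:)
      have "integrable lborel (\<Phi> n p)" using elim(2) by simp
      from has_integral_unique[OF has_integral_integral_lborel[OF this] hi]
      have "(\<integral>t. \<Phi> n p t \<partial>lborel) = indicator {-n..n} (fst p) * H (snd p) * (2 * pi * Re (winding_number c ?z))" .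
      also have "\<dots> = 2 * pi * w * (indicator ?I ?z *\<^sub>R H (snd p))"
      proof (cases "?z \<in> ?I")
        case True
        then show ?thesis using w[OF True] inside_sub(1)[OF True] n by (auto simp: indicator_def abs_le_iff)
      next
        case False
        then have "?z \<in> outside (path_image c)" using elim(1) inside_Un_outside[of "path_image c"] by blast
        then have "winding_number c ?z = 0" by (rule winding_number_zero_in_outside[OF path closed])
        then show ?thesis using False by simp
      qed
      finally show ?case .
    qed
    then have "(\<integral>p. (\<integral>t. \<Phi> n p t \<partial>lborel) \<partial>lborel) = (\<integral>p. 2 * pi * w * (indicator ?I (Complex (fst p) (snd p)) *\<^sub>R H (snd p)) \<partial>lborel)"
    proof (intro integral_cong_AE)
      have "(\<lambda>z. indicator ?I z *\<^sub>R H (Im z)) \<in> borel_measurable borel" by measurable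
      from measurable_compose[OF borel_measurable_Complex_pair this]
      show "(\<lambda>p. 2 * pi * w * (indicator ?I (Complex (fst p) (snd p)) *\<^sub>R H (snd p))) \<in> borel_measurable lborel"
        by simp
      show "(\<lambda>p. \<integral>t. \<Phi> n p t \<partial>lborel) \<in> borel_measurable lborel"
        by (rule lborel.borel_measurable_lebesgue_integral[OF \<Phi>m])
    qed
    also have "\<dots> = 2 * pi * w * (\<integral>z. indicator ?I z *\<^sub>R H (Im z) \<partial>lborel)"
      by (subst integral_complex_eq_integral_prod) auto
    also have "(\<integral>z. indicator ?I z *\<^sub>R H (Im z) \<partial>lborel) = integral ?I (\<lambda>z. h (Im z))"
      unfolding HI using set_borel_integral_eq_integral(2)[OF setint] by (simp add: set_lebesgue_integral_def)
    finally show ?thesis .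
  qed
  have inner: "(\<integral>p. \<Phi> n p t \<partial>lborel) = indicator {0..1} t * (\<integral>y. H y * kernel_primitive (d t) (Re (C t)) (Im (C t) - y) n \<partial>lborel)"
    if n: "n \<ge> 0" for n t
  proof -
    have i: "integrable (lborel \<Otimes>\<^sub>M lborel) (\<lambda>p. \<Phi> n p t)"
    proof (rule integrableI_bounded)
      show "(\<integral>\<^sup>+ p. ennreal (norm (\<Phi> n p t)) \<partial>(lborel \<Otimes>\<^sub>M lborel)) < \<infinity>"
        unfolding lborel_prod by (rule le_less_trans[OF nnb[OF n]]) simp
      show "(\<lambda>p. \<Phi> n p t) \<in> borel_measurable (lborel \<Otimes>\<^sub>M lborel)"
        unfolding lborel_prod using measurable_compose[OF measurable_Pair2'[of t lborel lborel] \<Phi>m[of n]] by simp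
    qed
    have eta: "(\<lambda>(x, y). \<Phi> n (x, y) t) = (\<lambda>p. \<Phi> n p t)" by auto
    have "(\<integral>p. \<Phi> n p t \<partial>lborel) = (\<integral>y. (\<integral>x. \<Phi> n (x, y) t \<partial>lborel) \<partial>lborel)"
      using lborel_pair.integral_snd[of "\<lambda>x y. \<Phi> n (x, y) t", unfolded eta, OF i] by (simp add: lborel_prod)
    also have "\<dots> = (\<integral>y. indicator {0..1} t * (H y * kernel_primitive (d t) (Re (C t)) (Im (C t) - y) n) \<partial>lborel)"
    proof (rule integral_cong_AE)
      show "(\<lambda>y. \<integral>x. \<Phi> n (x, y) t \<partial>lborel) \<in> borel_measurable lborel"
        using lborel_pair.integrable_snd[of "\<lambda>x y. \<Phi> n (x, y) t", unfolded eta, OF i] by simp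
      show "(\<lambda>y. indicator {0..1} t * (H y * kernel_primitive (d t) (Re (C t)) (Im (C t) - y) n)) \<in> borel_measurable lborel"
        unfolding kernel_primitive_def by measurable
      show "AE y in lborel. (\<integral>x. \<Phi> n (x, y) t \<partial>lborel) = indicator {0..1} t * (H y * kernel_primitive (d t) (Re (C t)) (Im (C t) - y) n)"
        using AE_lborel_singleton[of "Im (C t)"]
      proof eventually_elim
        case (elim y)
        have "(\<integral>x. \<Phi> n (x, y) t \<partial>lborel) = (\<integral>x. indicator {0..1} t * H y * (indicator {-n..n} x * Im (d t / Complex (Re (C t) - x) (Im (C t) - y))) \<partial>lborel)"
          by (intro Bochner_Integration.integral_cong) (auto simp: \<Phi>_def minus_complex.code)
        also have "\<dots> = indicator {0..1} t * H y * (\<integral>x. indicator {-n..n} x * Im (d t / Complex (Re (C t) - x) (Im (C t) - y)) \<partial>lborel)"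
          by simp
        also have "(\<integral>x. indicator {-n..n} x * Im (d t / Complex (Re (C t) - x) (Im (C t) - y)) \<partial>lborel) = kernel_primitive (d t) (Re (C t)) (Im (C t) - y) n"
          using elim n by (intro integral_cauchy_kernel_horizontal) auto
        finally show ?case by simp
      qed
    qed
    finally show ?thesis by simp
  qed
  \<comment> \<open>Abscissas of the curve are at most \<open>M\<close> in absolute value, so every
    index from \<open>N0\<close> on satisfies \<open>2 * \<bar>a\<bar> < n\<close>, as the uniform
    kernel bound requires.\<close>
  obtain N0 :: nat where N0: "real N0 > 2 * M" using reals_Archimedean2 by blast
  define g where "g n t = (\<integral>p. \<Phi> (real (n + N0)) p t \<partial>lborel)" for n t
  define K where "K = B * (pi + ln 9) * (\<integral>y. \<bar>H y\<bar> \<partial>lborel)"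
  have ln9: "ln 9 \<ge> (0::real)" by simp
  have intH: "integrable lborel (\<lambda>y. \<bar>H y\<bar>)"
  proof -
    have "integrable lborel (\<lambda>y. indicator {y1..y2} y *\<^sub>R \<bar>H y\<bar>)"
      by (rule integrableI_bounded_set_indicator[where B = Hb]) (use Hb in \<open>auto simp: emeasure_lborel_Icc_eq\<close>)
    moreover have "(\<lambda>y. indicator {y1..y2} y *\<^sub>R \<bar>H y\<bar>) = (\<lambda>y. \<bar>H y\<bar>)"
      by (auto simp: fun_eq_iff H_def indicator_def)
    ultimately show ?thesis by simp
  qed
  have kb: "AE y in lborel. norm (H y * kernel_primitive (d t) (Re (C t)) (Im (C t) - y) (real (n + N0))) \<le> B * (pi + ln 9) * \<bar>H y\<bar>" for n t
    using AE_lborel_singleton[of "Im (C t)"]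
  proof eventually_elim
    case (elim y)
    have "\<bar>kernel_primitive (d t) (Re (C t)) (Im (C t) - y) (real (n + N0))\<bar> \<le> cmod (d t) * (pi + ln 9)"
      using elim N0 CM(1)[of t] by (intro kernel_primitive_bound) auto
    also have "\<dots> \<le> B * (pi + ln 9)" using dB ln9 by (intro mult_right_mono) auto
    finally have "\<bar>H y\<bar> * \<bar>kernel_primitive (d t) (Re (C t)) (Im (C t) - y) (real (n + N0))\<bar> \<le> \<bar>H y\<bar> * (B * (pi + ln 9))"
      by (intro mult_left_mono) auto
    then show ?case by (simp add: abs_mult mult.commute)
  qed
  have kpm[measurable]: "(\<lambda>y. H y * kernel_primitive (d t) (Re (C t)) (Im (C t) - y) n) \<in> borel_measurable lborel" for t n
    unfolding kernel_primitive_def by measurable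
  have glim: "(\<lambda>n. g n t) \<longlonglongrightarrow> indicator {0..1} t * (- pi * Re (d t) * (k y1 + k y2 - 2 * k (Im (C t))))" for t
  proof -
    have "(\<lambda>n. \<integral>y. H y * kernel_primitive (d t) (Re (C t)) (Im (C t) - y) (real (n + N0)) \<partial>lborel)
       \<longlonglongrightarrow> (\<integral>y. H y * (- pi * sgn (Im (C t) - y) * Re (d t)) \<partial>lborel)"
    proof (rule integral_dominated_convergence[OF _ kpm _ _ kb])
      show "integrable lborel (\<lambda>y. B * (pi + ln 9) * \<bar>H y\<bar>)" using intH by simp
      show "AE y in lborel. (\<lambda>n. H y * kernel_primitive (d t) (Re (C t)) (Im (C t) - y) (real (n + N0)))
          \<longlonglongrightarrow> H y * (- pi * sgn (Im (C t) - y) * Re (d t))"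
        using AE_lborel_singleton[of "Im (C t)"]
      proof eventually_elim
        case (elim y)
        have "(\<lambda>n. kernel_primitive (d t) (Re (C t)) (Im (C t) - y) (real n)) \<longlonglongrightarrow> - pi * sgn (Im (C t) - y) * Re (d t)"
          using elim by (intro kernel_primitive_tendsto) auto
        then show ?case
          by (intro tendsto_intros) (rule LIMSEQ_ignore_initial_segment)
      qed
    qed simp
    also have "(\<integral>y. H y * (- pi * sgn (Im (C t) - y) * Re (d t)) \<partial>lborel) = (- pi * Re (d t)) * (\<integral>y. indicator {y1..y2} y * h y * sgn (Im (C t) - y) \<partial>lborel)"
      by (rule trans[OF Bochner_Integration.integral_cong integral_mult_right_zero]) (simp_all add: H_def)
    also have "(\<integral>y. indicator {y1..y2} y * h y * sgn (Im (C t) - y) \<partial>lborel) = k y1 + k y2 - 2 * k (Im (C t))"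
      by (rule integral_sgn_primitive[OF CM(3) k h])
    finally show ?thesis
      unfolding g_def inner[OF of_nat_0_le_iff] by (intro tendsto_mult tendsto_const)
  qed
  have kC: "continuous_on UNIV (\<lambda>t. k (Im (C t)))"
  proof -
    have "continuous_on {y1..y2} k"
      using k by (meson DERIV_atLeastAtMost_imp_continuous_on atLeastAtMost_iff)
    then show ?thesis
      by (rule continuous_on_compose2[where g = k]) (use CM(3) in \<open>auto intro!: continuous_intros contC\<close>)
  qed
  then have [measurable]: "(\<lambda>t. k (Im (C t))) \<in> borel_measurable borel" by (rule borel_measurable_continuous_onI)
  have "(\<lambda>n. \<integral>t. g n t \<partial>lborel) \<longlonglongrightarrow> (\<integral>t. indicator {0..1} t * (- pi * Re (d t) * (k y1 + k y2 - 2 * k (Im (C t)))) \<partial>lborel)"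
  proof (rule integral_dominated_convergence[where w = "\<lambda>t. indicator {0..1} t *\<^sub>R K"])
    show "g n \<in> borel_measurable lborel" for n
      unfolding g_def by measurable
    show "AE t in lborel. (\<lambda>n. g n t) \<longlonglongrightarrow> indicator {0..1} t * (- pi * Re (d t) * (k y1 + k y2 - 2 * k (Im (C t))))"
      using glim by simp
    show "AE t in lborel. norm (g n t) \<le> indicator {0..1} t *\<^sub>R K" for n
    proof (rule AE_I2)
      fix t
      have "\<bar>\<integral>y. H y * kernel_primitive (d t) (Re (C t)) (Im (C t) - y) (real (n + N0)) \<partial>lborel\<bar> \<le> K"
      proof -
        let ?f = "\<lambda>y. H y * kernel_primitive (d t) (Re (C t)) (Im (C t) - y) (real (n + N0))"
        have intg: "integrable lborel (\<lambda>y. B * (pi + ln 9) * \<bar>H y\<bar>)" using intH by simp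
        have "AE y in lborel. norm (?f y) \<le> norm (B * (pi + ln 9) * \<bar>H y\<bar>)"
          using kb[of t n] by eventually_elim (erule order_trans, simp only: real_norm_def abs_ge_self)
        then have "integrable lborel ?f"
          by (rule Bochner_Integration.integrable_bound[OF intg kpm])
        then have "norm (integral\<^sup>L lborel ?f) \<le> (\<integral>y. B * (pi + ln 9) * \<bar>H y\<bar> \<partial>lborel)"
          by (intro order_trans[OF integral_norm_bound] integral_mono_AE intg kb integrable_norm)
        then show ?thesis by (simp add: K_def)
      qed
      then show "norm (g n t) \<le> indicator {0..1} t *\<^sub>R K"
        unfolding g_def inner[OF of_nat_0_le_iff] by (simp add: indicator_def)
    qed
  qed (auto simp: set_integrable_def[symmetric])
  moreover have "(\<integral>t. g n t \<partial>lborel) = 2 * pi * w * integral ?I (\<lambda>z. h (Im z))" for n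
    unfolding g_def using N0 Mpos by (subst Fub) (auto intro!: LHS)
  ultimately have lim: "2 * pi * w * integral ?I (\<lambda>z. h (Im z)) = (\<integral>t. indicator {0..1} t * (- pi * Re (d t) * (k y1 + k y2 - 2 * k (Im (C t)))) \<partial>lborel)"
    by (simp add: LIMSEQ_const_iff)
  have idR: "integrable lborel (\<lambda>t. indicator {0..1} t *\<^sub>R (Re (d t) * k (Im (C t))))"
  proof -
    have "compact ((\<lambda>t. k (Im (C t))) ` {0..1})"
      by (intro compact_continuous_image continuous_on_subset[OF kC]) auto
    then have "bounded ((\<lambda>t. k (Im (C t))) ` {0..1})" by (rule compact_imp_bounded)
    then obtain kk where kk: "\<forall>t\<in>{0..1}. \<bar>k (Im (C t))\<bar> \<le> kk"
      by (auto simp: bounded_iff)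
    have "\<bar>Re (d t) * k (Im (C t))\<bar> \<le> B * kk" if "t \<in> {0..1}" for t
      unfolding abs_mult using bspec[OF kk that] dB[of t] abs_Re_le_cmod[of "d t"] B by (intro mult_mono) auto
    then show ?thesis
      by (intro integrableI_bounded_set_indicator[where B = "B * kk"]) (auto simp: emeasure_lborel_Icc_eq)
  qed
  have idd: "integrable lborel (\<lambda>t. indicator {0..1} t *\<^sub>R Re (d t))"
    by (intro integrableI_bounded_set_indicator[where B = B])
       (auto simp: emeasure_lborel_Icc_eq intro!: order_trans[OF abs_Re_le_cmod dB])
  \<comment> \<open>The curve is closed, so \<open>Re (d t)\<close> has integral 0 and the constants
    \<open>k y1 + k y2\<close> drop out.\<close>
  have "(d has_integral (c 1 - c 0)) {0..1}"
    by (rule lipschitz_has_integral_derivative[OF lip _ dae]) simp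
  moreover have "c 1 = c 0" using closed by (simp add: pathfinish_def pathstart_def)
  ultimately have "((\<lambda>t. Re (d t)) has_integral 0) {0..1}"
    using has_integral_linear[OF _ bounded_linear_Re, of d 0 "{0..1}"] by (simp add: o_def)
  then have d0: "(\<integral>t. indicator {0..1} t *\<^sub>R Re (d t) \<partial>lborel) = 0"
    using set_borel_integral_eq_integral(2)[of "{0..1}" "\<lambda>t. Re (d t)"] idd
    by (simp add: set_integrable_def set_lebesgue_integral_def integral_unique)
  have "(\<integral>t. indicator {0..1} t * (- pi * Re (d t) * (k y1 + k y2 - 2 * k (Im (C t)))) \<partial>lborel)
      = (\<integral>t. - pi * (k y1 + k y2) * (indicator {0..1} t *\<^sub>R Re (d t)) + 2 * pi * (indicator {0..1} t *\<^sub>R (Re (d t) * k (Im (C t)))) \<partial>lborel)"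
    by (intro Bochner_Integration.integral_cong) (auto simp: algebra_simps)
  also have "\<dots> = 2 * pi * (\<integral>t. indicator {0..1} t *\<^sub>R (Re (d t) * k (Im (C t))) \<partial>lborel)"
    using idR idd d0 by simp
  finally have "(\<integral>t. indicator {0..1} t *\<^sub>R (Re (d t) * k (Im (C t))) \<partial>lborel) = w * integral ?I (\<lambda>z. h (Im z))"
    using lim by simp
  then have hi: "((\<lambda>t. Re (d t) * k (Im (C t))) has_integral (w * integral ?I (\<lambda>z. h (Im z)))) {0..1}"
    using set_borel_integral_eq_integral[of "{0..1}" "\<lambda>t. Re (d t) * k (Im (C t))"] idR
    by (simp add: set_integrable_def set_lebesgue_integral_def has_integral_iff)
  have "AE t in lborel. t \<in> {0..1} \<longrightarrow> k (Im (c t)) * Re (vector_derivative c (at t)) = Re (d t) * k (Im (C t))"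
    using dae by eventually_elim (auto simp: vector_derivative_at Cc)
  then show "((\<lambda>t. k (Im (c t)) * Re (vector_derivative c (at t))) has_integral
           w * integral (inside (path_image c)) (\<lambda>z. h (Im z))) {0..1}"
    using hi by (subst has_integral_AE)
qed

definition cross :: "complex \<Rightarrow> complex \<Rightarrow> real" where
  "cross z w = Re z * Im w - Im z * Re w"

lemma lipschitz_on_mult_bounded:
  fixes f g :: "real \<Rightarrow> 'a::real_normed_algebra"
  assumes f: "B-lipschitz_on S f" and g: "C-lipschitz_on S g"
    and bf: "\<And>t. t \<in> S \<Longrightarrow> norm (f t) \<le> P" and bg: "\<And>t. t \<in> S \<Longrightarrow> norm (g t) \<le> Q" and "P \<ge> 0" "Q \<ge> 0"
  shows "(B * Q + P * C)-lipschitz_on S (\<lambda>t. f t * g t)"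
proof (rule lipschitz_onI)
  show "0 \<le> B * Q + P * C" using assms lipschitz_on_nonneg[OF f] lipschitz_on_nonneg[OF g] by simp
  fix x y assume xy: "x \<in> S" "y \<in> S"
  have "norm (f x * g x - f y * g y) = norm ((f x - f y) * g x + f y * (g x - g y))"
    by (simp add: algebra_simps)
  also have "\<dots> \<le> norm (f x - f y) * norm (g x) + norm (f y) * norm (g x - g y)"
    by (intro norm_triangle_le add_mono norm_mult_ineq)
  also have "\<dots> \<le> (B * \<bar>x - y\<bar>) * Q + P * (C * \<bar>x - y\<bar>)"
    using lipschitz_on_normD[OF f xy] lipschitz_on_normD[OF g xy] bf bg xy \<open>P \<ge> 0\<close>
    by (intro add_mono mult_mono) (auto intro: order_trans[OF norm_ge_zero])
  finally show "dist (f x * g x) (f y * g y) \<le> (B * Q + P * C) * dist x y"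
    by (simp add: dist_norm algebra_simps)
qed

lemma lipschitz_bounded_Icc:
  fixes f :: "real \<Rightarrow> 'a::real_normed_vector"
  assumes "B-lipschitz_on {a..b} f"
  shows "\<exists>P\<ge>0. \<forall>t\<in>{a..b}. norm (f t) \<le> P"
proof -
  have "bounded (f ` {a..b})"
    using assms by (intro compact_imp_bounded compact_continuous_image lipschitz_on_continuous_on) auto
  then obtain P where "\<forall>t\<in>{a..b}. norm (f t) \<le> P" by (auto simp: bounded_iff)
  then show ?thesis by (intro exI[of _ "max 0 P"]) (auto simp: le_max_iff_disj)
qed

lemma lipschitz_on_linear_image:
  assumes "B-lipschitz_on S c" and g: "\<And>x y. dist (g x) (g y) \<le> dist x y"
  shows "B-lipschitz_on S (\<lambda>t. g (c t))"
proof (rule lipschitz_onI)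
  show "dist (g (c x)) (g (c y)) \<le> B * dist x y" if "x \<in> S" "y \<in> S" for x y
    using order_trans[OF g lipschitz_onD[OF assms(1) that]] .
qed (rule lipschitz_on_nonneg[OF assms(1)])

lemma lipschitz_on_Re: "B-lipschitz_on S c \<Longrightarrow> B-lipschitz_on S (\<lambda>t. Re (c t))"
  by (erule lipschitz_on_linear_image) (metis abs_Re_le_cmod dist_norm dist_real_def minus_complex.simps(1))

lemma lipschitz_on_Im: "B-lipschitz_on S c \<Longrightarrow> B-lipschitz_on S (\<lambda>t. Im (c t))"
  by (erule lipschitz_on_linear_image) (metis abs_Im_le_cmod dist_norm dist_real_def minus_complex.simps(2))

lemma lipschitz_on_mult_Icc:
  fixes f g :: "real \<Rightarrow> 'a::real_normed_algebra"
  assumes f: "B-lipschitz_on {a..b} f" and g: "C-lipschitz_on {a..b} g"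
  obtains D where "D-lipschitz_on {a..b} (\<lambda>t. f t * g t)"
proof -
  obtain P where P: "P \<ge> 0" "\<And>t. t \<in> {a..b} \<Longrightarrow> norm (f t) \<le> P" using lipschitz_bounded_Icc[OF f] by blast
  obtain Q where Q: "Q \<ge> 0" "\<And>t. t \<in> {a..b} \<Longrightarrow> norm (g t) \<le> Q" using lipschitz_bounded_Icc[OF g] by blast
  show ?thesis by (rule that[OF lipschitz_on_mult_bounded[OF f g P(2) Q(2) P(1) Q(1)]])
qed

lemma has_vector_derivative_Re: "(c has_vector_derivative d) F \<Longrightarrow> ((\<lambda>t. Re (c t)) has_vector_derivative Re d) F"
  and has_vector_derivative_Im: "(c has_vector_derivative d) F \<Longrightarrow> ((\<lambda>t. Im (c t)) has_vector_derivative Im d) F"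
  by (erule bounded_linear.has_vector_derivative[OF bounded_linear_Re] bounded_linear.has_vector_derivative[OF bounded_linear_Im])+

lemma simple_closed_lipschitz_orientation:
  fixes c :: "real \<Rightarrow> complex"
  assumes "simple_path c"
  obtains w :: real where "w = 1 \<or> w = -1" "\<And>z. z \<in> inside (path_image c) \<Longrightarrow> winding_number c z = of_real w"
proof (rule simple_closed_path_winding_number_inside[OF assms])
  assume "\<And>z. z \<in> inside (path_image c) \<Longrightarrow> winding_number c z = 1"
  then show thesis by (intro that[of 1]) auto
next
  assume "\<And>z. z \<in> inside (path_image c) \<Longrightarrow> winding_number c z = -1"
  then show thesis by (intro that[of "-1"]) auto
qed

text \<open>Green's formula with \<open>h = 1\<close> and \<open>k y = - y\<close> yields the area
  as the integral of \<open>- y dx\<close>. Twice this plus the integral of \<open>d (x y)\<close>,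
  which vanishes on a closed curve, is the symmetric form.\<close>

lemma integral_cross_eq_area:
  fixes c :: "real \<Rightarrow> complex"
  assumes lip: "B-lipschitz_on {0..1} c" and closed: "pathfinish c = pathstart c"
    and w: "\<And>z. z \<in> inside (path_image c) \<Longrightarrow> winding_number c z = of_real w"
  shows "((\<lambda>t. cross (c t) (vector_derivative c (at t))) has_integral
           2 * w * measure lborel (inside (path_image c))) {0..1}"
proof -
  let ?x = "\<lambda>t. Re (c t)" and ?y = "\<lambda>t. Im (c t)"
  obtain P where P: "P \<ge> 0" "\<And>t. t \<in> {0..1} \<Longrightarrow> norm (?y t) \<le> P"
    using lipschitz_bounded_Icc[OF lipschitz_on_Im[OF lip]] by blast
  have path: "path c" using lip by (simp add: path_def lipschitz_on_continuous_on)
  have meas: "inside (path_image c) \<in> lmeasurable"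
    by (intro bounded_set_imp_lmeasurable)
       (auto simp: bounded_inside bounded_path_image path closed_path_image open_inside)
  have "((\<lambda>t. - ?y t * Re (vector_derivative c (at t))) has_integral
           w * integral (inside (path_image c)) (\<lambda>z. 1)) {0..1}"
  proof (rule green_horizontal(1)[OF lip closed w, where k = uminus and h = "\<lambda>_. 1"])
    show "Im (c t) \<in> {-P..P}" if "t \<in> {0..1}" for t using P(2)[OF that] by (auto simp: abs_le_iff)
  qed (auto intro!: derivative_eq_intros)
  also have "integral (inside (path_image c)) (\<lambda>z. 1::real) = measure lborel (inside (path_image c))"
    using meas by (simp add: lmeasure_integral[symmetric] measure_completion
         borel_open open_inside closed_path_image path)
  finally have A: "((\<lambda>t. - ?y t * Re (vector_derivative c (at t))) has_integral
           w * measure lborel (inside (path_image c))) {0..1}" .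
  obtain D where D: "D-lipschitz_on {0..1} (\<lambda>t. ?x t * ?y t)"
    using lipschitz_on_mult_Icc[OF lipschitz_on_Re[OF lip] lipschitz_on_Im[OF lip]] .
  have "((\<lambda>t. ?x t * Im (vector_derivative c (at t)) + Re (vector_derivative c (at t)) * ?y t) has_integral
          (?x 1 * ?y 1 - ?x 0 * ?y 0)) {0..1}"
  proof (rule lipschitz_has_integral_derivative[OF D])
    show "AE t in lborel. t \<in> {0..1} \<longrightarrow> ((\<lambda>t. ?x t * ?y t) has_vector_derivative
      ?x t * Im (vector_derivative c (at t)) + Re (vector_derivative c (at t)) * ?y t) (at t)"
      using lipschitz_ae_vector_derivative(1)[OF lip]
      by eventually_elim (auto intro!: has_vector_derivative_mult has_vector_derivative_Re has_vector_derivative_Im)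
  qed simp
  moreover have "c 1 = c 0" using closed by (simp add: pathfinish_def pathstart_def)
  ultimately have "((\<lambda>t. ?x t * Im (vector_derivative c (at t)) + Re (vector_derivative c (at t)) * ?y t) has_integral 0) {0..1}"
    by simp
  from has_integral_add[OF this has_integral_mult_right[OF A, of 2]]
  show ?thesis by (simp add: cross_def algebra_simps)
qed

subsection \<open>Gauges of planar convex bodies\<close>

locale convex_body =
  fixes K :: "complex set"
  assumes convex_K: "convex K" and compact_K: "compact K" and zero_in_interior: "0 \<in> interior K"
begin

lemma zero_in_K: "0 \<in> K"
  using zero_in_interior interior_subset by blast

lemma scaled_mem:
  assumes "x \<in> K" "0 \<le> s" "s \<le> 1"
  shows "s *\<^sub>R x \<in> K"
  using convexD_alt[OF convex_K zero_in_K assms(1), of s] assms by simp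

lemma minkowski_eq_Inf: "minkowski K x = Inf {t. t > 0 \<and> x /\<^sub>R t \<in> K}"
proof -
  have "x \<in> (\<lambda>z. t *\<^sub>R z) ` K \<longleftrightarrow> x /\<^sub>R t \<in> K" if "t > 0" for t
  proof
    assume "x /\<^sub>R t \<in> K"
    then show "x \<in> (\<lambda>z. t *\<^sub>R z) ` K" using that by (intro image_eqI[of _ _ "x /\<^sub>R t"]) auto
  qed (use that in auto)
  then have "{t. t > 0 \<and> x \<in> (\<lambda>z. t *\<^sub>R z) ` K} = {t. t > 0 \<and> x /\<^sub>R t \<in> K}" by auto
  then show ?thesis by (simp add: minkowski_def)
qed

lemma inner_radius: obtains r where "r > 0" "cball 0 r \<subseteq> K"
  using zero_in_interior by (auto simp: mem_interior_cball)

lemma outer_radius: obtains R where "R > 0" "K \<subseteq> cball 0 R"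
proof -
  obtain R where "\<forall>x\<in>K. norm x \<le> R" using compact_imp_bounded[OF compact_K] by (auto simp: bounded_iff)
  then show ?thesis by (intro that[of "\<bar>R\<bar> + 1"]) force+
qed

lemma minkowski_set_nonempty: "\<exists>t>0. x /\<^sub>R t \<in> K"
proof -
  obtain r where r: "r > 0" "cball 0 r \<subseteq> K" using inner_radius .
  let ?t = "(norm x + 1) / r"
  have "norm (x /\<^sub>R ?t) \<le> r"
  proof -
    have "r * norm x \<le> r * (norm x + 1)" using r by (intro mult_left_mono) auto
    moreover have "norm x + 1 > 0" by (simp add: add_nonneg_pos)
    ultimately show ?thesis using r(1) by (simp add: divide_simps abs_of_pos)
  qed
  moreover have "?t > 0" using r by (simp add: add_nonneg_pos)
  ultimately show ?thesis using r by (intro exI[of _ ?t]) auto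
qed

lemma minkowski_le: "t > 0 \<Longrightarrow> x /\<^sub>R t \<in> K \<Longrightarrow> minkowski K x \<le> t"
  unfolding minkowski_eq_Inf by (rule cInf_lower) (auto intro!: bdd_belowI[of _ 0])

lemma minkowski_nonneg: "minkowski K x \<ge> 0"
  unfolding minkowski_eq_Inf by (rule cInf_greatest) (use minkowski_set_nonempty in auto)

lemma mem_if_minkowski_less:
  assumes "minkowski K x < t"
  shows "x /\<^sub>R t \<in> K"
proof -
  have "Inf {t. t > 0 \<and> x /\<^sub>R t \<in> K} < t" using assms by (simp add: minkowski_eq_Inf)
  then obtain s where s: "s > 0" "x /\<^sub>R s \<in> K" "s < t"
    using cInf_lessD[of "{t. t > 0 \<and> x /\<^sub>R t \<in> K}" t] minkowski_set_nonempty by blast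
  have "x /\<^sub>R t = (s / t) *\<^sub>R (x /\<^sub>R s)" using s by (simp add: inverse_eq_divide)
  also have "\<dots> \<in> K" using s by (intro scaled_mem[OF s(2)]) auto
  finally show ?thesis .
qed

lemma minkowski_le_one_iff: "minkowski K x \<le> 1 \<longleftrightarrow> x \<in> K"
proof
  assume "x \<in> K" then show "minkowski K x \<le> 1" using minkowski_le[of 1 x] by simp
next
  assume m: "minkowski K x \<le> 1"
  have lim: "(\<lambda>n. x /\<^sub>R (1 + 1 / real (Suc n))) \<longlonglongrightarrow> x /\<^sub>R (1 + 0)"
    using LIMSEQ_inverse_real_of_nat by (intro tendsto_intros) (auto simp: divide_inverse)
  have mem: "x /\<^sub>R (1 + 1 / real (Suc n)) \<in> K" for n
    by (rule mem_if_minkowski_less, rule le_less_trans[OF m]) simp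
  have "x /\<^sub>R (1 + 0) \<in> K"
    by (rule closed_sequentially[OF compact_imp_closed[OF compact_K] mem lim])
  then show "x \<in> K" by simp
qed

lemma minkowski_scaleR:
  assumes "s > 0"
  shows "minkowski K (s *\<^sub>R x) = s * minkowski K x"
proof -
  have le: "minkowski K (s *\<^sub>R x) \<le> s * minkowski K x" if "s > 0" for s x
  proof (rule field_le_epsilon)
    fix e :: real assume e: "e > 0"
    have t: "minkowski K x + e / s > 0" using minkowski_nonneg[of x] e that by (simp add: add_nonneg_pos)
    have "x /\<^sub>R (minkowski K x + e / s) \<in> K" using e that by (intro mem_if_minkowski_less) auto
    moreover have "(s *\<^sub>R x) /\<^sub>R (s * (minkowski K x + e / s)) = x /\<^sub>R (minkowski K x + e / s)"
    proof -
      have "inverse (s * u) * s = inverse u" for u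
        using that by (cases "u = 0") (simp_all add: field_simps)
      then show ?thesis by (simp only: scaleR_scaleR)
    qed
    ultimately have "(s *\<^sub>R x) /\<^sub>R (s * (minkowski K x + e / s)) \<in> K" by (simp only:)
    then have "minkowski K (s *\<^sub>R x) \<le> s * (minkowski K x + e / s)"
      using t that by (intro minkowski_le) auto
    then show "minkowski K (s *\<^sub>R x) \<le> s * minkowski K x + e"
      using that by (simp add: algebra_simps)
  qed
  have "minkowski K ((1 / s) *\<^sub>R (s *\<^sub>R x)) \<le> (1 / s) * minkowski K (s *\<^sub>R x)"
    using assms by (intro le) auto
  then have "s * minkowski K x \<le> minkowski K (s *\<^sub>R x)"
    using assms by (simp add: field_simps)
  then show ?thesis using le[OF assms, of x] by simp
qed

lemma minkowski_triangle: "minkowski K (x + y) \<le> minkowski K x + minkowski K y"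
proof (rule field_le_epsilon)
  fix e :: real assume e: "e > 0"
  let ?s = "minkowski K x + e / 2" and ?t = "minkowski K y + e / 2"
  have pos: "?s > 0" "?t > 0" using minkowski_nonneg e by (auto simp: add_nonneg_pos)
  have "x /\<^sub>R ?s \<in> K" "y /\<^sub>R ?t \<in> K" using e by (auto intro!: mem_if_minkowski_less)
  then have "(?s / (?s + ?t)) *\<^sub>R (x /\<^sub>R ?s) + (?t / (?s + ?t)) *\<^sub>R (y /\<^sub>R ?t) \<in> K"
    using pos by (intro convexD[OF convex_K]) (simp_all flip: add_divide_distrib)
  moreover have "(u / v) *\<^sub>R (z /\<^sub>R u) = z /\<^sub>R v" if "u > 0" for u v :: real and z :: complex
    using that by (simp add: inverse_eq_divide)
  then have "(?s / (?s + ?t)) *\<^sub>R (x /\<^sub>R ?s) + (?t / (?s + ?t)) *\<^sub>R (y /\<^sub>R ?t) = (x + y) /\<^sub>R (?s + ?t)"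
    using pos by (simp only: scaleR_add_right)
  ultimately have "minkowski K (x + y) \<le> ?s + ?t" using pos by (intro minkowski_le) auto
  then show "minkowski K (x + y) \<le> minkowski K x + minkowski K y + e" by simp
qed

lemma minkowski_zero [simp]: "minkowski K 0 = 0"
  using minkowski_scaleR[OF zero_less_numeral, of num.One 0] minkowski_scaleR[OF zero_less_numeral, of "num.Bit0 num.One" 0]
  unfolding scaleR_zero_right by linarith

lemma minkowski_upper: "\<exists>r>0. \<forall>x. minkowski K x \<le> norm x / r"
proof -
  obtain r where r: "r > 0" "cball 0 r \<subseteq> K" using inner_radius .
  have "minkowski K x \<le> norm x / r" for x
  proof (cases "x = 0")
    case False
    then have "x /\<^sub>R (norm x / r) \<in> K" using r by (intro subsetD[OF r(2)]) simp
    then show ?thesis using False r by (intro minkowski_le) auto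
  qed simp
  with r(1) show ?thesis by blast
qed

lemma minkowski_lower: "\<exists>R>0. \<forall>x. norm x / R \<le> minkowski K x"
proof -
  obtain R where R: "R > 0" "K \<subseteq> cball 0 R" using outer_radius .
  have "norm x / R \<le> minkowski K x" for x
  proof (rule field_le_epsilon)
    fix e :: real assume e: "e > 0"
    have t: "minkowski K x + e > 0" using minkowski_nonneg[of x] e by simp
    have "x /\<^sub>R (minkowski K x + e) \<in> K" using e by (intro mem_if_minkowski_less) auto
    then have "norm (x /\<^sub>R (minkowski K x + e)) \<le> R" using R by auto
    then show "norm x / R \<le> minkowski K x + e" using t R by (simp add: field_simps)
  qed
  with R(1) show ?thesis by blast
qed

lemma minkowski_lipschitz: obtains C where "C-lipschitz_on UNIV (minkowski K)"
proof -
  obtain r where r: "r > 0" "\<And>x. minkowski K x \<le> norm x / r" using minkowski_upper by blast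
  have "(1 / r)-lipschitz_on UNIV (minkowski K)"
  proof (rule lipschitz_onI)
    fix x y
    have "minkowski K x \<le> minkowski K y + norm (x - y) / r" "minkowski K y \<le> minkowski K x + norm (x - y) / r"
      using minkowski_triangle[of y "x - y"] minkowski_triangle[of x "y - x"] r(2)[of "x - y"] r(2)[of "y - x"]
      by (auto simp: norm_minus_commute)
    then show "dist (minkowski K x) (minkowski K y) \<le> 1 / r * dist x y"
      by (simp add: dist_real_def dist_norm abs_le_iff)
  qed (use r in simp)
  then show ?thesis by (rule that)
qed

lemma continuous_minkowski: "continuous_on UNIV (minkowski K)"
proof (rule minkowski_lipschitz)
  show "continuous_on UNIV (minkowski K)" if "C-lipschitz_on UNIV (minkowski K)" for C
    using that by (rule lipschitz_on_continuous_on)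
qed

lemma minkowski_pos:
  assumes "x \<noteq> 0" shows "minkowski K x > 0"
proof -
  obtain R where R: "R > 0" "\<And>x. norm x / R \<le> minkowski K x" using minkowski_lower by blast
  then show ?thesis using assms by (metis divide_pos_pos less_le_trans zero_less_norm_iff)
qed

lemma interior_eq_minkowski: "interior K = {x. minkowski K x < 1}"
proof
  have "open {x. minkowski K x < 1}"
    by (intro open_Collect_less continuous_minkowski continuous_intros)
  moreover have "{x. minkowski K x < 1} \<subseteq> K"
    using minkowski_le_one_iff by (auto intro: less_imp_le)
  ultimately show "{x. minkowski K x < 1} \<subseteq> interior K" by (simp add: interior_maximal)
next
  show "interior K \<subseteq> {x. minkowski K x < 1}"
  proof
    fix x assume "x \<in> interior K"
    then obtain e where e: "e > 0" "cball x e \<subseteq> K" by (auto simp: mem_interior_cball)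
    show "x \<in> {x. minkowski K x < 1}"
    proof (cases "x = 0")
      case False
      define s where "s = 1 + e / norm x"
      have s: "s > 1" using e False by (simp add: s_def)
      have "x - s *\<^sub>R x = - (e / norm x) *\<^sub>R x" by (simp add: s_def algebra_simps)
      then have "dist x (s *\<^sub>R x) = e" using False e by (simp add: dist_norm)
      then have "s *\<^sub>R x \<in> K" using e by auto
      then have "s * minkowski K x \<le> 1" using minkowski_le_one_iff[of "s *\<^sub>R x"] minkowski_scaleR[of s x] s by auto
      moreover have "1 * minkowski K x < s * minkowski K x"
        using s minkowski_pos[OF False] by (intro mult_strict_right_mono)
      ultimately show ?thesis by simp
    qed simp
  qed
qed

lemma frontier_eq_minkowski: "frontier K = {x. minkowski K x = 1}"
proof -
  have "frontier K = K - interior K"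
    by (simp add: frontier_def closure_closed compact_imp_closed[OF compact_K])
  also have "\<dots> = {x. minkowski K x \<le> 1} - {x. minkowski K x < 1}"
    unfolding minkowski_le_one_iff interior_eq_minkowski by simp
  also have "\<dots> = {x. minkowski K x = 1}"
    by (auto intro: antisym simp: not_less)
  finally show ?thesis .
qed

lemma frontier_subset: "frontier K \<subseteq> K"
  by (rule frontier_subset_compact[OF compact_K])

lemma inside_frontier: "inside (frontier K) = interior K"
  by (rule inside_frontier_eq_interior[OF compact_imp_bounded[OF compact_K] convex_K])

lemma measure_interior: "measure lborel (interior K) = measure lborel K"
proof -
  have eq: "interior K \<union> frontier K = K"
    using frontier_subset interior_subset[of K] closure_subset[of K] unfolding frontier_def by blast
  have "frontier K \<in> sets lborel"
    by (simp add: borel_closed)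
  then have "frontier K \<in> null_sets lborel"
    using negligible_convex_frontier[OF convex_K] null_sets_completion_iff[of "frontier K" lborel]
    by (simp only: negligible_iff_null_sets)
  then have "measure lborel (interior K \<union> frontier K) = measure lborel (interior K)"
    by (intro measure_Un_null_set) (simp add: borel_open)
  then show ?thesis unfolding eq by (rule sym)
qed

end

subsection \<open>Convex trigonometry\<close>

lemma has_vector_derivative_cis: "(cis has_vector_derivative (\<i> * cis t)) (at t within S)"
proof -
  have e: "cis = (\<lambda>t. exp (t *\<^sub>R \<i>))"
    by (simp add: fun_eq_iff cis_conv_exp scaleR_conv_of_real mult.commute)
  show ?thesis
    unfolding e using exp_scaleR_has_vector_derivative_right[of \<i> t S] by (simp add: mult.commute)
qed

lemma lipschitz_on_cis: "1-lipschitz_on S cis"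
proof (rule lipschitz_onI)
  fix x y
  have "norm (cis x - cis y) \<le> 1 * norm (x - y)"
  proof (rule differentiable_bound[of UNIV])
    show "(cis has_derivative (\<lambda>h. h *\<^sub>R (\<i> * cis t))) (at t within UNIV)" for t
      using has_vector_derivative_cis[of t UNIV] by (simp add: has_vector_derivative_def)
    show "onorm (\<lambda>h. h *\<^sub>R (\<i> * cis t)) \<le> 1" for t
      by (rule onorm_le) (simp add: norm_mult)
  qed auto
  then show "dist (cis x) (cis y) \<le> 1 * dist x y" by (simp add: dist_norm)
qed simp

section \<open>Existence of the trigonometric functions: the boundary in polar coordinates\<close>

context convex_body
begin

text \<open>The radial function of \<open>K\<close>, the distance from 0 to the boundary in the
  direction \<open>cis \<phi>\<close>.\<close>

definition ray_radius :: "real \<Rightarrow> real" where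
  "ray_radius \<phi> = 1 / minkowski K (cis \<phi>)"

definition ray_point :: "real \<Rightarrow> complex" where
  "ray_point \<phi> = of_real (ray_radius \<phi>) * cis \<phi>"

lemma ray_radius_pos: "ray_radius \<phi> > 0"
  by (simp add: ray_radius_def minkowski_pos)

lemma ray_radius_bounds: "\<exists>p>0. \<exists>q>0. (\<forall>\<phi>. p \<le> ray_radius \<phi>) \<and> (\<forall>\<phi>. ray_radius \<phi> \<le> q)"
proof -
  obtain r where r: "r > 0" "\<And>x. minkowski K x \<le> norm x / r" using minkowski_upper by blast
  obtain R where R: "R > 0" "\<And>x. norm x / R \<le> minkowski K x" using minkowski_lower by blast
  have "r \<le> ray_radius \<phi>" for \<phi>
    using r(2)[of "cis \<phi>"] r(1) minkowski_pos[of "cis \<phi>"] by (simp add: ray_radius_def field_simps)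
  moreover have "ray_radius \<phi> \<le> R" for \<phi>
    using R(2)[of "cis \<phi>"] R(1) minkowski_pos[of "cis \<phi>"] by (simp add: ray_radius_def field_simps)
  ultimately show ?thesis using r(1) R(1) by blast
qed

lemma ray_radius_lipschitz: obtains C where "C-lipschitz_on UNIV ray_radius"
proof -
  obtain C where C: "C-lipschitz_on UNIV (minkowski K)" using minkowski_lipschitz .
  obtain p q where pq: "p > 0" "q > 0" "\<And>\<phi>. p \<le> ray_radius \<phi>" "\<And>\<phi>. ray_radius \<phi> \<le> q"
    using ray_radius_bounds by blast
  have C0: "C \<ge> 0" using C lipschitz_on_nonneg by blast
  have "(C * q\<^sup>2)-lipschitz_on UNIV ray_radius"
  proof (rule lipschitz_onI)
    fix x y
    let ?m = "\<lambda>t. minkowski K (cis t)"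
    have pos: "?m x > 0" "?m y > 0" by (simp_all add: minkowski_pos)
    have "ray_radius x - ray_radius y = ray_radius x * ray_radius y * (?m y - ?m x)"
      using pos by (simp add: ray_radius_def field_simps)
    then have "\<bar>ray_radius x - ray_radius y\<bar> = ray_radius x * ray_radius y * \<bar>?m y - ?m x\<bar>"
      using ray_radius_pos by (simp add: abs_mult less_imp_le)
    also have "\<dots> \<le> (q * q) * (C * \<bar>x - y\<bar>)"
    proof (intro mult_mono)
      have "\<bar>?m y - ?m x\<bar> \<le> C * norm (cis y - cis x)"
        using lipschitz_on_normD[OF C, of "cis y" "cis x"] by simp
      also have "norm (cis y - cis x) \<le> 1 * norm (y - x)"
        using lipschitz_on_normD[OF lipschitz_on_cis, of y UNIV x] by simp
      finally show "\<bar>?m y - ?m x\<bar> \<le> C * \<bar>x - y\<bar>" using C0 by (simp add: mult_left_mono abs_minus_commute)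
    qed (use pq ray_radius_pos in \<open>auto simp: less_imp_le\<close>)
    finally show "dist (ray_radius x) (ray_radius y) \<le> C * q\<^sup>2 * dist x y"
      by (simp add: dist_real_def power2_eq_square mult_ac)
  qed (use C0 in simp)
  then show ?thesis by (rule that)
qed

lemma ray_radius_periodic: "ray_radius (\<phi> + 2 * pi) = ray_radius \<phi>"
  by (simp add: ray_radius_def cis.ctr)

lemma ray_point_periodic: "ray_point (\<phi> + 2 * pi) = ray_point \<phi>"
  by (simp add: ray_point_def ray_radius_periodic) (simp add: cis.ctr)

lemma norm_ray_point: "cmod (ray_point \<phi>) = ray_radius \<phi>"
  using ray_radius_pos[of \<phi>] by (simp add: ray_point_def norm_mult)

lemma ray_point_lipschitz: obtains C where "C-lipschitz_on UNIV ray_point"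
proof -
  obtain p q where pq: "p > 0" "q > 0" "\<And>\<phi>. p \<le> ray_radius \<phi>" "\<And>\<phi>. ray_radius \<phi> \<le> q"
    using ray_radius_bounds by blast
  obtain C where C: "C-lipschitz_on UNIV ray_radius" using ray_radius_lipschitz .
  have C': "C-lipschitz_on UNIV (\<lambda>t. complex_of_real (ray_radius t))"
    by (rule lipschitz_on_linear_image[OF C]) (simp add: dist_norm flip: of_real_diff)
  have "(C * 1 + q * 1)-lipschitz_on UNIV ray_point"
    unfolding ray_point_def[abs_def]
    by (rule lipschitz_on_mult_bounded[OF C' lipschitz_on_cis])
       (use pq ray_radius_pos in \<open>auto simp: abs_of_pos\<close>)
  then show ?thesis by (rule that)
qed

lemma minkowski_ray_point: "minkowski K (ray_point \<phi>) = 1"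
proof -
  have "ray_point \<phi> = ray_radius \<phi> *\<^sub>R cis \<phi>" by (simp add: ray_point_def scaleR_conv_of_real)
  then show ?thesis
    using minkowski_scaleR[OF ray_radius_pos] minkowski_pos[of "cis \<phi>"] by (simp add: ray_radius_def)
qed

lemma ray_point_mem_frontier: "ray_point \<phi> \<in> frontier K"
  by (simp add: frontier_eq_minkowski minkowski_ray_point)

lemma frontier_eq_ray_point:
  assumes z: "z \<in> frontier K" and a: "z = of_real (cmod z) * cis a"
  shows "z = ray_point a"
proof -
  have "z \<noteq> 0" using z by (auto simp: frontier_eq_minkowski)
  then have "minkowski K z = cmod z * minkowski K (cis a)"
    using minkowski_scaleR[of "cmod z" "cis a"] by (subst a) (simp add: scaleR_conv_of_real)
  then have "cmod z = ray_radius a"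
    using z minkowski_pos[of "cis a"] by (simp add: frontier_eq_minkowski ray_radius_def field_simps)
  then show ?thesis by (subst a) (simp add: ray_point_def)
qed

lemma ray_point_eq_iff: "ray_point a = ray_point b \<longleftrightarrow> (\<exists>n::int. a = b + 2 * pi * n)"
proof -
  have "ray_point a = ray_point b \<longleftrightarrow> cis a = cis b"
  proof
    assume eq: "ray_point a = ray_point b"
    then have "ray_radius a = ray_radius b" using norm_ray_point by metis
    with eq show "cis a = cis b" using ray_radius_pos[of b] by (simp add: ray_point_def)
  qed (simp add: ray_point_def ray_radius_def)
  also have "\<dots> \<longleftrightarrow> (\<exists>n::int. a = b + 2 * pi * n)"
    using sin_cos_eq_iff[of a b] by (auto simp: complex_eq_iff)
  finally show ?thesis .
qed

text \<open>\<open>sector_area \<phi>\<close> is twice the area of the sector of \<open>K\<close> between the polar angles \<open>0\<close> and \<open>\<phi>\<close>.\<close>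

definition sector_area :: "real \<Rightarrow> real" where
  "sector_area = (SOME F. F 0 = 0 \<and> (\<forall>\<phi>. (F has_real_derivative (ray_radius \<phi>)\<^sup>2) (at \<phi>)))"

lemma sector_area: "sector_area 0 = 0" "(sector_area has_real_derivative (ray_radius \<phi>)\<^sup>2) (at \<phi>)"
proof -
  obtain C where "C-lipschitz_on UNIV ray_radius" using ray_radius_lipschitz .
  then have "continuous_on UNIV ray_radius" by (rule lipschitz_on_continuous_on)
  then have "\<And>x. isCont (\<lambda>\<phi>. (ray_radius \<phi>)\<^sup>2) x"
    by (intro continuous_intros) (simp add: continuous_on_eq_continuous_at)
  then obtain F where F: "\<And>x. (F has_vector_derivative (ray_radius x)\<^sup>2) (at x)"
    using einterval_antiderivative[of "-\<infinity>" "\<infinity>" "\<lambda>\<phi>. (ray_radius \<phi>)\<^sup>2"] by auto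
  have "((\<lambda>x. F x - F 0) has_real_derivative (ray_radius x)\<^sup>2) (at x)" for x
    using F[of x] by (auto intro!: derivative_eq_intros simp: has_real_derivative_iff_has_vector_derivative[symmetric])
  then have "\<exists>F. F 0 = 0 \<and> (\<forall>\<phi>. (F has_real_derivative (ray_radius \<phi>)\<^sup>2) (at \<phi>))"
    by (intro exI[of _ "\<lambda>x. F x - F 0"]) simp
  then have "sector_area 0 = 0 \<and> (\<forall>\<phi>. (sector_area has_real_derivative (ray_radius \<phi>)\<^sup>2) (at \<phi>))"
    unfolding sector_area_def by (rule someI_ex)
  then show "sector_area 0 = 0" "(sector_area has_real_derivative (ray_radius \<phi>)\<^sup>2) (at \<phi>)" by auto
qed

lemma sector_area_mono: "a < b \<Longrightarrow> sector_area a < sector_area b"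
  by (rule DERIV_pos_imp_increasing[of a b])
     (auto intro!: exI conjI sector_area(2) zero_less_power ray_radius_pos)

text \<open>A positive lower rate of growth makes \<open>sector_area\<close> a map onto the line and
  its inverse Lipschitz.\<close>

lemma sector_area_add_ge: "\<exists>p>0. \<forall>a b. a \<le> b \<longrightarrow> p * (b - a) \<le> sector_area b - sector_area a"
proof -
  obtain p q where pq: "p > 0" "q > 0" "\<And>\<phi>. p \<le> ray_radius \<phi>" "\<And>\<phi>. ray_radius \<phi> \<le> q"
    using ray_radius_bounds by blast
  have "p\<^sup>2 * (b - a) \<le> sector_area b - sector_area a" if ab: "a \<le> b" for a b
  proof -
    have "sector_area a - p\<^sup>2 * a \<le> sector_area b - p\<^sup>2 * b"
    proof (rule DERIV_nonneg_imp_nondecreasing[OF ab])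
      fix x
      have "((\<lambda>x. sector_area x - p\<^sup>2 * x) has_real_derivative (ray_radius x)\<^sup>2 - p\<^sup>2) (at x)"
        by (auto intro!: derivative_eq_intros sector_area(2))
      moreover have "(ray_radius x)\<^sup>2 - p\<^sup>2 \<ge> 0" using pq by (simp add: power_mono)
      ultimately show "\<exists>y. ((\<lambda>x. sector_area x - p\<^sup>2 * x) has_real_derivative y) (at x) \<and> 0 \<le> y" by blast
    qed
    then show ?thesis by (simp add: algebra_simps)
  qed
  then show ?thesis using pq(1) by (intro exI[of _ "p\<^sup>2"]) auto
qed

lemma sector_area_lipschitz: obtains C where "C-lipschitz_on UNIV sector_area"
proof -
  obtain p q where pq: "p > 0" "q > 0" "\<And>\<phi>. p \<le> ray_radius \<phi>" "\<And>\<phi>. ray_radius \<phi> \<le> q"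
    using ray_radius_bounds by blast
  have "(q\<^sup>2)-lipschitz_on UNIV sector_area"
  proof (rule lipschitz_onI)
    fix x y
    have "norm (sector_area x - sector_area y) \<le> q\<^sup>2 * norm (x - y)"
    proof (rule field_differentiable_bound[of UNIV])
      show "norm ((ray_radius z)\<^sup>2) \<le> q\<^sup>2" for z
        using pq ray_radius_pos[of z] by (simp add: power_mono less_imp_le)
    qed (use sector_area(2) in auto)
    then show "dist (sector_area x) (sector_area y) \<le> q\<^sup>2 * dist x y" by (simp add: dist_norm)
  qed simp
  then show ?thesis by (rule that)
qed

lemma sector_area_periodic: "sector_area (\<phi> + 2 * pi) = sector_area \<phi> + sector_area (2 * pi)"
proof -
  have "((\<lambda>x. sector_area (x + 2 * pi) - sector_area x) has_real_derivative 0) (at x)" for x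
  proof -
    have "((\<lambda>x. sector_area (x + 2 * pi)) has_real_derivative (ray_radius (x + 2 * pi))\<^sup>2) (at x)"
      using sector_area(2)[of "x + 2 * pi"] by (simp add: DERIV_shift)
    from DERIV_diff[OF this sector_area(2)[of x]] show ?thesis by (simp add: ray_radius_periodic)
  qed
  then have "sector_area (\<phi> + 2 * pi) - sector_area \<phi> = sector_area (0 + 2 * pi) - sector_area 0"
    by (intro DERIV_isconst_all) auto
  then show ?thesis by (simp add: sector_area(1))
qed

lemma sector_area_bij: "\<exists>!x. sector_area x = y"
proof -
  obtain p where p: "p > 0" "\<And>a b. a \<le> b \<Longrightarrow> p * (b - a) \<le> sector_area b - sector_area a"
    using sector_area_add_ge by blast
  have cont: "continuous_on S sector_area" for S
    using sector_area(2) by (meson DERIV_continuous_on has_field_derivative_at_within)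
  let ?b = "\<bar>y\<bar> / p"
  have "sector_area (- ?b) \<le> y" "y \<le> sector_area ?b"
    using p(2)[of "- ?b" 0] p(2)[of 0 ?b] p(1) by (auto simp: sector_area(1))
  then have "\<exists>x. sector_area x = y"
    using IVT'[of sector_area "- ?b" y ?b] cont p(1) by auto
  moreover have "sector_area a \<noteq> sector_area b" if "a \<noteq> b" for a b
    using sector_area_mono[of a b] sector_area_mono[of b a] that by (cases "a < b") auto
  ultimately show ?thesis by metis
qed

definition sector_angle :: "real \<Rightarrow> real" where
  "sector_angle y = (THE x. sector_area x = y)"

lemma sector_area_angle [simp]: "sector_area (sector_angle y) = y"
  unfolding sector_angle_def by (rule theI'[OF sector_area_bij])

lemma sector_angle_area [simp]: "sector_angle (sector_area x) = x"
  using sector_area_bij[of "sector_area x"] sector_area_angle[of "sector_area x"] by blast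

lemma sector_angle_lipschitz: obtains C where "C-lipschitz_on UNIV sector_angle"
proof -
  obtain p where p: "p > 0" "\<And>a b. a \<le> b \<Longrightarrow> p * (b - a) \<le> sector_area b - sector_area a"
    using sector_area_add_ge by blast
  have "(1 / p)-lipschitz_on UNIV sector_angle"
  proof (rule lipschitz_onI)
    fix x y
    have "p * \<bar>sector_angle x - sector_angle y\<bar> \<le> \<bar>x - y\<bar>"
      using p(2)[of "sector_angle x" "sector_angle y"] p(2)[of "sector_angle y" "sector_angle x"]
      by (cases "sector_angle x \<le> sector_angle y") (auto simp: abs_if)
    then show "dist (sector_angle x) (sector_angle y) \<le> 1 / p * dist x y"
      using p(1) by (simp add: dist_real_def field_simps)
  qed (use p in simp)
  then show ?thesis by (rule that)
qed

lemma sector_angle_derivative: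
  "(sector_angle has_real_derivative 1 / (ray_radius (sector_angle y))\<^sup>2) (at y)"
proof -
  obtain C where "C-lipschitz_on UNIV sector_angle" by (rule sector_angle_lipschitz)
  then have "continuous_on UNIV sector_angle" by (rule lipschitz_on_continuous_on)
  then have "isCont sector_angle y" by (simp add: continuous_on_eq_continuous_at)
  then have "(sector_angle has_real_derivative inverse ((ray_radius (sector_angle y))\<^sup>2)) (at y)"
    using ray_radius_pos[of "sector_angle y"]
    by (intro DERIV_inverse_function[where f = sector_area and a = "y - 1" and b = "y + 1"] sector_area(2)) auto
  then show ?thesis by (simp add: inverse_eq_divide)
qed

lemma sector_angle_mono: "a < b \<Longrightarrow> sector_angle a < sector_angle b"
  using sector_area_mono[of "sector_angle b" "sector_angle a"]
  by (metis linorder_neqE_linordered_idom not_less_iff_gr_or_eq sector_area_angle)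

lemma sector_angle_zero [simp]: "sector_angle 0 = 0"
  using sector_angle_area[of 0] by (simp add: sector_area(1))

lemma sector_angle_periodic: "sector_angle (y + sector_area (2 * pi)) = sector_angle y + 2 * pi"
  using sector_area_periodic[of "sector_angle y"] by (metis sector_angle_area sector_area_angle)

text \<open>The explicit candidate for \<open>convex_trig K\<close>: the parameter is twice the
  swept area, turned into a polar angle by \<open>sector_angle\<close>.\<close>

definition sector_point :: "real \<Rightarrow> complex" where
  "sector_point \<theta> = ray_point (sector_angle \<theta>)"

end

lemma lipschitz_on_scale_arg:
  fixes f :: "real \<Rightarrow> 'a::metric_space"
  assumes "B-lipschitz_on UNIV f"
  shows "(B * \<bar>k\<bar>)-lipschitz_on S (\<lambda>s. f (k * s))"
proof (rule lipschitz_onI)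
  show "dist (f (k * x)) (f (k * y)) \<le> B * \<bar>k\<bar> * dist x y" for x y
    using lipschitz_onD[OF assms, of "k * x" "k * y"]
    by (simp add: dist_real_def abs_mult right_diff_distrib[symmetric])
qed (use lipschitz_on_nonneg[OF assms] in simp)

lemma negligible_if_AE_lborel:
  assumes "AE x in lborel. P x"
  shows "negligible {x. \<not> P x}"
proof -
  have "AE x in lebesgue. P x" using assms by (simp add: AE_completion_iff)
  then show ?thesis
    using completion.AE_iff_null_sets[of P lborel] by (simp add: negligible_iff_null_sets)
qed

lemma AE_lborel_affine:
  fixes a k :: real
  assumes "AE x in lborel. P x" and k: "k \<noteq> 0"
  shows "AE s in lborel. P (a + k * s)"
proof (rule AE_lborel_if_negligible)
  let ?N = "{x. \<not> P x}" and ?f = "\<lambda>x. (x - a) / k"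
  have "\<exists>T B. open T \<and> x \<in> T \<and> (\<forall>y\<in>?N \<inter> T. norm (?f y - ?f x) \<le> B * norm (y - x))" for x
    by (intro exI[of _ UNIV] exI[of _ "1 / \<bar>k\<bar>"]) (auto simp: diff_divide_distrib[symmetric])
  then show "negligible (?f ` ?N)"
    by (intro negligible_locally_Lipschitz_image negligible_if_AE_lborel assms) auto
  show "P (a + k * s)" if "s \<notin> ?f ` ?N" for s
    using that k by (auto simp: image_iff dest: spec[of _ "a + k * s"])
qed

lemma periodic_int:
  fixes f :: "real \<Rightarrow> 'a"
  assumes "\<And>t. f (t + T) = f t"
  shows "f (t + of_int n * T) = f t"
proof -
  have nat: "f (t + real k * T) = f t" for t k
  proof (induction k)
    case (Suc k)
    have "f (t + real (Suc k) * T) = f ((t + real k * T) + T)" by (simp add: algebra_simps)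
    also have "\<dots> = f t" using assms Suc by simp
    finally show ?case .
  qed simp
  show ?thesis
  proof (cases "n \<ge> 0")
    case True
    then show ?thesis using nat[of t "nat n"] by simp
  next
    case False
    then show ?thesis using nat[of "t + of_int n * T" "nat (- n)"] by simp
  qed
qed

lemma continuous_injective_increasing:
  fixes f :: "real \<Rightarrow> real"
  assumes cont: "continuous_on {a..b} f" and inj: "inj_on f {a..b}" and ab: "f a < f b"
    and "a \<le> x" "x \<le> y" "y \<le> b"
  shows "f x \<le> f y"
proof -
  have 1: "f a \<le> f z \<and> f z \<le> f b" if "z \<in> {a..b}" for z
    using continuous_inj_imp_mono[of a z b f] cont inj ab that by (cases "z = a \<or> z = b") auto
  show ?thesis
  proof (cases "x = a \<or> x = y")
    case False
    show ?thesis
    proof (cases "y = b")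
      case False
      have c: "continuous_on {x..b} f" "inj_on f {x..b}"
        using cont inj assms(4) by (auto intro: continuous_on_subset inj_on_subset)
      show ?thesis
        using continuous_inj_imp_mono[of x y b f] c 1[of x] \<open>\<not> (x = a \<or> x = y)\<close> False assms by auto
    qed (use 1[of x] assms in auto)
  qed (use 1[of y] assms in auto)
qed

context convex_body
begin

lemma sector_point_mem_frontier: "sector_point \<theta> \<in> frontier K"
  by (simp add: sector_point_def ray_point_mem_frontier)

lemma total_sector_area_pos: "sector_area (2 * pi) > 0"
  using sector_area_mono[of 0 "2 * pi"] by (simp add: sector_area(1))

lemma sector_point_periodic: "sector_point (\<theta> + sector_area (2 * pi)) = sector_point \<theta>"
  by (simp add: sector_point_def sector_angle_periodic ray_point_periodic)

lemma sector_point_lipschitz: obtains C where "C-lipschitz_on UNIV sector_point"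
proof -
  obtain B where B: "B-lipschitz_on UNIV ray_point" by (rule ray_point_lipschitz)
  obtain C where C: "C-lipschitz_on UNIV sector_angle" by (rule sector_angle_lipschitz)
  have "(B * C)-lipschitz_on UNIV sector_point"
    unfolding sector_point_def[abs_def]
    by (rule lipschitz_on_compose2[OF C]) (rule lipschitz_on_subset[OF B], simp)
  then show ?thesis by (rule that)
qed

lemma sector_angle_range:
  assumes "0 \<le> \<theta>" "\<theta> \<le> sector_area (2 * pi)"
  shows "0 \<le> sector_angle \<theta>" "sector_angle \<theta> \<le> 2 * pi"
  using sector_angle_mono[of 0 \<theta>] sector_angle_mono[of \<theta> "sector_area (2 * pi)"] assms
  by (auto simp: le_less)

lemma sector_point_image: "sector_point ` {0..sector_area (2 * pi)} = frontier K"
proof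
  show "frontier K \<subseteq> sector_point ` {0..sector_area (2 * pi)}"
  proof
    fix z assume z: "z \<in> frontier K"
    define a where "a = Arg2pi z"
    have a: "0 \<le> a" "a < 2 * pi" "z = of_real (cmod z) * cis a"
      using Arg2pi[of z] by (auto simp: a_def is_Arg_def cis_conv_exp)
    have "z = ray_point a" by (rule frontier_eq_ray_point[OF z a(3)])
    then have "z = sector_point (sector_area a)" by (simp add: sector_point_def)
    moreover have "0 \<le> sector_area a" "sector_area a \<le> sector_area (2 * pi)"
      using sector_area_mono[of 0 a] sector_area_mono[of a "2 * pi"] a by (auto simp: sector_area(1) le_less)
    ultimately show "z \<in> sector_point ` {0..sector_area (2 * pi)}" by auto
  qed
qed (use sector_point_mem_frontier in auto)

lemma sector_point_injective:
  assumes "sector_point x = sector_point y" "x \<in> {0..sector_area (2 * pi)}" "y \<in> {0..sector_area (2 * pi)}"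
  shows "x = y \<or> x = 0 \<and> y = sector_area (2 * pi) \<or> x = sector_area (2 * pi) \<and> y = 0"
proof -
  obtain n :: int where n: "sector_angle x = sector_angle y + 2 * pi * n"
    using assms(1) by (auto simp: sector_point_def ray_point_eq_iff)
  have r: "0 \<le> sector_angle x" "sector_angle x \<le> 2 * pi" "0 \<le> sector_angle y" "sector_angle y \<le> 2 * pi"
    using sector_angle_range assms by auto
  then have le: "2 * pi * real_of_int n \<le> 2 * pi * 1" using n by linarith
  have ge: "2 * pi * (-1) \<le> 2 * pi * real_of_int n" using n r by linarith
  have "real_of_int n \<le> 1" "-1 \<le> real_of_int n"
    using le ge by (simp_all only: mult_le_cancel_left_pos[of "2 * pi"] pi_gt_zero mult_pos_pos zero_less_numeral)
  then consider "n = -1" | "n = 0" | "n = 1" by linarith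
  then show ?thesis
  proof cases
    case 1
    then have "sector_angle x = 0" "sector_angle y = 2 * pi" using n r by auto
    then show ?thesis by (metis sector_area(1) sector_area_angle)
  next
    case 2
    then show ?thesis using n by (metis add.right_neutral mult_zero_right of_int_0 sector_area_angle)
  next
    case 3
    then have "sector_angle x = 2 * pi" "sector_angle y = 0" using n r by auto
    then show ?thesis by (metis sector_area(1) sector_area_angle)
  qed
qed

text \<open>In polar coordinates the cross product of a point and its velocity is the squared radius
  times the angular speed. The latter is \<open>1 / (a \<theta>)\<^sup>2\<close> by the choice of
  the parameter, and the radial speed \<open>g \<theta>\<close>, which exists only almost
  everywhere, cancels.\<close>

lemma cross_sector_point:
  "AE \<theta> in lborel. \<exists>d. (sector_point has_vector_derivative d) (at \<theta>) \<and> cross (sector_point \<theta>) d = 1"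
proof -
  obtain B where B: "B-lipschitz_on UNIV ray_radius" by (rule ray_radius_lipschitz)
  obtain C where C: "C-lipschitz_on UNIV sector_angle" by (rule sector_angle_lipschitz)
  define a where "a \<theta> = ray_radius (sector_angle \<theta>)" for \<theta>
  have "(B * C)-lipschitz_on UNIV a"
    unfolding a_def by (rule lipschitz_on_compose2[OF C]) (rule lipschitz_on_subset[OF B], simp)
  then obtain g N where gN: "negligible N" "\<And>x. x \<notin> N \<Longrightarrow> (a has_real_derivative g x) (at x)"
    by (rule lipschitz_real_derivative_ae) (rule that; assumption)
  show ?thesis
  proof (rule AE_lborel_if_negligible[OF gN(1)])
    fix \<theta> assume "\<theta> \<notin> N"
    have apos: "a \<theta> > 0" by (simp add: a_def ray_radius_pos)
    let ?t = "sector_angle \<theta>"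
    let ?d = "of_real (a \<theta>) * (1 / (a \<theta>)\<^sup>2) *\<^sub>R (\<i> * cis ?t) + of_real (g \<theta>) * cis ?t"
    have "((\<lambda>\<theta>. cis (sector_angle \<theta>)) has_vector_derivative (1 / (a \<theta>)\<^sup>2) *\<^sub>R (\<i> * cis ?t)) (at \<theta>)"
      using vector_diff_chain_at[OF sector_angle_derivative[unfolded has_real_derivative_iff_has_vector_derivative] has_vector_derivative_cis]
      by (simp add: o_def a_def)
    moreover have "((\<lambda>\<theta>. complex_of_real (a \<theta>)) has_vector_derivative of_real (g \<theta>)) (at \<theta>)"
      by (rule has_vector_derivative_of_real[OF gN(2)[OF \<open>\<theta> \<notin> N\<close>]])
    ultimately have "((\<lambda>\<theta>. of_real (a \<theta>) * cis (sector_angle \<theta>)) has_vector_derivative ?d) (at \<theta>)"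
      by (intro has_vector_derivative_mult)
    moreover have "(\<lambda>\<theta>. of_real (a \<theta>) * cis (sector_angle \<theta>)) = sector_point"
      by (simp add: fun_eq_iff sector_point_def ray_point_def a_def)
    moreover have "cross (sector_point \<theta>) ?d = 1"
    proof -
      have "cross (of_real r * Complex c s) (of_real r * (1 / r\<^sup>2) *\<^sub>R (\<i> * Complex c s) + of_real u * Complex c s)
          = c * c + s * s" if "r > 0" for r u c s :: real
        using that by (simp add: cross_def power2_eq_square field_simps)
      from this[of "a \<theta>" "cos ?t" "sin ?t" "g \<theta>"]
      have "cross (of_real (a \<theta>) * cis ?t) ?d = 1"
        using apos by (simp add: cis.ctr)
      then show ?thesis using apos by (simp add: sector_point_def ray_point_def a_def)
    qed
    ultimately show "\<exists>d. (sector_point has_vector_derivative d) (at \<theta>) \<and> cross (sector_point \<theta>) d = 1"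
      by auto
  qed
qed

end

text \<open>The orientation and the total angle of a closed curve that sweeps area at unit speed both follow from
  Green's formula: the swept area is positive, so that the winding number is \<open>1\<close>.\<close>

lemma unit_sector_speed_path:
  fixes e :: "real \<Rightarrow> complex"
  assumes K: "convex_body K" and T: "T > 0" and lip: "B-lipschitz_on UNIV e"
    and simple: "simple_path (\<lambda>s. e (T * s))" and closed: "e T = e 0"
    and image: "path_image (\<lambda>s. e (T * s)) = frontier K"
    and cr: "AE \<theta> in lborel. \<theta> \<in> {0..T} \<longrightarrow> (\<exists>d. (e has_vector_derivative d) (at \<theta>) \<and> cross (e \<theta>) d = 1)"
  shows "T = 2 * measure lborel K" "positively_oriented (\<lambda>s. e (T * s))"
proof -
  interpret convex_body K by fact
  let ?p = "\<lambda>s. e (T * s)"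
  have lp: "(B * \<bar>T\<bar>)-lipschitz_on {0..1} ?p" by (rule lipschitz_on_scale_arg[OF lip])
  obtain w :: real where w: "w = 1 \<or> w = -1" "\<And>z. z \<in> inside (path_image ?p) \<Longrightarrow> winding_number ?p z = of_real w"
    using simple_closed_lipschitz_orientation[OF simple] by metis
  have cl: "pathfinish ?p = pathstart ?p" using closed by (simp add: pathfinish_def pathstart_def)
  have hi: "((\<lambda>s. cross (?p s) (vector_derivative ?p (at s))) has_integral 2 * w * measure lborel K) {0..1}"
    using integral_cross_eq_area[OF lp cl w(2)] by (simp add: image inside_frontier measure_interior)
  have sc: "AE s in lborel. T * s \<in> {0..T} \<longrightarrow> (\<exists>d. (e has_vector_derivative d) (at (T * s)) \<and> cross (e (T * s)) d = 1)"
    using AE_lborel_affine[OF cr, of T 0] T by simp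
  have "AE s in lborel. s \<in> {0..1} \<longrightarrow> cross (?p s) (vector_derivative ?p (at s)) = T"
    using sc
  proof eventually_elim
    case (elim s)
    show ?case
    proof
      assume "s \<in> {0..1}"
      then have "T * s \<in> {0..T}" using T by (auto simp: mult_left_le)
      with elim obtain d where d: "(e has_vector_derivative d) (at (T * s))" "cross (e (T * s)) d = 1" by auto
      have "((\<lambda>s. T * s) has_vector_derivative T) (at s)"
        by (auto intro!: derivative_eq_intros simp: has_real_derivative_iff_has_vector_derivative[symmetric])
      from vector_diff_chain_at[OF this d(1)] have "vector_derivative ?p (at s) = T *\<^sub>R d"
        by (intro vector_derivative_at) (simp add: o_def)
      then show "cross (?p s) (vector_derivative ?p (at s)) = T" using d(2) by (simp add: cross_def algebra_simps flip: right_diff_distrib)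
    qed
  qed
  from hi[unfolded has_integral_AE[OF this]] have "((\<lambda>s::real. T) has_integral 2 * w * measure lborel K) {0..1}" .
  moreover have "((\<lambda>s. T) has_integral T) {0..1::real}" using has_integral_const_real[of T 0 1] by simp
  ultimately have eq: "T = 2 * w * measure lborel K" by (rule has_integral_unique[symmetric])
  have w1: "w = 1"
  proof (rule ccontr)
    assume "w \<noteq> 1"
    then have "T = - (2 * measure lborel K)" using w(1) eq by simp
    then show False using T measure_nonneg[of lborel K] by linarith
  qed
  then show "T = 2 * measure lborel K" using eq by simp
  show "positively_oriented ?p" using w(2) w1 by (simp add: positively_oriented_def)
qed

lemma is_convex_trig_sector_point:
  assumes "convex_body K"
  shows "is_convex_trig K (convex_body.sector_point K)"
    and "convex_body.sector_area K (2 * pi) = 2 * euclidean_area K"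
proof -
  interpret convex_body K by fact
  let ?T = "sector_area (2 * pi)" and ?e = sector_point
  obtain B where B: "B-lipschitz_on UNIV ?e" by (rule sector_point_lipschitz)
  have T: "?T > 0" by (rule total_sector_area_pos)
  have l: "(B * \<bar>?T\<bar>)-lipschitz_on {0..1} (\<lambda>s. ?e (?T * s))" by (rule lipschitz_on_scale_arg[OF B])
  have img: "(\<lambda>s. ?T * s) ` {0..1} = {0..?T}"
    using T by (simp add: image_mult_atLeastAtMost)
  have pi: "path_image (\<lambda>s. ?e (?T * s)) = frontier K"
    unfolding path_image_def sector_point_image[symmetric] img[symmetric] by (simp add: image_image)
  have sp: "simple_path (\<lambda>s. ?e (?T * s))"
    unfolding simple_path_def loop_free_def
  proof (intro conjI ballI impI)
    show "path (\<lambda>s. ?e (?T * s))" using l by (simp add: path_def lipschitz_on_continuous_on)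
    fix x y :: real assume xy: "x \<in> {0..1}" "y \<in> {0..1}" and eq: "?e (?T * x) = ?e (?T * y)"
    have "?T * x \<in> {0..?T}" "?T * y \<in> {0..?T}" using xy img by blast+
    from sector_point_injective[OF eq this]
    show "x = y \<or> x = 0 \<and> y = 1 \<or> x = 1 \<and> y = 0" using T by auto
  qed
  have closed: "?e ?T = ?e 0" using sector_point_periodic[of 0] by simp
  have ar: "?T = 2 * measure lborel K" "positively_oriented (\<lambda>s. ?e (?T * s))"
  proof -
    have "AE \<theta> in lborel. \<theta> \<in> {0..?T} \<longrightarrow> (\<exists>d. (?e has_vector_derivative d) (at \<theta>) \<and> cross (?e \<theta>) d = 1)"
      using cross_sector_point by eventually_elim blast
    from unit_sector_speed_path[OF assms T B sp closed pi this]
    show "?T = 2 * measure lborel K" "positively_oriented (\<lambda>s. ?e (?T * s))" by blast+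
  qed
  have "Im (?e 0) = 0" "Re (?e 0) > 0"
    using ray_radius_pos[of 0] by (simp_all add: sector_point_def ray_point_def)
  then show "is_convex_trig K ?e"
    unfolding is_convex_trig_def euclidean_area_def ar(1)[symmetric]
    using B sp pi ar(2) sector_point_periodic cross_sector_point by (auto simp: cross_def)
  show "?T = 2 * euclidean_area K" using ar(1) by (simp add: euclidean_area_def)
qed

section \<open>Uniqueness of the trigonometric functions: the polar angle along a boundary
  curve\<close>

context convex_body
begin

text \<open>A ray from 0 meets the boundary once, so a boundary curve is determined by a continuous
  choice of its polar angle, the imaginary part of a logarithm. Both the uniqueness of the
  parametrization and the effect of its orientation are read off from the speed of this
  angle.\<close>

lemma lipschitz_frontier_path_angle:
  fixes p :: "real \<Rightarrow> complex"
  assumes lip: "B-lipschitz_on {a..b} p" and fr: "\<And>t. t \<in> {a..b} \<Longrightarrow> p t \<in> frontier K"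
    and q: "continuous_on {a..b} q" "\<And>t. t \<in> {a..b} \<Longrightarrow> p t = exp (q t)"
    and d: "AE t in lborel. t \<in> {a..b} \<longrightarrow> (p has_vector_derivative d t) (at t)"
  shows "\<And>t. t \<in> {a..b} \<Longrightarrow> p t = ray_point (Im (q t))"
    and "\<exists>C. C-lipschitz_on {a..b} q"
    and "AE t in lborel. t \<in> {a..b} \<longrightarrow> ((\<lambda>t. Im (q t)) has_vector_derivative cross (p t) (d t) / (cmod (p t))\<^sup>2) (at t)"
proof -
  show "p t = ray_point (Im (q t))" if "t \<in> {a..b}" for t
  proof (rule frontier_eq_ray_point[OF fr[OF that]])
    show "p t = of_real (cmod (p t)) * cis (Im (q t))"
      using q(2)[OF that] by (simp add: exp_eq_polar norm_mult)
  qed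
  have "B-lipschitz_on {a..b} (\<lambda>t. exp (q t))"
  proof (rule lipschitz_onI)
    show "dist (exp (q x)) (exp (q y)) \<le> B * dist x y" if "x \<in> {a..b}" "y \<in> {a..b}" for x y
      using lipschitz_onD[OF lip that] q(2) that by simp
  qed (rule lipschitz_on_nonneg[OF lip])
  then obtain C where C: "C-lipschitz_on {a..b} q" using lipschitz_on_log q(1) by blast
  then show "\<exists>C. C-lipschitz_on {a..b} q" by blast
  have "AE t in lborel. t \<in> {a..b} \<longrightarrow> (q has_vector_derivative d t / (p t - 0)) (at t)"
    by (rule has_vector_derivative_log_ae[OF C _ d]) (simp add: q(2))
  then show "AE t in lborel. t \<in> {a..b} \<longrightarrow> ((\<lambda>t. Im (q t)) has_vector_derivative cross (p t) (d t) / (cmod (p t))\<^sup>2) (at t)"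
  proof eventually_elim
    case (elim t)
    have "Im (z / w) = cross w z / (cmod w)\<^sup>2" for z w
      by (simp add: Im_divide cross_def cmod_power2 mult.commute)
    then show ?case using elim has_vector_derivative_Im by fastforce
  qed
qed

text \<open>Positive orientation makes the angle grow by \<open>2 * pi\<close> in total. On a simple
  path the angle is injective, and a continuous injective function with the larger final value
  increases, so its derivative is nonnegative.\<close>

lemma cross_nonneg_if_positively_oriented:
  assumes lip: "B-lipschitz_on {0..1} p" and simple: "simple_path p" and closed: "pathfinish p = pathstart p"
    and image: "path_image p = frontier K" and pos: "positively_oriented p"
    and d: "AE t in lborel. t \<in> {0..1} \<longrightarrow> (p has_vector_derivative d t) (at t)"
  shows "AE t in lborel. t \<in> {0..1} \<longrightarrow> cross (p t) (d t) \<ge> 0"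
proof -
  have path: "path p" using simple by (rule simple_path_imp_path)
  have z0: "0 \<notin> path_image p" using image by (auto simp: frontier_eq_minkowski)
  obtain q where q: "path q" "pathfinish q - pathstart q = 2 * of_real pi * \<i> * winding_number p 0"
     "\<And>t. t \<in> {0..1} \<Longrightarrow> p t = 0 + exp (q t)"
    using winding_number_as_continuous_log[OF path z0] by blast
  have "0 \<in> inside (path_image p)" by (simp add: image inside_frontier zero_in_interior)
  then have "winding_number p 0 = 1" using pos by (simp add: positively_oriented_def)
  then have q01: "Im (q 1) = Im (q 0) + 2 * pi"
    using arg_cong[OF q(2), of Im] by (simp add: pathfinish_def pathstart_def)
  have cont: "continuous_on {0..1} q" using q(1) by (simp add: path_def)
  have fr: "p t \<in> frontier K" if "t \<in> {0..1}" for t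
    using that image by (auto simp: path_image_def)
  note A = lipschitz_frontier_path_angle[OF lip fr cont _ d, simplified]
  have ray: "p t = ray_point (Im (q t))" if "t \<in> {0..1}" for t using A(1) q(3) that by simp
  have inj: "inj_on (\<lambda>t. Im (q t)) {0..1}"
  proof (rule inj_onI)
    fix x y :: real assume xy: "x \<in> {0..1}" "y \<in> {0..1}" "Im (q x) = Im (q y)"
    then have "p x = p y" using ray by simp
    with simple xy have "x = y \<or> x = 0 \<and> y = 1 \<or> x = 1 \<and> y = 0"
      unfolding simple_path_def loop_free_def by blast
    then show "x = y" using xy(3) q01 pi_gt_zero by auto
  qed
  have mono: "Im (q x) \<le> Im (q y)" if "0 \<le> x" "x \<le> y" "y \<le> 1" for x y
    by (rule continuous_injective_increasing[OF _ inj _ that])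
       (use q01 pi_gt_zero in \<open>auto intro!: continuous_intros cont\<close>)
  have "AE t in lborel. t \<in> {0..1} \<longrightarrow> ((\<lambda>t. Im (q t)) has_vector_derivative cross (p t) (d t) / (cmod (p t))\<^sup>2) (at t)"
    using A(3) q(3) by simp
  then show ?thesis
    using AE_lborel_singleton[of 0] AE_lborel_singleton[of 1]
  proof eventually_elim
    case (elim t)
    show ?case
    proof
      assume t: "t \<in> {0..1}"
      then have t': "t \<in> {0<..<1}" using elim by auto
      have "((\<lambda>t. Im (q t)) has_real_derivative cross (p t) (d t) / (cmod (p t))\<^sup>2) (at t)"
        using elim t by (simp add: has_real_derivative_iff_has_vector_derivative)
      then have "cross (p t) (d t) / (cmod (p t))\<^sup>2 \<ge> 0"
        by (rule mono_on_imp_deriv_nonneg[where A = "{0..1}", rotated])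
           (use mono t' in \<open>auto simp: mono_on_def interior_atLeastAtMost_real\<close>)
      moreover have "cmod (p t) > 0" using z0 t by (auto simp: path_image_def)
      ultimately show "cross (p t) (d t) \<ge> 0" by (simp add: zero_le_divide_iff)
    qed
  qed
qed

text \<open>The swept area \<open>sector_area (Im (q t))\<close> has derivative 1 almost everywhere,
  hence grows exactly like the parameter; the starting point on the positive first axis fixes it up
  to full turns.\<close>

lemma convex_trig_unique:
  assumes e: "is_convex_trig K e"
  shows "e = sector_point"
proof
  fix \<theta> :: real
  \<comment> \<open>A bounded window containing both 0 and \<theta>, on which the logarithm of the
    curve is Lipschitz.\<close>
  define N where "N = \<bar>\<theta>\<bar> + 1"
  obtain B where B: "B-lipschitz_on UNIV e" using e by (auto simp: is_convex_trig_def)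
  let ?T = "2 * euclidean_area K"
  have T: "?T > 0"
    using is_convex_trig_sector_point(2)[OF convex_body_axioms] total_sector_area_pos by simp
  have per: "e (t + ?T) = e t" for t using e by (simp add: is_convex_trig_def)
  have fr: "e t \<in> frontier K" for t
  proof -
    define s where "s = frac (t / ?T)"
    have "?T * s + of_int \<lfloor>t / ?T\<rfloor> * ?T = t"
      using T by (simp add: s_def frac_def field_simps)
    then have "e (?T * s) = e t"
      using periodic_int[of e ?T "?T * s" "\<lfloor>t / ?T\<rfloor>", OF per] by simp
    moreover have "e (?T * s) \<in> path_image (\<lambda>s. e (?T * s))"
      using frac_ge_0[of "t / ?T"] frac_lt_1[of "t / ?T"] by (auto simp: path_image_def s_def)
    ultimately show ?thesis using e by (simp add: is_convex_trig_def)
  qed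
  have nz: "e t \<noteq> 0" for t using fr[of t] by (auto simp: frontier_eq_minkowski)
  have "continuous_on UNIV e" using B by (rule lipschitz_on_continuous_on)
  then obtain q where q: "continuous_on UNIV q" "\<And>t. e t = exp (q t)"
    using continuous_logarithm_on_contractible[of UNIV e] nz by auto
  have "AE t in lborel. t \<in> {-N..N} \<longrightarrow> (e has_vector_derivative vector_derivative e (at t)) (at t)"
    by (rule lipschitz_ae_vector_derivative(1)[OF lipschitz_on_subset[OF B]]) simp
  note A = lipschitz_frontier_path_angle[OF lipschitz_on_subset[OF B] fr continuous_on_subset[OF q(1)] q(2) this, simplified]
  have ray: "e t = ray_point (Im (q t))" if "t \<in> {-N..N}" for t using A(1) that by simp
  obtain C where C: "C-lipschitz_on {-N..N} q" using A(2) by auto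
  obtain D where D: "D-lipschitz_on UNIV sector_area" by (rule sector_area_lipschitz)
  let ?\<tau> = "\<lambda>t. sector_area (Im (q t))"
  have lt: "(D * C)-lipschitz_on {-N..N} ?\<tau>"
    by (rule lipschitz_on_compose2[OF lipschitz_on_Im[OF C]]) (rule lipschitz_on_subset[OF D], simp)
  have ae: "AE t in lborel. t \<in> {-N..N} \<longrightarrow> (?\<tau> has_vector_derivative 1) (at t)"
  proof -
    have "AE t in lborel. \<exists>d. (e has_vector_derivative d) (at t) \<and> cross (e t) d = 1"
      using e by (simp add: is_convex_trig_def cross_def)
    then show ?thesis using A(3)
    proof eventually_elim
      case (elim t)
      show ?case
      proof
        assume t: "t \<in> {-N..N}"
        obtain d where "(e has_vector_derivative d) (at t)" "cross (e t) d = 1" using elim by auto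
        then have "cross (e t) (vector_derivative e (at t)) = 1" by (simp add: vector_derivative_at)
        then have "((\<lambda>t. Im (q t)) has_vector_derivative 1 / (cmod (e t))\<^sup>2) (at t)" using elim t by simp
        moreover have "cmod (e t) = ray_radius (Im (q t))" using ray[OF t] norm_ray_point by simp
        ultimately have "((\<lambda>t. Im (q t)) has_vector_derivative 1 / (ray_radius (Im (q t)))\<^sup>2) (at t)" by simp
        from vector_diff_chain_at[OF this sector_area(2)[unfolded has_real_derivative_iff_has_vector_derivative]]
        show "(?\<tau> has_vector_derivative 1) (at t)" using ray_radius_pos[of "Im (q t)"] by (simp add: o_def)
      qed
    qed
  qed
  have \<tau>: "?\<tau> v - ?\<tau> u = v - u" if "-N \<le> u" "u \<le> v" "v \<le> N" for u v
  proof -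
    have "((\<lambda>_. 1) has_integral (?\<tau> v - ?\<tau> u)) {u..v}"
      using ae that by (intro lipschitz_has_integral_derivative[OF lipschitz_on_subset[OF lt]]) (auto elim: eventually_mono)
    moreover have "((\<lambda>_. 1::real) has_integral (v - u)) {u..v}" using that has_integral_const_real[of "1::real" u v] by simp
    ultimately show ?thesis by (rule has_integral_unique)
  qed
  have N: "\<theta> \<in> {-N..N}" "0 \<in> {-N..N}" by (auto simp: N_def)
  have \<tau>\<theta>: "?\<tau> \<theta> = ?\<tau> 0 + \<theta>"
    using \<tau>[of 0 \<theta>] \<tau>[of \<theta> 0] N by (cases "0 \<le> \<theta>") auto
  have "Im (e 0) = 0" "Re (e 0) > 0" using e by (simp_all add: is_convex_trig_def)
  then have "e 0 = of_real (cmod (e 0)) * cis 0"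
    by (simp add: complex_eq_iff cmod_eq_Re)
  then have "ray_point (Im (q 0)) = ray_point 0"
    using frontier_eq_ray_point[OF fr] ray N by metis
  then obtain n :: int where n: "Im (q 0) = 2 * pi * n" using ray_point_eq_iff by auto
  \<comment> \<open>The starting angle consists of \<open>n\<close> full turns, \<open>n\<close>
    possibly negative. Subtracting the mean growth leaves a periodic function \<open>f\<close>,
    through which the turns are removed.\<close>
  define b where "b = Im (q \<theta>) - 2 * pi * n"
  define f where "f \<phi> = sector_area \<phi> - \<phi> * sector_area (2 * pi) / (2 * pi)" for \<phi>
  have "f (\<phi> + 2 * pi) = f \<phi>" for \<phi>
    unfolding f_def sector_area_periodic by (simp add: field_simps)
  from periodic_int[of f "2 * pi" b n, OF this] periodic_int[of f "2 * pi" 0 n, OF this]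
  have "f (b + of_int n * (2 * pi)) = f b" "f (0 + of_int n * (2 * pi)) = f 0" by blast+
  then have "sector_area (b + of_int n * (2 * pi)) - sector_area (of_int n * (2 * pi)) = sector_area b"
  proof -
    have "(x + of_int n * (2 * pi)) * U / (2 * pi) = x * U / (2 * pi) + of_int n * U" for x U :: real
      by (simp add: field_simps)
    then show ?thesis
      using \<open>f (b + of_int n * (2 * pi)) = f b\<close> \<open>f (0 + of_int n * (2 * pi)) = f 0\<close>
      unfolding f_def by (simp only:) (simp add: sector_area(1))
  qed
  then have "sector_area b = \<theta>"
    using \<tau>\<theta> n by (simp add: b_def algebra_simps)
  then have "sector_angle \<theta> = b" using sector_angle_area by metis
  moreover have "ray_point (Im (q \<theta>)) = ray_point b"
    unfolding ray_point_eq_iff b_def by (intro exI[of _ n]) simp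
  moreover have "e \<theta> = ray_point (Im (q \<theta>))" using ray N by simp
  ultimately show "e \<theta> = sector_point \<theta>" by (simp add: sector_point_def)
qed

theorem is_convex_trig_convex_trig: "is_convex_trig K (convex_trig K)"
  unfolding convex_trig_def
  by (rule theI[of "is_convex_trig K" sector_point])
     (rule is_convex_trig_sector_point(1)[OF convex_body_axioms], rule convex_trig_unique)

end

lemma has_integral_nonneg_zero_AE:
  fixes f :: "'a::euclidean_space \<Rightarrow> real"
  assumes hi: "(f has_integral 0) S" and nn: "AE x in lborel. x \<in> S \<longrightarrow> f x \<ge> 0"
  shows "AE x in lborel. x \<in> S \<longrightarrow> f x = 0"
proof -
  let ?g = "\<lambda>x. max 0 (f x)"
  have "AE x in lborel. x \<in> S \<longrightarrow> ?g x = f x"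
    using nn by eventually_elim auto
  then have g: "(?g has_integral 0) S" using hi by (subst has_integral_AE)
  then have m: "(\<lambda>x. indicator S x *\<^sub>R ?g x) \<in> lebesgue \<rightarrow>\<^sub>M borel"
    by (rule has_integral_implies_lebesgue_measurable)
  have "integral\<^sup>N lborel (\<lambda>x. indicator S x * ?g x) = ennreal 0"
    by (rule nn_integral_has_integral_lebesgue[OF _ g]) simp
  then have "integral\<^sup>N lebesgue (\<lambda>x. ennreal (indicator S x * ?g x)) = 0"
    by (simp add: nn_integral_completion)
  then have "AE x in lebesgue. ennreal (indicator S x * ?g x) = 0"
    by (subst (asm) nn_integral_0_iff_AE) (use m in simp_all)
  then have "AE x in lborel. ennreal (indicator S x * ?g x) = 0"
    by (simp only: AE_completion_iff)
  then show ?thesis using nn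
    by eventually_elim (auto simp: indicator_def)
qed

subsection \<open>Vertical fibres of a planar convex body\<close>

definition upper_fibre :: "complex set \<Rightarrow> real \<Rightarrow> real" where
  "upper_fibre K s = Sup {v. Complex s v \<in> K}"

text \<open>Defined through complex conjugation, so that the results on \<open>upper_fibre\<close>
  carry over by reflection.\<close>

definition lower_fibre :: "complex set \<Rightarrow> real \<Rightarrow> real" where
  "lower_fibre K s = - upper_fibre (cnj ` K) s"

lemma compact_attains_upper_fibre:
  assumes K: "compact K" and s: "s \<in> Re ` K"
  shows "Complex s (upper_fibre K s) \<in> K" "\<And>v. Complex s v \<in> K \<Longrightarrow> v \<le> upper_fibre K s"
proof -
  let ?V = "{v. Complex s v \<in> K}"
  have V: "?V = Im ` (K \<inter> {p. Re p = s})" by (force simp: image_iff complex_eq_iff)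
  have "compact ?V" unfolding V
    by (intro compact_continuous_image compact_Int_closed K closed_Collect_eq continuous_intros)
  moreover have "?V \<noteq> {}" unfolding V using s by auto
  ultimately obtain v where v: "v \<in> ?V" "\<And>u. u \<in> ?V \<Longrightarrow> u \<le> v"
    using compact_attains_sup[of ?V] by auto
  have "upper_fibre K s = v" unfolding upper_fibre_def using v by (intro cSup_eq_maximum) auto
  with v show "Complex s (upper_fibre K s) \<in> K" "\<And>v. Complex s v \<in> K \<Longrightarrow> v \<le> upper_fibre K s" by auto
qed

lemma compact_attains_lower_fibre:
  assumes K: "compact K" and s: "s \<in> Re ` K"
  shows "Complex s (lower_fibre K s) \<in> K" "\<And>v. Complex s v \<in> K \<Longrightarrow> lower_fibre K s \<le> v"
proof -
  have K': "compact (cnj ` K)" by (intro compact_continuous_image K continuous_intros)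
  have s': "s \<in> Re ` cnj ` K" using s by (auto simp: image_iff)
  have mem: "Complex s v \<in> cnj ` K \<longleftrightarrow> Complex s (- v) \<in> K" for v
    by (auto simp: image_iff complex_eq_iff intro!: bexI[of _ "Complex s (- v)"])
  show "Complex s (lower_fibre K s) \<in> K" using compact_attains_upper_fibre(1)[OF K' s'] mem by (simp add: lower_fibre_def)
  show "lower_fibre K s \<le> v" if "Complex s v \<in> K" for v
    using compact_attains_upper_fibre(2)[OF K' s', of "- v"] mem[of "- v"] that by (simp add: lower_fibre_def)
qed

lemma upper_fibre_concave:
  assumes K: "compact K" "convex K" and s: "s \<in> Re ` K" "u \<in> Re ` K" and \<theta>: "0 \<le> \<theta>" "\<theta> \<le> 1"
  shows "(1 - \<theta>) * s + \<theta> * u \<in> Re ` K"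
    "(1 - \<theta>) * upper_fibre K s + \<theta> * upper_fibre K u \<le> upper_fibre K ((1 - \<theta>) * s + \<theta> * u)"
proof -
  have "(1 - \<theta>) *\<^sub>R Complex s (upper_fibre K s) + \<theta> *\<^sub>R Complex u (upper_fibre K u) \<in> K"
    using \<theta> by (intro convexD[OF K(2)] compact_attains_upper_fibre(1)[OF K(1)] s) auto
  moreover have "(1 - \<theta>) *\<^sub>R Complex s (upper_fibre K s) + \<theta> *\<^sub>R Complex u (upper_fibre K u)
     = Complex ((1 - \<theta>) * s + \<theta> * u) ((1 - \<theta>) * upper_fibre K s + \<theta> * upper_fibre K u)"
    by (simp add: complex_eq_iff)
  ultimately have m: "Complex ((1 - \<theta>) * s + \<theta> * u) ((1 - \<theta>) * upper_fibre K s + \<theta> * upper_fibre K u) \<in> K" by simp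
  then show 1: "(1 - \<theta>) * s + \<theta> * u \<in> Re ` K" by (metis complex.sel(1) imageI)
  show "(1 - \<theta>) * upper_fibre K s + \<theta> * upper_fibre K u \<le> upper_fibre K ((1 - \<theta>) * s + \<theta> * u)"
    by (rule compact_attains_upper_fibre(2)[OF K(1) 1 m])
qed

text \<open>Lower semicontinuity is the one-sided chord bound of a concave function, upper semicontinuity comes from compactness.\<close>

lemma upper_fibre_continuous:
  assumes K: "compact K" "convex K" and I: "Re ` K = {l..r}"
  shows "continuous_on {l..r} (upper_fibre K)"
  unfolding continuous_on
proof (rule ballI, rule order_tendstoI)
  let ?a = "upper_fibre K"
  fix x assume x: "x \<in> {l..r}"
  show "eventually (\<lambda>u. c < ?a u) (at x within {l..r})" if c: "c < ?a x" for c
  proof -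
    define g where "g u = ?a x - \<bar>?a r - ?a x\<bar> * ((u - x) / (r - x)) - \<bar>?a l - ?a x\<bar> * ((x - u) / (x - l))" for u
    \<comment> \<open>Concavity along the chord from \<open>x\<close> to \<open>z\<close>, later an
      end point of the interval, bounds the fall of the fibre by a linear function of the way
      covered.\<close>
    have below: "?a x - \<bar>?a z - ?a x\<bar> * \<theta> \<le> ?a ((1 - \<theta>) * x + \<theta> * z)" if "0 \<le> \<theta>" "\<theta> \<le> 1" "z \<in> {l..r}" for z \<theta>
    proof -
      have "?a x - \<bar>?a z - ?a x\<bar> * \<theta> \<le> (1 - \<theta>) * ?a x + \<theta> * ?a z"
        using mult_right_mono[of "- \<bar>?a z - ?a x\<bar>" "?a z - ?a x" \<theta>] that by (simp add: algebra_simps)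
      also have "\<dots> \<le> ?a ((1 - \<theta>) * x + \<theta> * z)"
        using x that I by (intro upper_fibre_concave K) auto
      finally show ?thesis .
    qed
    have "(\<lambda>u. ?a x - \<bar>?a r - ?a x\<bar> * (\<bar>u - x\<bar> / (r - x)) - \<bar>?a l - ?a x\<bar> * (\<bar>x - u\<bar> / (x - l))) \<midarrow>x\<rightarrow>
       ?a x - \<bar>?a r - ?a x\<bar> * (\<bar>x - x\<bar> / (r - x)) - \<bar>?a l - ?a x\<bar> * (\<bar>x - x\<bar> / (x - l))"
      unfolding divide_inverse by (intro tendsto_intros)
    then have "(\<lambda>u. ?a x - \<bar>?a r - ?a x\<bar> * (\<bar>u - x\<bar> / (r - x)) - \<bar>?a l - ?a x\<bar> * (\<bar>x - u\<bar> / (x - l))) \<midarrow>x\<rightarrow> ?a x" by simp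
    then have "((\<lambda>u. ?a x - \<bar>?a r - ?a x\<bar> * (\<bar>u - x\<bar> / (r - x)) - \<bar>?a l - ?a x\<bar> * (\<bar>x - u\<bar> / (x - l))) \<longlongrightarrow> ?a x) (at x within {l..r})"
      by (rule tendsto_within_subset) simp
    then have "eventually (\<lambda>u. c < ?a x - \<bar>?a r - ?a x\<bar> * (\<bar>u - x\<bar> / (r - x)) - \<bar>?a l - ?a x\<bar> * (\<bar>x - u\<bar> / (x - l))) (at x within {l..r})"
      using c by (rule order_tendstoD)
    moreover have "eventually (\<lambda>u. u \<in> {l..r}) (at x within {l..r})"
      by (auto simp: eventually_at_filter)
    ultimately show ?thesis
    proof eventually_elim
      case (elim u)
      have nn: "\<bar>?a r - ?a x\<bar> * (\<bar>u - x\<bar> / (r - x)) \<ge> 0" "\<bar>?a l - ?a x\<bar> * (\<bar>x - u\<bar> / (x - l)) \<ge> 0"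
        using x by auto
      consider "u = x" | "u > x" | "u < x" by linarith
      then show ?case
      proof cases
        case 2
        then have rx: "r > x" using elim(2) by auto
        have "(1 - (u - x) / (r - x)) * x + (u - x) / (r - x) * r = x + (u - x) / (r - x) * (r - x)"
          by (simp only: algebra_simps)
        then have "(1 - (u - x) / (r - x)) * x + (u - x) / (r - x) * r = u"
          using rx by simp
        then have "?a x - \<bar>?a r - ?a x\<bar> * (\<bar>u - x\<bar> / (r - x)) \<le> ?a u"
          using below[of "(u - x) / (r - x)" r] 2 rx elim(2) x by (simp add: abs_of_pos)
        then show ?thesis using elim(1) nn by linarith
      next
        case 3
        then have rx: "x > l" using elim(2) by auto
        have "(1 - (x - u) / (x - l)) * x + (x - u) / (x - l) * l = x - (x - u) / (x - l) * (x - l)"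
          by (simp only: algebra_simps)
        then have "(1 - (x - u) / (x - l)) * x + (x - u) / (x - l) * l = u"
          using rx by simp
        then have "?a x - \<bar>?a l - ?a x\<bar> * (\<bar>x - u\<bar> / (x - l)) \<le> ?a u"
          using below[of "(x - u) / (x - l)" l] 3 rx elim(2) x by (simp add: abs_of_pos)
        then show ?thesis using elim(1) nn by linarith
      qed (use c in simp)
    qed
  qed
  show "eventually (\<lambda>u. ?a u < c) (at x within {l..r})" if c: "?a x < c" for c
  proof -
    \<comment> \<open>The part of \<open>K\<close> at height at least \<open>c\<close> is compact,
      so its projection is closed; it misses \<open>x\<close>, hence a neighbourhood of
      \<open>x\<close>.\<close>
    let ?P = "Re ` (K \<inter> {p. Im p \<ge> c})"
    have "compact ?P"
      by (intro compact_continuous_image compact_Int_closed K closed_Collect_le continuous_intros)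
    then have "open (- ?P)" by (simp add: compact_imp_closed open_Compl)
    moreover have "x \<notin> ?P"
    proof
      assume "x \<in> ?P"
      then obtain p where p: "p \<in> K" "Im p \<ge> c" "Re p = x" by auto
      then have "Im p \<le> ?a x" using compact_attains_upper_fibre(2)[OF K(1), of x "Im p"] by (auto simp: complex.collapse)
      with p c show False by simp
    qed
    ultimately have "eventually (\<lambda>u. u \<in> - ?P) (at x within {l..r})"
      by (intro topological_tendstoD[OF tendsto_ident_at]) auto
    moreover have "eventually (\<lambda>u. u \<in> {l..r}) (at x within {l..r})"
      by (auto simp: eventually_at_filter)
    ultimately show ?thesis
    proof eventually_elim
      case (elim u)
      have "Complex u (?a u) \<in> K" using compact_attains_upper_fibre(1)[OF K(1)] elim I by auto
      with elim(1) show "?a u < c" by (force simp: image_iff not_le)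
    qed
  qed
qed

lemma cnj_image_convex_compact:
  assumes "compact K" "convex K"
  shows "compact (cnj ` K)" "convex (cnj ` K)" "Re ` cnj ` K = Re ` K"
  using assms
  by (auto intro!: compact_continuous_image continuous_intros convex_linear_image
      simp: bounded_linear.linear[OF bounded_linear_cnj] image_image)

lemma lower_fibre_continuous:
  assumes K: "compact K" "convex K" and I: "Re ` K = {l..r}"
  shows "continuous_on {l..r} (lower_fibre K)"
  unfolding lower_fibre_def[abs_def]
  using cnj_image_convex_compact[OF K] I
  by (intro continuous_on_minus upper_fibre_continuous) auto

text \<open>Slopes of a concave function on \<open>{s..u}\<close> lie between those of chords that
  reach out to \<open>l\<close> and to \<open>r\<close>, which are bounded by twice the maximum over
  the margins \<open>s - l\<close> and \<open>r - u\<close>. At \<open>l\<close> and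
  \<open>r\<close> themselves the slope may be infinite, as for a disk.\<close>

lemma upper_fibre_lipschitz_inside:
  assumes K: "compact K" "convex K" and I: "Re ` K = {l..r}" and su: "l < s" "u < r"
  shows "\<exists>C. C-lipschitz_on {s..u} (upper_fibre K)"
proof -
  let ?a = "upper_fibre K"
  have conc: "convex_on {l..r} (\<lambda>x. - ?a x)"
  proof (rule convex_onI)
    show "convex {l..r}" by simp
    fix t x y :: real assume "0 < t" "t < 1" "x \<in> {l..r}" "y \<in> {l..r}"
    then show "- ?a ((1 - t) *\<^sub>R x + t *\<^sub>R y) \<le> (1 - t) * (- ?a x) + t * (- ?a y)"
      using upper_fibre_concave(2)[OF K, of x y t] I by simp
  qed
  have "bounded (?a ` {l..r})"
    by (intro compact_imp_bounded compact_continuous_image upper_fibre_continuous[OF K I]) simp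
  then obtain Q where Q: "\<forall>x\<in>{l..r}. \<bar>?a x\<bar> \<le> Q" by (auto simp: bounded_iff)
  define C where "C = \<bar>2 * Q / (s - l)\<bar> + \<bar>2 * Q / (r - u)\<bar>"
  have key: "\<bar>?a y - ?a x\<bar> \<le> C * (y - x)" if xy: "s \<le> x" "x < y" "y \<le> u" for x y
  proof -
    have dQ: "?a x - ?a z \<le> 2 * Q" if "x \<in> {l..r}" "z \<in> {l..r}" for x z
      using bspec[OF Q that(1)] bspec[OF Q that(2)] by linarith
    have Q0: "Q \<ge> 0" using bspec[OF Q, of x] xy su by auto
    have lr: "l \<le> x" "x \<le> r" "l \<le> y" "y \<le> r" "l \<in> {l..r}" "r \<in> {l..r}" using xy su by auto
    have 1: "(- ?a l - (- ?a x)) / (l - x) \<le> (- ?a x - (- ?a y)) / (x - y)"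
      using convex_on_slope_le(1)[OF conc, of l y x] convex_on_slope_le(2)[OF conc, of l y x] xy su lr by fastforce
    have 2: "(- ?a x - (- ?a y)) / (x - y) \<le> (- ?a y - (- ?a r)) / (y - r)"
      using convex_on_slope_le(1)[OF conc, of x r y] convex_on_slope_le(2)[OF conc, of x r y] xy su lr by fastforce
    have "(- ?a l - (- ?a x)) / (l - x) = - ((?a x - ?a l) / (x - l)) "
      using xy su by (simp add: field_simps)
    moreover have "(?a x - ?a l) / (x - l) \<le> 2 * Q / (s - l)"
      by (rule frac_le) (use dQ[of x l] lr xy su Q0 in auto)
    moreover have "2 * Q / (s - l) \<le> C" unfolding C_def by linarith
    ultimately have L: "- C \<le> (?a y - ?a x) / (x - y)" using 1 by simp
    have "(- ?a y - (- ?a r)) / (y - r) = (?a y - ?a r) / (r - y)"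
      using xy su by (simp add: field_simps)
    moreover have "(?a y - ?a r) / (r - y) \<le> 2 * Q / (r - u)"
      by (rule frac_le) (use dQ[of y r] lr xy su Q0 in auto)
    moreover have "2 * Q / (r - u) \<le> C" unfolding C_def by linarith
    ultimately have U: "(?a y - ?a x) / (x - y) \<le> C" using 2 by simp
    have "\<bar>(?a y - ?a x) / (x - y)\<bar> \<le> C" using L U by linarith
    then show ?thesis using xy by (simp add: abs_divide field_simps)
  qed
  have "C-lipschitz_on {s..u} ?a"
  proof (rule lipschitz_onI)
    fix x y assume "x \<in> {s..u}" "y \<in> {s..u}"
    then show "dist (?a x) (?a y) \<le> C * dist x y"
      using key[of x y] key[of y x]
      by (cases x y rule: linorder_cases) (auto simp: dist_real_def abs_minus_commute)
  qed (simp add: C_def)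
  then show ?thesis by blast
qed

lemma lower_fibre_lipschitz_inside:
  assumes K: "compact K" "convex K" and I: "Re ` K = {l..r}" and su: "l < s" "u < r"
  shows "\<exists>C. C-lipschitz_on {s..u} (lower_fibre K)"
  unfolding lower_fibre_def[abs_def] lipschitz_on_minus_iff
  using cnj_image_convex_compact[OF K] I su by (intro upper_fibre_lipschitz_inside) auto

text \<open>Fubini: the vertical fibres of a convex compact set are segments, so a weight depending
  on the abscissa alone is integrated against the fibre length.\<close>

lemma integral_fibre:
  fixes k :: "real \<Rightarrow> real"
  assumes K: "compact K" "convex K" and I: "Re ` K = {l..r}" and k: "continuous_on {l..r} k"
  shows "set_integrable lborel K (\<lambda>p. k (Re p))"
    and "((\<lambda>s. (upper_fibre K s - lower_fibre K s) * k s) has_integral integral K (\<lambda>p. k (Re p))) {l..r}"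
proof -
  define k0 where "k0 s = indicator {l..r} s * k s" for s
  have k0m[measurable]: "k0 \<in> borel_measurable borel"
    using borel_measurable_continuous_on_indicator[OF _ k] by (simp add: k0_def[abs_def])
  have "bounded (k ` {l..r})" by (intro compact_imp_bounded compact_continuous_image k) simp
  then obtain Q where "\<forall>x\<in>{l..r}. \<bar>k x\<bar> \<le> Q" by (auto simp: bounded_iff)
  then have Q: "\<bar>k0 x\<bar> \<le> max 0 Q" for x by (force simp: k0_def indicator_def)
  have Km[measurable]: "K \<in> sets borel" using K by (simp add: compact_imp_closed borel_closed)
  have int: "integrable lborel (\<lambda>p. indicator K p *\<^sub>R k0 (Re p))"
  proof (rule integrableI_bounded_set_indicator)
    show "emeasure lborel K < \<infinity>" using K by (intro emeasure_bounded_finite compact_imp_bounded)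
  qed (use Q in auto)
  have eq: "(\<lambda>p. indicator K p *\<^sub>R k0 (Re p)) = (\<lambda>p. indicator K p *\<^sub>R k (Re p))"
    using I by (auto simp: fun_eq_iff indicator_def k0_def)
  show setint: "set_integrable lborel K (\<lambda>p. k (Re p))"
    using int unfolding eq set_integrable_def .
  let ?f = "\<lambda>p. indicator K (Complex (fst p) (snd p)) *\<^sub>R k0 (fst p)"
  have fm: "(\<lambda>p. indicator K p *\<^sub>R k0 (Re p)) \<in> borel_measurable borel" by measurable
  have int': "integrable (lborel \<Otimes>\<^sub>M lborel) (case_prod (\<lambda>s v. indicator K (Complex s v) *\<^sub>R k0 s))"
    using int integral_complex_eq_integral_prod(2)[OF fm] by (simp add: lborel_prod case_prod_beta')
  have inner: "(\<integral>v. indicator K (Complex s v) *\<^sub>R k0 s \<partial>lborel) = indicator {l..r} s *\<^sub>R ((upper_fibre K s - lower_fibre K s) * k s)" for s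
  proof (cases "s \<in> {l..r}")
    case True
    then have s: "s \<in> Re ` K" using I by simp
    note up = compact_attains_upper_fibre[OF K(1) s] and lo = compact_attains_lower_fibre[OF K(1) s]
    have le: "lower_fibre K s \<le> upper_fibre K s" using up(2)[OF lo(1)] .
    have mem: "Complex s v \<in> K \<longleftrightarrow> v \<in> {lower_fibre K s..upper_fibre K s}" for v
    proof
      assume v: "v \<in> {lower_fibre K s..upper_fibre K s}"
      show "Complex s v \<in> K"
      proof (cases "lower_fibre K s = upper_fibre K s")
        case False
        define \<theta> where "\<theta> = (v - lower_fibre K s) / (upper_fibre K s - lower_fibre K s)"
        have \<theta>: "0 \<le> \<theta>" "\<theta> \<le> 1" using v False le by (auto simp: \<theta>_def field_simps)
        have "(1 - \<theta>) *\<^sub>R Complex s (lower_fibre K s) + \<theta> *\<^sub>R Complex s (upper_fibre K s) \<in> K"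
          using \<theta> by (intro convexD[OF K(2)] up lo) auto
        moreover have "\<theta> * (upper_fibre K s - lower_fibre K s) = v - lower_fibre K s"
          using False by (simp add: \<theta>_def)
        then have "(1 - \<theta>) * lower_fibre K s + \<theta> * upper_fibre K s = v"
          by (simp add: algebra_simps)
        then have "(1 - \<theta>) *\<^sub>R Complex s (lower_fibre K s) + \<theta> *\<^sub>R Complex s (upper_fibre K s) = Complex s v"
          by (simp add: complex_eq_iff algebra_simps)
        ultimately show ?thesis by simp
      qed (use v up in auto)
    qed (use up lo in auto)
    have "(\<integral>v. indicator K (Complex s v) *\<^sub>R k0 s \<partial>lborel) = (\<integral>v. indicator {lower_fibre K s..upper_fibre K s} v *\<^sub>R k0 s \<partial>lborel)"
      by (intro Bochner_Integration.integral_cong) (auto simp: mem indicator_def)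
    also have "\<dots> = measure lborel {lower_fibre K s..upper_fibre K s} *\<^sub>R k0 s"
      by (subst integral_scaleR_left) (auto intro!: integrable_real_indicator simp: emeasure_lborel_Icc_eq)
    also have "\<dots> = indicator {l..r} s *\<^sub>R ((upper_fibre K s - lower_fibre K s) * k s)"
      using True le by (simp add: k0_def measure_lborel_Icc)
    finally show ?thesis .
  qed (simp add: k0_def)
  have "(\<integral>s. (\<integral>v. indicator K (Complex s v) *\<^sub>R k0 s \<partial>lborel) \<partial>lborel) = (\<integral>p. ?f p \<partial>lborel)"
    using lborel_pair.integral_fst[OF int'] by (simp add: lborel_prod case_prod_beta')
  also have "\<dots> = integral\<^sup>L lborel (\<lambda>p. indicator K p *\<^sub>R k0 (Re p))"
    using integral_complex_eq_integral_prod(1)[OF fm] by simp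
  also have "\<dots> = integral K (\<lambda>p. k (Re p))"
    unfolding eq using set_borel_integral_eq_integral(2)[OF setint] by (simp add: set_lebesgue_integral_def)
  finally have val: "(\<integral>s. indicator {l..r} s *\<^sub>R ((upper_fibre K s - lower_fibre K s) * k s) \<partial>lborel) = integral K (\<lambda>p. k (Re p))"
    unfolding inner .
  have "continuous_on {l..r} (\<lambda>s. (upper_fibre K s - lower_fibre K s) * k s)"
    by (intro continuous_intros upper_fibre_continuous[OF K I] lower_fibre_continuous[OF K I] k)
  then have si: "set_integrable lborel {l..r} (\<lambda>s. (upper_fibre K s - lower_fibre K s) * k s)"
    by (rule borel_integrable_atLeastAtMost')
  show "((\<lambda>s. (upper_fibre K s - lower_fibre K s) * k s) has_integral integral K (\<lambda>p. k (Re p))) {l..r}"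
    using set_borel_integral_eq_integral[OF si] val by (simp add: set_lebesgue_integral_def has_integral_iff)
qed

subsection \<open>Extremal contours\<close>

text \<open>\<open>placed R c\<close> is the quarter turn by \<open>- pi / 2\<close> followed by a dilation and a translation.\<close>

definition placed :: "real \<Rightarrow> complex \<Rightarrow> complex \<Rightarrow> complex" where
  "placed R c p = - \<i> * of_real R * p + c"

lemma Re_placed [simp]: "Re (placed R c p) = R * Im p + Re c"
  and Im_placed [simp]: "Im (placed R c p) = Im c - R * Re p"
  by (simp_all add: placed_def)

lemma placed_eq_iff: "R > 0 \<Longrightarrow> placed R c p = placed R c q \<longleftrightarrow> p = q"
  by (simp add: placed_def)

lemma inj_placed: "R > 0 \<Longrightarrow> inj (placed R c)"
  by (simp add: inj_def placed_eq_iff)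

lemma placed_inverse: "R > 0 \<Longrightarrow> placed R c (\<i> * (z - c) / of_real R) = z"
  by (simp add: placed_def)

lemma continuous_placed [continuous_intros]: "continuous_on S f \<Longrightarrow> continuous_on S (\<lambda>x. placed R c (f x))"
  unfolding placed_def by (intro continuous_intros)

lemma linear_turn: "linear (\<lambda>z::complex. - \<i> * of_real R * z)"
  by (rule bounded_linear.linear[OF bounded_linear_mult_right])

lemma inj_turn: "R > 0 \<Longrightarrow> inj (\<lambda>z::complex. - \<i> * of_real R * z)"
  by (simp add: inj_def)

lemma dist_placed: "R > 0 \<Longrightarrow> dist (placed R c p) (placed R c q) = R * dist p q"
proof -
  assume "R > 0"
  have "placed R c p - placed R c q = - \<i> * of_real R * (p - q)"
    by (simp add: placed_def algebra_simps)
  then show ?thesis using \<open>R > 0\<close> by (simp add: dist_norm norm_mult)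
qed

lemma interior_placed:
  assumes "R > 0" shows "interior (placed R c ` S) = placed R c ` interior S"
proof -
  let ?lin = "\<lambda>z::complex. - \<i> * of_real R * z"
  have eq: "placed R c ` A = (\<lambda>x. c + x) ` ?lin ` A" for A
    by (simp add: image_image placed_def add.commute)
  have "surj ?lin"
    by (rule surjI[of _ "\<lambda>z. \<i> * z / of_real R"]) (use assms in simp)
  then have "interior (?lin ` S) = ?lin ` interior S"
    using interior_bijective_linear_image[OF linear_turn, of R S] inj_turn[OF assms] by (simp add: bij_def)
  then show ?thesis unfolding eq interior_translation by simp
qed

lemma convex_placed: "convex S \<Longrightarrow> convex (placed R c ` S)"
proof -
  assume "convex S"
  then have "convex ((\<lambda>z. c + z) ` (\<lambda>p. - \<i> * of_real R * p) ` S)"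
    by (intro convex_translation convex_linear_image linear_turn)
  then show ?thesis by (simp add: placed_def image_image add.commute)
qed

lemma compact_placed: "compact S \<Longrightarrow> compact (placed R c ` S)"
  by (intro compact_continuous_image continuous_placed continuous_intros)

lemma (in convex_body) frontier_placed:
  assumes "R > 0"
  shows "frontier (placed R c ` K) = placed R c ` frontier K"
    and "inside (placed R c ` frontier K) = placed R c ` interior K"
proof -
  have cl: "closed K" "closed (placed R c ` K)"
    using compact_imp_closed compact_placed compact_K by blast+
  show f: "frontier (placed R c ` K) = placed R c ` frontier K"
    unfolding frontier_def closure_closed[OF cl(1)] closure_closed[OF cl(2)] interior_placed[OF assms]
    using inj_placed[OF assms, of c] by (simp add: image_set_diff)
  show "inside (placed R c ` frontier K) = placed R c ` interior K"
    unfolding f[symmetric] interior_placed[OF assms, symmetric]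
    by (intro inside_frontier_eq_interior compact_imp_bounded compact_placed convex_placed compact_K convex_K)
qed

lemma lborel_placed:
  assumes R: "R > 0"
  shows "(lborel :: complex measure) = density (distr lborel borel (placed R c)) (\<lambda>_. ennreal (R\<^sup>2))"
proof (rule lborel_eqI)
  have m[measurable]: "placed R c \<in> borel_measurable borel"
    by (intro borel_measurable_continuous_onI continuous_placed continuous_intros)
  fix l u :: complex assume "\<And>b. b \<in> Basis \<Longrightarrow> l \<bullet> b \<le> u \<bullet> b"
  from this[of 1] this[of \<i>] have lu: "Re l \<le> Re u" "Im l \<le> Im u" by auto
  let ?L = "Complex ((Im c - Im u) / R) ((Re l - Re c) / R)" and ?U = "Complex ((Im c - Im l) / R) ((Re u - Re c) / R)"
  have vim: "placed R c -` box l u = box ?L ?U"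
    using R by (auto simp: in_box_complex_iff field_simps)
  have "emeasure (density (distr lborel borel (placed R c)) (\<lambda>_. ennreal (R\<^sup>2))) (box l u)
     = ennreal (R\<^sup>2) * emeasure lborel (box ?L ?U)"
    by (simp add: emeasure_density_const emeasure_distr vim)
  also have "emeasure lborel (box ?L ?U) = ennreal (((Im c - Im l) / R - (Im c - Im u) / R) * ((Re u - Re c) / R - (Re l - Re c) / R))"
    using lu R by (simp add: emeasure_lborel_box_eq Basis_complex_def divide_right_mono)
  also have "ennreal (R\<^sup>2) * \<dots> = ennreal (R\<^sup>2 * (((Im c - Im l) / R - (Im c - Im u) / R) * ((Re u - Re c) / R - (Re l - Re c) / R)))"
    by (simp add: ennreal_mult')
  also have "R\<^sup>2 * (((Im c - Im l) / R - (Im c - Im u) / R) * ((Re u - Re c) / R - (Re l - Re c) / R)) = (\<Prod>b\<in>Basis. (u - l) \<bullet> b)"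
    using R by (simp add: Basis_complex_def power2_eq_square diff_divide_distrib[symmetric] mult.commute)
  finally show "emeasure (density (distr lborel borel (placed R c)) (\<lambda>_. ennreal (R\<^sup>2))) (box l u) = ennreal (\<Prod>b\<in>Basis. (u - l) \<bullet> b)" .
qed simp

lemma integral_placed:
  fixes f :: "complex \<Rightarrow> real"
  assumes R: "R > 0" and si: "set_integrable lborel (placed R c ` S) f"
    and si': "set_integrable lborel S (\<lambda>p. f (placed R c p))"
  shows "integral (placed R c ` S) f = R\<^sup>2 * integral S (\<lambda>p. f (placed R c p))"
proof -
  let ?g = "\<lambda>z. indicator (placed R c ` S) z *\<^sub>R f z"
  have m[measurable]: "placed R c \<in> borel_measurable borel"
    by (intro borel_measurable_continuous_onI continuous_placed continuous_intros)
  have g[measurable]: "?g \<in> borel_measurable borel" using si unfolding set_integrable_def by simp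
  have "integral\<^sup>L lborel ?g = integral\<^sup>L (density (distr lborel borel (placed R c)) (\<lambda>_. ennreal (R\<^sup>2))) ?g"
    using lborel_placed[OF R, of c] by simp
  also have "\<dots> = (\<integral>z. R\<^sup>2 *\<^sub>R ?g z \<partial>distr lborel borel (placed R c))"
    by (rule integral_density) (use g in simp_all)
  also have "\<dots> = (\<integral>p. R\<^sup>2 *\<^sub>R ?g (placed R c p) \<partial>lborel)"
    by (rule integral_distr) (use g m in simp_all)
  also have "\<dots> = R\<^sup>2 * (\<integral>p. indicator S p *\<^sub>R f (placed R c p) \<partial>lborel)"
    using inj_placed[OF R, of c] by (simp add: indicator_def inj_image_mem_iff)
  finally show ?thesis
    using set_borel_integral_eq_integral(2)[OF si] set_borel_integral_eq_integral(2)[OF si']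
    by (simp add: set_lebesgue_integral_def)
qed

lemma placed_path:
  fixes p :: "real \<Rightarrow> complex"
  assumes R: "R > 0"
  shows "simple_path (\<lambda>t. placed R c (p t)) \<longleftrightarrow> simple_path p"
    "pathfinish (\<lambda>t. placed R c (p t)) = pathstart (\<lambda>t. placed R c (p t)) \<longleftrightarrow> pathfinish p = pathstart p"
    "path_image (\<lambda>t. placed R c (p t)) = placed R c ` path_image p"
    "B-lipschitz_on S p \<Longrightarrow> (R * B)-lipschitz_on S (\<lambda>t. placed R c (p t))"
    "(p has_vector_derivative d) (at t) \<Longrightarrow> ((\<lambda>t. placed R c (p t)) has_vector_derivative - \<i> * of_real R * d) (at t)"
proof -
  let ?lin = "\<lambda>z::complex. - \<i> * of_real R * z"
  have eq: "(\<lambda>t. placed R c (p t)) = (\<lambda>x. c + x) \<circ> (?lin \<circ> p)"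
    by (simp add: fun_eq_iff placed_def add.commute)
  show "simple_path (\<lambda>t. placed R c (p t)) \<longleftrightarrow> simple_path p"
    unfolding eq simple_path_translation_eq by (rule simple_path_linear_image_eq[OF linear_turn inj_turn[OF R]])
  show "pathfinish (\<lambda>t. placed R c (p t)) = pathstart (\<lambda>t. placed R c (p t)) \<longleftrightarrow> pathfinish p = pathstart p"
    by (simp add: pathfinish_def pathstart_def placed_eq_iff R)
  show "path_image (\<lambda>t. placed R c (p t)) = placed R c ` path_image p"
    by (auto simp: path_image_def)
  show "(R * B)-lipschitz_on S (\<lambda>t. placed R c (p t))" if "B-lipschitz_on S p"
    using that R lipschitz_onD[OF that] lipschitz_on_nonneg[OF that]
    by (auto intro!: lipschitz_onI simp: dist_placed mult.assoc)
  show "((\<lambda>t. placed R c (p t)) has_vector_derivative - \<i> * of_real R * d) (at t)" if "(p has_vector_derivative d) (at t)"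
    unfolding placed_def using that by (auto intro!: derivative_eq_intros)
qed

lemma positively_oriented_iff:
  fixes c :: "real \<Rightarrow> complex"
  assumes lip: "B-lipschitz_on {0..1} c" and simple: "simple_path c" and closed: "pathfinish c = pathstart c"
    and hi: "((\<lambda>t. cross (c t) (vector_derivative c (at t))) has_integral I) {0..1}"
  shows "positively_oriented c \<longleftrightarrow> I > 0" "I \<noteq> 0"
proof -
  obtain w :: real where w: "w = 1 \<or> w = -1" "\<And>z. z \<in> inside (path_image c) \<Longrightarrow> winding_number c z = of_real w"
    using simple_closed_lipschitz_orientation[OF simple] by metis
  have path: "path c" using simple by (rule simple_path_imp_path)
  let ?I = "inside (path_image c)"
  have I: "I = 2 * w * measure lborel ?I"
    using has_integral_unique[OF hi integral_cross_eq_area[OF lip closed w(2)]] .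
  have ne: "?I \<noteq> {}" using Jordan_inside_outside[OF simple closed] by auto
  have "open ?I" by (simp add: closed_path_image open_inside path)
  have meas: "?I \<in> lmeasurable"
    by (intro bounded_set_imp_lmeasurable) (auto simp: bounded_inside bounded_path_image path \<open>open ?I\<close>)
  have "measure lebesgue ?I \<noteq> 0"
    using open_not_negligible[OF \<open>open ?I\<close> ne] meas by (simp add: negligible_iff_measure)
  then have "measure lborel ?I > 0"
    using \<open>open ?I\<close> by (simp add: measure_completion borel_open zero_less_measure_iff)
  then show "I \<noteq> 0" "positively_oriented c \<longleftrightarrow> I > 0"
    using w ne I by (auto simp: positively_oriented_def)
qed

text \<open>The density \<open>1 / y\<^sup>2\<close> of the invariant area is minus the derivative
  of \<open>1 / y\<close>, so Green's formula turns the area into the integral of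
  \<open>dx / y\<close>.\<close>

lemma area_line_integral:
  fixes c :: "real \<Rightarrow> complex"
  assumes lip: "B-lipschitz_on {0..1} c" and closed: "pathfinish c = pathstart c" and half: "path_image c \<subseteq> half_plane"
    and w: "\<And>z. z \<in> inside (path_image c) \<Longrightarrow> winding_number c z = of_real w"
  shows "((\<lambda>t. Re (vector_derivative c (at t)) / Im (c t)) has_integral w * area (inside (path_image c))) {0..1}"
    and "set_integrable lborel (inside (path_image c)) (\<lambda>z. 1 / (Im z)\<^sup>2)"
proof -
  have cont: "continuous_on {0..1} (\<lambda>t. Im (c t))"
    by (rule lipschitz_on_continuous_on[OF lipschitz_on_Im[OF lip]])
  obtain a where a: "a \<in> {0..1}" "\<And>t. t \<in> {0..1} \<Longrightarrow> Im (c a) \<le> Im (c t)"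
    using continuous_attains_inf[OF compact_Icc _ cont] by auto
  obtain b where b: "b \<in> {0..1}" "\<And>t. t \<in> {0..1} \<Longrightarrow> Im (c t) \<le> Im (c b)"
    using continuous_attains_sup[OF compact_Icc _ cont] by auto
  have strip: "Im (c t) \<in> {Im (c a)..Im (c b)}" if "t \<in> {0..1}" for t using a b that by simp
  have pos: "Im (c a) > 0" using half imageI[OF a(1), of c] by (auto simp: path_image_def half_plane_def)
  have k: "((\<lambda>y. 1 / y) has_real_derivative - (1 / y\<^sup>2)) (at y)" if "y \<in> {Im (c a)..Im (c b)}" for y
    using pos that by (auto intro!: derivative_eq_intros simp: power2_eq_square divide_simps)
  have h: "continuous_on {Im (c a)..Im (c b)} (\<lambda>y. 1 / y\<^sup>2)" using pos by (auto intro!: continuous_intros)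
  note g = green_horizontal[OF lip closed w strip, of "\<lambda>y. 1 / y" "\<lambda>y. 1 / y\<^sup>2", OF _ _ k h]
  have "((\<lambda>t. 1 / Im (c t) * Re (vector_derivative c (at t))) has_integral w * area (inside (path_image c))) {0..1}"
    unfolding area_def by (rule g(1)) auto
  then show "((\<lambda>t. Re (vector_derivative c (at t)) / Im (c t)) has_integral w * area (inside (path_image c))) {0..1}" by simp
  show "set_integrable lborel (inside (path_image c)) (\<lambda>z. 1 / (Im z)\<^sup>2)" by (rule g(2)) auto
qed

lemma lipschitz_on_if_bounded_derivative:
  fixes f :: "real \<Rightarrow> real"
  assumes "\<And>x. x \<in> {a..b} \<Longrightarrow> (f has_real_derivative f' x) (at x within {a..b})" and cont: "continuous_on {a..b} f'"
  shows "\<exists>C. C-lipschitz_on {a..b} f"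
proof -
  have "bounded (f' ` {a..b})"
    by (intro compact_imp_bounded compact_continuous_image cont compact_Icc)
  then obtain C where C: "\<And>x. x \<in> {a..b} \<Longrightarrow> norm (f' x) \<le> C"
    unfolding bounded_iff by blast
  have "(max 0 C)-lipschitz_on {a..b} f"
  proof (rule lipschitz_onI)
    fix x y assume xy: "x \<in> {a..b}" "y \<in> {a..b}"
    have "norm (f x - f y) \<le> max 0 C * norm (x - y)"
      by (rule field_differentiable_bound[of "{a..b}" f f'])
         (use assms(1) C xy in \<open>auto intro: max.coboundedI2\<close>)
    then show "dist (f x) (f y) \<le> max 0 C * dist x y" by (simp add: dist_norm)
  qed simp
  then show ?thesis by blast
qed

text \<open>The integral of \<open>d (x * k y)\<close> around a closed curve vanishes, which trades
  \<open>dx\<close> for \<open>dy\<close>.\<close>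

lemma closed_curve_by_parts:
  fixes c :: "real \<Rightarrow> complex"
  assumes lip: "B-lipschitz_on {0..1} c" and closed: "c 1 = c 0"
    and strip: "\<And>t. t \<in> {0..1} \<Longrightarrow> Im (c t) \<in> {y1..y2}"
    and k: "\<And>y. y \<in> {y1..y2} \<Longrightarrow> (k has_real_derivative k' y) (at y)" and k': "continuous_on {y1..y2} k'"
    and hi: "((\<lambda>t. k (Im (c t)) * Re (vector_derivative c (at t))) has_integral I) {0..1}"
  shows "((\<lambda>t. Re (c t) * (k' (Im (c t)) * Im (vector_derivative c (at t)))) has_integral - I) {0..1}"
proof -
  have kw: "(k has_real_derivative k' y) (at y within {y1..y2})" if "y \<in> {y1..y2}" for y
    using k[OF that] by (rule has_field_derivative_at_within)
  obtain C where C: "C-lipschitz_on {y1..y2} k" using lipschitz_on_if_bounded_derivative[OF kw k'] by blast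
  have kl: "(C * B)-lipschitz_on {0..1} (\<lambda>t. k (Im (c t)))"
    using strip by (intro lipschitz_on_compose2[OF lipschitz_on_Im[OF lip] lipschitz_on_subset[OF C]]) auto
  obtain D where D: "D-lipschitz_on {0..1} (\<lambda>t. Re (c t) * k (Im (c t)))"
    using lipschitz_on_mult_Icc[OF lipschitz_on_Re[OF lip] kl] .
  have "((\<lambda>t. Re (c t) * (k' (Im (c t)) * Im (vector_derivative c (at t))) + Re (vector_derivative c (at t)) * k (Im (c t)))
       has_integral (Re (c 1) * k (Im (c 1)) - Re (c 0) * k (Im (c 0)))) {0..1}"
  proof (rule lipschitz_has_integral_derivative[OF D])
    show "AE t in lborel. t \<in> {0..1} \<longrightarrow> ((\<lambda>t. Re (c t) * k (Im (c t))) has_vector_derivative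
       Re (c t) * (k' (Im (c t)) * Im (vector_derivative c (at t))) + Re (vector_derivative c (at t)) * k (Im (c t))) (at t)"
      using lipschitz_ae_vector_derivative(1)[OF lip]
    proof eventually_elim
      case (elim t)
      show ?case
      proof
        assume t: "t \<in> {0..1}"
        with elim have d: "(c has_vector_derivative vector_derivative c (at t)) (at t)" by blast
        have "((\<lambda>t. k (Im (c t))) has_vector_derivative k' (Im (c t)) * Im (vector_derivative c (at t))) (at t)"
          using DERIV_chain2[of k "k' (Im (c t))" "\<lambda>t. Im (c t)" t _ UNIV, OF k[OF strip[OF t]]] has_vector_derivative_Im[OF d]
          by (simp add: has_real_derivative_iff_has_vector_derivative)
        from has_vector_derivative_mult[OF has_vector_derivative_Re[OF d] this]
        show "((\<lambda>t. Re (c t) * k (Im (c t))) has_vector_derivative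
          Re (c t) * (k' (Im (c t)) * Im (vector_derivative c (at t))) + Re (vector_derivative c (at t)) * k (Im (c t))) (at t)" .
      qed
    qed
  qed simp
  from has_integral_diff[OF this hi] show ?thesis by (simp add: closed mult.commute)
qed

text \<open>What the variational argument uses of the Finsler structure: \<open>K\<close> stands for
  the polar of \<Omega>, \<open>m\<close> for the gauge of \<Omega>, \<open>e\<close> for the
  boundary of \<open>K\<close> in the area parameter and \<open>w\<close> for the corresponding
  points on the boundary of \<Omega>. The abstraction lets the reflected problem be a second
  instance.\<close>

locale isoperimetric = convex_body K for K :: "complex set" +
  fixes m :: "complex \<Rightarrow> real" and e w :: "real \<Rightarrow> complex" and T :: real
  assumes T_pos: "T > 0"
    and e_lipschitz: "\<exists>B. B-lipschitz_on UNIV e"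
    and e_simple: "simple_path (\<lambda>s. e (T * s))" and e_closed: "e T = e 0"
    and e_image: "path_image (\<lambda>s. e (T * s)) = frontier K"
    and e_cross: "AE t in lborel. t \<in> {0..T} \<longrightarrow> (\<exists>d. (e has_vector_derivative d) (at t) \<and> cross (e t) d = 1)"
    and m_cont: "continuous_on UNIV m"
    and m_scaleR: "\<And>s x. s \<ge> 0 \<Longrightarrow> m (s *\<^sub>R x) = s * m x"
    and m_ge: "\<And>p x. p \<in> K \<Longrightarrow> p \<bullet> x \<le> m x"
    and e_w: "\<And>t. t \<in> {0..T} \<Longrightarrow> e t \<bullet> w t = 1"
    and m_w: "\<And>t. t \<in> {0..T} \<Longrightarrow> m (w t) = 1"
begin

definition l where "l = Inf (Re ` K)"
definition r where "r = Sup (Re ` K)"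

text \<open>The area inside an extremal contour with parameter \<mu>, the same for all sizes because
  dilations preserve the area form; also minus the derivative of \<open>G_area\<close>.\<close>

definition F_area :: "real \<Rightarrow> real" where "F_area \<mu> = integral K (\<lambda>p. 1 / (\<mu> - Re p)\<^sup>2)"
definition G_area :: "real \<Rightarrow> real" where "G_area \<mu> = integral K (\<lambda>p. 1 / (\<mu> - Re p))"

lemma Re_image: "Re ` K = {l..r}" and l_neg: "l < 0" and r_pos: "0 < r"
proof -
  have c: "compact (Re ` K)" by (intro compact_continuous_image compact_K continuous_intros)
  have ne: "Re ` K \<noteq> {}" using zero_in_K by auto
  have "convex (Re ` K)"
    by (intro convex_linear_image convex_K bounded_linear.linear bounded_linear_Re)
  then have "is_interval (Re ` K)" by (simp add: is_interval_convex_1)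
  have bd: "bdd_below (Re ` K)" "bdd_above (Re ` K)"
    using compact_imp_bounded[OF c] by (auto intro: bounded_imp_bdd_below bounded_imp_bdd_above)
  have lr: "l \<in> Re ` K" "r \<in> Re ` K"
    unfolding l_def r_def using c ne bd
    by (auto intro: closed_contains_Inf closed_contains_Sup compact_imp_closed)
  show "Re ` K = {l..r}"
  proof
    show "Re ` K \<subseteq> {l..r}"
    proof
      fix s assume "s \<in> Re ` K"
      then show "s \<in> {l..r}"
        using cInf_lower[OF _ bd(1), of s] cSup_upper[OF _ bd(2), of s] by (simp add: l_def r_def)
    qed
    show "{l..r} \<subseteq> Re ` K"
      using \<open>is_interval (Re ` K)\<close> lr unfolding is_interval_1 by (meson atLeastAtMost_iff subsetI)
  qed
  obtain \<rho> where \<rho>: "\<rho> > 0" "cball 0 \<rho> \<subseteq> K" using inner_radius .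
  have "of_real \<rho> \<in> K" "- of_real \<rho> \<in> K" using \<rho> by (auto intro!: subsetD[OF \<rho>(2)])
  from this[THEN imageI, of Re] have "\<rho> \<in> Re ` K" "- \<rho> \<in> Re ` K" by simp_all
  then show "l < 0" "0 < r"
    using \<rho>(1) cInf_lower[OF _ bd(1), of "- \<rho>"] cSup_upper[OF _ bd(2), of \<rho>] by (auto simp: l_def r_def)
qed

lemma Re_bounds: "p \<in> K \<Longrightarrow> l \<le> Re p" "p \<in> K \<Longrightarrow> Re p \<le> r"
  using imageI[of p K Re] Re_image by simp_all

lemma cont_kernel:
  assumes "\<mu> > r"
  shows "continuous_on {l..r} (\<lambda>s. 1 / (\<mu> - s))" "continuous_on {l..r} (\<lambda>s. 1 / (\<mu> - s)\<^sup>2)"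
  using assms by (auto intro!: continuous_intros)

lemma F_area_integral:
  assumes "\<mu> > r"
  shows "((\<lambda>s. (upper_fibre K s - lower_fibre K s) * (1 / (\<mu> - s)\<^sup>2)) has_integral F_area \<mu>) {l..r}"
    and "set_integrable lborel K (\<lambda>p. 1 / (\<mu> - Re p)\<^sup>2)"
  using integral_fibre[OF compact_K convex_K Re_image cont_kernel(2)[OF assms]] by (simp_all only: F_area_def)

lemma G_area_integral:
  assumes "\<mu> > r"
  shows "((\<lambda>s. (upper_fibre K s - lower_fibre K s) * (1 / (\<mu> - s))) has_integral G_area \<mu>) {l..r}"
    and "set_integrable lborel K (\<lambda>p. 1 / (\<mu> - Re p))"
  using integral_fibre[OF compact_K convex_K Re_image cont_kernel(1)[OF assms]] by (simp_all only: G_area_def)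

lemma integral_interior: "integral (interior K) f = integral K f" for f :: "complex \<Rightarrow> real"
proof (rule integral_subset_negligible)
  show "negligible (K - interior K)"
    by (rule negligible_subset[OF negligible_convex_frontier[OF convex_K]])
       (use closure_subset in \<open>auto simp: frontier_def\<close>)
qed (rule interior_subset)

text \<open>With \<open>z = (x0, R * \<mu>)\<close> the third integrand expands to
  \<open>x dy / (R y) - x0 dy / (R y) - dx / R + \<mu> dx / y\<close>. The two middle terms are
  exact, the last gives \<mu> times the area, and the first becomes \<open>G_area \<mu>\<close>
  through partial integration and Green's formula with \<open>k y = - ln y\<close>.\<close>

lemma extremal_integrals:
  fixes c :: "real \<Rightarrow> complex"
  assumes R: "R > 0" and \<mu>: "\<mu> > r" and z: "Im z = R * \<mu>"
    and lip: "B-lipschitz_on {0..1} c" and simple: "simple_path c" and closed: "pathfinish c = pathstart c"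
    and image: "path_image c = placed R z ` frontier K" and pos: "positively_oriented c"
  shows "((\<lambda>t. Re (vector_derivative c (at t)) / Im (c t)) has_integral F_area \<mu>) {0..1}"
    and "integral (inside (path_image c)) (\<lambda>z. 1 / (Im z)\<^sup>2) = F_area \<mu>"
    and "((\<lambda>t. cross (c t - z) (vector_derivative c (at t)) / (R * Im (c t))) has_integral \<mu> * F_area \<mu> + G_area \<mu>) {0..1}"
    and "path_image c \<subseteq> half_plane"
proof -
  define y1 y2 where "y1 = R * (\<mu> - r)" and "y2 = R * (\<mu> - l)"
  have y1: "y1 > 0" using R \<mu> by (simp add: y1_def)
  have ins: "inside (path_image c) = placed R z ` interior K"
    unfolding image by (rule frontier_placed(2)[OF R])
  have w: "winding_number c u = of_real 1" if "u \<in> inside (path_image c)" for u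
    using pos that by (simp add: positively_oriented_def)
  have strip: "Im (c t) \<in> {y1..y2}" if t: "t \<in> {0..1}" for t
  proof -
    have "c t \<in> placed R z ` frontier K" using t image by (auto simp: path_image_def)
    then obtain p where "p \<in> K" "c t = placed R z p" using frontier_subset by auto
    then show ?thesis using Re_bounds[of p] R by (simp add: z y1_def y2_def right_diff_distrib[symmetric])
  qed
  show half: "path_image c \<subseteq> half_plane"
    using strip y1 by (force simp: path_image_def half_plane_def)
  \<comment> \<open>The inside is the placed interior of \<open>K\<close>, where the image of
    \<open>p\<close> has height \<open>R * (\<mu> - Re p)\<close>; the Jacobian is
    \<open>R\<^sup>2\<close>.\<close>
  have sub: "integral (placed R z ` interior K) (\<lambda>u. h (Im u)) = R\<^sup>2 * integral K (\<lambda>p. h (R * (\<mu> - Re p)))"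
    if i1: "set_integrable lborel (inside (path_image c)) (\<lambda>u. h (Im u))"
      and i2: "set_integrable lborel K (\<lambda>p. h (R * (\<mu> - Re p)))" for h :: "real \<Rightarrow> real"
  proof -
    have i2': "set_integrable lborel (interior K) (\<lambda>p. h (R * (\<mu> - Re p)))"
      by (rule set_integrable_subset[OF i2]) (auto simp: interior_subset)
    have eq: "Im (placed R z p) = R * (\<mu> - Re p)" for p by (simp add: z right_diff_distrib)
    have "integral (placed R z ` interior K) (\<lambda>u. h (Im u)) = R\<^sup>2 * integral (interior K) (\<lambda>p. h (Im (placed R z p)))"
      by (rule integral_placed[OF R i1[unfolded ins]]) (use i2' in \<open>simp only: eq\<close>)
    then show ?thesis by (simp only: eq integral_interior)
  qed
  have pos': "y > 0" if "y \<in> {y1..y2}" for y using that y1 by auto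
  have g1: "((\<lambda>t. Re (vector_derivative c (at t)) / Im (c t)) has_integral area (inside (path_image c))) {0..1}"
    "set_integrable lborel (inside (path_image c)) (\<lambda>z. 1 / (Im z)\<^sup>2)"
    using area_line_integral[OF lip closed half, of 1] w by simp_all
  have "set_integrable lborel K (\<lambda>p. (1 / R\<^sup>2) * (1 / (\<mu> - Re p)\<^sup>2))"
    using F_area_integral(2)[OF \<mu>] by (rule set_integrable_mult_right[OF _])
  then have "integral (placed R z ` interior K) (\<lambda>u. 1 / (Im u)\<^sup>2) = R\<^sup>2 * integral K (\<lambda>p. 1 / (R * (\<mu> - Re p))\<^sup>2)"
    by (intro sub g1(2)) (simp add: power_mult_distrib)
  also have "\<dots> = F_area \<mu>"
    using R by (simp add: F_area_def power_mult_distrib divide_inverse)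
  finally show FA: "integral (inside (path_image c)) (\<lambda>z. 1 / (Im z)\<^sup>2) = F_area \<mu>" by (simp only: ins)
  show X: "((\<lambda>t. Re (vector_derivative c (at t)) / Im (c t)) has_integral F_area \<mu>) {0..1}"
    using g1(1) FA by (simp add: area_def)
  have g2: "((\<lambda>t. - ln (Im (c t)) * Re (vector_derivative c (at t))) has_integral 1 * integral (inside (path_image c)) (\<lambda>z. 1 / Im z)) {0..1}"
    "set_integrable lborel (inside (path_image c)) (\<lambda>z. 1 / Im z)"
  proof -
    have k: "((\<lambda>y. - ln y) has_real_derivative - (1 / y)) (at y)" if "y \<in> {y1..y2}" for y
      using pos'[OF that] by (auto intro!: derivative_eq_intros)
    have h: "continuous_on {y1..y2} (\<lambda>y. 1 / y)" using y1 by (auto intro!: continuous_intros)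
    note g = green_horizontal[OF lip closed w strip, of "\<lambda>y. - ln y" "\<lambda>y. 1 / y", OF _ _ k h]
    show "((\<lambda>t. - ln (Im (c t)) * Re (vector_derivative c (at t))) has_integral 1 * integral (inside (path_image c)) (\<lambda>z. 1 / Im z)) {0..1}"
      by (rule g(1)) auto
    show "set_integrable lborel (inside (path_image c)) (\<lambda>z. 1 / Im z)"
      by (rule g(2)) auto
  qed
  have "set_integrable lborel K (\<lambda>p. (1 / R) * (1 / (\<mu> - Re p)))"
    using G_area_integral(2)[OF \<mu>] by (rule set_integrable_mult_right[OF _])
  then have "integral (placed R z ` interior K) (\<lambda>u. 1 / Im u) = R\<^sup>2 * integral K (\<lambda>p. 1 / (R * (\<mu> - Re p)))"
    by (intro sub g2(2)) simp
  also have "\<dots> = R * G_area \<mu>"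
    using R by (simp add: G_area_def divide_inverse power2_eq_square)
  finally have lnx: "((\<lambda>t. - ln (Im (c t)) * Re (vector_derivative c (at t))) has_integral R * G_area \<mu>) {0..1}"
    using g2(1) by (simp add: ins)
  have derc: "AE t in lborel. t \<in> {0..1} \<longrightarrow> (c has_vector_derivative vector_derivative c (at t)) (at t)"
    by (rule lipschitz_ae_vector_derivative(1)[OF lip])
  have dln: "(ln has_real_derivative 1 / y) (at y)" if "y \<in> {y1..y2}" for y
    using pos'[OF that] by (auto intro!: derivative_eq_intros)
  have kc: "continuous_on {y1..y2} (\<lambda>y. 1 / y)" using y1 by (auto intro!: continuous_intros)
  obtain C where C: "C-lipschitz_on {y1..y2} ln"
    using lipschitz_on_if_bounded_derivative[OF has_field_derivative_at_within[OF dln] kc] by blast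
  have D: "(C * B)-lipschitz_on {0..1} (\<lambda>t. ln (Im (c t)))"
    using strip by (intro lipschitz_on_compose2[OF lipschitz_on_Im[OF lip] lipschitz_on_subset[OF C]]) auto
  have cc: "c 1 = c 0" using closed by (simp add: pathfinish_def pathstart_def)
  have derln: "((\<lambda>t. ln (Im (c t))) has_vector_derivative Im (vector_derivative c (at t)) / Im (c t)) (at t)"
    if "(c has_vector_derivative vector_derivative c (at t)) (at t)" "t \<in> {0..1}" for t
  proof -
    have "((\<lambda>t. Im (c t)) has_real_derivative Im (vector_derivative c (at t))) (at t)"
      using has_vector_derivative_Im[OF that(1)] by (simp add: has_real_derivative_iff_has_vector_derivative)
    from DERIV_chain2[OF DERIV_ln_divide[OF pos'[OF strip[OF that(2)]]] this]
    show ?thesis by (simp add: has_real_derivative_iff_has_vector_derivative)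
  qed
  have A1: "((\<lambda>t. Im (vector_derivative c (at t)) / Im (c t)) has_integral 0) {0..1}"
  proof -
    have "AE t in lborel. t \<in> {0..1} \<longrightarrow> ((\<lambda>t. ln (Im (c t))) has_vector_derivative Im (vector_derivative c (at t)) / Im (c t)) (at t)"
      using derc by eventually_elim (blast intro: derln)
    from lipschitz_has_integral_derivative[OF D _ this] show ?thesis by (simp add: cc)
  qed
  have dln': "((\<lambda>y. - ln y) has_real_derivative - (1 / y)) (at y)" if "y \<in> {y1..y2}" for y
    using DERIV_minus[OF dln[OF that]] .
  have "continuous_on {y1..y2} (\<lambda>y. - (1 / y))" by (intro continuous_on_minus kc)
  from has_integral_neg[OF closed_curve_by_parts[OF lip cc strip dln' this lnx]]
  have A2: "((\<lambda>t. Re (c t) * (Im (vector_derivative c (at t)) / Im (c t))) has_integral R * G_area \<mu>) {0..1}"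
    by simp
  have A3: "((\<lambda>t. Re (vector_derivative c (at t))) has_integral 0) {0..1}"
    using has_integral_linear[OF lipschitz_ae_vector_derivative(2)[OF lip] bounded_linear_Re] cc by (simp add: o_def)
  have "((\<lambda>t. (1 / R) * (Re (c t) * (Im (vector_derivative c (at t)) / Im (c t))) - (Re z / R) * (Im (vector_derivative c (at t)) / Im (c t))
      - (1 / R) * Re (vector_derivative c (at t)) + \<mu> * (Re (vector_derivative c (at t)) / Im (c t)))
      has_integral (1 / R) * (R * G_area \<mu>) - (Re z / R) * 0 - (1 / R) * 0 + \<mu> * F_area \<mu>) {0..1}"
    by (intro has_integral_add has_integral_diff has_integral_mult_right A1 A2 A3 X)
  then have Y: "((\<lambda>t. (1 / R) * (Re (c t) * (Im (vector_derivative c (at t)) / Im (c t))) - (Re z / R) * (Im (vector_derivative c (at t)) / Im (c t))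
      - (1 / R) * Re (vector_derivative c (at t)) + \<mu> * (Re (vector_derivative c (at t)) / Im (c t)))
      has_integral \<mu> * F_area \<mu> + G_area \<mu>) {0..1}"
    using R by (simp add: add.commute)
  show "((\<lambda>t. cross (c t - z) (vector_derivative c (at t)) / (R * Im (c t))) has_integral \<mu> * F_area \<mu> + G_area \<mu>) {0..1}"
  proof (rule has_integral_eq[OF _ Y])
    fix t :: real assume t: "t \<in> {0..1}"
    have "(1 / R) * (x * (v / y)) - (x0 / R) * (v / y) - (1 / R) * u + \<mu> * (u / y) = ((x - x0) * v - (y - R * \<mu>) * u) / (R * y)"
      if "y > 0" for x x0 y u v :: real
      using that R by (simp add: field_simps)
    from this[OF pos'[OF strip[OF t]]]
    show "(1 / R) * (Re (c t) * (Im (vector_derivative c (at t)) / Im (c t))) - (Re z / R) * (Im (vector_derivative c (at t)) / Im (c t))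
      - (1 / R) * Re (vector_derivative c (at t)) + \<mu> * (Re (vector_derivative c (at t)) / Im (c t))
      = cross (c t - z) (vector_derivative c (at t)) / (R * Im (c t))"
      by (simp add: cross_def z)
  qed
qed

end

lemma cross_turn: "cross (- \<i> * of_real R * p) (- \<i> * of_real R * q) = R\<^sup>2 * cross p q"
  by (simp add: cross_def power2_eq_square algebra_simps)

text \<open>The sign of the integral of the cross product decides the orientation. A quarter turn
  and a dilation by \<open>R\<close> multiply it by \<open>R\<^sup>2\<close>, and the translation
  adds the integral of an exact form.\<close>

lemma positively_oriented_placed:
  fixes p :: "real \<Rightarrow> complex"
  assumes R: "R > 0" and lip: "B-lipschitz_on {0..1} p" and simple: "simple_path p" and closed: "pathfinish p = pathstart p"
  shows "positively_oriented (\<lambda>t. placed R z (p t)) \<longleftrightarrow> positively_oriented p"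
proof -
  obtain v :: real where v: "\<And>z. z \<in> inside (path_image p) \<Longrightarrow> winding_number p z = of_real v"
    using simple_closed_lipschitz_orientation[OF simple] by metis
  define I where "I = 2 * v * measure lborel (inside (path_image p))"
  have I: "((\<lambda>t. cross (p t) (vector_derivative p (at t))) has_integral I) {0..1}"
    unfolding I_def by (rule integral_cross_eq_area[OF lip closed v])
  let ?c = "\<lambda>t. placed R z (p t)"
  have cl: "(R * B)-lipschitz_on {0..1} ?c" by (rule placed_path(4)[OF R lip])
  have c1: "simple_path ?c" "pathfinish ?c = pathstart ?c"
    using simple closed by (simp_all only: placed_path(1,2)[OF R])
  have ae: "AE t in lborel. t \<in> {0..1} \<longrightarrow> (p has_vector_derivative vector_derivative p (at t)) (at t)"
    by (rule lipschitz_ae_vector_derivative(1)[OF lip])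
  have zl: "linear (cross z)" by (rule linearI) (simp_all add: cross_def algebra_simps)
  have "((\<lambda>t. vector_derivative ?c (at t)) has_integral 0) {0..1}"
    using lipschitz_ae_vector_derivative(2)[OF cl] c1(2) by (simp add: pathfinish_def pathstart_def)
  from has_integral_linear[OF this, of "cross z"] zl
  have z0: "((\<lambda>t. cross z (vector_derivative ?c (at t))) has_integral 0) {0..1}"
    by (simp add: o_def linear_conv_bounded_linear linear_0)
  have "((\<lambda>t. R\<^sup>2 * cross (p t) (vector_derivative p (at t)) + cross z (vector_derivative ?c (at t))) has_integral R\<^sup>2 * I + 0) {0..1}"
    by (intro has_integral_add has_integral_mult_right I z0)
  then have J: "((\<lambda>t. cross (?c t) (vector_derivative ?c (at t))) has_integral R\<^sup>2 * I) {0..1}"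
  proof (subst has_integral_AE)
    show "AE t in lborel. t \<in> {0..1} \<longrightarrow> cross (?c t) (vector_derivative ?c (at t))
        = R\<^sup>2 * cross (p t) (vector_derivative p (at t)) + cross z (vector_derivative ?c (at t))"
      using ae
    proof eventually_elim
      case (elim t)
      have "cross (?c t) d = cross (- \<i> * of_real R * p t) d + cross z d" for d
        by (simp add: placed_def cross_def algebra_simps)
      moreover have "vector_derivative ?c (at t) = - \<i> * of_real R * vector_derivative p (at t)" if "t \<in> {0..1}"
        using elim that by (intro vector_derivative_at placed_path(5)[OF R]) simp
      ultimately show ?case using cross_turn by simp
    qed
  qed simp
  have "positively_oriented ?c \<longleftrightarrow> R\<^sup>2 * I > 0"
    by (rule positively_oriented_iff(1)[OF cl c1 J])
  also have "\<dots> \<longleftrightarrow> I > 0" using R by (simp add: zero_less_mult_iff)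
  also have "\<dots> \<longleftrightarrow> positively_oriented p"
    by (rule positively_oriented_iff(1)[OF lip simple closed I, symmetric])
  finally show ?thesis .
qed

text \<open>A linear functional restricted to a curve in \<open>K\<close> is stationary where it attains its maximum over \<open>K\<close>.\<close>

lemma tangent_eq_turned_normal:
  fixes f :: "real \<Rightarrow> complex"
  assumes d: "(f has_vector_derivative d) (at t)" and t: "t \<in> {a<..<b}" and fK: "\<And>s. s \<in> {a<..<b} \<Longrightarrow> f s \<in> K"
    and le: "\<And>p. p \<in> K \<Longrightarrow> p \<bullet> v \<le> 1" and eq: "f t \<bullet> v = 1"
  shows "d = of_real (cross (f t) d) * \<i> * v"
proof -
  have "((\<lambda>s. f s \<bullet> v) has_real_derivative d \<bullet> v) (at t)"
    using bounded_linear.has_vector_derivative[OF bounded_linear_inner_left d, of v]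
    by (simp add: has_real_derivative_iff_has_vector_derivative)
  then have "d \<bullet> v = 0"
  proof (rule DERIV_local_max)
    show "min (t - a) (b - t) > 0" using t by simp
    show "\<forall>y. \<bar>t - y\<bar> < min (t - a) (b - t) \<longrightarrow> f y \<bullet> v \<le> f t \<bullet> v"
    proof (intro allI impI)
      fix y assume "\<bar>t - y\<bar> < min (t - a) (b - t)"
      then have "y \<in> {a<..<b}" by auto
      then show "f y \<bullet> v \<le> f t \<bullet> v" using le[OF fK] eq by simp
    qed
  qed
  then have z: "Re d * Re v + Im d * Im v = 0" and o: "Re (f t) * Re v + Im (f t) * Im v = 1"
    using eq by (simp_all add: inner_complex_def)
  have "- (cross (f t) d * Im v) - Re d * 1 = - Re (f t) * 0"
    unfolding z[symmetric] o[symmetric] cross_def by (simp add: algebra_simps)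
  moreover have "cross (f t) d * Re v - Im d * 1 = - Im (f t) * 0"
    unfolding z[symmetric] o[symmetric] cross_def by (simp add: algebra_simps)
  ultimately show ?thesis by (simp add: complex_eq_iff)
qed

lemma AE_not_endpoint: "AE t in lborel. t \<noteq> (a::real)"
  by (rule AE_lborel_if_negligible[where N = "{a}"]) auto

context isoperimetric
begin

lemma e_frontier: "t \<in> {0..T} \<Longrightarrow> e t \<in> frontier K"
proof -
  assume t: "t \<in> {0..T}"
  then have "e (T * (t / T)) \<in> path_image (\<lambda>s. e (T * s))"
    unfolding path_image_def using T_pos by (intro imageI) simp
  then show ?thesis using T_pos by (simp add: e_image)
qed

lemma frontier_e: "p \<in> frontier K \<Longrightarrow> \<exists>t\<in>{0..T}. e t = p"
  using T_pos unfolding e_image[symmetric] path_image_def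
  by (auto intro!: bexI[of _ "T * _"] mult_left_le)

lemma e_in_K: "t \<in> {0..T} \<Longrightarrow> e t \<in> K"
  using e_frontier frontier_subset by blast

lemma w_le: "t \<in> {0..T} \<Longrightarrow> p \<in> K \<Longrightarrow> p \<bullet> w t \<le> 1"
  using m_ge m_w by metis

text \<open>The boundary point \<open>e t\<close> maximizes the inner product with
  \<open>w t\<close> over \<open>K\<close>, so the velocity is a multiple of \<open>w t\<close>
  turned by a right angle; unit sector speed fixes the factor as 1.\<close>

lemma e_derivative: "AE t in lborel. t \<in> {0..T} \<longrightarrow> (e has_vector_derivative \<i> * w t) (at t)"
  using e_cross AE_not_endpoint[of 0] AE_not_endpoint[of T]
proof eventually_elim
  case (elim t)
  show ?case
  proof
    assume t: "t \<in> {0..T}"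
    with elim obtain d where d: "(e has_vector_derivative d) (at t)" "cross (e t) d = 1" by blast
    have "d = of_real (cross (e t) d) * \<i> * w t"
      by (rule tangent_eq_turned_normal[OF d(1) _ _ w_le[OF t] e_w[OF t], of 0 T])
         (use elim t in \<open>auto intro: e_in_K\<close>)
    with d show "(e has_vector_derivative \<i> * w t) (at t)" by simp
  qed
qed

text \<open>Turning the boundary of \<open>K\<close> by \<open>- pi / 2\<close> makes its tangent a
  multiple of \<open>w\<close>, where the gauge \<open>m\<close> is 1. Up to the factor
  \<open>R\<close> the gauge of the velocity is thus the cross product with the radius from the
  centre \<open>z\<close>, whose integral is known. The multiple \<open>?s\<close> has to be
  nonnegative, and this is where the orientation enters.\<close>

lemma length_extremal:
  fixes c :: "real \<Rightarrow> complex"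
  assumes R: "R > 0" and \<mu>: "\<mu> > r" and z: "Im z = R * \<mu>"
    and lip: "B-lipschitz_on {0..1} c" and simple: "simple_path c" and closed: "pathfinish c = pathstart c"
    and image: "path_image c = placed R z ` frontier K" and pos: "positively_oriented c"
  shows "((\<lambda>t. m (vector_derivative c (at t)) / Im (c t)) has_integral \<mu> * F_area \<mu> + G_area \<mu>) {0..1}"
proof -
  define p where "p t = \<i> * (c t - z) / of_real R" for t
  have cp: "c = (\<lambda>t. placed R z (p t))" using placed_inverse[OF R] by (simp add: p_def)
  have sp: "simple_path p" "pathfinish p = pathstart p"
    using simple closed unfolding cp by (simp_all only: placed_path(1,2)[OF R])
  have lp: "(B / R)-lipschitz_on {0..1} p"
  proof (rule lipschitz_onI)
    show "dist (p x) (p y) \<le> B / R * dist x y" if "x \<in> {0..1}" "y \<in> {0..1}" for x y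
    proof -
      have "R * dist (p x) (p y) = dist (c x) (c y)" unfolding cp by (rule dist_placed[OF R, symmetric])
      also have "\<dots> \<le> B * dist x y" using lipschitz_onD[OF lip that] .
      finally show ?thesis using R by (simp add: field_simps)
    qed
    show "0 \<le> B / R" using R lipschitz_on_nonneg[OF lip] by simp
  qed
  have ip: "path_image p = frontier K"
  proof -
    have "placed R z ` path_image p = placed R z ` frontier K"
      using image unfolding cp by (simp only: placed_path(3)[OF R])
    then show ?thesis using inj_image_eq_iff[OF inj_placed[OF R]] by blast
  qed
  have pp: "positively_oriented p"
    using pos positively_oriented_placed[OF R lp sp, of z] unfolding cp by simp
  have dp: "AE t in lborel. t \<in> {0..1} \<longrightarrow> (p has_vector_derivative vector_derivative p (at t)) (at t)"
    by (rule lipschitz_ae_vector_derivative(1)[OF lp])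
  have cr: "AE t in lborel. t \<in> {0..1} \<longrightarrow> cross (p t) (vector_derivative p (at t)) \<ge> 0"
    by (rule cross_nonneg_if_positively_oriented[OF lp sp ip pp dp])
  have pK: "p s \<in> frontier K" if "s \<in> {0..1}" for s using ip that by (auto simp: path_image_def)
  have "AE t in lborel. t \<in> {0..1} \<longrightarrow> m (vector_derivative c (at t)) / Im (c t) = cross (c t - z) (vector_derivative c (at t)) / (R * Im (c t))"
    using dp cr AE_not_endpoint[of 0] AE_not_endpoint[of 1]
  proof eventually_elim
    case (elim t)
    show ?case
    proof
      assume t: "t \<in> {0..1}"
      let ?d = "vector_derivative p (at t)" and ?s = "cross (p t) (vector_derivative p (at t))"
      obtain \<theta> where \<theta>: "\<theta> \<in> {0..T}" "e \<theta> = p t" using frontier_e[OF pK[OF t]] by blast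
      have d: "?d = of_real ?s * \<i> * w \<theta>"
      proof (rule tangent_eq_turned_normal)
        show "(p has_vector_derivative ?d) (at t)" using elim t by blast
        show "t \<in> {0<..<1}" using elim t by simp
        show "p s \<in> K" if "s \<in> {0<..<1}" for s using pK[of s] that frontier_subset by auto
        show "q \<bullet> w \<theta> \<le> 1" if "q \<in> K" for q by (rule w_le[OF \<theta>(1) that])
        show "p t \<bullet> w \<theta> = 1" using e_w[OF \<theta>(1)] \<theta>(2) by simp
      qed
      have c': "vector_derivative c (at t) = - \<i> * of_real R * ?d"
        unfolding cp using elim t by (intro vector_derivative_at placed_path(5)[OF R]) simp
      have "- \<i> * of_real R * ?d = (R * ?s) *\<^sub>R w \<theta>"
        by (subst d) (simp add: complex_eq_iff)
      then have "m (vector_derivative c (at t)) = R * ?s"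
        using m_scaleR[of "R * ?s" "w \<theta>"] m_w[OF \<theta>(1)] R elim t by (simp add: c')
      moreover have "cross (c t - z) (vector_derivative c (at t)) = R\<^sup>2 * ?s"
        unfolding c' by (subst cross_turn[symmetric]) (simp add: cp placed_def)
      ultimately show "m (vector_derivative c (at t)) / Im (c t) = cross (c t - z) (vector_derivative c (at t)) / (R * Im (c t))"
        using R by (simp add: power2_eq_square)
    qed
  qed
  from has_integral_AE[OF this] show ?thesis
    using extremal_integrals(3)[OF R \<mu> z lip simple closed image pos] by blast
qed

lemma e_path:
  "\<exists>B. B-lipschitz_on {0..1} (\<lambda>s. e (T * s))"
  "pathfinish (\<lambda>s. e (T * s)) = pathstart (\<lambda>s. e (T * s))"
  "positively_oriented (\<lambda>s. e (T * s))"
  "AE s in lborel. s \<in> {0..1} \<longrightarrow> ((\<lambda>s. e (T * s)) has_vector_derivative of_real T * \<i> * w (T * s)) (at s)"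
proof -
  obtain B where B: "B-lipschitz_on UNIV e" using e_lipschitz by blast
  have lip: "(B * \<bar>T\<bar>)-lipschitz_on {0..1} (\<lambda>s. e (T * s))"
    by (rule lipschitz_on_scale_arg[OF B])
  then show "\<exists>B. B-lipschitz_on {0..1} (\<lambda>s. e (T * s))" by blast
  show cl: "pathfinish (\<lambda>s. e (T * s)) = pathstart (\<lambda>s. e (T * s))"
    by (simp add: pathfinish_def pathstart_def e_closed)
  have "AE s in lborel. 0 + T * s \<in> {0..T} \<longrightarrow> (e has_vector_derivative \<i> * w (0 + T * s)) (at (0 + T * s))"
    by (rule AE_lborel_affine[OF e_derivative]) (use T_pos in simp)
  then show ae: "AE s in lborel. s \<in> {0..1} \<longrightarrow> ((\<lambda>s. e (T * s)) has_vector_derivative of_real T * \<i> * w (T * s)) (at s)"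
  proof eventually_elim
    case (elim s)
    show ?case
    proof
      assume s: "s \<in> {0..1}"
      then have "T * s \<in> {0..T}" using T_pos by (auto intro: mult_left_le)
      with elim have "(e has_vector_derivative \<i> * w (T * s)) (at (T * s))" by simp
      moreover have "((\<lambda>s. T * s) has_vector_derivative T) (at s)"
        by (auto intro!: derivative_eq_intros simp: has_real_derivative_iff_has_vector_derivative[symmetric])
      ultimately have "((e \<circ> (\<lambda>s. T * s)) has_vector_derivative T *\<^sub>R (\<i> * w (T * s))) (at s)"
        by (rule vector_diff_chain_at[rotated])
      then show "((\<lambda>s. e (T * s)) has_vector_derivative of_real T * \<i> * w (T * s)) (at s)"
        by (simp add: o_def scaleR_conv_of_real mult.assoc)
    qed
  qed
  have "((\<lambda>s. cross (e (T * s)) (vector_derivative (\<lambda>s. e (T * s)) (at s))) has_integral T) {0..1}"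
  proof (subst has_integral_AE)
    show "AE s in lborel. s \<in> {0..1} \<longrightarrow> cross (e (T * s)) (vector_derivative (\<lambda>s. e (T * s)) (at s)) = T"
      using ae
    proof eventually_elim
      case (elim s)
      show ?case
      proof
        assume s: "s \<in> {0..1}"
        then have "T * s \<in> {0..T}" using T_pos by (auto intro: mult_left_le)
        from e_w[OF this] have "T * (Re (e (T * s)) * Re (w (T * s)) + Im (e (T * s)) * Im (w (T * s))) = T"
          by (simp add: inner_complex_def)
        then show "cross (e (T * s)) (vector_derivative (\<lambda>s. e (T * s)) (at s)) = T"
          using elim s by (simp add: vector_derivative_at cross_def algebra_simps)
      qed
    qed
    show "((\<lambda>s. T) has_integral T) {0..1::real}" using has_integral_const_real[of T 0 1] by simp
  qed
  from positively_oriented_iff(1)[OF lip e_simple cl this] T_pos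
  show "positively_oriented (\<lambda>s. e (T * s))" by simp
qed

lemma extremal_parametrization:
  assumes R: "R > 0"
  shows "lipschitz_parametrization (\<lambda>s. placed R z (e (T * s))) (placed R z ` frontier K)"
    and "positively_oriented (\<lambda>s. placed R z (e (T * s)))"
proof -
  obtain B where B: "B-lipschitz_on {0..1} (\<lambda>s. e (T * s))" using e_path(1) by blast
  show "positively_oriented (\<lambda>s. placed R z (e (T * s)))"
    using positively_oriented_placed[OF R B e_simple e_path(2)] e_path(3) by blast
  show "lipschitz_parametrization (\<lambda>s. placed R z (e (T * s))) (placed R z ` frontier K)"
    unfolding lipschitz_parametrization_def placed_path(1-3)[OF R] e_image
    using e_simple e_path(2) placed_path(4)[OF R B] by blast
qed

text \<open>Both integrals are read off from one extremal contour, the one with \<open>R = 1\<close>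
  and centre \<open>\<i> * \<mu>\<close>, parametrized by \<open>e\<close> itself: its velocity is
  \<open>T\<close> times \<open>w\<close> and its height is \<open>\<mu> - Re e\<close>.\<close>

lemma length_integral:
  assumes \<mu>: "\<mu> > r"
  shows "((\<lambda>t. 1 / (\<mu> - Re (e t))) has_integral \<mu> * F_area \<mu> + G_area \<mu>) {0..T}"
    and "((\<lambda>t. Re (w t) / (\<mu> - Re (e t))) has_integral F_area \<mu>) {0..T}"
proof -
  let ?c = "\<lambda>s. placed 1 (\<i> * of_real \<mu>) (e (T * s))"
  note ep = extremal_parametrization[of 1 "\<i> * of_real \<mu>", OF zero_less_one]
  obtain B where c: "B-lipschitz_on {0..1} ?c" "simple_path ?c" "pathfinish ?c = pathstart ?c"
      "path_image ?c = placed 1 (\<i> * of_real \<mu>) ` frontier K"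
    using ep(1) unfolding lipschitz_parametrization_def by blast
  have Im: "Im (\<i> * of_real \<mu>) = 1 * \<mu>" by simp
  note l = length_extremal[OF zero_less_one \<mu> Im c ep(2)] extremal_integrals(1)[OF zero_less_one \<mu> Im c ep(2)]
  have ae: "AE s in lborel. s \<in> {0..1} \<longrightarrow> vector_derivative ?c (at s) = T *\<^sub>R w (T * s) \<and> T * s \<in> {0..T}"
    using e_path(4)
  proof eventually_elim
    case (elim s)
    show ?case
    proof (intro impI conjI)
      assume s: "s \<in> {0..1}"
      have "(?c has_vector_derivative - \<i> * of_real 1 * (of_real T * \<i> * w (T * s))) (at s)"
        by (rule placed_path(5)) (use elim s in auto)
      also have "- \<i> * of_real 1 * (of_real T * \<i> * w (T * s)) = T *\<^sub>R w (T * s)"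
        by (simp add: complex_eq_iff)
      finally show "vector_derivative ?c (at s) = T *\<^sub>R w (T * s)" by (rule vector_derivative_at)
      show "T * s \<in> {0..T}" using s T_pos by (auto intro: mult_left_le)
    qed
  qed
  have stretch: "(f has_integral I) {0..T}"
    if "((\<lambda>s. T * f (T * s)) has_integral I) {0..1}" for f :: "real \<Rightarrow> real" and I
  proof -
    have "((\<lambda>s. T * f (T * s)) has_integral I) (cbox 0 1)" using that by simp
    from has_integral_mult_right[OF has_integral_affinity'[OF this, of "1 / T" 0], of "1 / T"]
    show ?thesis using T_pos by (simp add: field_simps)
  qed
  show "((\<lambda>t. 1 / (\<mu> - Re (e t))) has_integral \<mu> * F_area \<mu> + G_area \<mu>) {0..T}"
  proof (rule stretch)
    have "AE s in lborel. s \<in> {0..1} \<longrightarrow> m (vector_derivative ?c (at s)) / Im (?c s) = T * (1 / (\<mu> - Re (e (T * s))))"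
      using ae
    proof eventually_elim
      case (elim s)
      then show ?case using T_pos m_scaleR[of T "w (T * s)"] m_w[of "T * s"] by auto
    qed
    from has_integral_AE[OF this] l(1)
    show "((\<lambda>s. T * (1 / (\<mu> - Re (e (T * s))))) has_integral \<mu> * F_area \<mu> + G_area \<mu>) {0..1}" by blast
  qed
  show "((\<lambda>t. Re (w t) / (\<mu> - Re (e t))) has_integral F_area \<mu>) {0..T}"
  proof (rule stretch)
    have "AE s in lborel. s \<in> {0..1} \<longrightarrow> Re (vector_derivative ?c (at s)) / Im (?c s) = T * (Re (w (T * s)) / (\<mu> - Re (e (T * s))))"
      using ae by eventually_elim auto
    from has_integral_AE[OF this] l(2)
    show "((\<lambda>s. T * (Re (w (T * s)) / (\<mu> - Re (e (T * s))))) has_integral F_area \<mu>) {0..1}" by blast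
  qed
qed

end

section \<open>Length and area of the extremals as functions of their parameter\<close>

lemma bij_betw_decreasing:
  fixes f :: "real \<Rightarrow> real"
  assumes cont: "continuous_on {r<..} f" and dec: "\<And>a b. r < a \<Longrightarrow> a < b \<Longrightarrow> f b < f a"
    and pos: "\<And>a. r < a \<Longrightarrow> 0 < f a"
    and large: "\<And>y::real. 0 < y \<Longrightarrow> \<exists>a>r. y < f a" and small: "\<And>y::real. 0 < y \<Longrightarrow> \<exists>a>r. f a < y"
  shows "bij_betw f {r<..} {0<..}"
proof (rule bij_betw_imageI)
  have d: "f a = f b \<Longrightarrow> a = b" if "r < a" "r < b" for a b
    using dec[of a b] dec[of b a] that by (cases a b rule: linorder_cases) auto
  then show "inj_on f {r<..}" by (auto simp: inj_on_def)
  show "f ` {r<..} = {0<..}"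
  proof (intro equalityI subsetI)
    fix y :: real assume "y \<in> {0<..}"
    then obtain a b where ab: "r < a" "y < f a" "r < b" "f b < y" using large[of y] small[of y] by auto
    have "a < b"
    proof (rule ccontr)
      assume "\<not> a < b"
      then show False using dec[of b a] ab by (cases "a = b") auto
    qed
    then have "\<exists>x\<ge>a. x \<le> b \<and> f x = y"
      using ab by (intro IVT2' continuous_on_subset[OF cont]) auto
    then show "y \<in> f ` {r<..}" using ab by (auto intro!: imageI)
  qed (use pos in auto)
qed

lemma (in convex_body) measure_K_pos: "measure lborel K > 0" and measure_K: "((\<lambda>p. c) has_integral c * measure lborel K) K"
proof -
  obtain \<rho> where \<rho>: "\<rho> > 0" "cball 0 \<rho> \<subseteq> K" using inner_radius .
  have Kb: "K \<in> sets borel" using compact_imp_closed[OF compact_K] by simp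
  have fin: "emeasure lborel K < \<infinity>" using compact_K by (intro emeasure_bounded_finite compact_imp_bounded)
  have "measure lborel (cball (0::complex) \<rho>) \<noteq> 0" using \<rho>(1) by simp
  then have "0 < measure lborel (cball (0::complex) \<rho>)" by (simp add: less_le)
  also have "\<dots> \<le> measure lborel K"
    by (rule measure_mono_fmeasurable[OF \<rho>(2) _ fmeasurableI]) (use Kb fin in auto)
  finally show "measure lborel K > 0" .
  from has_integral_mult_right[OF has_integral_measure_lborel[OF Kb fin], of c]
  show "((\<lambda>p. c) has_integral c * measure lborel K) K" by simp
qed

context isoperimetric
begin

text \<open>The common length of all extremal contours with parameter \<mu>, by
  \<open>length_extremal\<close>.\<close>

definition L :: "real \<Rightarrow> real" where "L \<mu> = \<mu> * F_area \<mu> + G_area \<mu>"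

lemma F_area_has_integral: "\<mu> > r \<Longrightarrow> ((\<lambda>p. 1 / (\<mu> - Re p)\<^sup>2) has_integral F_area \<mu>) K"
  unfolding F_area_def by (rule integrable_integral[OF set_borel_integral_eq_integral(1)[OF F_area_integral(2)]])

lemma G_area_has_integral: "\<mu> > r \<Longrightarrow> ((\<lambda>p. 1 / (\<mu> - Re p)) has_integral G_area \<mu>) K"
  unfolding G_area_def by (rule integrable_integral[OF set_borel_integral_eq_integral(1)[OF G_area_integral(2)]])

lemma F_area_pos: "\<mu> > r \<Longrightarrow> F_area \<mu> > 0"
proof -
  assume \<mu>: "\<mu> > r"
  have "1 / (\<mu> - l)\<^sup>2 * measure lborel K \<le> F_area \<mu>"
  proof (rule has_integral_le[OF measure_K F_area_has_integral[OF \<mu>]])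
    fix p assume "p \<in> K"
    with \<mu> Re_bounds[of p] show "1 / (\<mu> - l)\<^sup>2 \<le> 1 / (\<mu> - Re p)\<^sup>2"
      by (intro divide_left_mono power_mono) auto
  qed
  moreover have "0 < 1 / (\<mu> - l)\<^sup>2 * measure lborel K" using \<mu> l_neg r_pos measure_K_pos by simp
  ultimately show ?thesis by linarith
qed

lemma G_area_pos: "\<mu> > r \<Longrightarrow> G_area \<mu> \<ge> 0"
  by (rule has_integral_nonneg[OF G_area_has_integral]) (use Re_bounds in force)+

text \<open>For each \<open>p\<close> the convex function \<open>1 / (\<kappa> - Re p)\<close> of
  \<kappa> lies above its tangent at \<mu>, whose slope is
  \<open>- 1 / (\<mu> - Re p)\<^sup>2\<close>. Integration over \<open>K\<close> gives the
  inequality, strict because the gap has a positive lower bound.\<close>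

lemma L_less:
  assumes "\<kappa> > r" "\<mu> > r" "\<kappa> \<noteq> \<mu>"
  shows "L \<mu> < \<kappa> * F_area \<mu> + G_area \<kappa>"
proof -
  \<comment> \<open>The gap is \<open>(\<kappa> - \<mu>)\<^sup>2 / (a * b\<^sup>2)\<close> with
    \<open>a = \<kappa> - Re p\<close> and \<open>b = \<mu> - Re p\<close>; replacing
    \<open>Re p\<close> by the left end \<open>l\<close> makes the denominator largest.\<close>
  define d where "d = (\<kappa> - \<mu>)\<^sup>2 / ((\<kappa> - l) * (\<mu> - l)\<^sup>2)"
  have "((\<lambda>p. (\<kappa> - \<mu>) * (1 / (\<mu> - Re p)\<^sup>2) + 1 / (\<kappa> - Re p) - 1 / (\<mu> - Re p)) has_integral
      (\<kappa> - \<mu>) * F_area \<mu> + G_area \<kappa> - G_area \<mu>) K"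
    by (intro has_integral_diff has_integral_add has_integral_mult_right F_area_has_integral G_area_has_integral assms)
  then have "d * measure lborel K \<le> (\<kappa> - \<mu>) * F_area \<mu> + G_area \<kappa> - G_area \<mu>"
  proof (rule has_integral_le[OF measure_K])
    fix p assume "p \<in> K"
    with assms Re_bounds[of p] have p: "\<kappa> - Re p > 0" "\<mu> - Re p > 0" "\<kappa> - Re p \<le> \<kappa> - l" "\<mu> - Re p \<le> \<mu> - l" by auto
    have "(a - b) * (1 / b\<^sup>2) + 1 / a - 1 / b = (a - b)\<^sup>2 / (a * b\<^sup>2)" if "a > 0" "b > 0" for a b :: real
      using that by (simp add: divide_simps power2_eq_square) (simp add: algebra_simps)
    from this[OF p(1,2)]
    have "(\<kappa> - \<mu>) * (1 / (\<mu> - Re p)\<^sup>2) + 1 / (\<kappa> - Re p) - 1 / (\<mu> - Re p) = (\<kappa> - \<mu>)\<^sup>2 / ((\<kappa> - Re p) * (\<mu> - Re p)\<^sup>2)"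
      by simp
    also have "d \<le> \<dots>" unfolding d_def
      using p by (intro divide_left_mono mult_mono power_mono mult_pos_pos) auto
    finally show "d \<le> (\<kappa> - \<mu>) * (1 / (\<mu> - Re p)\<^sup>2) + 1 / (\<kappa> - Re p) - 1 / (\<mu> - Re p)" .
  qed
  moreover have "d > 0" unfolding d_def using assms l_neg r_pos by (intro divide_pos_pos mult_pos_pos) auto
  ultimately show ?thesis using measure_K_pos mult_pos_pos[of d "measure lborel K"]
    unfolding L_def left_diff_distrib by linarith
qed

text \<open>Two instances of \<open>L_less\<close> with exchanged parameters are added: the values
  of \<open>G_area\<close> cancel, and \<open>(b - a) * (F_area a - F_area b)\<close> comes out
  positive.\<close>

lemma F_area_decreasing: "r < a \<Longrightarrow> a < b \<Longrightarrow> F_area b < F_area a"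
proof -
  assume ab: "r < a" "a < b"
  then have "L a < b * F_area a + G_area b" "L b < a * F_area b + G_area a"
    using L_less by auto
  then have "(b - a) * F_area b < (b - a) * F_area a" by (simp add: L_def algebra_simps)
  with ab show ?thesis by simp
qed

lemma L_decreasing: "r < a \<Longrightarrow> a < b \<Longrightarrow> L b < L a"
proof -
  assume ab: "r < a" "a < b"
  then have "L b < a * F_area b + G_area a" using L_less by auto
  also have "\<dots> < L a" using F_area_decreasing[OF ab] ab r_pos by (simp add: L_def)
  finally show ?thesis .
qed

lemma L_pos: "\<mu> > r \<Longrightarrow> L \<mu> > 0"
  unfolding L_def using r_pos F_area_pos G_area_pos by (intro add_pos_nonneg mult_pos_pos) auto

lemma continuous_F_area: "continuous_on {r<..} F_area" and continuous_G_area: "continuous_on {r<..} G_area"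
proof -
  let ?u = "\<lambda>s. upper_fibre K s - lower_fibre K s"
  have u: "continuous_on {l..r} ?u"
    by (intro continuous_intros upper_fibre_continuous lower_fibre_continuous compact_K convex_K Re_image)
  have u2: "continuous_on ({r<..} \<times> {l..r}) (\<lambda>x. ?u (snd x))"
    by (rule continuous_on_compose2[OF u]) (auto intro!: continuous_intros)
  have "continuous_on {r<..} (\<lambda>\<mu>. integral (cbox l r) (\<lambda>s. ?u s * (1 / (\<mu> - s)\<^sup>2)))"
    by (rule integral_continuous_on_param)
       (auto simp: case_prod_beta intro!: continuous_intros u2)
  then show "continuous_on {r<..} F_area"
    by (rule continuous_on_eq) (use integral_unique[OF F_area_integral(1)] in simp)
  have "continuous_on {r<..} (\<lambda>\<mu>. integral (cbox l r) (\<lambda>s. ?u s * (1 / (\<mu> - s))))"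
    by (rule integral_continuous_on_param)
       (auto simp: case_prod_beta intro!: continuous_intros u2)
  then show "continuous_on {r<..} G_area"
    by (rule continuous_on_eq) (use integral_unique[OF G_area_integral(1)] in simp)
qed

lemma F_area_le: "\<mu> > r \<Longrightarrow> F_area \<mu> \<le> measure lborel K / (\<mu> - r)\<^sup>2"
  and G_area_le: "\<mu> > r \<Longrightarrow> G_area \<mu> \<le> measure lborel K / (\<mu> - r)"
proof -
  assume \<mu>: "\<mu> > r"
  have "F_area \<mu> \<le> 1 / (\<mu> - r)\<^sup>2 * measure lborel K"
  proof (rule has_integral_le[OF F_area_has_integral[OF \<mu>] measure_K])
    fix p assume "p \<in> K"
    with \<mu> Re_bounds[of p] show "1 / (\<mu> - Re p)\<^sup>2 \<le> 1 / (\<mu> - r)\<^sup>2"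
      by (intro divide_left_mono power_mono) auto
  qed
  then show "F_area \<mu> \<le> measure lborel K / (\<mu> - r)\<^sup>2" by simp
  have "G_area \<mu> \<le> 1 / (\<mu> - r) * measure lborel K"
  proof (rule has_integral_le[OF G_area_has_integral[OF \<mu>] measure_K])
    fix p assume "p \<in> K"
    with \<mu> Re_bounds[of p] show "1 / (\<mu> - Re p) \<le> 1 / (\<mu> - r)"
      by (intro divide_left_mono) auto
  qed
  then show "G_area \<mu> \<le> measure lborel K / (\<mu> - r)" by simp
qed

lemma F_area_small: "y > 0 \<Longrightarrow> \<exists>a>r. F_area a < y" and L_small: "y > 0 \<Longrightarrow> \<exists>a>r. L a < y"
proof -
  assume y: "y > 0"
  have t: "((\<lambda>\<mu>. measure lborel K / (\<mu> - r)\<^sup>2) \<longlongrightarrow> 0) at_top"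
    "((\<lambda>\<mu>. \<mu> * (measure lborel K / (\<mu> - r)\<^sup>2) + measure lborel K / (\<mu> - r)) \<longlongrightarrow> 0) at_top"
    by real_asymp+
  have "eventually (\<lambda>\<mu>. measure lborel K / (\<mu> - r)\<^sup>2 < y \<and> \<mu> > r) at_top"
    using order_tendstoD(2)[OF t(1) y] eventually_gt_at_top[of r] by eventually_elim simp
  then obtain \<mu> where "measure lborel K / (\<mu> - r)\<^sup>2 < y" "\<mu> > r"
    using eventually_happens'[OF trivial_limit_at_top_linorder] by blast
  then show "\<exists>a>r. F_area a < y" using F_area_le[of \<mu>] by (intro exI[of _ \<mu>]) simp
  have "eventually (\<lambda>\<mu>. \<mu> * (measure lborel K / (\<mu> - r)\<^sup>2) + measure lborel K / (\<mu> - r) < y \<and> \<mu> > r) at_top"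
    using order_tendstoD(2)[OF t(2) y] eventually_gt_at_top[of r] by eventually_elim simp
  then obtain \<nu> where \<nu>: "\<nu> * (measure lborel K / (\<nu> - r)\<^sup>2) + measure lborel K / (\<nu> - r) < y" "\<nu> > r"
    using eventually_happens'[OF trivial_limit_at_top_linorder] by blast
  then have "\<nu> * F_area \<nu> \<le> \<nu> * (measure lborel K / (\<nu> - r)\<^sup>2)"
    using F_area_le[of \<nu>] r_pos by (intro mult_left_mono) auto
  then show "\<exists>a>r. L a < y" using \<nu> G_area_le[of \<nu>] by (intro exI[of _ \<nu>]) (simp add: L_def)
qed

text \<open>\<open>K\<close> contains a triangle with a vertex on the line \<open>Re p = r\<close>, over which the integral
  of \<open>1 / (\<mu> - Re p)\<^sup>2\<close> diverges logarithmically as \<open>\<mu>\<close> decreases to \<open>r\<close>.\<close>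

lemma F_area_large: "\<exists>a>r. y < F_area a"
proof -
  obtain \<rho> where \<rho>: "\<rho> > 0" "cball 0 \<rho> \<subseteq> K" using inner_radius .
  have K: "0 \<in> K" "Complex 0 \<rho> \<in> K" using \<rho> by (auto intro!: subsetD[OF \<rho>(2)] simp: cmod_def)
  let ?u = "\<lambda>s. upper_fibre K s - lower_fibre K s"
  have in0: "0 \<in> Re ` K" "r \<in> Re ` K" using l_neg r_pos by (simp_all add: Re_image)
  have u0: "?u 0 \<ge> \<rho>"
    using compact_attains_upper_fibre(2)[OF compact_K in0(1) K(2)]
      compact_attains_lower_fibre(2)[OF compact_K in0(1), of 0] K(1) by (simp add: complex_eq_iff zero_complex.code)
  have ur: "?u s \<ge> 0" if "s \<in> {l..r}" for s
    using compact_attains_upper_fibre(2)[OF compact_K _ compact_attains_lower_fibre(1)[OF compact_K], of s] that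
    by (simp add: Re_image)
  \<comment> \<open>The fibre length is concave, at least \<rho> at 0 and nonnegative at
    \<open>r\<close>, so on \<open>{0..r}\<close> it lies above the line that falls from \<rho> to
    0.\<close>
  have width: "?u s \<ge> \<rho> / r * (r - s)" if s: "s \<in> {0..r}" for s
  proof -
    have th: "0 \<le> s / r" "s / r \<le> 1" using s r_pos by auto
    have eq: "(1 - s / r) * 0 + s / r * r = s" using r_pos by simp
    have "(1 - s / r) * upper_fibre K 0 + s / r * upper_fibre K r \<le> upper_fibre K s"
      using upper_fibre_concave(2)[OF compact_K convex_K in0 th] unfolding eq .
    moreover have "lower_fibre K s \<le> (1 - s / r) * lower_fibre K 0 + s / r * lower_fibre K r"
    proof (rule compact_attains_lower_fibre(2)[OF compact_K])
      show "s \<in> Re ` K" using s l_neg by (simp add: Re_image)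
      have "(1 - s / r) *\<^sub>R Complex 0 (lower_fibre K 0) + (s / r) *\<^sub>R Complex r (lower_fibre K r) \<in> K"
        using th by (intro convexD[OF convex_K] compact_attains_lower_fibre(1)[OF compact_K] in0) auto
      moreover have "(1 - s / r) *\<^sub>R Complex 0 (lower_fibre K 0) + (s / r) *\<^sub>R Complex r (lower_fibre K r)
          = Complex s ((1 - s / r) * lower_fibre K 0 + s / r * lower_fibre K r)"
        using r_pos by (simp add: complex_eq_iff)
      ultimately show "Complex s ((1 - s / r) * lower_fibre K 0 + s / r * lower_fibre K r) \<in> K" by simp
    qed
    ultimately have "(1 - s / r) * ?u 0 + s / r * ?u r \<le> ?u s" by (simp add: algebra_simps)
    moreover have "(1 - s / r) * \<rho> \<le> (1 - s / r) * ?u 0" using th u0 by (intro mult_left_mono) auto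
    moreover have "0 \<le> s / r * ?u r" using th ur[of r] l_neg r_pos by (intro mult_nonneg_nonneg) auto
    moreover have "(1 - s / r) * \<rho> = \<rho> / r * (r - s)" using r_pos by (simp add: field_simps)
    ultimately show ?thesis by linarith
  qed
  \<comment> \<open>With \<open>q = r + \<epsilon> - s\<close> the integrand
    \<open>(r - s) / q\<^sup>2\<close> is \<open>1 / q - \<epsilon> / q\<^sup>2\<close>, which has
    the primitive \<open>- ln q - \<epsilon> / q\<close> in \<open>s\<close>; the logarithm supplies
    the divergence.\<close>
  have bound: "\<rho> / r * (ln (r / \<epsilon>) - 1) \<le> F_area (r + \<epsilon>)" if \<epsilon>: "\<epsilon> > 0" for \<epsilon>
  proof -
    let ?\<mu> = "r + \<epsilon>"
    have i: "((\<lambda>s. (r - s) * (1 / (?\<mu> - s)\<^sup>2)) has_integral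
        (- ln (?\<mu> - r) - \<epsilon> / (?\<mu> - r)) - (- ln (?\<mu> - 0) - \<epsilon> / (?\<mu> - 0))) {0..r}"
    proof (rule fundamental_theorem_of_calculus)
      show "0 \<le> r" using r_pos by simp
      fix s assume s: "s \<in> {0..r}"
      have "- ((0 - 1) / q) - (0 * q - \<epsilon> * (0 - 1)) / (q * q) = (q - \<epsilon>) * (1 / q\<^sup>2)" if "q > 0" for q :: real
        using that by (simp add: field_simps power2_eq_square)
      from this[of "?\<mu> - s"] have "((\<lambda>s. - ln (?\<mu> - s) - \<epsilon> / (?\<mu> - s)) has_real_derivative (r - s) * (1 / (?\<mu> - s)\<^sup>2)) (at s)"
        using s \<epsilon> by (auto intro!: derivative_eq_intros simp: divide_inverse mult_ac)
      then show "((\<lambda>s. - ln (?\<mu> - s) - \<epsilon> / (?\<mu> - s)) has_vector_derivative (r - s) * (1 / (?\<mu> - s)\<^sup>2)) (at s within {0..r})"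
        by (simp add: has_real_derivative_iff_has_vector_derivative has_vector_derivative_at_within)
    qed
    have "((\<lambda>s. ?u s * (1 / (?\<mu> - s)\<^sup>2)) has_integral F_area ?\<mu>) {l..r}"
      using \<epsilon> by (intro F_area_integral(1)) simp
    then have I: "(\<lambda>s. ?u s * (1 / (?\<mu> - s)\<^sup>2)) integrable_on {l..r}" "integral {l..r} (\<lambda>s. ?u s * (1 / (?\<mu> - s)\<^sup>2)) = F_area ?\<mu>"
      by (auto simp: has_integral_iff)
    have I0: "(\<lambda>s. ?u s * (1 / (?\<mu> - s)\<^sup>2)) integrable_on {0..r}"
      by (rule integrable_subinterval_real[OF I(1)]) (use l_neg in auto)
    have "\<rho> / r * ((- ln (?\<mu> - r) - \<epsilon> / (?\<mu> - r)) - (- ln (?\<mu> - 0) - \<epsilon> / (?\<mu> - 0))) \<le> integral {0..r} (\<lambda>s. ?u s * (1 / (?\<mu> - s)\<^sup>2))"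
    proof (rule has_integral_le[OF has_integral_mult_right[OF i] integrable_integral[OF I0]])
      fix s assume "s \<in> {0..r}"
      from mult_right_mono[OF width[OF this], of "1 / (?\<mu> - s)\<^sup>2"]
      show "\<rho> / r * ((r - s) * (1 / (?\<mu> - s)\<^sup>2)) \<le> ?u s * (1 / (?\<mu> - s)\<^sup>2)" by simp
    qed
    also have "\<dots> \<le> F_area ?\<mu>" unfolding I(2)[symmetric]
      by (rule integral_subset_le[OF _ I0 I(1)]) (use l_neg ur in auto)
    finally have "\<rho> / r * (ln ?\<mu> - ln \<epsilon> - 1 + \<epsilon> / ?\<mu>) \<le> F_area ?\<mu>" using \<epsilon> by (simp add: algebra_simps)
    moreover have "ln (r / \<epsilon>) - 1 \<le> ln ?\<mu> - ln \<epsilon> - 1 + \<epsilon> / ?\<mu>"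
      using \<epsilon> r_pos by (simp add: ln_div add_increasing2)
    ultimately show ?thesis
      using mult_left_mono[of "ln (r / \<epsilon>) - 1" "ln ?\<mu> - ln \<epsilon> - 1 + \<epsilon> / ?\<mu>" "\<rho> / r"] \<rho>(1) r_pos by simp
  qed
  \<comment> \<open>Chosen so that \<epsilon> = \<open>r * exp (- x)\<close> turns the lower bound
    into \<open>\<bar>y\<bar> + \<rho> / r\<close>.\<close>
  define x where "x = \<bar>y\<bar> * r / \<rho> + 2"
  have "\<rho> / r * (ln (r / (r * exp (- x))) - 1) = \<bar>y\<bar> + \<rho> / r"
    using r_pos \<rho>(1) by (simp add: x_def exp_minus field_simps)
  then have "y < \<rho> / r * (ln (r / (r * exp (- x))) - 1)" using \<rho>(1) r_pos divide_pos_pos[of \<rho> r] by linarith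
  also have "\<dots> \<le> F_area (r + r * exp (- x))" using r_pos by (intro bound) simp
  finally show ?thesis using r_pos by (intro exI[of _ "r + r * exp (- x)"]) simp
qed

lemma bij_F_area: "bij_betw F_area {r<..} {0<..}"
  by (rule bij_betw_decreasing) (use F_area_large F_area_small F_area_pos F_area_decreasing continuous_F_area in auto)

lemma bij_L: "bij_betw L {r<..} {0<..}"
proof (rule bij_betw_decreasing)
  show "continuous_on {r<..} L"
    unfolding L_def[abs_def] by (intro continuous_intros continuous_F_area continuous_G_area)
  show "\<exists>a>r. y < L a" for y
  proof -
    obtain a where a: "a > r" "y / r < F_area a" using F_area_large by blast
    then have "y < r * F_area a" using r_pos by (simp add: field_simps)
    also have "\<dots> \<le> a * F_area a" using a F_area_pos[of a] by (intro mult_right_mono) auto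
    also have "\<dots> \<le> L a" using G_area_pos[OF a(1)] by (simp add: L_def)
    finally show ?thesis using a by blast
  qed
qed (use L_small L_pos L_decreasing in auto)

end

text \<open>Substitution without monotonicity: a primitive of \<open>f\<close> composed with
  \<sigma> is Lipschitz, so an oscillating \<sigma> contributes only through its end values.\<close>

lemma has_integral_composed_lipschitz:
  fixes \<sigma> f :: "real \<Rightarrow> real"
  assumes f: "continuous_on {l..r} f" and lip: "B-lipschitz_on {a..b} \<sigma>" and "a \<le> b"
    and range: "\<And>t. t \<in> {a..b} \<Longrightarrow> \<sigma> t \<in> {l..r}"
    and ae: "AE t in lborel. t \<in> {a..b} \<longrightarrow> (\<sigma> has_vector_derivative d t) (at t)"
  shows "((\<lambda>t. f (\<sigma> t) * d t) has_integral (integral {l..\<sigma> b} f - integral {l..\<sigma> a} f)) {a..b}"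
proof -
  define \<Phi> where "\<Phi> s = integral {l..s} f" for s
  have d\<Phi>: "(\<Phi> has_vector_derivative f s) (at s within {l..r})" if "s \<in> {l..r}" for s
    unfolding \<Phi>_def by (rule integral_has_vector_derivative[OF f that])
  obtain C where C: "C-lipschitz_on {l..r} \<Phi>"
    using lipschitz_on_if_bounded_derivative[OF _ f, of \<Phi>] d\<Phi>
    by (auto simp: has_real_derivative_iff_has_vector_derivative)
  have "(C * B)-lipschitz_on {a..b} (\<lambda>t. \<Phi> (\<sigma> t))"
    using range by (intro lipschitz_on_compose2[OF lip lipschitz_on_subset[OF C]]) auto
  then have "((\<lambda>t. f (\<sigma> t) * d t) has_integral \<Phi> (\<sigma> b) - \<Phi> (\<sigma> a)) {a..b}"
  proof (rule lipschitz_has_integral_derivative[OF _ \<open>a \<le> b\<close>])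
    show "AE t in lborel. t \<in> {a..b} \<longrightarrow> ((\<lambda>t. \<Phi> (\<sigma> t)) has_vector_derivative f (\<sigma> t) * d t) (at t)"
      using ae AE_not_endpoint[of a] AE_not_endpoint[of b]
    proof eventually_elim
      case (elim t)
      show ?case
      proof
        assume t: "t \<in> {a..b}"
        then have t': "t \<in> {a<..<b}" using elim by simp
        have 1: "(\<sigma> has_vector_derivative d t) (at t within {a<..<b})"
          using elim t by (simp add: has_vector_derivative_at_within)
        have "(\<Phi> has_vector_derivative f (\<sigma> t)) (at (\<sigma> t) within \<sigma> ` {a<..<b})"
          using range by (intro has_vector_derivative_within_subset[OF d\<Phi>[OF range[OF t]]]) auto
        from vector_diff_chain_within[OF 1 this]
        have "((\<lambda>t. \<Phi> (\<sigma> t)) has_vector_derivative f (\<sigma> t) * d t) (at t within {a<..<b})"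
          by (simp add: o_def mult.commute)
        then show "((\<lambda>t. \<Phi> (\<sigma> t)) has_vector_derivative f (\<sigma> t) * d t) (at t)"
          using at_within_open[OF t'] by simp
      qed
    qed
  qed
  then show ?thesis by (simp add: \<Phi>_def)
qed

text \<open>The calibration wants a curve that starts at a lowest point. This lemma and the next two
  show that moving the starting point of a closed curve preserves the Lipschitz constant, the line
  integrals and the positive orientation.\<close>

lemma shiftpath_lipschitz:
  fixes c :: "real \<Rightarrow> complex"
  assumes lip: "B-lipschitz_on {0..1} c" and closed: "pathfinish c = pathstart c" and a: "a \<in> {0..1}"
  shows "B-lipschitz_on {0..1} (shiftpath a c)"
  unfolding shiftpath_alt_def
proof (rule lipschitz_on_concat)
  have B: "0 \<le> B" using lip by (rule lipschitz_on_nonneg)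
  have 1: "dist (a + x) (a + y) = dist x y" "dist (a + x - 1) (a + y - 1) = dist x y" for x y
    by (simp_all add: dist_real_def)
  show "B-lipschitz_on {0..1 - a} (\<lambda>x. c (a + x))"
  proof (rule lipschitz_onI[OF _ B])
    show "dist (c (a + x)) (c (a + y)) \<le> B * dist x y" if "x \<in> {0..1 - a}" "y \<in> {0..1 - a}" for x y
      using lipschitz_onD[OF lip, of "a + x" "a + y"] that a by (simp add: 1)
  qed
  show "B-lipschitz_on {1 - a..1} (\<lambda>x. c (a + x - 1))"
  proof (rule lipschitz_onI[OF _ B])
    show "dist (c (a + x - 1)) (c (a + y - 1)) \<le> B * dist x y" if "x \<in> {1 - a..1}" "y \<in> {1 - a..1}" for x y
      using lipschitz_onD[OF lip, of "a + x - 1" "a + y - 1"] that a by (simp add: 1)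
  qed
  show "c (a + (1 - a)) = c (a + (1 - a) - 1)"
    using closed by (simp add: pathfinish_def pathstart_def)
qed

lemma has_integral_shiftpath:
  fixes c :: "real \<Rightarrow> complex" and f :: "complex \<Rightarrow> complex \<Rightarrow> real"
  assumes lip: "B-lipschitz_on {0..1} c" and a: "a \<in> {0..1}"
    and hi: "((\<lambda>t. f (c t) (vector_derivative c (at t))) has_integral I) {0..1}"
  shows "((\<lambda>t. f (shiftpath a c t) (vector_derivative (shiftpath a c) (at t))) has_integral I) {0..1}"
proof -
  let ?g = "\<lambda>t. f (c t) (vector_derivative c (at t))"
  have int: "?g integrable_on {0..a}" "?g integrable_on {a..1}"
    using a hi by (auto intro!: integrable_subinterval_real[OF has_integral_integrable[OF hi]])
  define i j where "i = integral {0..a} ?g" and "j = integral {a..1} ?g"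
  have i: "(?g has_integral i) {0..a}" and j: "(?g has_integral j) {a..1}"
    using int by (simp_all add: i_def j_def integrable_integral)
  have "I = i + j"
    by (rule has_integral_unique[OF hi has_integral_combine[OF _ _ i j]]) (use a in auto)
  have tr: "(g has_integral x) {u..v}" if "(h has_integral x) {u + k..v + k}"
      and "\<And>t. t \<in> {u<..<v} \<Longrightarrow> g t = h (t + k)" for g h :: "real \<Rightarrow> real" and x u v k :: real
  proof -
    have "(h has_integral x) (cbox (u + k) (v + k))" using that(1) by simp
    from has_integral_affinity'[OF this, of 1 k] have "((\<lambda>t. h (t + k)) has_integral x) {u..v}" by simp
    then show ?thesis
      by (rule has_integral_spike_finite[of "{u, v}", rotated 2]) (use that(2) in auto)
  qed
  let ?s = "shiftpath a c"
  have eqs: "?s t = c (t + a)" if "t < 1 - a" for t using that by (simp add: shiftpath_def add.commute)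
  have eqs': "?s t = c (t + (a - 1))" if "t > 1 - a" for t using that by (simp add: shiftpath_def algebra_simps)
  \<comment> \<open>The two curves have the same derivatives or none at all at corresponding points,
    so the identity holds also where \<open>vector_derivative\<close> has no meaning.\<close>
  have vd: "vector_derivative ?s (at t) = vector_derivative c (at (t + k))"
    if "open S" "t \<in> S" "\<And>x. x \<in> S \<Longrightarrow> ?s x = c (x + k)" for S k t
  proof -
    have shift: "((\<lambda>x. g (x + k)) has_vector_derivative d) (at t)" if "(g has_vector_derivative d) (at (t + k))"
      for g :: "real \<Rightarrow> complex" and d t k
    proof -
      have "((\<lambda>x. x + k) has_vector_derivative 1) (at t)" by (auto intro!: derivative_eq_intros)
      from vector_diff_chain_at[OF this that] show ?thesis by (simp add: o_def)
    qed
    have "(?s has_vector_derivative d) (at t) \<longleftrightarrow> (c has_vector_derivative d) (at (t + k))" for d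
    proof -
      have "(?s has_vector_derivative d) (at t) \<longleftrightarrow> ((\<lambda>x. c (x + k)) has_vector_derivative d) (at t)"
        using that by (intro has_vector_derivative_cong_ev) (auto simp: eventually_nhds intro!: exI[of _ S])
      also have "\<dots> \<longleftrightarrow> (c has_vector_derivative d) (at (t + k))"
        using shift[of c d t k] shift[of "\<lambda>x. c (x + k)" d "t + k" "- k"] by auto
      finally show ?thesis .
    qed
    then show ?thesis by (simp add: vector_derivative_def)
  qed
  let ?h = "\<lambda>t. f (?s t) (vector_derivative ?s (at t))"
  have 1: "(?h has_integral j) {0..1 - a}"
  proof (rule tr[of ?g _ _ a])
    show "?h t = ?g (t + a)" if "t \<in> {0<..<1 - a}" for t
      using that vd[of "{..<1 - a}" t a] eqs by simp
  qed (use j in simp)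
  have 2: "(?h has_integral i) {1 - a..1}"
  proof (rule tr[of ?g _ _ "a - 1"])
    show "?h t = ?g (t + (a - 1))" if "t \<in> {1 - a<..<1}" for t
      using that vd[of "{1 - a<..}" t "a - 1"] eqs' by simp
  qed (use i in simp)
  from has_integral_combine[OF _ _ 1 2] a show ?thesis by (simp add: \<open>I = i + j\<close> add.commute)
qed

lemma positively_oriented_shiftpath:
  assumes "simple_path c" "pathfinish c = pathstart c" "a \<in> {0..1}" "positively_oriented c"
  shows "positively_oriented (shiftpath a c)"
proof -
  have p: "path_image (shiftpath a c) = path_image c" by (rule path_image_shiftpath) (use assms in auto)
  show ?thesis unfolding positively_oriented_def p
  proof
    fix z assume z: "z \<in> inside (path_image c)"
    then have "z \<notin> path_image c" using inside_no_overlap by blast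
    from winding_number_shiftpath[OF simple_path_imp_path[OF assms(1)] this assms(2,3)]
    show "winding_number (shiftpath a c) z = 1" using assms(4) z by (simp add: positively_oriented_def)
  qed
qed

lemma inside_subset_convex:
  fixes U :: "complex set"
  assumes "convex U" "S \<subseteq> U"
  shows "inside S \<subseteq> U"
  using outside_subset_convex[OF assms] inside_Int_outside[of S] by blast

text \<open>The derivative is exchanged for a Borel and bounded version; \<open>m\<close> is
  continuous, and the heights of a compact curve in the half-plane stay away from 0.\<close>

lemma (in isoperimetric) length_integrable:
  fixes c :: "real \<Rightarrow> complex"
  assumes lip: "B-lipschitz_on {0..1} c" and half: "path_image c \<subseteq> half_plane"
  shows "(\<lambda>t. m (vector_derivative c (at t)) / Im (c t)) integrable_on {0..1}"
proof -
  obtain d where d: "d \<in> borel_measurable borel" "\<And>t. norm (d t) \<le> B"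
    "AE t in lborel. t \<in> {0..1} \<longrightarrow> (c has_vector_derivative d t) (at t)"
    by (rule lipschitz_borel_derivative[OF lip zero_le_one]) (rule that; assumption)
  have pos: "Im (c t) > 0" if "t \<in> {0..1}" for t
    using imageI[OF that, of c] half by (auto simp: path_image_def half_plane_def)
  have ci: "continuous_on {0..1} (\<lambda>t. 1 / Im (c t))"
    using pos by (intro continuous_intros lipschitz_on_continuous_on[OF lip]) (auto simp: less_imp_neq[symmetric])
  then have ci_meas: "(\<lambda>t. indicator {0..1} t * (1 / Im (c t))) \<in> borel_measurable borel"
    using borel_measurable_continuous_on_indicator[OF _ ci] by simp
  have "bounded ((\<lambda>t. 1 / Im (c t)) ` {0..1})"
    by (intro compact_imp_bounded compact_continuous_image ci compact_Icc)
  then obtain P where P: "\<And>t. t \<in> {0..1} \<Longrightarrow> norm (1 / Im (c t)) \<le> P" unfolding bounded_iff by blast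
  have "bounded (m ` cball 0 B)"
    by (intro compact_imp_bounded compact_continuous_image continuous_on_subset[OF m_cont] compact_cball) auto
  then obtain Q where Q: "\<And>x. x \<in> cball 0 B \<Longrightarrow> norm (m x) \<le> Q" unfolding bounded_iff by blast
  have mm: "(\<lambda>t. m (d t)) \<in> borel_measurable borel"
    by (rule measurable_compose[OF d(1) borel_measurable_continuous_onI[OF m_cont]])
  have "set_integrable lborel {0..1} (\<lambda>t. m (d t) / Im (c t))"
    unfolding set_integrable_def
  proof (rule integrableI_bounded_set[where A = "{0..1}" and B = "Q * P"])
    have "(\<lambda>t. m (d t) * (indicator {0..1} t * (1 / Im (c t)))) \<in> borel_measurable borel"
      using mm ci_meas by measurable
    also have "(\<lambda>t. m (d t) * (indicator {0..1} t * (1 / Im (c t)))) = (\<lambda>t. indicator {0..1} t *\<^sub>R (m (d t) / Im (c t)))"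
      by (auto simp: indicator_def)
    finally show "(\<lambda>t. indicator {0..1} t *\<^sub>R (m (d t) / Im (c t))) \<in> borel_measurable lborel" by simp
    show "AE t\<in>{0..1} in lborel. norm (indicator {0..1} t *\<^sub>R (m (d t) / Im (c t))) \<le> Q * P"
    proof (intro AE_I2 impI)
      fix t :: real assume t: "t \<in> {0..1}"
      have "norm (m (d t)) * norm (1 / Im (c t)) \<le> Q * P"
        using Q[of "d t"] d(2)[of t] P[OF t] by (intro mult_mono) (auto intro: order_trans[OF norm_ge_zero])
      then show "norm (indicator {0..1} t *\<^sub>R (m (d t) / Im (c t))) \<le> Q * P"
        using t by (simp add: abs_mult[symmetric])
    qed
  qed auto
  then have "(\<lambda>t. m (d t) / Im (c t)) integrable_on {0..1}" by (rule set_borel_integral_eq_integral(1))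
  then obtain I where I: "((\<lambda>t. m (d t) / Im (c t)) has_integral I) {0..1}" by blast
  have "AE t in lborel. t \<in> {0..1} \<longrightarrow> m (vector_derivative c (at t)) / Im (c t) = m (d t) / Im (c t)"
    using d(3) by eventually_elim (auto simp: vector_derivative_at)
  from has_integral_AE[OF this] I show ?thesis by blast
qed

subsection \<open>Calibration of a contour\<close>

text \<open>The position of the contour between two horizontal lines determines the similar copy of the rotated
  body \<open>K\<close> between the same lines; the curve is calibrated by the boundary of that copy.\<close>

locale calibrated = isoperimetric +
  fixes c :: "real \<Rightarrow> complex" and B tm :: real
  assumes lip: "B-lipschitz_on {0..1} c" and simple: "simple_path c" and closed: "pathfinish c = pathstart c"
    and pos: "positively_oriented c" and half: "path_image c \<subseteq> half_plane" and tm: "tm \<in> {0..1}"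
    and lowest: "\<And>t. t \<in> {0..1} \<Longrightarrow> Im (c 0) \<le> Im (c t)"
    and highest: "\<And>t. t \<in> {0..1} \<Longrightarrow> Im (c t) \<le> Im (c tm)"
begin

definition "y1 = Im (c 0)"
definition "y2 = Im (c tm)"
definition "R = (y2 - y1) / (r - l)"
definition "\<kappa> = y1 / R + r"
definition "\<sigma> t = \<kappa> - Im (c t) / R"
definition "p t = Complex (\<sigma> t) (if t \<le> tm then upper_fibre K (\<sigma> t) else lower_fibre K (\<sigma> t))"
definition "A = integral (inside (path_image c)) (\<lambda>z. 1 / (Im z)\<^sup>2)"

abbreviation "c' t \<equiv> vector_derivative c (at t)"

lemma c1: "c 1 = c 0"
  using closed by (simp add: pathfinish_def pathstart_def)

lemma strip: "t \<in> {0..1} \<Longrightarrow> Im (c t) \<in> {y1..y2}"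
  using lowest highest by (simp add: y1_def y2_def)

lemma y1_pos: "y1 > 0"
  using half by (force simp: path_image_def half_plane_def y1_def)

lemma pos_Im: "t \<in> {0..1} \<Longrightarrow> Im (c t) > 0"
  using strip y1_pos by force

lemma derivative: "AE t in lborel. t \<in> {0..1} \<longrightarrow> (c has_vector_derivative c' t) (at t)"
  by (rule lipschitz_ae_vector_derivative(1)[OF lip])

lemma winding: "z \<in> inside (path_image c) \<Longrightarrow> winding_number c z = of_real 1"
  using pos by (simp add: positively_oriented_def)

lemma euclidean_area_pos: "measure lborel (inside (path_image c)) > 0"
proof -
  have "2 * 1 * measure lborel (inside (path_image c)) \<noteq> 0"
    by (rule positively_oriented_iff(2)[OF lip simple closed integral_cross_eq_area[OF lip closed winding]])
  then show ?thesis by (simp add: less_le)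
qed

lemma Re_derivative_integral: "((\<lambda>t. Re (c' t)) has_integral 0) {0..1}"
  using has_integral_linear[OF lipschitz_ae_vector_derivative(2)[OF lip] bounded_linear_Re] c1 by (simp add: o_def)

text \<open>On a single horizontal line the cross product is a multiple of \<open>Re (c' t)\<close>,
  which has integral 0, while for a simple closed curve this integral is twice a nonzero signed
  area.\<close>

lemma y1_less_y2: "y1 < y2"
proof (rule ccontr)
  assume "\<not> y1 < y2"
  then have y: "Im (c t) = y1" if "t \<in> {0..1}" for t using strip[OF that] by auto
  have "AE t in lborel. t \<in> {0..1} \<longrightarrow> cross (c t) (c' t) = - y1 * Re (c' t)"
    using derivative AE_not_endpoint[of 0] AE_not_endpoint[of 1]
  proof eventually_elim
    case (elim t)
    show ?case
    proof
      assume t: "t \<in> {0..1}"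
      then have t': "t \<in> {0<..<1}" using elim by simp
      have "((\<lambda>t. Im (c t)) has_vector_derivative Im (c' t)) (at t)"
        using elim t by (intro has_vector_derivative_Im) simp
      moreover have "((\<lambda>t. Im (c t)) has_vector_derivative 0) (at t) \<longleftrightarrow> ((\<lambda>t. y1) has_vector_derivative 0) (at t)"
        using t' by (intro has_vector_derivative_cong_ev) (auto simp: eventually_nhds y intro!: exI[of _ "{0<..<1}"])
      ultimately have "Im (c' t) = 0" by (auto intro: vector_derivative_unique_at)
      then show "cross (c t) (c' t) = - y1 * Re (c' t)" by (simp add: cross_def y[OF t])
    qed
  qed
  from has_integral_AE[OF this, of 0] has_integral_mult_right[OF Re_derivative_integral, of "- y1"]
  have "((\<lambda>t. cross (c t) (c' t)) has_integral 0) {0..1}" by simp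
  from positively_oriented_iff(2)[OF lip simple closed this] show False by simp
qed

lemma R_pos: "R > 0"
  using y1_less_y2 l_neg r_pos by (simp add: R_def)

lemma \<kappa>_gt: "\<kappa> > r"
  using y1_pos R_pos by (simp add: \<kappa>_def)

lemma Im_eq: "Im (c t) = R * (\<kappa> - \<sigma> t)"
  using R_pos by (simp add: \<sigma>_def)

lemma y_eq: "y1 = R * (\<kappa> - r)" "y2 = R * (\<kappa> - l)"
proof -
  show "y1 = R * (\<kappa> - r)" using R_pos by (simp add: \<kappa>_def)
  moreover have "y2 - y1 = R * (r - l)" using l_neg r_pos by (simp add: R_def)
  ultimately show "y2 = R * (\<kappa> - l)" by (simp add: algebra_simps)
qed

lemma \<sigma>_range: "t \<in> {0..1} \<Longrightarrow> \<sigma> t \<in> {l..r}"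
proof -
  assume "t \<in> {0..1}"
  then have "R * (\<kappa> - r) \<le> R * (\<kappa> - \<sigma> t)" "R * (\<kappa> - \<sigma> t) \<le> R * (\<kappa> - l)"
    using strip[of t] by (simp_all add: y_eq[symmetric] Im_eq[symmetric])
  then show ?thesis using R_pos by simp
qed

lemma \<sigma>_ends: "\<sigma> 0 = r" "\<sigma> tm = l" "\<sigma> 1 = r"
  using Im_eq[of 0] Im_eq[of tm] y_eq R_pos c1 by (simp_all add: y1_def[symmetric] y2_def[symmetric] \<sigma>_def)

lemma p_in_K: "t \<in> {0..1} \<Longrightarrow> p t \<in> K"
  using \<sigma>_range[of t] compact_attains_upper_fibre(1)[OF compact_K, of "\<sigma> t"]
    compact_attains_lower_fibre(1)[OF compact_K, of "\<sigma> t"] by (simp add: p_def Re_image)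

lemma lipschitz_\<sigma>: "\<exists>C. C-lipschitz_on {0..1} \<sigma>"
proof -
  have "(B / R)-lipschitz_on {0..1} \<sigma>"
  proof (rule lipschitz_onI)
    show "dist (\<sigma> t) (\<sigma> u) \<le> B / R * dist t u" if "t \<in> {0..1}" "u \<in> {0..1}" for t u
    proof -
      have "dist (\<sigma> t) (\<sigma> u) = dist (Im (c t)) (Im (c u)) / R"
        using R_pos by (simp add: \<sigma>_def dist_real_def diff_divide_distrib[symmetric] abs_minus_commute)
      also have "\<dots> \<le> B * dist t u / R"
        using lipschitz_onD[OF lipschitz_on_Im[OF lip] that] R_pos by (intro divide_right_mono) auto
      finally show ?thesis by simp
    qed
    show "0 \<le> B / R" using R_pos lipschitz_on_nonneg[OF lip] by simp
  qed
  then show ?thesis by blast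
qed

lemma derivative_\<sigma>:
  assumes "(c has_vector_derivative d) (at t)"
  shows "(\<sigma> has_vector_derivative - (Im d / R)) (at t)"
proof -
  have "((\<lambda>t. Im (c t)) has_real_derivative Im d) (at t)"
    using has_vector_derivative_Im[OF assms] by (simp add: has_real_derivative_iff_has_vector_derivative)
  from DERIV_diff[OF DERIV_const DERIV_cdivide[OF this]]
  show ?thesis unfolding \<sigma>_def[abs_def] by (simp add: has_real_derivative_iff_has_vector_derivative)
qed

text \<open>Along an arc, \<open>Im c = R * (\<kappa> - \<sigma>)\<close> turns \<open>dy / y\<close> into \<open>- d\<sigma> / (\<kappa> - \<sigma>)\<close>.\<close>

lemma arc_integral:
  assumes f: "continuous_on {l..r} f" and st: "0 \<le> s" "s \<le> t" "t \<le> 1"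
  shows "((\<lambda>t. f (\<sigma> t) * Im (c' t)) has_integral R * (integral {l..\<sigma> s} f - integral {l..\<sigma> t} f)) {s..t}"
proof -
  obtain C where C: "C-lipschitz_on {0..1} \<sigma>" using lipschitz_\<sigma> by blast
  have "((\<lambda>t. f (\<sigma> t) * (- (Im (c' t) / R))) has_integral integral {l..\<sigma> t} f - integral {l..\<sigma> s} f) {s..t}"
  proof (rule has_integral_composed_lipschitz[OF f lipschitz_on_subset[OF C] st(2)])
    show "\<sigma> u \<in> {l..r}" if "u \<in> {s..t}" for u using that st by (intro \<sigma>_range) auto
    show "AE u in lborel. u \<in> {s..t} \<longrightarrow> (\<sigma> has_vector_derivative - (Im (c' u) / R)) (at u)"
      using derivative by eventually_elim (use st in \<open>auto intro!: derivative_\<sigma>\<close>)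
  qed (use st in auto)
  from has_integral_mult_right[OF this, of "- R"] show ?thesis using R_pos by (simp add: algebra_simps)
qed

lemma area_integral: "((\<lambda>t. Re (c' t) / Im (c t)) has_integral A) {0..1}"
  and area_integrable: "set_integrable lborel (inside (path_image c)) (\<lambda>z. 1 / (Im z)\<^sup>2)"
  using area_line_integral[OF lip closed half, of 1] winding by (simp_all add: A_def area_def)

lemma A_pos: "A > 0"
proof -
  let ?U = "inside (path_image c)"
  have sub: "?U \<subseteq> {z. Im z > 0}" "?U \<subseteq> {z. Im z \<le> y2}"
  proof -
    show "?U \<subseteq> {z. Im z > 0}"
      by (rule inside_subset_convex) (use pos_Im convex_halfspace_Im_gt in \<open>auto simp: path_image_def\<close>)
    show "?U \<subseteq> {z. Im z \<le> y2}"
      by (rule inside_subset_convex) (use strip convex_halfspace_Im_le in \<open>auto simp: path_image_def\<close>)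
  qed
  have "path c" using simple by (rule simple_path_imp_path)
  then have U: "open ?U" "bounded ?U"
    by (auto intro!: open_inside closed_path_image bounded_inside bounded_path_image)
  have "((\<lambda>z. 1 / y2\<^sup>2 * 1) has_integral 1 / y2\<^sup>2 * measure lborel ?U) ?U"
    by (intro has_integral_mult_right has_integral_measure_lborel)
       (use U emeasure_bounded_finite[OF U(2)] in simp_all)
  then have "1 / y2\<^sup>2 * measure lborel ?U \<le> A"
    unfolding A_def
  proof (rule has_integral_le[OF _ integrable_integral[OF set_borel_integral_eq_integral(1)[OF area_integrable]]])
    fix z assume "z \<in> ?U"
    then have "Im z > 0" "Im z \<le> y2" using sub by auto
    then show "1 / y2\<^sup>2 * 1 \<le> 1 / (Im z)\<^sup>2" by (simp add: frac_le)
  qed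
  moreover have "1 / y2\<^sup>2 * measure lborel ?U > 0" using euclidean_area_pos y1_pos y1_less_y2 by simp
  ultimately show ?thesis by linarith
qed

lemma continuous_kernel:
  assumes "continuous_on {l..r} f"
  shows "continuous_on {l..r} (\<lambda>s. f s / (R * (\<kappa> - s)))" "continuous_on {l..r} (\<lambda>s. f s / (R * (\<kappa> - s))\<^sup>2)"
  using \<kappa>_gt R_pos by (auto intro!: continuous_intros assms)

lemma fibres_continuous: "continuous_on {l..r} (upper_fibre K)" "continuous_on {l..r} (lower_fibre K)"
  by (intro upper_fibre_continuous lower_fibre_continuous compact_K convex_K Re_image)+

text \<open>Since \<open>Re (p t) = \<kappa> - Im (c t) / R\<close>, the first component contributes
  \<open>\<kappa> * A\<close> and a multiple of the integral of \<open>dx\<close>, which is 0. In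
  the second component \<open>Im (p t)\<close> is a function of \<sigma> on each side, so that only
  the end values \<open>r\<close> and \<open>l\<close> matter, and the difference of the fibres
  gives \<open>G_area \<kappa>\<close>.\<close>

lemma calibration: "((\<lambda>t. (p t \<bullet> c' t) / Im (c t)) has_integral \<kappa> * A + G_area \<kappa>) {0..1}"
proof -
  let ?a = "\<lambda>s. upper_fibre K s / (R * (\<kappa> - s))" and ?b = "\<lambda>s. lower_fibre K s / (R * (\<kappa> - s))"
  have a: "?a integrable_on {l..r}" and b: "?b integrable_on {l..r}"
    by (intro integrable_continuous_real continuous_kernel fibres_continuous)+
  have ia: "((\<lambda>t. ?a (\<sigma> t) * Im (c' t)) has_integral R * (integral {l..r} ?a)) {0..tm}"
    using arc_integral[OF continuous_kernel(1)[OF fibres_continuous(1)], of 0 tm] tm by (simp add: \<sigma>_ends)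
  have ib: "((\<lambda>t. ?b (\<sigma> t) * Im (c' t)) has_integral - R * (integral {l..r} ?b)) {tm..1}"
    using arc_integral[OF continuous_kernel(1)[OF fibres_continuous(2)], of tm 1] tm by (simp add: \<sigma>_ends)
  have G: "G_area \<kappa> = R * integral {l..r} ?a - R * integral {l..r} ?b"
  proof (rule has_integral_unique[OF G_area_integral(1)[OF \<kappa>_gt]])
    have "((\<lambda>s. R * ?a s - R * ?b s) has_integral R * integral {l..r} ?a - R * integral {l..r} ?b) {l..r}"
      by (intro has_integral_diff has_integral_mult_right integrable_integral a b)
    then show "((\<lambda>s. (upper_fibre K s - lower_fibre K s) * (1 / (\<kappa> - s))) has_integral
        R * integral {l..r} ?a - R * integral {l..r} ?b) {l..r}"
      using R_pos by (simp add: diff_divide_distrib)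
  qed
  have ia': "((\<lambda>t. Im (p t) * Im (c' t) / Im (c t)) has_integral R * (integral {l..r} ?a)) {0..tm}"
    by (rule has_integral_eq[OF _ ia]) (simp add: p_def Im_eq)
  \<comment> \<open>At \<open>tm\<close> itself \<open>p\<close> takes the upper fibre, a single
    point without influence on the integral.\<close>
  have ib': "((\<lambda>t. Im (p t) * Im (c' t) / Im (c t)) has_integral - R * (integral {l..r} ?b)) {tm..1}"
    by (rule has_integral_spike_finite[OF _ _ ib, of "{tm}"]) (auto simp: p_def Im_eq)
  have "((\<lambda>t. Im (p t) * Im (c' t) / Im (c t)) has_integral G_area \<kappa>) {0..1}"
    using has_integral_combine[OF _ _ ia' ib'] tm by (simp add: G)
  then have "((\<lambda>t. Im (p t) * Im (c' t) / Im (c t) + (\<kappa> * (Re (c' t) / Im (c t)) - 1 / R * Re (c' t))) has_integral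
      G_area \<kappa> + (\<kappa> * A - 1 / R * 0)) {0..1}"
    by (intro has_integral_add has_integral_diff has_integral_mult_right area_integral Re_derivative_integral)
  then have "((\<lambda>t. Im (p t) * Im (c' t) / Im (c t) + (\<kappa> * (Re (c' t) / Im (c t)) - 1 / R * Re (c' t))) has_integral
      \<kappa> * A + G_area \<kappa>) {0..1}"
    by (simp add: add.commute)
  then show ?thesis
  proof (rule has_integral_eq[rotated])
    fix t :: real assume t: "t \<in> {0..1}"
    have "v / y + (\<kappa> * (u / y) - 1 / R * u) = ((\<kappa> - y / R) * u + v) / y" if "y > 0" for u v y
      using that R_pos by (simp add: field_simps)
    from this[OF pos_Im[OF t], of "Im (p t) * Im (c' t)" "Re (c' t)"]
    show "Im (p t) * Im (c' t) / Im (c t) + (\<kappa> * (Re (c' t) / Im (c t)) - 1 / R * Re (c' t)) = (p t \<bullet> c' t) / Im (c t)"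
      by (simp add: inner_complex_def p_def \<sigma>_def)
  qed
qed

lemma length_ge: "\<kappa> * A + G_area \<kappa> \<le> integral {0..1} (\<lambda>t. m (c' t) / Im (c t))"
proof (rule has_integral_le[OF calibration integrable_integral[OF length_integrable[OF lip half]]])
  fix t :: real assume t: "t \<in> {0..1}"
  show "(p t \<bullet> c' t) / Im (c t) \<le> m (c' t) / Im (c t)"
    using m_ge[OF p_in_K[OF t], of "c' t"] pos_Im[OF t] by (simp add: divide_right_mono)
qed

lemma isoperimetric_inequality:
  assumes "\<mu> > r" "F_area \<mu> = A"
  shows "L \<mu> \<le> integral {0..1} (\<lambda>t. m (c' t) / Im (c t))"
proof -
  have "L \<mu> \<le> \<kappa> * A + G_area \<kappa>"
    using L_less[OF \<kappa>_gt assms(1)] assms(2) by (cases "\<kappa> = \<mu>") (auto simp: L_def)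
  then show ?thesis using length_ge by linarith
qed

text \<open>The length is at least \<open>\<kappa> * A + G_area \<kappa>\<close>, which is at least
  \<open>L \<mu>\<close>; both must be equalities. The second is strict unless \<kappa> = \<mu>, and
  the first compares integrands pointwise, so these agree almost everywhere.\<close>

lemma equality_calibrated:
  assumes "\<mu> > r" "F_area \<mu> = A" and eq: "integral {0..1} (\<lambda>t. m (c' t) / Im (c t)) = L \<mu>"
  shows "\<kappa> = \<mu>" and "AE t in lborel. t \<in> {0..1} \<longrightarrow> m (c' t) = p t \<bullet> c' t"
proof -
  show "\<kappa> = \<mu>" using L_less[OF \<kappa>_gt assms(1)] assms(2) length_ge eq by force
  then have "((\<lambda>t. m (c' t) / Im (c t) - (p t \<bullet> c' t) / Im (c t)) has_integral L \<mu> - L \<mu>) {0..1}"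
    using has_integral_diff[OF integrable_integral[OF length_integrable[OF lip half]] calibration] eq assms(2)
    by (simp add: L_def)
  then have "((\<lambda>t. (m (c' t) - p t \<bullet> c' t) / Im (c t)) has_integral 0) {0..1}"
    by (simp add: diff_divide_distrib)
  then have "AE t in lborel. t \<in> {0..1} \<longrightarrow> (m (c' t) - p t \<bullet> c' t) / Im (c t) = 0"
    by (rule has_integral_nonneg_zero_AE)
       (use m_ge[OF p_in_K] pos_Im in \<open>auto intro!: AE_I2 divide_nonneg_pos\<close>)
  then show "AE t in lborel. t \<in> {0..1} \<longrightarrow> m (c' t) = p t \<bullet> c' t"
  proof eventually_elim
    case (elim t)
    then show ?case using pos_Im[of t] by auto
  qed
qed

end

section \<open>The case of equality\<close>

lemma simple_closed_path_eq_frontier: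
  fixes c :: "real \<Rightarrow> complex"
  assumes simple: "simple_path c" and closed: "pathfinish c = pathstart c"
    and S: "convex S" "compact S" and sub: "path_image c \<subseteq> frontier S"
  shows "path_image c = frontier S"
proof -
  note J = Jordan_inside_outside[OF simple closed]
  have cl: "closed S" using S(2) by (rule compact_imp_closed)
  have "inside (path_image c) \<subseteq> S"
    using sub frontier_subset_closed[OF cl] by (intro inside_subset_convex[OF S(1)]) auto
  then have i1: "inside (path_image c) \<subseteq> interior S" using J by (intro interior_maximal) auto
  obtain x where x: "x \<in> inside (path_image c)" using J by auto
  \<comment> \<open>The interior of \<open>S\<close> is convex and misses the curve, so it lies in
    one component of the complement, and it contains the point \<open>x\<close> of the inside. Once
    the inside is the interior of \<open>S\<close>, the curve is recovered as its frontier.\<close>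
  have "interior S \<subseteq> inside (path_image c)"
  proof
    fix y assume y: "y \<in> interior S"
    have "connected_component (- path_image c) x y"
      unfolding connected_component_def
      using x i1 y sub by (intro exI[of _ "interior S"])
        (auto simp: frontier_def convex_connected convex_interior S)
    then show "y \<in> inside (path_image c)" using x by (rule inside_same_component)
  qed
  with i1 have eq: "inside (path_image c) = interior S" by blast
  have "path_image c = frontier (inside (path_image c))" using J by simp
  also have "\<dots> = closure (interior S) - interior S" by (simp add: eq frontier_def)
  also have "\<dots> = frontier S"
    using convex_closure_interior[OF S(1)] x i1 by (auto simp: frontier_def)
  finally show ?thesis .
qed

text \<open>A chain rule where \<open>f\<close> need not be differentiable at
  \<open>\<sigma> t\<close>: the difference quotient of the composition is at most \<open>C\<close>
  times that of \<sigma>, which tends to 0.\<close>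

lemma has_vector_derivative_zero_compose:
  fixes f \<sigma> :: "real \<Rightarrow> real"
  assumes \<sigma>: "(\<sigma> has_vector_derivative 0) (at t)" and f: "C-lipschitz_on S f"
    and ev: "eventually (\<lambda>u. \<sigma> u \<in> S) (nhds t)"
  shows "((\<lambda>u. f (\<sigma> u)) has_vector_derivative 0) (at t)"
proof -
  have t: "\<sigma> t \<in> S" using eventually_nhds_x_imp_x[OF ev] .
  have "((\<lambda>u. (\<sigma> u - \<sigma> t) / (u - t)) \<longlongrightarrow> 0) (at t)"
    using \<sigma> by (simp add: has_real_derivative_iff_has_vector_derivative[symmetric] has_field_derivative_iff)
  from tendsto_mult_right_zero[OF tendsto_rabs_zero[OF this], of C]
  have "((\<lambda>u. (f (\<sigma> u) - f (\<sigma> t)) / (u - t)) \<longlongrightarrow> 0) (at t)"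
  proof (rule Lim_null_comparison[rotated])
    have "eventually (\<lambda>u. \<sigma> u \<in> S) (at t)" using ev by (auto simp: eventually_at_filter elim: eventually_mono)
    then show "eventually (\<lambda>u. norm ((f (\<sigma> u) - f (\<sigma> t)) / (u - t)) \<le> C * \<bar>(\<sigma> u - \<sigma> t) / (u - t)\<bar>) (at t)"
    proof eventually_elim
      case (elim u)
      have "\<bar>f (\<sigma> u) - f (\<sigma> t)\<bar> / \<bar>u - t\<bar> \<le> C * \<bar>\<sigma> u - \<sigma> t\<bar> / \<bar>u - t\<bar>"
        using lipschitz_onD[OF f elim t] by (intro divide_right_mono) (auto simp: dist_real_def)
      then show ?case by simp
    qed
  qed
  then show ?thesis
    by (simp add: has_real_derivative_iff_has_vector_derivative[symmetric] has_field_derivative_iff)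
qed

lemma (in isoperimetric) fibre_frontier:
  assumes s: "s \<in> {l..r}" and v: "v \<in> {lower_fibre K s..upper_fibre K s}"
    and b: "s = l \<or> s = r \<or> v = lower_fibre K s \<or> v = upper_fibre K s"
  shows "Complex s v \<in> frontier K"
proof -
  have s': "s \<in> Re ` K" using s by (simp add: Re_image)
  note up = compact_attains_upper_fibre[OF compact_K s'] and lo = compact_attains_lower_fibre[OF compact_K s']
  have "Complex s v \<in> closed_segment (Complex s (lower_fibre K s)) (Complex s (upper_fibre K s))"
    using v by (auto simp: closed_segment_same_Re closed_segment_eq_real_ivl)
  then have vK: "Complex s v \<in> K"
    using closed_segment_subset[OF lo(1) up(1) convex_K] by blast
  have "Complex s v \<notin> interior K"
  proof
    assume "Complex s v \<in> interior K"
    then obtain \<epsilon> where \<epsilon>: "\<epsilon> > 0" "cball (Complex s v) \<epsilon> \<subseteq> K" by (auto simp: mem_interior_cball)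
    have "Complex (s + \<epsilon>) v \<in> K" "Complex (s - \<epsilon>) v \<in> K" "Complex s (v + \<epsilon>) \<in> K" "Complex s (v - \<epsilon>) \<in> K"
      using \<epsilon>(1) by (auto intro!: subsetD[OF \<epsilon>(2)] simp: dist_norm cmod_def)
    then show False
      using b \<epsilon>(1) Re_bounds[of "Complex (s + \<epsilon>) v"] Re_bounds[of "Complex (s - \<epsilon>) v"] up(2)[of "v + \<epsilon>"] lo(2)[of "v - \<epsilon>"] by auto
  qed
  then show ?thesis using vK closure_subset by (auto simp: frontier_def)
qed

lemma (in isoperimetric) fibre_less:
  assumes "l < s" "s < r" shows "lower_fibre K s < upper_fibre K s"
proof -
  have s: "s \<in> Re ` K" using assms by (simp add: Re_image)
  have le: "lower_fibre K s \<le> upper_fibre K s"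
    by (rule compact_attains_upper_fibre(2)[OF compact_K s compact_attains_lower_fibre(1)[OF compact_K s]])
  have "lower_fibre K s \<noteq> upper_fibre K s"
  proof
    assume eq: "lower_fibre K s = upper_fibre K s"
    obtain \<rho> where \<rho>: "\<rho> > 0" "cball 0 \<rho> \<subseteq> K" using inner_radius .
    \<comment> \<open>The end of the projection on the side of \<open>s\<close>. Convex combinations
      of a point above it with the vertical segment from \<open>- \<rho>\<close> to \<rho> over 0
      spread the fibre at \<open>s\<close> to length at least
      \<open>2 * (1 - \<theta>) * \<rho>\<close>.\<close>
    let ?b = "if 0 \<le> s then r else l"
    have "?b \<in> Re ` K" using l_neg r_pos by (simp add: Re_image)
    then obtain q where q: "q \<in> K" "Re q = ?b" by auto
    define \<theta> where "\<theta> = s / ?b"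
    have th: "0 \<le> \<theta>" "\<theta> < 1" "\<theta> * ?b = s"
      using assms l_neg r_pos by (auto simp: \<theta>_def divide_simps)
    have "Complex 0 \<rho> \<in> K" "Complex 0 (- \<rho>) \<in> K"
      using \<rho> by (auto intro!: subsetD[OF \<rho>(2)] simp: cmod_def)
    then have "(1 - \<theta>) *\<^sub>R Complex 0 \<rho> + \<theta> *\<^sub>R q \<in> K" "(1 - \<theta>) *\<^sub>R Complex 0 (- \<rho>) + \<theta> *\<^sub>R q \<in> K"
      using q th by (auto intro!: convexD[OF convex_K])
    moreover have "(1 - \<theta>) *\<^sub>R Complex 0 x + \<theta> *\<^sub>R q = Complex s ((1 - \<theta>) * x + \<theta> * Im q)" for x
      using th(3) q(2) by (simp add: complex_eq_iff)
    ultimately have "Complex s ((1 - \<theta>) * \<rho> + \<theta> * Im q) \<in> K" "Complex s ((1 - \<theta>) * (- \<rho>) + \<theta> * Im q) \<in> K"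
      by simp_all
    from compact_attains_upper_fibre(2)[OF compact_K s this(1)] compact_attains_lower_fibre(2)[OF compact_K s this(2)] eq
    have "(1 - \<theta>) * \<rho> \<le> 0" by simp
    moreover have "0 < (1 - \<theta>) * \<rho>" using th \<rho>(1) by (intro mult_pos_pos) auto
    ultimately show False by simp
  qed
  with le show ?thesis by simp
qed

context calibrated
begin

lemma flat_derivative:
  assumes t: "t \<in> {0<..<1}" and d: "(c has_vector_derivative d) (at t)" and y: "Im (c t) = y1 \<or> Im (c t) = y2"
  shows "Im d = 0"
proof -
  have D: "((\<lambda>t. Im (c t)) has_real_derivative Im d) (at t)"
    using has_vector_derivative_Im[OF d] by (simp add: has_real_derivative_iff_has_vector_derivative)
  have near: "u \<in> {0..1}" if "\<bar>t - u\<bar> < min t (1 - t)" for u using that t by auto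
  have m: "0 < min t (1 - t)" using t by simp
  from y show ?thesis
  proof
    assume "Im (c t) = y1"
    then show ?thesis using near strip by (intro DERIV_local_min[OF D m]) force
  next
    assume "Im (c t) = y2"
    then show ?thesis using near strip by (intro DERIV_local_max[OF D m]) force
  qed
qed

lemma maximal_if_calibrated:
  assumes "AE t in lborel. t \<in> {0..1} \<longrightarrow> m (c' t) = p t \<bullet> c' t"
  shows "AE t in lborel. t \<in> {0..1} \<longrightarrow> (\<forall>q\<in>K. q \<bullet> c' t \<le> p t \<bullet> c' t)"
  using assms by eventually_elim (metis m_ge)

context
  assumes maximal: "AE t in lborel. t \<in> {0..1} \<longrightarrow> (\<forall>q\<in>K. q \<bullet> c' t \<le> p t \<bullet> c' t)"
begin

text \<open>At the lowest level \<sigma> is \<open>r\<close> and the height is stationary, so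
  comparing the maximizing \<open>p\<close> with a point of abscissa \<open>l\<close> gives
  \<open>(r - l) * Re (c' u) \<ge> 0\<close>; at the highest level \<sigma> is \<open>l\<close> and
  the sign is opposite. This controls the horizontal pieces, along which \<open>p\<close> does not
  move.\<close>

lemma flat_arc_monotone:
  assumes st: "0 \<le> s" "s \<le> t" "t \<le> 1"
  shows "(\<And>u. u \<in> {s..t} \<Longrightarrow> Im (c u) = y1) \<Longrightarrow> Re (c s) \<le> Re (c t)"
    and "(\<And>u. u \<in> {s..t} \<Longrightarrow> Im (c u) = y2) \<Longrightarrow> Re (c t) \<le> Re (c s)"
proof -
  have lr: "l \<in> Re ` K" "r \<in> Re ` K" using l_neg r_pos by (simp_all add: Re_image)
  then obtain ql qr where q: "ql \<in> K" "Re ql = l" "qr \<in> K" "Re qr = r" by auto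
  have x: "B-lipschitz_on {s..t} (\<lambda>u. Re (c u))"
    by (rule lipschitz_on_subset[OF lipschitz_on_Re[OF lip]]) (use st in auto)
  have ae: "AE u in lborel. u \<in> {s..t} \<longrightarrow> (Im (c u) = y1 \<or> Im (c u) = y2) \<longrightarrow>
      vector_derivative (\<lambda>u. Re (c u)) (at u) = Re (c' u) \<and> l * Re (c' u) \<le> \<sigma> u * Re (c' u) \<and> r * Re (c' u) \<le> \<sigma> u * Re (c' u)"
    using derivative maximal AE_not_endpoint[of 0] AE_not_endpoint[of 1]
  proof eventually_elim
    case (elim u)
    show ?case
    proof (intro impI)
      assume u: "u \<in> {s..t}" "Im (c u) = y1 \<or> Im (c u) = y2"
      then have u': "u \<in> {0<..<1}" "u \<in> {0..1}" using elim st by auto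
      with elim have d: "(c has_vector_derivative c' u) (at u)" and mx: "\<And>q. q \<in> K \<Longrightarrow> q \<bullet> c' u \<le> p u \<bullet> c' u" by auto
      have i0: "Im (c' u) = 0" by (rule flat_derivative[OF u'(1) d u(2)])
      show "vector_derivative (\<lambda>u. Re (c u)) (at u) = Re (c' u) \<and> l * Re (c' u) \<le> \<sigma> u * Re (c' u) \<and> r * Re (c' u) \<le> \<sigma> u * Re (c' u)"
        using mx[OF q(1)] mx[OF q(3)] q i0
        by (simp add: inner_complex_def p_def vector_derivative_at[OF has_vector_derivative_Re[OF d]])
    qed
  qed
  show "Re (c s) \<le> Re (c t)" if y: "\<And>u. u \<in> {s..t} \<Longrightarrow> Im (c u) = y1"
  proof (rule lipschitz_mono_if_derivative_nonneg[OF x st(2)])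
    show "AE u in lborel. u \<in> {s..t} \<longrightarrow> 0 \<le> vector_derivative (\<lambda>u. Re (c u)) (at u)"
      using ae
    proof eventually_elim
      case (elim u)
      show ?case
      proof
        assume u: "u \<in> {s..t}"
        have "\<sigma> u = r" using y[OF u] y_eq(1) Im_eq[of u] R_pos by simp
        then have "0 \<le> (r - l) * Re (c' u)" using elim u y[OF u] by (simp add: algebra_simps)
        then show "0 \<le> vector_derivative (\<lambda>u. Re (c u)) (at u)"
          using elim u y[OF u] l_neg r_pos by (simp add: zero_le_mult_iff)
      qed
    qed
  qed
  show "Re (c t) \<le> Re (c s)" if y: "\<And>u. u \<in> {s..t} \<Longrightarrow> Im (c u) = y2"
  proof -
    have x': "B-lipschitz_on {s..t} (\<lambda>u. - Re (c u))" using x by simp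
    have "- Re (c s) \<le> - Re (c t)"
    proof (rule lipschitz_mono_if_derivative_nonneg[OF x' st(2)])
      show "AE u in lborel. u \<in> {s..t} \<longrightarrow> 0 \<le> vector_derivative (\<lambda>u. - Re (c u)) (at u)"
        using ae derivative
      proof eventually_elim
        case (elim u)
        show ?case
        proof
          assume u: "u \<in> {s..t}"
          have "\<sigma> u = l" using y[OF u] y_eq(2) Im_eq[of u] R_pos by simp
          then have "(r - l) * Re (c' u) \<le> 0" using elim u y[OF u] by (simp add: algebra_simps)
          then have "Re (c' u) \<le> 0" using l_neg r_pos by (simp add: mult_le_0_iff)
          moreover have "(c has_vector_derivative c' u) (at u)" using elim u st by auto
          then have "((\<lambda>u. - Re (c u)) has_vector_derivative - Re (c' u)) (at u)"
            by (intro has_vector_derivative_minus has_vector_derivative_Re)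
          ultimately show "0 \<le> vector_derivative (\<lambda>u. - Re (c u)) (at u)" by (simp add: vector_derivative_at)
        qed
      qed
    qed
    then show ?thesis by simp
  qed
qed

text \<open>One side of the contour, with \<open>f\<close> the fibre attached to it and
  \<open>g\<close> the opposite one; \<epsilon> is 1 on the rising and -1 on the descending side.
  Maximality against \<open>g\<close> makes the height monotone. Between the last time
  \<open>u0\<close> at the initial level and the first time \<open>u1\<close> at the final level it
  stays strictly inside the strip, and there maximality against \<open>f\<close> fixes the shape up
  to the horizontal offset \<open>k\<close>.\<close>

lemma arc_structure:
  fixes f g :: "real \<Rightarrow> real"
  assumes t01: "0 \<le> t0" "t0 < t1" "t1 \<le> 1" and ends: "Im (c t0) \<noteq> Im (c t1)" "\<And>t. t = t0 \<or> t = t1 \<Longrightarrow> Im (c t) = y1 \<or> Im (c t) = y2"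
    and pf: "\<And>t. t \<in> {t0<..<t1} \<Longrightarrow> Im (p t) = f (\<sigma> t)"
    and fg: "\<And>s. s \<in> {l..r} \<Longrightarrow> Complex s (f s) \<in> K" "\<And>s. s \<in> {l..r} \<Longrightarrow> Complex s (g s) \<in> K"
    and f: "continuous_on {l..r} f" "\<And>s u. l < s \<Longrightarrow> u < r \<Longrightarrow> \<exists>C. C-lipschitz_on {s..u} f"
    and \<epsilon>: "\<epsilon> = 1 \<or> \<epsilon> = - 1" "\<And>s. l < s \<Longrightarrow> s < r \<Longrightarrow> 0 < \<epsilon> * (f s - g s)"
  shows "\<exists>k u0 u1. t0 \<le> u0 \<and> u0 < u1 \<and> u1 \<le> t1 \<and> (\<forall>t\<in>{t0..u0}. Im (c t) = Im (c t0)) \<and>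
           (\<forall>t\<in>{u1..t1}. Im (c t) = Im (c t1)) \<and> (\<forall>t\<in>{u0..u1}. Re (c t) = R * f (\<sigma> t) + k)"
proof -
  have in01: "t \<in> {0..1}" if "t \<in> {t0..t1}" for t using that t01 by auto
  have \<sigma>_inner: "l < \<sigma> t" "\<sigma> t < r" if "t \<in> {0..1}" "Im (c t) \<noteq> y1" "Im (c t) \<noteq> y2" for t
    using \<sigma>_range[OF that(1)] that(2,3) y_eq Im_eq[of t] by (auto simp: less_le)
  have mono: "\<epsilon> * Im (c s) \<le> \<epsilon> * Im (c t)" if st: "t0 \<le> s" "s \<le> t" "t \<le> t1" for s t
  proof -
    have "(\<bar>\<epsilon>\<bar> * B)-lipschitz_on {s..t} (\<lambda>t. \<epsilon> * Im (c t))"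
      using \<epsilon>(1) lipschitz_on_subset[OF lipschitz_on_Im[OF lip], of "{s..t}"] st t01 by auto
    then show ?thesis using st(2)
    proof (rule lipschitz_mono_if_derivative_nonneg)
      show "AE u in lborel. u \<in> {s..t} \<longrightarrow> 0 \<le> vector_derivative (\<lambda>t. \<epsilon> * Im (c t)) (at u)"
        using derivative maximal AE_not_endpoint[of t0] AE_not_endpoint[of t1]
      proof eventually_elim
        case (elim u)
        show ?case
        proof
          assume u: "u \<in> {s..t}"
          then have u': "u \<in> {t0<..<t1}" "u \<in> {0<..<1}" "u \<in> {0..1}" using elim st t01 by auto
          with elim have d: "(c has_vector_derivative c' u) (at u)" and mx: "\<And>q. q \<in> K \<Longrightarrow> q \<bullet> c' u \<le> p u \<bullet> c' u" by auto
          have "0 \<le> \<epsilon> * Im (c' u)"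
          proof (cases "Im (c u) = y1 \<or> Im (c u) = y2")
            case True
            then show ?thesis using flat_derivative[OF u'(2) d] by simp
          next
            case False
            then have s: "l < \<sigma> u" "\<sigma> u < r" using \<sigma>_inner[OF u'(3)] by auto
            then have "Complex (\<sigma> u) (g (\<sigma> u)) \<bullet> c' u \<le> p u \<bullet> c' u" by (intro mx fg(2)) auto
            then have "0 \<le> (f (\<sigma> u) - g (\<sigma> u)) * Im (c' u)"
              using pf[OF u'(1)] by (simp add: inner_complex_def p_def algebra_simps)
            also have "\<dots> = (\<epsilon> * (f (\<sigma> u) - g (\<sigma> u))) * (\<epsilon> * Im (c' u))" using \<epsilon>(1) by auto
            finally show ?thesis using \<epsilon>(2)[OF s] by (simp add: zero_le_mult_iff)
          qed
          moreover have "((\<lambda>t. \<epsilon> * Im (c t)) has_vector_derivative \<epsilon> * Im (c' u)) (at u)"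
            using has_vector_derivative_mult_right[OF has_vector_derivative_Im[OF d]] .
          ultimately show "0 \<le> vector_derivative (\<lambda>t. \<epsilon> * Im (c t)) (at u)" by (simp add: vector_derivative_at)
        qed
      qed
    qed
  qed
  have yc: "continuous_on {t0..t1} (\<lambda>t. Im (c t))"
    by (rule continuous_on_subset[OF lipschitz_on_continuous_on[OF lipschitz_on_Im[OF lip]]]) (use t01 in auto)
  have level: "compact {t \<in> {t0..t1}. Im (c t) = y}" for y
  proof -
    have "closed {t \<in> {t0..t1}. Im (c t) = y}" by (rule continuous_closed_preimage_constant[OF yc closed_atLeastAtMost])
    moreover have "bounded {t \<in> {t0..t1}. Im (c t) = y}" by (rule bounded_subset[OF bounded_closed_interval[of t0 t1]]) auto
    ultimately show ?thesis by (simp add: compact_eq_bounded_closed)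
  qed
  have "t0 \<in> {t \<in> {t0..t1}. Im (c t) = Im (c t0)}" "t1 \<in> {t \<in> {t0..t1}. Im (c t) = Im (c t1)}"
    using t01 by auto
  then have ne: "{t \<in> {t0..t1}. Im (c t) = Im (c t0)} \<noteq> {}" "{t \<in> {t0..t1}. Im (c t) = Im (c t1)} \<noteq> {}"
    by blast+
  from compact_attains_sup[OF level ne(1)] obtain u0 where u0: "u0 \<in> {t0..t1}" "Im (c u0) = Im (c t0)"
      "\<And>t. t \<in> {t0..t1} \<Longrightarrow> Im (c t) = Im (c t0) \<Longrightarrow> t \<le> u0" by auto
  from compact_attains_inf[OF level ne(2)] obtain u1 where u1: "u1 \<in> {t0..t1}" "Im (c u1) = Im (c t1)"
      "\<And>t. t \<in> {t0..t1} \<Longrightarrow> Im (c t) = Im (c t1) \<Longrightarrow> u1 \<le> t" by auto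
  have flat0: "Im (c t) = Im (c t0)" if "t \<in> {t0..u0}" for t
    using mono[of t0 t] mono[of t u0] u0(1,2) that \<epsilon>(1) by auto
  have flat1: "Im (c t) = Im (c t1)" if "t \<in> {u1..t1}" for t
    using mono[of u1 t] mono[of t t1] u1(1,2) that \<epsilon>(1) by auto
  have u01: "u0 < u1"
  proof (rule ccontr)
    assume "\<not> u0 < u1"
    then have "u1 \<in> {t0..u0}" using u1 by auto
    from flat0[OF this] show False using u1(2) ends(1) by simp
  qed
  have inner: "Im (c t) \<noteq> y1" "Im (c t) \<noteq> y2" if "t \<in> {u0<..<u1}" for t
  proof -
    have "Im (c t) \<noteq> Im (c t0)" "Im (c t) \<noteq> Im (c t1)" using u0(3)[of t] u1(3)[of t] u0(1) u1(1) that by auto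
    then show "Im (c t) \<noteq> y1" "Im (c t) \<noteq> y2" using ends(1) ends(2)[of t0] ends(2)[of t1] by auto
  qed
  let ?h = "\<lambda>t. Re (c t) - R * f (\<sigma> t)"
  have \<sigma>c: "continuous_on {0..1} \<sigma>" using lipschitz_\<sigma> lipschitz_on_continuous_on by blast
  \<comment> \<open>On a compact part of the open arc \<sigma> stays away from \<open>l\<close> and
    \<open>r\<close>, where \<open>f\<close> may have infinite slope, so \<open>f\<close> is
    Lipschitz on the values taken.\<close>
  have const: "?h s = ?h u" if su: "u0 < s" "s \<le> u" "u < u1" for s u
  proof -
    have su01: "{s..u} \<subseteq> {0..1}" "{s..u} \<subseteq> {u0<..<u1}" using su u0(1) u1(1) t01 by auto
    have sc: "continuous_on {s..u} \<sigma>" using \<sigma>c su01(1) by (rule continuous_on_subset)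
    obtain tl where tl: "tl \<in> {s..u}" "\<And>t. t \<in> {s..u} \<Longrightarrow> \<sigma> tl \<le> \<sigma> t"
      using continuous_attains_inf[OF compact_Icc _ sc] su(2) by auto
    obtain tr where tr: "tr \<in> {s..u}" "\<And>t. t \<in> {s..u} \<Longrightarrow> \<sigma> t \<le> \<sigma> tr"
      using continuous_attains_sup[OF compact_Icc _ sc] su(2) by auto
    have lr: "l < \<sigma> tl" "\<sigma> tr < r" using tl(1) tr(1) su01 \<sigma>_inner inner by blast+
    obtain C where C: "C-lipschitz_on {\<sigma> tl..\<sigma> tr} f" using f(2)[OF lr] by blast
    obtain D where D: "D-lipschitz_on {0..1} \<sigma>" using lipschitz_\<sigma> by blast
    have fl: "(C * D)-lipschitz_on {s..u} (\<lambda>t. f (\<sigma> t))"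
      using tl(2) tr(2) by (intro lipschitz_on_compose2[OF lipschitz_on_subset[OF D su01(1)] lipschitz_on_subset[OF C]]) auto
    have hl: "(B + \<bar>R\<bar> * (C * D))-lipschitz_on {s..u} ?h"
      by (intro lipschitz_on_diff lipschitz_on_subset[OF lipschitz_on_Re[OF lip] su01(1)] lipschitz_on_cmult_real fl)
    show ?thesis
    proof (rule lipschitz_const_if_derivative_zero[OF hl su(2)])
      show "AE t in lborel. t \<in> {s..u} \<longrightarrow> vector_derivative ?h (at t) = 0"
        using derivative maximal lipschitz_ae_vector_derivative(1)[OF fl] AE_not_endpoint[of s] AE_not_endpoint[of u]
      proof eventually_elim
        case (elim t)
        show ?case
        proof
          assume t: "t \<in> {s..u}"
          then have t': "t \<in> {s<..<u}" "t \<in> {0..1}" "t \<in> {t0<..<t1}" using elim su01 u0(1) u1(1) by auto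
          let ?D = "vector_derivative (\<lambda>t. f (\<sigma> t)) (at t)"
          from elim t t' have d: "(c has_vector_derivative c' t) (at t)"
            and mx: "\<And>q. q \<in> K \<Longrightarrow> q \<bullet> c' t \<le> p t \<bullet> c' t"
            and D: "((\<lambda>t. f (\<sigma> t)) has_vector_derivative ?D) (at t)" by auto
          have s': "l < \<sigma> t" "\<sigma> t < r" using \<sigma>_inner[OF t'(2)] inner t su01 by blast+
          \<comment> \<open>With the velocity at \<open>t\<close> frozen, the boundary point over
            \<open>\<sigma> u\<close> has its largest inner product with it at \<open>u = t\<close>;
            the vanishing derivative says that the contour is tangent to the placed
            boundary.\<close>
          have "((\<lambda>u. \<sigma> u * Re (c' t) + f (\<sigma> u) * Im (c' t)) has_real_derivative
             - (Im (c' t) / R) * Re (c' t) + ?D * Im (c' t)) (at t)"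
            using derivative_\<sigma>[OF d] D unfolding has_real_derivative_iff_has_vector_derivative[symmetric]
            by (intro DERIV_add DERIV_cmult_right)
          then have "- (Im (c' t) / R) * Re (c' t) + ?D * Im (c' t) = 0"
          proof (rule DERIV_local_max)
            show "0 < min (t - s) (u - t)" using t' by simp
            show "\<forall>x. \<bar>t - x\<bar> < min (t - s) (u - t) \<longrightarrow>
               \<sigma> x * Re (c' t) + f (\<sigma> x) * Im (c' t) \<le> \<sigma> t * Re (c' t) + f (\<sigma> t) * Im (c' t)"
            proof (intro allI impI)
              fix x assume "\<bar>t - x\<bar> < min (t - s) (u - t)"
              then have "x \<in> {0..1}" using su01(1) by auto
              from mx[OF fg(1)[OF \<sigma>_range[OF this]]]
              show "\<sigma> x * Re (c' t) + f (\<sigma> x) * Im (c' t) \<le> \<sigma> t * Re (c' t) + f (\<sigma> t) * Im (c' t)"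
                using pf[OF t'(3)] by (simp add: inner_complex_def p_def)
            qed
          qed
          then have z: "(?D - Re (c' t) / R) * Im (c' t) = 0" by (simp add: algebra_simps)
          \<comment> \<open>Where the height is stationary the relation \<open>z\<close> is empty.
            Comparison with points of abscissa \<open>l\<close> and \<open>r\<close>, on both sides
            of \<open>\<sigma> t\<close>, then forces \<open>Re (c' t) = 0\<close>, and
            \<open>f\<close> composed with \<sigma> is stationary too.\<close>
          have "?D = Re (c' t) / R"
          proof (cases "Im (c' t) = 0")
            case True
            have "l * Re (c' t) \<le> \<sigma> t * Re (c' t)" "r * Re (c' t) \<le> \<sigma> t * Re (c' t)"
              using mx[OF fg(1)[of l]] mx[OF fg(1)[of r]] True l_neg r_pos by (simp_all add: inner_complex_def p_def)
            then have "0 \<le> (\<sigma> t - l) * Re (c' t)" "0 \<le> (r - \<sigma> t) * - Re (c' t)" by (simp_all add: algebra_simps)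
            then have "Re (c' t) = 0" using s' by (simp add: zero_le_mult_iff mult_le_0_iff)
            moreover have "((\<lambda>t. f (\<sigma> t)) has_vector_derivative 0) (at t)"
            proof (rule has_vector_derivative_zero_compose[OF _ C])
              show "(\<sigma> has_vector_derivative 0) (at t)" using derivative_\<sigma>[OF d] True by simp
              show "eventually (\<lambda>u. \<sigma> u \<in> {\<sigma> tl..\<sigma> tr}) (nhds t)"
                unfolding eventually_nhds using t' tl(2) tr(2) by (intro exI[of _ "{s<..<u}"]) auto
            qed
            then have "?D = 0" by (rule vector_derivative_at)
            ultimately show ?thesis by simp
          qed (use z in simp)
          moreover have "(?h has_vector_derivative Re (c' t) - R * ?D) (at t)"
            by (intro has_vector_derivative_diff has_vector_derivative_Re d has_vector_derivative_mult_right D)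
          ultimately show "vector_derivative ?h (at t) = 0" using R_pos by (simp add: vector_derivative_at)
        qed
      qed
    qed
  qed
  define k where "k = ?h ((u0 + u1) / 2)"
  \<comment> \<open>Constancy on the open interval extends to its ends, where only continuity of
    \<open>f\<close> is available.\<close>
  have hc: "continuous_on {u0..u1} ?h"
    using u0(1) u1(1) t01 \<sigma>_range
    by (intro continuous_intros continuous_on_subset[OF lipschitz_on_continuous_on[OF lip]]
        continuous_on_compose2[OF f(1) continuous_on_subset[OF \<sigma>c]]) auto
  have cl: "closure {u0<..<u1} = {u0..u1}" using u01 by simp
  have "?h t = k" if t: "t \<in> {u0..u1}" for t
  proof (rule continuous_constant_on_closure[of "{u0<..<u1}" ?h k])
    show "continuous_on (closure {u0<..<u1}) ?h" using hc by (simp only: cl)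
    show "t \<in> closure {u0<..<u1}" using t by (simp only: cl)
    show "?h x = k" if "x \<in> {u0<..<u1}" for x
    proof (cases "x \<le> (u0 + u1) / 2")
      case True
      then show ?thesis unfolding k_def using that by (intro const) simp_all
    next
      case False
      then show ?thesis unfolding k_def using that by (intro const[symmetric]) simp_all
    qed
  qed
  then have "\<forall>t\<in>{u0..u1}. Re (c t) = R * f (\<sigma> t) + k"
    by (intro ballI) (simp only: diff_eq_eq add.commute)
  moreover have "\<forall>t\<in>{t0..u0}. Im (c t) = Im (c t0)" "\<forall>t\<in>{u1..t1}. Im (c t) = Im (c t1)"
    using flat0 flat1 by blast+
  moreover have "t0 \<le> u0" "u1 \<le> t1" using u0(1) u1(1) by simp_all
  ultimately show ?thesis using u01 by blast
qed

end

text \<open>In this form of the area the abscissa is not differentiated, so that the offsets of the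
  two arcs can be inserted.\<close>

lemma area_integral_by_parts:
  "((\<lambda>t. Re (c t) / (Im (c t))\<^sup>2 * Im (c' t)) has_integral A) {0..1}"
proof -
  have k: "((\<lambda>y. 1 / y) has_real_derivative - (1 / y\<^sup>2)) (at y)" if "y \<in> {y1..y2}" for y
    using y1_pos that by (auto intro!: derivative_eq_intros simp: power2_eq_square divide_simps)
  have k': "continuous_on {y1..y2} (\<lambda>y. - (1 / y\<^sup>2))" using y1_pos by (auto intro!: continuous_intros)
  have "((\<lambda>t. 1 / Im (c t) * Re (c' t)) has_integral A) {0..1}" using area_integral by simp
  from has_integral_neg[OF closed_curve_by_parts[OF lip c1 strip k k' this]]
  show ?thesis by simp
qed

text \<open>Both sides of the contour are arcs of the boundary of the similar copy of \<open>K\<close>, with horizontal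
  offsets \<open>k1\<close> and \<open>k2\<close>; the area forces the offsets to agree.\<close>

lemma equality_image:
  assumes maximal: "AE t in lborel. t \<in> {0..1} \<longrightarrow> (\<forall>q\<in>K. q \<bullet> c' t \<le> p t \<bullet> c' t)" and area: "F_area \<kappa> = A"
  shows "\<exists>z. Im z = R * \<kappa> \<and> path_image c = placed R z ` frontier K"
proof -
  let ?a = "upper_fibre K" and ?b = "lower_fibre K"
  have y0: "Im (c 0) = y1" "Im (c tm) = y2" "Im (c 1) = y1" by (simp_all add: y1_def y2_def c1)
  have "tm \<noteq> 0" "tm \<noteq> 1" using y0 y1_less_y2 by auto
  then have tm': "0 < tm" "tm < 1" using tm by auto
  have Ka: "Complex s (?a s) \<in> K" and Kb: "Complex s (?b s) \<in> K" if "s \<in> {l..r}" for s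
    using that compact_attains_upper_fibre(1)[OF compact_K, of s] compact_attains_lower_fibre(1)[OF compact_K, of s]
    by (simp_all add: Re_image)
  have "\<exists>k u0 u1. 0 \<le> u0 \<and> u0 < u1 \<and> u1 \<le> tm \<and> (\<forall>t\<in>{0..u0}. Im (c t) = Im (c 0)) \<and>
           (\<forall>t\<in>{u1..tm}. Im (c t) = Im (c tm)) \<and> (\<forall>t\<in>{u0..u1}. Re (c t) = R * ?a (\<sigma> t) + k)"
  proof (rule arc_structure[OF maximal, where \<epsilon> = 1 and g = ?b])
    show "\<exists>C. C-lipschitz_on {s..u} ?a" if "l < s" "u < r" for s u
      by (rule upper_fibre_lipschitz_inside[OF compact_K convex_K Re_image that])
  qed (use tm' y0 y1_less_y2 Ka Kb fibres_continuous fibre_less in \<open>auto simp: p_def\<close>)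
  then obtain k1 a0 a1 where a: "0 \<le> a0" "a0 < a1" "a1 \<le> tm" "\<And>t. t \<in> {0..a0} \<Longrightarrow> Im (c t) = y1"
      "\<And>t. t \<in> {a1..tm} \<Longrightarrow> Im (c t) = y2" "\<And>t. t \<in> {a0..a1} \<Longrightarrow> Re (c t) = R * ?a (\<sigma> t) + k1"
    unfolding y0 by blast
  have "\<exists>k u0 u1. tm \<le> u0 \<and> u0 < u1 \<and> u1 \<le> 1 \<and> (\<forall>t\<in>{tm..u0}. Im (c t) = Im (c tm)) \<and>
           (\<forall>t\<in>{u1..1}. Im (c t) = Im (c 1)) \<and> (\<forall>t\<in>{u0..u1}. Re (c t) = R * ?b (\<sigma> t) + k)"
  proof (rule arc_structure[OF maximal, where \<epsilon> = "- 1" and g = ?a])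
    show "\<exists>C. C-lipschitz_on {s..u} ?b" if "l < s" "u < r" for s u
      by (rule lower_fibre_lipschitz_inside[OF compact_K convex_K Re_image that])
  qed (use tm' y0 y1_less_y2 Ka Kb fibres_continuous fibre_less in \<open>auto simp: p_def\<close>)
  then obtain k2 b0 b1 where b: "tm \<le> b0" "b0 < b1" "b1 \<le> 1" "\<And>t. t \<in> {tm..b0} \<Longrightarrow> Im (c t) = y2"
      "\<And>t. t \<in> {b1..1} \<Longrightarrow> Im (c t) = y1" "\<And>t. t \<in> {b0..b1} \<Longrightarrow> Re (c t) = R * ?b (\<sigma> t) + k2"
    unfolding y0 by blast
  have \<sigma>y: "\<sigma> t = r" if "Im (c t) = y1" for t using that Im_eq[of t] y_eq(1) R_pos by simp
  have \<sigma>y': "\<sigma> t = l" if "Im (c t) = y2" for t using that Im_eq[of t] y_eq(2) R_pos by simp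
  \<comment> \<open>Computed with both arcs, the area is \<open>F_area \<kappa>\<close> plus
    \<open>(k1 - k2) / R\<close> times the positive number \<open>Z\<close>. The arc formulas may be
    used on the whole of each side, since \<open>Im (c' t)\<close> vanishes on the horizontal
    pieces.\<close>
  have "k1 = k2"
  proof -
    let ?f = "\<lambda>s. (R * ?a s + k1) / (R * (\<kappa> - s))\<^sup>2" and ?g = "\<lambda>s. (R * ?b s + k2) / (R * (\<kappa> - s))\<^sup>2"
    have cf: "continuous_on {l..r} ?f" and cg: "continuous_on {l..r} ?g"
      by (intro continuous_kernel(2) continuous_intros fibres_continuous)+
    have if': "((\<lambda>t. ?f (\<sigma> t) * Im (c' t)) has_integral R * integral {l..r} ?f) {0..tm}"
      using arc_integral[OF cf, of 0 tm] tm by (simp add: \<sigma>_ends)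
    have ig: "((\<lambda>t. ?g (\<sigma> t) * Im (c' t)) has_integral - R * integral {l..r} ?g) {tm..1}"
      using arc_integral[OF cg, of tm 1] tm by (simp add: \<sigma>_ends)
    have ae: "AE t in lborel. t \<in> {0..1} \<longrightarrow> (Im (c t) = y1 \<or> Im (c t) = y2 \<longrightarrow> Im (c' t) = 0)"
      using derivative AE_not_endpoint[of 0] AE_not_endpoint[of 1]
      by eventually_elim (auto intro!: flat_derivative)
    let ?x = "\<lambda>t. Re (c t) / (Im (c t))\<^sup>2 * Im (c' t)"
    have "AE t in lborel. t \<in> {0..tm} \<longrightarrow> ?x t = ?f (\<sigma> t) * Im (c' t)"
      using ae
    proof eventually_elim
      case (elim t)
      show ?case
      proof
        assume t: "t \<in> {0..tm}"
        then consider "t \<in> {0..a0}" | "t \<in> {a0..a1}" | "t \<in> {a1..tm}" by fastforce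
        then show "?x t = ?f (\<sigma> t) * Im (c' t)"
        proof cases
          case 2 then show ?thesis using a(6) by (simp add: Im_eq)
        qed (use elim t tm a(4,5) in auto)
      qed
    qed
    from has_integral_AE[OF this] if' have x1: "(?x has_integral R * integral {l..r} ?f) {0..tm}" by blast
    have "AE t in lborel. t \<in> {tm..1} \<longrightarrow> ?x t = ?g (\<sigma> t) * Im (c' t)"
      using ae
    proof eventually_elim
      case (elim t)
      show ?case
      proof
        assume t: "t \<in> {tm..1}"
        then consider "t \<in> {tm..b0}" | "t \<in> {b0..b1}" | "t \<in> {b1..1}" by fastforce
        then show "?x t = ?g (\<sigma> t) * Im (c' t)"
        proof cases
          case 2 then show ?thesis using b(6) by (simp add: Im_eq)
        qed (use elim t tm b(4,5) in auto)
      qed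
    qed
    from has_integral_AE[OF this] ig have x2: "(?x has_integral - R * integral {l..r} ?g) {tm..1}" by blast
    have A: "A = R * integral {l..r} ?f + - R * integral {l..r} ?g"
      by (rule has_integral_unique[OF area_integral_by_parts has_integral_combine[OF _ _ x1 x2]]) (use tm in auto)
    define Z where "Z = integral {l..r} (\<lambda>s. 1 / (\<kappa> - s)\<^sup>2)"
    have Zi: "((\<lambda>s. 1 / (\<kappa> - s)\<^sup>2) has_integral Z) {l..r}"
      unfolding Z_def by (intro integrable_integral integrable_continuous_real cont_kernel \<kappa>_gt)
    have "((\<lambda>s. 1 / (\<kappa> - l)\<^sup>2) has_integral (r - l) * (1 / (\<kappa> - l)\<^sup>2)) {l..r}"
      using has_integral_const_real[of "1 / (\<kappa> - l)\<^sup>2" l r] l_neg r_pos by simp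
    then have "(r - l) * (1 / (\<kappa> - l)\<^sup>2) \<le> Z"
      by (rule has_integral_le[OF _ Zi]) (use \<kappa>_gt in \<open>auto intro!: divide_left_mono power_mono\<close>)
    moreover have "0 < (r - l) * (1 / (\<kappa> - l)\<^sup>2)" using \<kappa>_gt l_neg r_pos by simp
    ultimately have Z: "Z > 0" by linarith
    have "((\<lambda>s. R * ?f s - R * ?g s) has_integral R * integral {l..r} ?f - R * integral {l..r} ?g) {l..r}"
      by (intro has_integral_diff has_integral_mult_right integrable_integral integrable_continuous_real cf cg)
    moreover have "((\<lambda>s. (?a s - ?b s) * (1 / (\<kappa> - s)\<^sup>2) + (k1 - k2) / R * (1 / (\<kappa> - s)\<^sup>2)) has_integral F_area \<kappa> + (k1 - k2) / R * Z) {l..r}"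
      by (intro has_integral_add has_integral_mult_right Zi F_area_integral(1) \<kappa>_gt)
    moreover have "R * ?f s - R * ?g s = (?a s - ?b s) * (1 / (\<kappa> - s)\<^sup>2) + (k1 - k2) / R * (1 / (\<kappa> - s)\<^sup>2)" for s
    proof -
      have "R * ((R * u + k1) / (R\<^sup>2 * q)) - R * ((R * v + k2) / (R\<^sup>2 * q)) = (u - v) * (1 / q) + (k1 - k2) / R * (1 / q)" for u v q
        using R_pos by (cases "q = 0") (simp_all add: field_simps power2_eq_square)
      then show ?thesis by (simp only: power_mult_distrib)
    qed
    ultimately have "R * integral {l..r} ?f - R * integral {l..r} ?g = F_area \<kappa> + (k1 - k2) / R * Z"
      using has_integral_unique by (simp only:)
    then have "(k1 - k2) / R * Z = 0" using A area by simp
    then show "k1 = k2" using Z R_pos by simp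
  qed
  define z where "z = Complex k1 (R * \<kappa>)"
  have z: "c t \<in> placed R z ` frontier K" if "Complex (\<sigma> t) ((Re (c t) - k1) / R) \<in> frontier K" for t
  proof -
    have "c t = placed R z (Complex (\<sigma> t) ((Re (c t) - k1) / R))"
      using R_pos by (simp add: complex_eq_iff z_def Im_eq) (simp add: right_diff_distrib)
    with that show ?thesis by blast
  qed
  \<comment> \<open>A point at the lowest level lies on the placed boundary if its abscissa is
    between those of the ends of the fibre over \<open>r\<close>, a possibly degenerate vertical
    edge of \<open>K\<close>.\<close>
  have low: "c t \<in> placed R z ` frontier K"
    if "Im (c t) = y1" "R * ?b r + k1 \<le> Re (c t)" "Re (c t) \<le> R * ?a r + k1" for t
  proof (rule z, rule fibre_frontier)
    show "(Re (c t) - k1) / R \<in> {?b (\<sigma> t)..?a (\<sigma> t)}"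
      using that(2,3) R_pos by (simp add: \<sigma>y[OF that(1)] field_simps)
  qed (use \<sigma>y[OF that(1)] l_neg r_pos in auto)
  have high: "c t \<in> placed R z ` frontier K"
    if "Im (c t) = y2" "R * ?b l + k1 \<le> Re (c t)" "Re (c t) \<le> R * ?a l + k1" for t
  proof (rule z, rule fibre_frontier)
    show "(Re (c t) - k1) / R \<in> {?b (\<sigma> t)..?a (\<sigma> t)}"
      using that(2,3) R_pos by (simp add: \<sigma>y'[OF that(1)] field_simps)
  qed (use \<sigma>y'[OF that(1)] l_neg r_pos in auto)
  have le: "?b s \<le> ?a s" if "s \<in> {l..r}" for s
    using compact_attains_upper_fibre(2)[OF compact_K _ Kb[OF that]] that by (simp add: Re_image)
  have ends: "Re (c a0) = R * ?a r + k1" "Re (c a1) = R * ?a l + k1"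
      "Re (c b0) = R * ?b l + k1" "Re (c b1) = R * ?b r + k1"
    using a(6)[of a0] a(6)[of a1] b(6)[of b0] b(6)[of b1] a(1-3) b(1-3) \<open>k1 = k2\<close>
      \<sigma>y[OF a(4)[of a0]] \<sigma>y'[OF a(5)[of a1]] \<sigma>y'[OF b(4)[of b0]] \<sigma>y[OF b(5)[of b1]] by simp_all
  have up: "Re (c s) \<le> Re (c t)" if "0 \<le> s" "s \<le> t" "t \<le> 1" "\<And>u. u \<in> {s..t} \<Longrightarrow> Im (c u) = y1" for s t
    using flat_arc_monotone(1)[OF maximal that] .
  have down: "Re (c t) \<le> Re (c s)" if "0 \<le> s" "s \<le> t" "t \<le> 1" "\<And>u. u \<in> {s..t} \<Longrightarrow> Im (c u) = y2" for s t
    using flat_arc_monotone(2)[OF maximal that] .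
  \<comment> \<open>At the lowest level the contour runs to the right from time \<open>b1\<close>
    through 1, which is 0 again, to \<open>a0\<close>; its abscissas are thus enclosed by the ends
    of the two arcs. At the highest level it runs to the left from \<open>a1\<close> to
    \<open>b0\<close>.\<close>
  have b1_0: "Re (c b1) \<le> Re (c 0)" and a0_0: "Re (c 0) \<le> Re (c a0)"
    using up[of b1 1] up[of 0 a0] a b tm' c1 by auto
  have a1_m: "Re (c tm) \<le> Re (c a1)" and b0_m: "Re (c b0) \<le> Re (c tm)"
    using down[of a1 tm] down[of tm b0] a b tm' by auto
  have on: "c t \<in> placed R z ` frontier K" if t: "t \<in> {0..1}" for t
  proof -
    consider "t \<in> {0..a0}" | "t \<in> {a0..a1}" | "t \<in> {a1..tm}" | "t \<in> {tm..b0}" | "t \<in> {b0..b1}" | "t \<in> {b1..1}"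
      using t by fastforce
    then show ?thesis
    proof cases
      case 1
      have "Re (c 0) \<le> Re (c t)" "Re (c t) \<le> Re (c a0)"
        using up[of 0 t] up[of t a0] 1 a tm' by auto
      then show ?thesis using b1_0 ends a(4)[OF 1] by (intro low) auto
    next
      case 2
      have "(Re (c t) - k1) / R = ?a (\<sigma> t)" using a(6)[OF 2] R_pos by simp
      then show ?thesis using \<sigma>_range[OF t] le by (intro z fibre_frontier) auto
    next
      case 3
      have "Re (c t) \<le> Re (c a1)" "Re (c tm) \<le> Re (c t)"
        using down[of a1 t] down[of t tm] 3 a tm' by auto
      then show ?thesis using b0_m ends a(5)[OF 3] by (intro high) auto
    next
      case 4
      have "Re (c t) \<le> Re (c tm)" "Re (c b0) \<le> Re (c t)"
        using down[of tm t] down[of t b0] 4 b tm' by auto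
      then show ?thesis using a1_m ends b(4)[OF 4] by (intro high) auto
    next
      case 5
      have "(Re (c t) - k1) / R = ?b (\<sigma> t)" using b(6)[OF 5] R_pos \<open>k1 = k2\<close> by simp
      then show ?thesis using \<sigma>_range[OF t] le by (intro z fibre_frontier) auto
    next
      case 6
      have "Re (c b1) \<le> Re (c t)" "Re (c t) \<le> Re (c 1)"
        using up[of b1 t] up[of t 1] 6 b tm' by auto
      then show ?thesis using a0_0 ends b(5)[OF 6] c1 by (intro low) auto
    qed
  qed
  have "path_image c = frontier (placed R z ` K)"
    by (rule simple_closed_path_eq_frontier[OF simple closed convex_placed[OF convex_K] compact_placed[OF compact_K]])
       (use on in \<open>auto simp: path_image_def frontier_placed(1)[OF R_pos]\<close>)
  then have "path_image c = placed R z ` frontier K" by (simp only: frontier_placed(1)[OF R_pos])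
  then show ?thesis by (intro exI[of _ z]) (simp add: z_def)
qed

lemma equality_extremal:
  assumes "\<mu> > r" "F_area \<mu> = A" "integral {0..1} (\<lambda>t. m (c' t) / Im (c t)) = L \<mu>"
  shows "\<exists>\<rho> z. \<rho> > 0 \<and> Im z = \<rho> * \<mu> \<and> path_image c = placed \<rho> z ` frontier K"
proof -
  note e = equality_calibrated[OF assms]
  show ?thesis
    using equality_image[OF maximal_if_calibrated[OF e(2)]] e(1) assms(2) R_pos by blast
qed

end

section \<open>The inequality and its equality case for arbitrary contours\<close>

context isoperimetric
begin

definition len :: "(real \<Rightarrow> complex) \<Rightarrow> real" where
  "len c = integral {0..1} (\<lambda>t. m (vector_derivative c (at t)) / Im (c t))"

lemma contour_inequality:
  assumes param: "lipschitz_parametrization c \<gamma>" and pos: "positively_oriented c" and half: "\<gamma> \<subseteq> half_plane"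
  shows "area (inside \<gamma>) > 0"
    and "\<And>\<mu>. r < \<mu> \<Longrightarrow> F_area \<mu> = area (inside \<gamma>) \<Longrightarrow> L \<mu> \<le> len c"
    and "\<And>\<mu>. r < \<mu> \<Longrightarrow> F_area \<mu> = area (inside \<gamma>) \<Longrightarrow> len c = L \<mu> \<Longrightarrow>
      \<exists>\<rho> z. \<rho> > 0 \<and> Im z = \<rho> * \<mu> \<and> \<gamma> = placed \<rho> z ` frontier K"
proof -
  obtain B where lip: "B-lipschitz_on {0..1} c" using param by (auto simp: lipschitz_parametrization_def)
  have simple: "simple_path c" and closed: "pathfinish c = pathstart c" and \<gamma>: "\<gamma> = path_image c"
    using param by (auto simp: lipschitz_parametrization_def)
  have Im_cont: "continuous_on {0..1} (\<lambda>t. Im (d t))" if "B-lipschitz_on {0..1} d" for d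
    by (rule lipschitz_on_continuous_on[OF lipschitz_on_Im[OF that]])
  obtain a where a: "a \<in> {0..1}" "\<And>t. t \<in> {0..1} \<Longrightarrow> Im (c a) \<le> Im (c t)"
    using continuous_attains_inf[OF compact_Icc _ Im_cont[OF lip]] by auto
  define d where "d = shiftpath a c"
  have d: "B-lipschitz_on {0..1} d" unfolding d_def by (rule shiftpath_lipschitz[OF lip closed a(1)])
  obtain tm where tm: "tm \<in> {0..1}" "\<And>t. t \<in> {0..1} \<Longrightarrow> Im (d t) \<le> Im (d tm)"
    using continuous_attains_sup[OF compact_Icc _ Im_cont[OF d]] by auto
  have img: "path_image d = path_image c"
    unfolding d_def by (rule path_image_shiftpath[OF a(1)]) (use closed in auto)
  have d0: "d 0 = c a" using a(1) by (simp add: d_def shiftpath_def)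
  interpret q: calibrated K m e w T d B tm
  proof unfold_locales
    show "Im (d 0) \<le> Im (d t)" if "t \<in> {0..1}" for t
    proof -
      have "d t \<in> path_image d" unfolding path_image_def using that by (rule imageI)
      then have "d t \<in> path_image c" by (simp only: img)
      then obtain u where "u \<in> {0..1}" "d t = c u" by (auto simp: path_image_def)
      then show ?thesis using a(2) by (simp add: d0)
    qed
    show "simple_path d" unfolding d_def by (rule simple_path_shiftpath[OF simple closed]) (use a(1) in auto)
    show "pathfinish d = pathstart d" unfolding d_def by (rule closed_shiftpath[OF closed]) (use a(1) in auto)
    show "positively_oriented d" unfolding d_def by (rule positively_oriented_shiftpath[OF simple closed a(1) pos])
    show "path_image d \<subseteq> half_plane" using half by (simp add: img \<gamma>)
  qed (use d tm in auto)
  have A: "q.A = area (inside \<gamma>)" by (simp add: q.A_def area_def img \<gamma>)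
  have "((\<lambda>t. m (vector_derivative d (at t)) / Im (d t)) has_integral len c) {0..1}"
    unfolding d_def len_def
    by (rule has_integral_shiftpath[OF lip a(1), of "\<lambda>z v. m v / Im z", OF integrable_integral[OF length_integrable[OF lip]]])
       (use half in \<open>simp add: \<gamma>\<close>)
  then have len: "integral {0..1} (\<lambda>t. m (vector_derivative d (at t)) / Im (d t)) = len c"
    by (rule integral_unique)
  show "area (inside \<gamma>) > 0" using q.A_pos by (simp add: A)
  show "L \<mu> \<le> len c" if "r < \<mu>" "F_area \<mu> = area (inside \<gamma>)" for \<mu>
    using q.isoperimetric_inequality[OF that(1)] that(2) by (simp only: A len)
  show "\<exists>\<rho> z. \<rho> > 0 \<and> Im z = \<rho> * \<mu> \<and> \<gamma> = placed \<rho> z ` frontier K"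
    if "r < \<mu>" "F_area \<mu> = area (inside \<gamma>)" "len c = L \<mu>" for \<mu>
    using q.equality_extremal[OF that(1)] that(2,3) by (simp only: A len img \<gamma>)
qed

lemma extremal_contour_values:
  assumes \<rho>: "\<rho> > 0" and \<mu>: "\<mu> > r" and z: "Im z = \<rho> * \<mu>"
  shows "placed \<rho> z ` frontier K \<subseteq> half_plane"
    and "area (inside (placed \<rho> z ` frontier K)) = F_area \<mu>"
    and "\<exists>c. lipschitz_parametrization c (placed \<rho> z ` frontier K) \<and> positively_oriented c"
    and "lipschitz_parametrization c (placed \<rho> z ` frontier K) \<Longrightarrow> positively_oriented c \<Longrightarrow> len c = L \<mu>"
proof -
  let ?\<gamma> = "placed \<rho> z ` frontier K" and ?e = "\<lambda>s. placed \<rho> z (e (T * s))"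
  note ep = extremal_parametrization[OF \<rho>, of z]
  show "\<exists>c. lipschitz_parametrization c ?\<gamma> \<and> positively_oriented c" using ep by blast
  obtain B where "B-lipschitz_on {0..1} ?e" "simple_path ?e" "pathfinish ?e = pathstart ?e" and i: "path_image ?e = ?\<gamma>"
    using ep(1) unfolding lipschitz_parametrization_def by blast
  from extremal_integrals(2,4)[OF \<rho> \<mu> z this ep(2)]
  show "?\<gamma> \<subseteq> half_plane" "area (inside ?\<gamma>) = F_area \<mu>" by (simp_all add: i area_def)
  show "len c = L \<mu>" if c: "lipschitz_parametrization c ?\<gamma>" "positively_oriented c"
  proof -
    obtain B where "B-lipschitz_on {0..1} c" "simple_path c" "pathfinish c = pathstart c" "path_image c = ?\<gamma>"
      using c(1) unfolding lipschitz_parametrization_def by blast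
    from length_extremal[OF \<rho> \<mu> z this c(2)] show ?thesis
      unfolding len_def L_def by (rule integral_unique)
  qed
qed

lemma contour_equality:
  assumes param: "lipschitz_parametrization c \<gamma>" and pos: "positively_oriented c" and half: "\<gamma> \<subseteq> half_plane"
    and \<mu>: "r < \<mu>" "F_area \<mu> = area (inside \<gamma>)"
  shows "len c = L \<mu> \<longleftrightarrow> (\<exists>\<rho> z. \<rho> > 0 \<and> Im z = \<rho> * \<mu> \<and> \<gamma> = placed \<rho> z ` frontier K)"
  using contour_inequality(3)[OF param pos half \<mu>] extremal_contour_values(4)[OF _ \<mu>(1)] param pos by blast

lemma F_area_solution: "A > 0 \<Longrightarrow> \<exists>\<mu>>r. F_area \<mu> = A"
  using imageE[of A F_area "{r<..}"] bij_betw_imp_surj_on[OF bij_F_area] by auto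

lemma L_solution: "x > 0 \<Longrightarrow> \<exists>\<mu>>r. L \<mu> = x"
  using imageE[of x L "{r<..}"] bij_betw_imp_surj_on[OF bij_L] by auto

text \<open>Both functions decrease in the parameter, so lengths and areas of extremals are ordered
  alike; this gives the equivalence of the length form and the area form of the inequality.\<close>

lemma L_le_iff: "r < \<mu> \<Longrightarrow> r < \<nu> \<Longrightarrow> L \<mu> \<le> L \<nu> \<longleftrightarrow> F_area \<mu> \<le> F_area \<nu>"
  using L_decreasing[of \<mu> \<nu>] L_decreasing[of \<nu> \<mu>] F_area_decreasing[of \<mu> \<nu>] F_area_decreasing[of \<nu> \<mu>]
  by (cases \<mu> \<nu> rule: linorder_cases) auto

end

text \<open>Evaluates \<open>calF_plus\<close>, \<open>calL_plus\<close> and their minus versions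
  along a common parameter: with \<open>f\<close> the length and \<open>g\<close> the area as
  functions of \<mu>, the composite sends the length at \<mu> to the area at \<mu>, and its inverse
  goes back.\<close>

lemma the_inv_into_parametrized:
  assumes f: "bij_betw f D S" and g: "inj_on g D" and x: "x \<in> D"
  shows "g (the_inv_into D f (f x)) = g x"
    and "the_inv_into S (\<lambda>y. g (the_inv_into D f y)) (g x) = f x"
proof -
  have i: "inj_on f D" and im: "f ` D = S" using f by (auto simp: bij_betw_def)
  have 1: "g (the_inv_into D f (f x)) = g x" if "x \<in> D" for x using that i by (simp add: the_inv_into_f_f)
  then show "g (the_inv_into D f (f x)) = g x" using x .
  show "the_inv_into S (\<lambda>y. g (the_inv_into D f y)) (g x) = f x"
  proof (rule the_inv_into_f_eq)
    have "inj_on (\<lambda>y. g (the_inv_into D f y)) (f ` D)"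
      using g by (auto simp: inj_on_def 1)
    then show "inj_on (\<lambda>y. g (the_inv_into D f y)) S" by (simp only: im)
  qed (use x im 1 in auto)
qed

subsection \<open>Reflection in the vertical axis\<close>

definition mirror :: "complex \<Rightarrow> complex" where "mirror z = - cnj z"

lemma mirror_simps [simp]:
  "Re (mirror z) = - Re z" "Im (mirror z) = Im z" "mirror (mirror z) = z"
  "mirror z = mirror w \<longleftrightarrow> z = w" "mirror 0 = 0" "cross (mirror z) (mirror w) = - cross z w"
  by (simp_all add: mirror_def cross_def complex_eq_iff)

lemma inner_mirror: "mirror p \<bullet> z = p \<bullet> mirror z"
  by (simp add: inner_complex_def)

lemma linear_mirror: "linear mirror"
  by (rule linearI) (simp_all add: mirror_def)

lemma bounded_linear_mirror: "bounded_linear mirror"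
  using linear_mirror by (simp add: linear_conv_bounded_linear)

lemma inj_mirror: "inj mirror"
  by (simp add: inj_def)

lemma mirror_image_image [simp]: "mirror ` mirror ` S = S"
  by (simp add: image_image)

lemma frontier_mirror: "frontier (mirror ` S) = mirror ` frontier S"
  unfolding frontier_def interior_injective_linear_image[OF linear_mirror inj_mirror]
    closure_injective_linear_image[OF linear_mirror inj_mirror, symmetric]
  by (rule image_set_diff[OF inj_mirror, symmetric])

lemma dist_mirror [simp]: "dist (mirror z) (mirror w) = dist z w"
proof -
  have "mirror z - mirror w = mirror (z - w)" by (simp add: mirror_def)
  then show ?thesis by (simp add: dist_norm cmod_def power2_commute)
qed

lemma has_vector_derivative_mirror:
  "(c has_vector_derivative d) F \<Longrightarrow> ((\<lambda>t. mirror (c t)) has_vector_derivative mirror d) F"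
  by (rule bounded_linear.has_vector_derivative[OF bounded_linear_mirror])

lemma AE_vector_derivative_mirror:
  fixes c :: "real \<Rightarrow> complex"
  assumes "B-lipschitz_on {0..1} c"
  shows "AE t in lborel. t \<in> {0..1} \<longrightarrow> vector_derivative (\<lambda>t. mirror (c t)) (at t) = mirror (vector_derivative c (at t))"
  using lipschitz_ae_vector_derivative(1)[OF assms]
  by eventually_elim (auto intro!: vector_derivative_at has_vector_derivative_mirror)

lemma lipschitz_on_mirror: "B-lipschitz_on S c \<Longrightarrow> B-lipschitz_on S (\<lambda>t. mirror (c t))"
  by (simp add: lipschitz_on_def)

lemma simple_path_mirror: "simple_path (\<lambda>t. mirror (c t)) \<longleftrightarrow> simple_path c"
  using simple_path_linear_image_eq[OF linear_mirror inj_mirror, of c] by (simp add: o_def)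

lemma lipschitz_parametrization_mirror:
  "lipschitz_parametrization c \<gamma> \<Longrightarrow> lipschitz_parametrization (\<lambda>t. mirror (c t)) (mirror ` \<gamma>)"
  unfolding lipschitz_parametrization_def
  by (auto simp: simple_path_mirror pathfinish_def pathstart_def path_image_def intro: lipschitz_on_mirror)

lemma mirror_half_plane: "mirror ` \<gamma> \<subseteq> half_plane \<longleftrightarrow> \<gamma> \<subseteq> half_plane"
  by (auto simp: half_plane_def)

lemma negatively_oriented_iff:
  assumes "simple_path c" "pathfinish c = pathstart c"
  shows "negatively_oriented c \<longleftrightarrow> \<not> positively_oriented c"
proof -
  obtain w :: real where w: "w = 1 \<or> w = -1" "\<And>z. z \<in> inside (path_image c) \<Longrightarrow> winding_number c z = of_real w"
    using simple_closed_lipschitz_orientation[OF assms(1)] by metis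
  moreover obtain z where "z \<in> inside (path_image c)" using Jordan_inside_outside[OF assms] by auto
  ultimately show ?thesis by (fastforce simp: negatively_oriented_def positively_oriented_def)
qed

text \<open>The reflection changes the sign of the cross product, hence of the integral that decides
  the orientation.\<close>

lemma positively_oriented_mirror:
  assumes "lipschitz_parametrization c \<gamma>"
  shows "positively_oriented (\<lambda>t. mirror (c t)) \<longleftrightarrow> negatively_oriented c"
proof -
  obtain B where lip: "B-lipschitz_on {0..1} c" and simple: "simple_path c" and closed: "pathfinish c = pathstart c"
    using assms by (auto simp: lipschitz_parametrization_def)
  have mc: "simple_path (\<lambda>t. mirror (c t))" "pathfinish (\<lambda>t. mirror (c t)) = pathstart (\<lambda>t. mirror (c t))"
    using lipschitz_parametrization_mirror[OF assms] by (auto simp: lipschitz_parametrization_def)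
  obtain w :: real where w: "\<And>z. z \<in> inside (path_image c) \<Longrightarrow> winding_number c z = of_real w"
    using simple_closed_lipschitz_orientation[OF simple] by metis
  obtain I where I: "((\<lambda>t. cross (c t) (vector_derivative c (at t))) has_integral I) {0..1}"
    using integral_cross_eq_area[OF lip closed w] by blast
  have "AE t in lborel. t \<in> {0..1} \<longrightarrow> cross (mirror (c t)) (vector_derivative (\<lambda>t. mirror (c t)) (at t))
      = - cross (c t) (vector_derivative c (at t))"
    using AE_vector_derivative_mirror[OF lip] by eventually_elim simp
  from has_integral_AE[OF this] has_integral_neg[OF I]
  have J: "((\<lambda>t. cross (mirror (c t)) (vector_derivative (\<lambda>t. mirror (c t)) (at t))) has_integral - I) {0..1}" by blast
  have "positively_oriented (\<lambda>t. mirror (c t)) \<longleftrightarrow> - I > 0"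
    by (rule positively_oriented_iff(1)[OF lipschitz_on_mirror[OF lip] mc J])
  also have "\<dots> \<longleftrightarrow> \<not> I > 0" using positively_oriented_iff(2)[OF lip simple closed I] by auto
  also have "\<dots> \<longleftrightarrow> negatively_oriented c"
    using positively_oriented_iff(1)[OF lip simple closed I] negatively_oriented_iff[OF simple closed] by simp
  finally show ?thesis .
qed

text \<open>Both areas are line integrals of \<open>dx / y\<close>. The reflection changes the sign
  of \<open>dx\<close> and the orientation together, so the two signs cancel.\<close>

lemma area_mirror:
  assumes param: "lipschitz_parametrization c \<gamma>" and half: "\<gamma> \<subseteq> half_plane"
  shows "area (inside (mirror ` \<gamma>)) = area (inside \<gamma>)"
proof -
  have *: "area (inside (mirror ` \<gamma>)) = area (inside \<gamma>)"
    if param: "lipschitz_parametrization c \<gamma>" and half: "\<gamma> \<subseteq> half_plane" and neg: "negatively_oriented c" for c \<gamma>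
  proof -
    obtain B where c: "B-lipschitz_on {0..1} c" "pathfinish c = pathstart c" "path_image c = \<gamma>"
      using param by (auto simp: lipschitz_parametrization_def)
    let ?d = "\<lambda>t. mirror (c t)"
    have d: "B-lipschitz_on {0..1} ?d" "pathfinish ?d = pathstart ?d" "path_image ?d = mirror ` \<gamma>"
      using lipschitz_parametrization_mirror[OF param] lipschitz_on_mirror[OF c(1)]
      by (auto simp: lipschitz_parametrization_def)
    have 1: "((\<lambda>t. Re (vector_derivative c (at t)) / Im (c t)) has_integral - 1 * area (inside \<gamma>)) {0..1}"
      using area_line_integral(1)[OF c(1,2), of "- 1"] neg half by (simp add: c(3) negatively_oriented_def)
    have 2: "((\<lambda>t. Re (vector_derivative ?d (at t)) / Im (?d t)) has_integral 1 * area (inside (mirror ` \<gamma>))) {0..1}"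
      using area_line_integral(1)[OF d(1,2), of 1] positively_oriented_mirror[OF param] neg half
      by (simp add: d(3) positively_oriented_def mirror_half_plane)
    have "AE t in lborel. t \<in> {0..1} \<longrightarrow> Re (vector_derivative ?d (at t)) / Im (?d t) = - (Re (vector_derivative c (at t)) / Im (c t))"
      using AE_vector_derivative_mirror[OF c(1)] by eventually_elim simp
    from has_integral_AE[OF this] 2
    have "((\<lambda>t. - (Re (vector_derivative c (at t)) / Im (c t))) has_integral 1 * area (inside (mirror ` \<gamma>))) {0..1}" by blast
    from has_integral_unique[OF this has_integral_neg[OF 1]] show ?thesis by simp
  qed
  show ?thesis
  proof (cases "negatively_oriented c")
    case True
    then show ?thesis by (rule *[OF param half])
  next
    case False
    \<comment> \<open>The reflection of a positively oriented curve is negatively oriented, and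
      reflecting once more gives the original contour; so the statement already shown is applied to
      the reflected curve.\<close>
    let ?d = "\<lambda>t. mirror (c t)"
    have d: "lipschitz_parametrization ?d (mirror ` \<gamma>)" by (rule lipschitz_parametrization_mirror[OF param])
    have "simple_path c" "pathfinish c = pathstart c" using param by (auto simp: lipschitz_parametrization_def)
    with False have "positively_oriented c" using negatively_oriented_iff by blast
    then have "negatively_oriented ?d" using positively_oriented_mirror[OF d] by simp
    from *[OF d _ this] half show ?thesis by (simp add: mirror_half_plane)
  qed
qed

text \<open>Reflection reverses the sweep of the boundary; running through it backwards, in the
  parameter \<open>T - t\<close>, restores the sector speed 1 with its positive sign.\<close>

lemma (in isoperimetric) isoperimetric_mirror:
  "isoperimetric (mirror ` K) (\<lambda>x. m (mirror x)) (\<lambda>t. mirror (e (T - t))) (\<lambda>t. mirror (w (T - t))) T"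
proof
  show "convex (mirror ` K)" by (rule convex_linear_image[OF linear_mirror convex_K])
  show "compact (mirror ` K)"
    by (rule compact_continuous_image[OF linear_continuous_on[OF bounded_linear_mirror] compact_K])
  show "0 \<in> interior (mirror ` K)"
    unfolding interior_injective_linear_image[OF linear_mirror inj_mirror]
    using zero_in_interior by (intro image_eqI[of _ _ 0]) simp_all
  obtain B where B: "B-lipschitz_on UNIV e" using e_lipschitz by blast
  have "B-lipschitz_on UNIV (\<lambda>t. mirror (e (T - t)))"
  proof (rule lipschitz_on_mirror, rule lipschitz_onI)
    show "dist (e (T - x)) (e (T - y)) \<le> B * dist x y" for x y
      using lipschitz_onD[OF B, of "T - x" "T - y"] by (simp add: dist_real_def abs_minus_commute)
  qed (rule lipschitz_on_nonneg[OF B])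
  then show "\<exists>B. B-lipschitz_on UNIV (\<lambda>t. mirror (e (T - t)))" by blast
  have rev: "(\<lambda>s. e (T - T * s)) = reversepath (\<lambda>s. e (T * s))"
    by (simp add: reversepath_def fun_eq_iff right_diff_distrib)
  show "simple_path (\<lambda>s. mirror (e (T - T * s)))"
    unfolding simple_path_mirror[of "\<lambda>s. e (T - T * s)"] rev by (rule simple_path_reversepath[OF e_simple])
  show "path_image (\<lambda>s. mirror (e (T - T * s))) = frontier (mirror ` K)"
  proof -
    have "path_image (\<lambda>s. mirror (e (T - T * s))) = mirror ` path_image (\<lambda>s. e (T - T * s))"
      by (simp add: path_image_def image_image)
    then show ?thesis by (simp add: rev e_image frontier_mirror)
  qed
  show "mirror (e (T - T)) = mirror (e (T - 0))" by (simp add: e_closed)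
  have "AE t in lborel. T + (- 1) * t \<in> {0..T} \<longrightarrow> (\<exists>d. (e has_vector_derivative d) (at (T + (- 1) * t)) \<and> cross (e (T + (- 1) * t)) d = 1)"
    by (rule AE_lborel_affine[OF e_cross]) simp
  then show "AE t in lborel. t \<in> {0..T} \<longrightarrow> (\<exists>d. ((\<lambda>t. mirror (e (T - t))) has_vector_derivative d) (at t) \<and> cross (mirror (e (T - t))) d = 1)"
  proof eventually_elim
    case (elim t)
    show ?case
    proof
      assume "t \<in> {0..T}"
      with elim obtain d where d: "(e has_vector_derivative d) (at (T - t))" "cross (e (T - t)) d = 1" by auto
      have "((\<lambda>t. T - t) has_vector_derivative - 1) (at t)" by (auto intro!: derivative_eq_intros)
      from vector_diff_chain_at[OF this d(1)]
      have "((\<lambda>t. e (T - t)) has_vector_derivative - d) (at t)" by (simp add: o_def)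
      from has_vector_derivative_mirror[OF this]
      show "\<exists>d. ((\<lambda>t. mirror (e (T - t))) has_vector_derivative d) (at t) \<and> cross (mirror (e (T - t))) d = 1"
        using d(2) by (intro exI[of _ "mirror (- d)"]) (simp add: cross_def)
    qed
  qed
  show "continuous_on UNIV (\<lambda>x. m (mirror x))"
    by (rule continuous_on_compose2[OF m_cont linear_continuous_on[OF bounded_linear_mirror]]) simp
  show "m (mirror (s *\<^sub>R x)) = s * m (mirror x)" if "s \<ge> 0" for s x
    using m_scaleR[OF that, of "mirror x"] by (simp add: linear_cmul[OF linear_mirror])
  show "p \<bullet> x \<le> m (mirror x)" if "p \<in> mirror ` K" for p x
    using that m_ge[of "mirror p" "mirror x"] by (auto simp: inner_mirror)
  show "mirror (e (T - t)) \<bullet> mirror (w (T - t)) = 1" if "t \<in> {0..T}" for t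
    using e_w[of "T - t"] that by (simp add: inner_mirror)
  show "m (mirror (mirror (w (T - t)))) = 1" if "t \<in> {0..T}" for t
    using m_w[of "T - t"] that by simp
qed (rule T_pos)

lemma (in isoperimetric) len_mirror:
  assumes "lipschitz_parametrization c \<gamma>"
  shows "isoperimetric.len (\<lambda>x. m (mirror x)) (\<lambda>t. mirror (c t)) = len c"
proof -
  interpret q: isoperimetric "mirror ` K" "\<lambda>x. m (mirror x)" "\<lambda>t. mirror (e (T - t))" "\<lambda>t. mirror (w (T - t))" T
    by (rule isoperimetric_mirror)
  obtain B where lip: "B-lipschitz_on {0..1} c" using assms by (auto simp: lipschitz_parametrization_def)
  have "AE t in lborel. t \<in> {0..1} \<longrightarrow> m (mirror (vector_derivative (\<lambda>t. mirror (c t)) (at t))) / Im (mirror (c t))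
     = m (vector_derivative c (at t)) / Im (c t)"
    using AE_vector_derivative_mirror[OF lip] by eventually_elim simp
  from has_integral_AE[OF this] show ?thesis
    by (simp only: q.len_def len_def integral_def integrable_on_def)
qed

subsection \<open>The isoperimetric inequalities for both orientations\<close>

lemma (in convex_body) convex_body_polar: "convex_body (polar K)"
proof
  have eq: "polar K = (\<Inter>z\<in>K. {p. z \<bullet> p \<le> 1})"
    by (auto simp: polar_def inner_commute)
  show "convex (polar K)" unfolding eq by (intro convex_INT convex_halfspace_le)
  have "closed (polar K)" unfolding eq by (intro closed_INT ballI closed_halfspace_le)
  moreover have "bounded (polar K)"
  proof -
    obtain \<rho> where \<rho>: "\<rho> > 0" "cball 0 \<rho> \<subseteq> K" using inner_radius .
    have "norm p \<le> 1 / \<rho>" if "p \<in> polar K" for p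
    proof (cases "p = 0")
      case False
      have "(\<rho> / norm p) *\<^sub>R p \<in> K" using \<rho> False by (intro subsetD[OF \<rho>(2)]) simp
      then have "p \<bullet> ((\<rho> / norm p) *\<^sub>R p) \<le> 1" using that by (auto simp: polar_def)
      also have "p \<bullet> ((\<rho> / norm p) *\<^sub>R p) = \<rho> * norm p"
        using False by (simp add: dot_square_norm power2_eq_square)
      finally show ?thesis using \<rho>(1) by (simp add: field_simps)
    qed (use \<rho> in simp)
    then show ?thesis by (auto simp: bounded_iff)
  qed
  ultimately show "compact (polar K)" by (simp add: compact_eq_bounded_closed)
  obtain M where M: "M > 0" "K \<subseteq> cball 0 M" using outer_radius .
  have "cball 0 (1 / M) \<subseteq> polar K"
  proof
    fix p :: complex assume p: "p \<in> cball 0 (1 / M)"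
    have "p \<bullet> z \<le> 1" if "z \<in> K" for z
    proof -
      have "p \<bullet> z \<le> norm p * norm z" by (rule norm_cauchy_schwarz)
      also have "\<dots> \<le> 1 / M * M" using p M that by (intro mult_mono) auto
      finally show ?thesis using M(1) by simp
    qed
    then show "p \<in> polar K" by (simp add: polar_def)
  qed
  then show "0 \<in> interior (polar K)"
    unfolding mem_interior_cball using M(1) by (intro exI[of _ "1 / M"]) simp
qed

lemma (in convex_body) inner_le_minkowski:
  assumes "p \<in> polar K" shows "p \<bullet> x \<le> minkowski K x"
proof (rule field_le_epsilon)
  fix \<epsilon> :: real assume "\<epsilon> > 0"
  let ?t = "minkowski K x + \<epsilon>"
  have t: "?t > 0" using \<open>\<epsilon> > 0\<close> minkowski_nonneg[of x] by linarith
  have "x /\<^sub>R ?t \<in> K" using \<open>\<epsilon> > 0\<close> by (intro mem_if_minkowski_less) simp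
  then have "p \<bullet> (x /\<^sub>R ?t) \<le> 1" using assms by (auto simp: polar_def)
  then show "p \<bullet> x \<le> ?t" using t by (simp add: field_simps)
qed

lemma (in convex_body) convex_trig:
  shows "\<exists>B. B-lipschitz_on UNIV (convex_trig K)"
    and "convex_trig K (\<theta> + 2 * euclidean_area K) = convex_trig K \<theta>"
    and "simple_path (\<lambda>s. convex_trig K (2 * euclidean_area K * s))"
    and "path_image (\<lambda>s. convex_trig K (2 * euclidean_area K * s)) = frontier K"
    and "AE \<theta> in lborel. \<exists>d. (convex_trig K has_vector_derivative d) (at \<theta>) \<and> cross (convex_trig K \<theta>) d = 1"
  using is_convex_trig_convex_trig by (simp_all add: is_convex_trig_def cross_def)

lemma (in convex_body) range_convex_trig: "range (convex_trig K) = frontier K"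
proof -
  let ?T = "2 * euclidean_area K"
  have T: "?T > 0" using measure_K_pos by (simp add: euclidean_area_def)
  have per: "convex_trig K (x + of_int n * ?T) = convex_trig K x" for x n
    using periodic_int[of "convex_trig K" ?T, OF convex_trig(2)] .
  have "convex_trig K \<theta> \<in> convex_trig K ` {0..?T}" for \<theta>
  proof -
    define n where "n = - \<lfloor>\<theta> / ?T\<rfloor>"
    have "\<theta> + of_int n * ?T = frac (\<theta> / ?T) * ?T"
      using T by (simp add: n_def frac_def left_diff_distrib)
    also have "\<dots> \<in> {0..?T}" using T frac_lt_1[of "\<theta> / ?T"] by (auto simp: mult_le_cancel_right1 less_imp_le)
    finally show ?thesis by (metis per imageI)
  qed
  then have "range (convex_trig K) = convex_trig K ` {0..?T}" by auto
  also have "{0..?T} = (\<lambda>s. ?T * s) ` {0..1}" using T by (simp add: image_mult_atLeastAtMost)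
  finally show ?thesis using convex_trig(4) by (simp add: path_image_def image_image)
qed

section \<open>The Finsler problem as an instance\<close>

locale finsler_problem =
  fixes \<Omega> :: "complex set" and \<phi> :: "real \<Rightarrow> real"
  assumes convex: "convex \<Omega>" and compact: "compact \<Omega>" and zero: "0 \<in> interior \<Omega>"
    and selection: "angle_selection \<Omega> \<phi>"

sublocale finsler_problem \<subseteq> body: convex_body \<Omega>
  by unfold_locales (rule convex compact zero)+

sublocale finsler_problem \<subseteq> polar: convex_body "polar \<Omega>"
  by (rule body.convex_body_polar)

text \<open>The gauge of \<Omega> dominates all functionals from the polar. The relation of
  corresponding angles is the condition \<open>e_w\<close>: the boundary point of \<Omega> at
  \<open>\<phi> t\<close> is paired to 1 with the boundary point of the polar at
  \<open>t\<close>.\<close>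

sublocale finsler_problem \<subseteq> isoperimetric "polar \<Omega>" "minkowski \<Omega>" "convex_trig (polar \<Omega>)"
    "\<lambda>t. convex_trig \<Omega> (\<phi> t)" "2 * euclidean_area (polar \<Omega>)"
proof
  show "2 * euclidean_area (polar \<Omega>) > 0" using polar.measure_K_pos by (simp add: euclidean_area_def)
  show "convex_trig (polar \<Omega>) (2 * euclidean_area (polar \<Omega>)) = convex_trig (polar \<Omega>) 0"
    using polar.convex_trig(2)[of 0] by simp
  show "AE t in lborel. t \<in> {0..2 * euclidean_area (polar \<Omega>)} \<longrightarrow>
      (\<exists>d. (convex_trig (polar \<Omega>) has_vector_derivative d) (at t) \<and> cross (convex_trig (polar \<Omega>) t) d = 1)"
    using polar.convex_trig(5) by eventually_elim simp
  show "minkowski \<Omega> (s *\<^sub>R x) = s * minkowski \<Omega> x" if "s \<ge> 0" for s x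
    using that body.minkowski_scaleR[of s x] by (cases "s = 0") auto
  show "p \<bullet> x \<le> minkowski \<Omega> x" if "p \<in> polar \<Omega>" for p x
    by (rule body.inner_le_minkowski[OF that])
  show "convex_trig (polar \<Omega>) t \<bullet> convex_trig \<Omega> (\<phi> t) = 1" if "t \<in> {0..2 * euclidean_area (polar \<Omega>)}" for t
    using selection that by (simp add: angle_selection_def corresponding_angles_def inner_complex_def cosK_def sinK_def mult.commute)
  show "minkowski \<Omega> (convex_trig \<Omega> (\<phi> t)) = 1" if "t \<in> {0..2 * euclidean_area (polar \<Omega>)}" for t
    using body.range_convex_trig body.frontier_eq_minkowski by blast
qed (rule polar.convex_trig body.continuous_minkowski)+

lemma (in isoperimetric) frontier_Re_image: "l \<in> Re ` frontier K" "r \<in> Re ` frontier K"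
proof -
  have *: "s \<in> Re ` frontier K" if "s \<in> {l..r}" "s = l \<or> s = r" for s
  proof (rule image_eqI[of _ _ "Complex s (upper_fibre K s)"])
    have "s \<in> Re ` K" using that by (simp add: Re_image)
    then have "lower_fibre K s \<le> upper_fibre K s"
      using compact_attains_upper_fibre(2)[OF compact_K _ compact_attains_lower_fibre(1)[OF compact_K]] by blast
    then show "Complex s (upper_fibre K s) \<in> frontier K" using that by (intro fibre_frontier) auto
  qed simp
  show "l \<in> Re ` frontier K" "r \<in> Re ` frontier K" using *[of l] *[of r] l_neg r_pos by auto
qed

context finsler_problem
begin

abbreviation "K \<equiv> polar \<Omega>"
abbreviation "T \<equiv> 2 * euclidean_area (polar \<Omega>)"

lemma cosK_polar_range: "range (cosK K) = Re ` frontier K"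
  unfolding cosK_def[abs_def] polar.range_convex_trig[symmetric] by (simp add: image_image)

lemma M_plus: "M_plus \<Omega> = r" and M_minus: "- M_minus \<Omega> = l"
proof -
  have b: "l \<le> s" "s \<le> r" if "s \<in> Re ` frontier K" for s
    using that Re_bounds polar.frontier_subset by auto
  show "M_plus \<Omega> = r" "- M_minus \<Omega> = l"
    unfolding M_plus_def M_minus_def cosK_polar_range
    using frontier_Re_image b by (auto intro!: cSup_eq_maximum cInf_eq_minimum)
qed

lemma curve_length: "curve_length \<Omega> c = len c"
  by (simp add: curve_length_def finsler_def len_def)

lemma has_Len_plus_iff: "has_Len_plus \<Omega> \<gamma> x \<longleftrightarrow> (\<exists>c. lipschitz_parametrization c \<gamma> \<and> positively_oriented c \<and> len c = x)"
  and has_Len_minus_iff: "has_Len_minus \<Omega> \<gamma> x \<longleftrightarrow> (\<exists>c. lipschitz_parametrization c \<gamma> \<and> negatively_oriented c \<and> len c = x)"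
  by (simp_all add: has_Len_plus_def has_Len_minus_def curve_length)

lemma L_plus: "\<mu> > r \<Longrightarrow> L_plus \<Omega> \<mu> = L \<mu>"
  unfolding L_plus_def cosK_def L_def by (rule integral_unique[OF length_integral(1)])

lemma F_plus: "\<mu> > r \<Longrightarrow> F_plus \<Omega> \<phi> \<mu> = F_area \<mu>"
  unfolding F_plus_def cosK_def by (rule integral_unique[OF length_integral(2)])

lemma bij_plus: "bij_betw (L_plus \<Omega>) {M_plus \<Omega><..} {0<..}" and inj_plus: "inj_on (F_plus \<Omega> \<phi>) {M_plus \<Omega><..}"
proof -
  show "bij_betw (L_plus \<Omega>) {M_plus \<Omega><..} {0<..}"
    unfolding M_plus using bij_L bij_betw_cong[of "{r<..}" L "L_plus \<Omega>" "{0<..}"] L_plus by simp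
  show "inj_on (F_plus \<Omega> \<phi>) {M_plus \<Omega><..}"
    unfolding M_plus using bij_betw_imp_inj_on[OF bij_F_area] inj_on_cong[of "{r<..}" F_area "F_plus \<Omega> \<phi>"] F_plus by simp
qed

text \<open>Translates the functions of the problem into the parameter \<mu>, in which
  \<open>L\<close> and \<open>F_area\<close> are already understood.\<close>

lemma plus_values:
  assumes "\<mu> > r"
  shows "calF_plus \<Omega> \<phi> (L \<mu>) = F_area \<mu>" "calL_plus \<Omega> \<phi> (F_area \<mu>) = L \<mu>" "lambda_plus \<Omega> \<phi> (F_area \<mu>) = \<mu>"
proof -
  have \<mu>: "\<mu> \<in> {M_plus \<Omega><..}" using assms by (simp add: M_plus)
  show "calF_plus \<Omega> \<phi> (L \<mu>) = F_area \<mu>" "calL_plus \<Omega> \<phi> (F_area \<mu>) = L \<mu>"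
    using the_inv_into_parametrized[OF bij_plus inj_plus \<mu>] assms
    by (simp_all add: calF_plus_def calL_plus_def calF_plus_def[abs_def] Lambda_plus_def L_plus F_plus)
  show "lambda_plus \<Omega> \<phi> (F_area \<mu>) = \<mu>"
    unfolding lambda_plus_def F_plus[OF assms, symmetric] by (rule the_inv_into_f_f[OF inj_plus \<mu>])
qed

lemma extremal_contour_eq:
  "extremal_contour \<Omega> g \<mu> \<alpha> =
     (let R = Im g / (\<mu> - cosK K \<alpha>) in
      (\<lambda>p. Complex (R * Im p + (Re g - R * sinK K \<alpha>)) (- R * Re p + R * \<mu>)) ` frontier K)"
proof -
  have "{0..T} = (\<lambda>s. T * s) ` {0..1}" using T_pos by (simp add: image_mult_atLeastAtMost)
  then have "frontier K = convex_trig K ` {0..T}"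
    unfolding polar.convex_trig(4)[symmetric] path_image_def by (simp only: image_image)
  then show ?thesis
    by (simp add: extremal_contour_def Let_def cosK_def sinK_def image_image)
qed

text \<open>The base point and the angle \<alpha> say only through which point a contour passes and
  which point of the boundary of \<open>K\<close> it comes from. Over all \<open>g\<close> in the
  half-plane the families exhaust the placed copies whose centre has height \<rho> times \<mu>, the
  condition expressed by \<open>cy\<close> in \<open>extremal_contour\<close>.\<close>

lemma Gamma_plus_iff:
  assumes "\<mu> > r"
  shows "(\<exists>g\<in>half_plane. \<gamma> \<in> Gamma_plus \<Omega> \<phi> g (F_area \<mu>)) \<longleftrightarrow> (\<exists>\<rho> z. \<rho> > 0 \<and> Im z = \<rho> * \<mu> \<and> \<gamma> = placed \<rho> z ` frontier K)"
proof -
  have lt: "cosK K \<alpha> < \<mu>" for \<alpha>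
    using Re_bounds(2)[of "convex_trig K \<alpha>"] polar.range_convex_trig polar.frontier_subset assms
    by (fastforce simp: cosK_def)
  have pl: "(\<lambda>p. Complex (R * Im p + x) (- R * Re p + R * \<mu>)) = placed R (Complex x (R * \<mu>))" for R x
    by (simp add: fun_eq_iff complex_eq_iff)
  show ?thesis
  proof (intro iffI)
    assume "\<exists>g\<in>half_plane. \<gamma> \<in> Gamma_plus \<Omega> \<phi> g (F_area \<mu>)"
    then obtain g \<alpha> where g: "Im g > 0" "\<gamma> = extremal_contour \<Omega> g \<mu> \<alpha>"
      by (auto simp: Gamma_plus_def plus_values[OF assms] half_plane_def)
    have "Im g / (\<mu> - cosK K \<alpha>) > 0" using g(1) lt[of \<alpha>] by simp
    then show "\<exists>\<rho> z. \<rho> > 0 \<and> Im z = \<rho> * \<mu> \<and> \<gamma> = placed \<rho> z ` frontier K"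
      unfolding g(2) extremal_contour_eq Let_def pl by (metis complex.sel(2))
  next
    assume "\<exists>\<rho> z. \<rho> > 0 \<and> Im z = \<rho> * \<mu> \<and> \<gamma> = placed \<rho> z ` frontier K"
    then obtain \<rho> z where z: "\<rho> > 0" "Im z = \<rho> * \<mu>" "\<gamma> = placed \<rho> z ` frontier K" by blast
    \<comment> \<open>Any point of the contour can serve as base point; the one at angle 0 goes with
      \<alpha> = 0.\<close>
    define g where "g = placed \<rho> z (convex_trig K 0)"
    have Im_g: "Im g = \<rho> * (\<mu> - cosK K 0)" by (simp add: g_def z cosK_def right_diff_distrib)
    have R: "Im g / (\<mu> - cosK K 0) = \<rho>" using lt[of 0] by (simp add: Im_g)
    have "extremal_contour \<Omega> g \<mu> 0 = placed \<rho> z ` frontier K"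
      unfolding extremal_contour_eq Let_def R pl
      by (rule arg_cong[of _ _ "\<lambda>c. placed \<rho> c ` frontier K"]) (simp add: complex_eq_iff z(2) g_def sinK_def)
    moreover have "g \<in> half_plane" using z(1) lt[of 0] by (simp add: half_plane_def Im_g)
    moreover have "0 \<in> {0..<T}" using T_pos by simp
    ultimately show "\<exists>g\<in>half_plane. \<gamma> \<in> Gamma_plus \<Omega> \<phi> g (F_area \<mu>)"
      unfolding Gamma_plus_def plus_values[OF assms] z(3) by (metis imageI)
  qed
qed

lemma plus_contour:
  assumes len: "has_Len_plus \<Omega> \<gamma> x" and half: "\<gamma> \<subseteq> half_plane"
  shows "calL_plus \<Omega> \<phi> (area (inside \<gamma>)) \<le> x"
    and "calL_plus \<Omega> \<phi> (area (inside \<gamma>)) \<le> x \<longleftrightarrow> area (inside \<gamma>) \<le> calF_plus \<Omega> \<phi> x"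
    and "x = calL_plus \<Omega> \<phi> (area (inside \<gamma>)) \<longleftrightarrow> (\<exists>g\<in>half_plane. \<gamma> \<in> Gamma_plus \<Omega> \<phi> g (area (inside \<gamma>)))"
proof -
  obtain c where c: "lipschitz_parametrization c \<gamma>" "positively_oriented c" "len c = x"
    using len by (auto simp: has_Len_plus_iff)
  obtain \<mu> where \<mu>: "\<mu> > r" "F_area \<mu> = area (inside \<gamma>)"
    using F_area_solution[OF contour_inequality(1)[OF c(1,2) half]] by blast
  have le: "L \<mu> \<le> x" using contour_inequality(2)[OF c(1,2) half \<mu>] c(3) by simp
  then have "x > 0" using L_pos[OF \<mu>(1)] by simp
  \<comment> \<open>\<nu> is the parameter of the extremals that have the length of the given
    contour, so both sides of the equivalence compare two extremals.\<close>
  then obtain \<nu> where \<nu>: "\<nu> > r" "L \<nu> = x" using L_solution by blast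
  show "calL_plus \<Omega> \<phi> (area (inside \<gamma>)) \<le> x"
    unfolding \<mu>(2)[symmetric] plus_values[OF \<mu>(1)] by (rule le)
  show "calL_plus \<Omega> \<phi> (area (inside \<gamma>)) \<le> x \<longleftrightarrow> area (inside \<gamma>) \<le> calF_plus \<Omega> \<phi> x"
    unfolding \<mu>(2)[symmetric] \<nu>(2)[symmetric] plus_values[OF \<mu>(1)] plus_values[OF \<nu>(1)] by (rule L_le_iff[OF \<mu>(1) \<nu>(1)])
  show "x = calL_plus \<Omega> \<phi> (area (inside \<gamma>)) \<longleftrightarrow> (\<exists>g\<in>half_plane. \<gamma> \<in> Gamma_plus \<Omega> \<phi> g (area (inside \<gamma>)))"
    using contour_equality[OF c(1,2) half \<mu>] unfolding \<mu>(2)[symmetric] plus_values[OF \<mu>(1)] Gamma_plus_iff[OF \<mu>(1)] c(3) .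
qed

lemma plus_family:
  assumes A: "A > 0" and g: "g \<in> half_plane" and \<gamma>: "\<gamma> \<in> Gamma_plus \<Omega> \<phi> g A"
  shows "simple_lipschitz_contour \<gamma>" "\<gamma> \<subseteq> half_plane" "area (inside \<gamma>) = A" "has_Len_plus \<Omega> \<gamma> (calL_plus \<Omega> \<phi> A)"
proof -
  obtain \<mu> where \<mu>: "\<mu> > r" "A = F_area \<mu>" using F_area_solution[OF A] by auto
  obtain \<rho> z where z: "\<rho> > 0" "Im z = \<rho> * \<mu>" "\<gamma> = placed \<rho> z ` frontier K"
    using Gamma_plus_iff[OF \<mu>(1)] g \<gamma> unfolding \<mu>(2) by blast
  note v = extremal_contour_values[OF z(1) \<mu>(1) z(2), folded z(3)]
  show "\<gamma> \<subseteq> half_plane" "area (inside \<gamma>) = A" using v(1,2) by (simp_all add: \<mu>(2))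
  show "simple_lipschitz_contour \<gamma>" using v(3) by (auto simp: simple_lipschitz_contour_def)
  show "has_Len_plus \<Omega> \<gamma> (calL_plus \<Omega> \<phi> A)"
    unfolding has_Len_plus_iff \<mu>(2) plus_values[OF \<mu>(1)] using v(3,4) by blast
qed

end

lemma has_integral_reflect_shift:
  fixes f :: "real \<Rightarrow> real"
  assumes "((\<lambda>t. f (T - t)) has_integral I) {0..T}"
  shows "(f has_integral I) {0..T}"
proof -
  have "((\<lambda>t. f (T + t)) has_integral I) (cbox (- T) (- 0))"
    using assms has_integral_reflect_real[of "\<lambda>t. f (T - t)" I T 0] by simp
  from has_integral_affinity'[OF this, of 1 "- T"] show ?thesis by simp
qed

text \<open>The negative orientation is the positive one of the reflected body, whose projection is
  \<open>{- r..- l}\<close>; its parameter \<mu> corresponds to the parameter - \<mu> of the minus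
  family.\<close>

sublocale finsler_problem \<subseteq> mirrored: isoperimetric "mirror ` polar \<Omega>" "\<lambda>x. minkowski \<Omega> (mirror x)"
    "\<lambda>t. mirror (convex_trig (polar \<Omega>) (2 * euclidean_area (polar \<Omega>) - t))"
    "\<lambda>t. mirror (convex_trig \<Omega> (\<phi> (2 * euclidean_area (polar \<Omega>) - t)))" "2 * euclidean_area (polar \<Omega>)"
  by (rule isoperimetric_mirror)

context finsler_problem
begin

lemma mirrored_r: "mirrored.r = - l"
proof -
  have "{mirrored.l..mirrored.r} = uminus ` Re ` K"
    unfolding mirrored.Re_image[symmetric] by (simp add: image_image)
  also have "\<dots> = {- r..- l}" by (simp add: Re_image)
  finally show ?thesis using l_neg r_pos by (simp add: Icc_eq_Icc)
qed

lemma L_minus: "\<mu> > - l \<Longrightarrow> L_minus \<Omega> (- \<mu>) = mirrored.L \<mu>"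
proof -
  assume "\<mu> > - l"
  then have "((\<lambda>t. 1 / (cosK K (T - t) - - \<mu>)) has_integral mirrored.L \<mu>) {0..T}"
    using mirrored.length_integral(1)[of \<mu>] by (simp add: mirrored_r mirrored.L_def cosK_def add.commute)
  from has_integral_reflect_shift[OF this] show ?thesis
    unfolding L_minus_def by (rule integral_unique)
qed

text \<open>The reflection negates \<open>cosK \<Omega>\<close> as well, whence the sign:
  \<open>F_minus\<close> takes negative values while \<open>mirrored.F_area\<close> is an
  area.\<close>

lemma F_minus: "\<mu> > - l \<Longrightarrow> F_minus \<Omega> \<phi> (- \<mu>) = - mirrored.F_area \<mu>"
proof -
  assume "\<mu> > - l"
  then have "((\<lambda>t. - (cosK \<Omega> (\<phi> (T - t)) / (cosK K (T - t) - - \<mu>))) has_integral mirrored.F_area \<mu>) {0..T}"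
    using mirrored.length_integral(2)[of \<mu>] by (simp add: mirrored_r cosK_def add.commute)
  from has_integral_neg[OF this]
  have "((\<lambda>t. cosK \<Omega> (\<phi> (T - t)) / (cosK K (T - t) - - \<mu>)) has_integral - mirrored.F_area \<mu>) {0..T}" by simp
  from has_integral_reflect_shift[where f = "\<lambda>t. cosK \<Omega> (\<phi> t) / (cosK K t - - \<mu>)", OF this] show ?thesis
    unfolding F_minus_def by (rule integral_unique)
qed

lemma bij_minus: "bij_betw (L_minus \<Omega>) {..<- M_minus \<Omega>} {0<..}"
  and inj_minus: "inj_on (F_minus \<Omega> \<phi>) {..<- M_minus \<Omega>}"
proof -
  have u: "bij_betw uminus {..<l} {mirrored.r<..}"
    by (rule bij_betwI[of _ _ _ uminus]) (auto simp: mirrored_r)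
  have "bij_betw (mirrored.L \<circ> uminus) {..<l} {0<..}" by (rule bij_betw_trans[OF u mirrored.bij_L])
  moreover have "(mirrored.L \<circ> uminus) x = L_minus \<Omega> x" if "x \<in> {..<l}" for x
    using L_minus[of "- x"] that by simp
  ultimately show "bij_betw (L_minus \<Omega>) {..<- M_minus \<Omega>} {0<..}"
    unfolding M_minus using bij_betw_cong[of "{..<l}" "mirrored.L \<circ> uminus" "L_minus \<Omega>" "{0<..}"] by blast
  have F: "F_minus \<Omega> \<phi> x = - mirrored.F_area (- x)" if "x < l" for x
    using F_minus[of "- x"] that by simp
  show "inj_on (F_minus \<Omega> \<phi>) {..<- M_minus \<Omega>}"
    unfolding M_minus
  proof (rule inj_onI)
    fix x y assume xy: "x \<in> {..<l}" "y \<in> {..<l}" "F_minus \<Omega> \<phi> x = F_minus \<Omega> \<phi> y"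
    then have "mirrored.F_area (- x) = mirrored.F_area (- y)" by (simp add: F)
    then have "- x = - y"
      by (rule inj_onD[OF bij_betw_imp_inj_on[OF mirrored.bij_F_area]]) (use xy in \<open>auto simp: mirrored_r\<close>)
    then show "x = y" by simp
  qed
qed

lemma minus_values:
  assumes "\<mu> > - l"
  shows "calF_minus \<Omega> \<phi> (mirrored.L \<mu>) = - mirrored.F_area \<mu>"
    "calL_minus \<Omega> \<phi> (- mirrored.F_area \<mu>) = mirrored.L \<mu>" "lambda_minus \<Omega> \<phi> (mirrored.F_area \<mu>) = - \<mu>"
proof -
  have \<mu>: "- \<mu> \<in> {..<- M_minus \<Omega>}" using assms by (simp add: M_minus)
  show "calF_minus \<Omega> \<phi> (mirrored.L \<mu>) = - mirrored.F_area \<mu>" "calL_minus \<Omega> \<phi> (- mirrored.F_area \<mu>) = mirrored.L \<mu>"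
    using the_inv_into_parametrized[OF bij_minus inj_minus \<mu>] assms
    by (simp_all add: calF_minus_def calL_minus_def calF_minus_def[abs_def] Lambda_minus_def L_minus F_minus)
  show "lambda_minus \<Omega> \<phi> (mirrored.F_area \<mu>) = - \<mu>"
    unfolding lambda_minus_def F_minus[OF assms, symmetric] by (rule the_inv_into_f_f[OF inj_minus \<mu>])
qed

lemma Gamma_minus_iff:
  assumes "\<mu> > - l"
  shows "(\<exists>g\<in>half_plane. \<gamma> \<in> Gamma_minus \<Omega> \<phi> g (mirrored.F_area \<mu>)) \<longleftrightarrow>
    (\<exists>\<rho> z. \<rho> > 0 \<and> Im z = \<rho> * \<mu> \<and> mirror ` \<gamma> = placed \<rho> z ` frontier (mirror ` K))"
proof -
  have lt: "0 < \<mu> + cosK K \<alpha>" for \<alpha>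
    using Re_bounds(1)[of "convex_trig K \<alpha>"] polar.range_convex_trig polar.frontier_subset assms
    by (fastforce simp: cosK_def)
  \<comment> \<open>In the minus family the factor \<open>R\<close> of
    \<open>extremal_contour\<close> is negative. A negative dilation of the turned \<open>K\<close>
    becomes, after reflection, a positive dilation of the turned reflected body.\<close>
  have pl: "mirror ` (\<lambda>p. Complex (- R * Im p + x) (- (- R) * Re p + - R * (- \<mu>))) ` S = placed R (Complex (- x) (R * \<mu>)) ` mirror ` S" for R x S
    unfolding image_image by (intro image_cong refl) (simp add: complex_eq_iff)
  have R: "Im g / (- \<mu> - cosK K \<alpha>) = - (Im g / (\<mu> + cosK K \<alpha>))" for g \<alpha>
    by (metis minus_add_distrib minus_divide_right uminus_add_conv_diff add.commute)
  show ?thesis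
  proof (intro iffI)
    assume "\<exists>g\<in>half_plane. \<gamma> \<in> Gamma_minus \<Omega> \<phi> g (mirrored.F_area \<mu>)"
    then obtain g \<alpha> where g: "Im g > 0" "\<gamma> = extremal_contour \<Omega> g (- \<mu>) \<alpha>"
      by (auto simp: Gamma_minus_def minus_values[OF assms] half_plane_def)
    have "Im g / (\<mu> + cosK K \<alpha>) > 0" using g(1) lt[of \<alpha>] by simp
    then show "\<exists>\<rho> z. \<rho> > 0 \<and> Im z = \<rho> * \<mu> \<and> mirror ` \<gamma> = placed \<rho> z ` frontier (mirror ` K)"
      unfolding g(2) extremal_contour_eq Let_def R pl frontier_mirror by (metis complex.sel(2))
  next
    assume "\<exists>\<rho> z. \<rho> > 0 \<and> Im z = \<rho> * \<mu> \<and> mirror ` \<gamma> = placed \<rho> z ` frontier (mirror ` K)"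
    then obtain \<rho> z where z: "\<rho> > 0" "Im z = \<rho> * \<mu>" "mirror ` \<gamma> = placed \<rho> z ` mirror ` frontier K"
      unfolding frontier_mirror by blast
    define g where "g = mirror (placed \<rho> z (mirror (convex_trig K 0)))"
    have Im_g: "Im g = \<rho> * (\<mu> + cosK K 0)" by (simp add: g_def z cosK_def distrib_left)
    have R0: "Im g / (- \<mu> - cosK K 0) = - \<rho>" unfolding R using lt[of 0] by (simp add: Im_g)
    have "mirror ` extremal_contour \<Omega> g (- \<mu>) 0 = placed \<rho> z ` mirror ` frontier K"
      unfolding extremal_contour_eq Let_def R0 pl
      by (rule arg_cong[of _ _ "\<lambda>c. placed \<rho> c ` mirror ` frontier K"]) (simp add: complex_eq_iff z(2) g_def sinK_def)
    then have "\<gamma> = extremal_contour \<Omega> g (- \<mu>) 0"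
      unfolding z(3)[symmetric] inj_image_eq_iff[OF inj_mirror] by simp
    moreover have "g \<in> half_plane" using z(1) lt[of 0] by (simp add: half_plane_def Im_g)
    moreover have "0 \<in> {0..<T}" using T_pos by simp
    ultimately show "\<exists>g\<in>half_plane. \<gamma> \<in> Gamma_minus \<Omega> \<phi> g (mirrored.F_area \<mu>)"
      unfolding Gamma_minus_def minus_values[OF assms] by (metis imageI)
  qed
qed

lemma minus_contour:
  assumes len: "has_Len_minus \<Omega> \<gamma> x" and half: "\<gamma> \<subseteq> half_plane"
  shows "calL_minus \<Omega> \<phi> (- area (inside \<gamma>)) \<le> x"
    and "calL_minus \<Omega> \<phi> (- area (inside \<gamma>)) \<le> x \<longleftrightarrow> calF_minus \<Omega> \<phi> x \<le> - area (inside \<gamma>)"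
    and "x = calL_minus \<Omega> \<phi> (- area (inside \<gamma>)) \<longleftrightarrow> (\<exists>g\<in>half_plane. \<gamma> \<in> Gamma_minus \<Omega> \<phi> g (area (inside \<gamma>)))"
proof -
  obtain c where c: "lipschitz_parametrization c \<gamma>" "negatively_oriented c" "len c = x"
    using len by (auto simp: has_Len_minus_iff)
  let ?d = "\<lambda>t. mirror (c t)"
  have d: "lipschitz_parametrization ?d (mirror ` \<gamma>)" "positively_oriented ?d" "mirrored.len ?d = x"
    using lipschitz_parametrization_mirror[OF c(1)] positively_oriented_mirror[OF c(1)] len_mirror[OF c(1)] c(2,3)
    by simp_all
  have half': "mirror ` \<gamma> \<subseteq> half_plane" using half by (simp add: mirror_half_plane)
  have area: "area (inside (mirror ` \<gamma>)) = area (inside \<gamma>)" by (rule area_mirror[OF c(1) half])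
  obtain \<mu> where \<mu>: "\<mu> > mirrored.r" "mirrored.F_area \<mu> = area (inside \<gamma>)"
    using mirrored.F_area_solution[OF mirrored.contour_inequality(1)[OF d(1,2) half']] unfolding area by blast
  have le: "mirrored.L \<mu> \<le> x"
    using mirrored.contour_inequality(2)[OF d(1,2) half' \<mu>(1)] \<mu>(2) d(3) by (simp add: area)
  then have "x > 0" using mirrored.L_pos[OF \<mu>(1)] by simp
  then obtain \<nu> where \<nu>: "\<nu> > mirrored.r" "mirrored.L \<nu> = x" using mirrored.L_solution by blast
  note v = minus_values[OF \<mu>(1)[unfolded mirrored_r]] minus_values[OF \<nu>(1)[unfolded mirrored_r]]
  show "calL_minus \<Omega> \<phi> (- area (inside \<gamma>)) \<le> x"
    unfolding \<mu>(2)[symmetric] v by (rule le)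
  show "calL_minus \<Omega> \<phi> (- area (inside \<gamma>)) \<le> x \<longleftrightarrow> calF_minus \<Omega> \<phi> x \<le> - area (inside \<gamma>)"
    unfolding \<mu>(2)[symmetric] \<nu>(2)[symmetric] v neg_le_iff_le by (rule mirrored.L_le_iff[OF \<mu>(1) \<nu>(1)])
  have "mirrored.F_area \<mu> = area (inside (mirror ` \<gamma>))" by (simp add: \<mu>(2) area)
  from mirrored.contour_equality[OF d(1,2) half' \<mu>(1) this]
  show "x = calL_minus \<Omega> \<phi> (- area (inside \<gamma>)) \<longleftrightarrow> (\<exists>g\<in>half_plane. \<gamma> \<in> Gamma_minus \<Omega> \<phi> g (area (inside \<gamma>)))"
    unfolding \<mu>(2)[symmetric] v Gamma_minus_iff[OF \<mu>(1)[unfolded mirrored_r]] d(3) .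
qed

lemma minus_family:
  assumes A: "A > 0" and g: "g \<in> half_plane" and \<gamma>: "\<gamma> \<in> Gamma_minus \<Omega> \<phi> g A"
  shows "simple_lipschitz_contour \<gamma>" "\<gamma> \<subseteq> half_plane" "area (inside \<gamma>) = A" "has_Len_minus \<Omega> \<gamma> (calL_minus \<Omega> \<phi> (- A))"
proof -
  obtain \<mu> where \<mu>: "\<mu> > mirrored.r" "A = mirrored.F_area \<mu>" using mirrored.F_area_solution[OF A] by auto
  note \<mu>' = \<mu>(1)[unfolded mirrored_r]
  obtain \<rho> z where z: "\<rho> > 0" "Im z = \<rho> * \<mu>" "mirror ` \<gamma> = placed \<rho> z ` frontier (mirror ` K)"
    using Gamma_minus_iff[OF \<mu>'] g \<gamma> unfolding \<mu>(2) by blast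
  note v = mirrored.extremal_contour_values[OF z(1) \<mu>(1) z(2), folded z(3)]
  obtain d where d: "lipschitz_parametrization d (mirror ` \<gamma>)" "positively_oriented d" using v(3) by blast
  let ?c = "\<lambda>t. mirror (d t)"
  have c: "lipschitz_parametrization ?c \<gamma>" using lipschitz_parametrization_mirror[OF d(1)] by simp
  have neg: "negatively_oriented ?c" using positively_oriented_mirror[OF c] d(2) by simp
  have len: "len ?c = mirrored.L \<mu>" using len_mirror[OF c] v(4)[OF d] by simp
  show half: "\<gamma> \<subseteq> half_plane" using v(1) by (simp add: mirror_half_plane)
  show "area (inside \<gamma>) = A" using area_mirror[OF c half] v(2) by (simp add: \<mu>(2))
  show "simple_lipschitz_contour \<gamma>" using c by (auto simp: simple_lipschitz_contour_def)
  show "has_Len_minus \<Omega> \<gamma> (calL_minus \<Omega> \<phi> (- A))"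
    unfolding has_Len_minus_iff \<mu>(2) minus_values[OF \<mu>'] using c neg len by blast
qed

end

theorem mainTheorem2:
  fixes \<Omega> :: "complex set" and \<phi> :: "real \<Rightarrow> real"
  assumes "convex \<Omega>" and "compact \<Omega>" and "0 \<in> interior \<Omega>"
    and "angle_selection \<Omega> \<phi>"
  shows
    "(\<forall>\<gamma> A Lp Lm.
        simple_lipschitz_contour \<gamma> \<and> \<gamma> \<subseteq> half_plane \<and>
        has_Len_plus \<Omega> \<gamma> Lp \<and> has_Len_minus \<Omega> \<gamma> Lm \<and> area (inside \<gamma>) = A \<longrightarrow>
          Lp \<ge> calL_plus \<Omega> \<phi> A \<and>
          (Lp \<ge> calL_plus \<Omega> \<phi> A \<longleftrightarrow> A \<le> calF_plus \<Omega> \<phi> Lp) \<and>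
          Lm \<ge> calL_minus \<Omega> \<phi> (- A) \<and>
          (Lm \<ge> calL_minus \<Omega> \<phi> (- A) \<longleftrightarrow> - A \<ge> calF_minus \<Omega> \<phi> Lm) \<and>
          (Lp = calL_plus \<Omega> \<phi> A \<longleftrightarrow> (\<exists>g \<in> half_plane. \<gamma> \<in> Gamma_plus \<Omega> \<phi> g A)) \<and>
          (Lm = calL_minus \<Omega> \<phi> (- A) \<longleftrightarrow> (\<exists>g \<in> half_plane. \<gamma> \<in> Gamma_minus \<Omega> \<phi> g A))) \<and>
     (\<forall>A > 0. \<forall>g \<in> half_plane.
        (\<forall>\<gamma> \<in> Gamma_plus \<Omega> \<phi> g A.
           simple_lipschitz_contour \<gamma> \<and> \<gamma> \<subseteq> half_plane \<and> area (inside \<gamma>) = A \<and>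
           has_Len_plus \<Omega> \<gamma> (calL_plus \<Omega> \<phi> A)) \<and>
        (\<forall>\<gamma> \<in> Gamma_minus \<Omega> \<phi> g A.
           simple_lipschitz_contour \<gamma> \<and> \<gamma> \<subseteq> half_plane \<and> area (inside \<gamma>) = A \<and>
           has_Len_minus \<Omega> \<gamma> (calL_minus \<Omega> \<phi> (- A))))"
proof -
  interpret finsler_problem \<Omega> \<phi> by unfold_locales (rule assms)+
  show ?thesis
    by (intro conjI allI impI ballI; (elim conjE)?; hypsubst?;
        (rule plus_contour minus_contour plus_family minus_family; assumption))
qed

end
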